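(* Let $m=m_1+m_2$ and $j=\begin{bmatrix} I_{m_1}&0\\0&-I_{m_2}\end{bmatrix}$. For an $m\times m$ rational matrix function $W$ with block partition $W=\{W_{kl}\}_{k,l=1}^2$ ($W_{11}$ of size $m_1\times m_1$), consider the relation $$R(\lambda)=W_{21}(\lambda)W_{11}(\lambda)^{-1}. \qquad ( * )$$ (i) The weakly $j$-elementary, regular in $\mathbb{C}_+$ rational matrix function $W$ tending to $I_m$ at infinity is uniquely recovered by the $m_2\times m_1$ matrix function $R$ satisfying $( * )$. This matrix function $R$ is contractive on $\mathbb{R}$ and tends to zero at infinity. (ii) Moreover, by each rational $m_2\times m_1$ matrix function $R$ which is contractive on $\mathbb{R}$ and tends to zero at infinity, one can recover a unique weakly $j$-elementary and regular in $\mathbb{C}_+$ rational matrix function $W$ tending to $I_m$ at infinity, of the same McMillan degree as $R$, and such that $( * )$ holds. The matrix function $W$ is recovered in the following way. Consider a minimal realization $$R(\lambda)=C(\lambda I_n-A)^{-1}B,$$ where $n$ is the McMillan degree of $R$, i.e., the order of $A$, and choose the $n\times n$ Hermitian solution $X=X^*$ of the Riccati equation $$i(XA-A^*X)=C^*C+XBB^*X$$ such that $$\sigma(A+iBB^*X)\subset\overline{\mathbb{C}}_-.$$ Next put $$\alpha=A+iBB^*X,\quad S_0=X^{-1},\quad \gamma_1=B,\quad \gamma=-iS_0C^*,\quad \Lambda_0=[\gamma_1\ \ \gamma].$$ Finally, $W$ is given by $$W(\lambda)=I_m+ij\Lambda_0^*S_0^{-1}(\lambda I_n-\alpha)^{-1}\Lambda_0.$$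 (iii) If $W$ is a $j$-elementary rational factor in $\mathbb{C}_+$ that is regular in $\mathbb{C}_+$, then $R$ given by $( * )$ is contractive in $\mathbb{C}_+$. Vice versa, if the conditions of (ii) hold and $R$ is contractive in $\mathbb{C}_+$, then the matrix $X$ in (ii) is strictly positive and the recovered $W$ is a $j$-elementary rational factor in $\mathbb{C}_+$ that is regular in $\mathbb{C}_+$.
   Context: $\mathbb{C}_+$ and $\mathbb{C}_-$ are the open upper and lower half-planes, $\overline{\mathbb{C}}_-$ is the closed lower half-plane, $\sigma$ denotes spectrum, $^*$ denotes conjugate transpose, and $I_k$ is the $k\times k$ identity matrix. An $m\times m$ rational matrix function $W(\lambda)$ that tends to $I_m$ at infinity is called: weakly $j$-elementary if it is $j$-unitary on the real axis, i.e. $W(\lambda)^*jW(\lambda)=j$ for $\lambda\in\mathbb{R}$; regular in $\mathbb{C}_+$ if it has no singularities in $\mathbb{C}_+$; a $j$-elementary rational factor in $\mathbb{C}_+$ if $W(\lambda)^*jW(\lambda)\ge j$ for $\lambda\in\mathbb{C}_+$ and $W(\lambda)^*jW(\lambda)\le j$ for $\lambda\in\mathbb{C}_-$. A matrix function $R$ is contractive on a set if $R(\lambda)^*R(\lambda)\le I$ for $\lambda$ in that set. A realization of a proper rational $p\times q$ matrix function $F$ (proper means analytic at infinity) is a representation $F(\lambda)=D+C(\lambda I_n-A)^{-1}B$ with $A$ an $n\times n$ matrix and $D=F(\infty)$; it is minimal if the order $n$ of $A$ is minimal among all realizations of $F$, and this minimal $n$ is called the McMillan degree of $F$.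
   Formalization: In (i), unique recovery of W from R is stated only among W of the same McMillan degree as R; without this it is false, since I_m and diag(1,...,1,(λ-i)/(λ+i)) both give R=0. The other claims of (i) hold for every such W. *)

theory Defs
  imports
    Complex_Main
    "HOL-Computational_Algebra.Computational_Algebra"
    "Jordan_Normal_Form.Schur_Decomposition"
    "Jordan_Normal_Form.Spectral_Radius"
begin

section \<open>Complex matrices\<close>

definition mat_inv :: "'a :: field mat \<Rightarrow> 'a mat" where
  "mat_inv M = the (mat_inverse M)"

definition hermitian_mat :: "complex mat \<Rightarrow> bool" where
  "hermitian_mat M \<longleftrightarrow> square_mat M \<and> mat_adjoint M = M"

text \<open>In the order on complex numbers used here, \<open>0 \<le> z\<close> says that \<open>z\<close> is real and
  nonnegative. The library order on matrices is entrywise, so the order of quadratic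
  forms needs a definition of its own.\<close>

definition loewner_le :: "complex mat \<Rightarrow> complex mat \<Rightarrow> bool" where
  "loewner_le M N \<longleftrightarrow> (\<exists>n. M \<in> carrier_mat n n \<and> N \<in> carrier_mat n n \<and>
     (\<forall>v \<in> carrier_vec n. 0 \<le> ((N - M) *\<^sub>v v) \<bullet>c v))"

definition pos_def_mat :: "complex mat \<Rightarrow> bool" where
  "pos_def_mat M \<longleftrightarrow> hermitian_mat M \<and>
     (\<forall>v \<in> carrier_vec (dim_row M). v \<noteq> 0\<^sub>v (dim_row M) \<longrightarrow> 0 < (M *\<^sub>v v) \<bullet>c v)"

definition hcat :: "'a :: zero mat \<Rightarrow> 'a mat \<Rightarrow> 'a mat" where
  "hcat M N = four_block_mat M N (0\<^sub>m 0 (dim_col M)) (0\<^sub>m 0 (dim_col N))"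

definition j_mat :: "nat \<Rightarrow> nat \<Rightarrow> complex mat" where
  "j_mat m1 m2 = four_block_mat (1\<^sub>m m1) (0\<^sub>m m1 m2) (0\<^sub>m m2 m1) (- 1\<^sub>m m2)"

section \<open>Rational matrix functions\<close>

text \<open>A rational matrix function is a matrix over the field of rational functions in one
  complex variable, so equality is equality of rational functions. Poles and values are
  those of the entries: \<open>f\<close> is analytic at \<open>z\<close> if it is a quotient of polynomials whose
  denominator does not vanish at \<open>z\<close>, and its value there does not depend on the quotient.
  Values at poles are meaningless.\<close>

type_synonym ratfun = "complex poly fract"
type_synonym ratmat = "complex poly fract mat"

definition rat_pole :: "ratfun \<Rightarrow> complex \<Rightarrow> bool" where
  "rat_pole f z \<longleftrightarrow> \<not> (\<exists>p q. f = Fraction_Field.Fract p q \<and> poly q z \<noteq> 0)"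

definition rat_eval :: "ratfun \<Rightarrow> complex \<Rightarrow> complex" where
  "rat_eval f z = (THE v. \<exists>p q. f = Fraction_Field.Fract p q \<and> poly q z \<noteq> 0 \<and>
     v = poly p z / poly q z)"

definition is_singular_at :: "ratmat \<Rightarrow> complex \<Rightarrow> bool" where
  "is_singular_at F z \<longleftrightarrow> (\<exists>f \<in> elements_mat F. rat_pole f z)"

definition mat_eval :: "ratmat \<Rightarrow> complex \<Rightarrow> complex mat" where
  "mat_eval F z = map_mat (\<lambda>f. rat_eval f z) F"

definition tends_at_infinity :: "ratmat \<Rightarrow> complex mat \<Rightarrow> bool" where
  "tends_at_infinity F D \<longleftrightarrow> dim_row F = dim_row D \<and> dim_col F = dim_col D \<and>
     (\<forall>i < dim_row D. \<forall>k < dim_col D.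
        ((\<lambda>z. rat_eval (F $$ (i, k)) z) \<longlongrightarrow> D $$ (i, k)) at_infinity)"

definition upper_half_plane :: "complex set" where
  "upper_half_plane = {z. 0 < Im z}"

definition lower_half_plane :: "complex set" where
  "lower_half_plane = {z. Im z < 0}"

definition closed_lower_half_plane :: "complex set" where
  "closed_lower_half_plane = {z. Im z \<le> 0}"

definition regular_on :: "complex set \<Rightarrow> ratmat \<Rightarrow> bool" where
  "regular_on S F \<longleftrightarrow> (\<forall>z \<in> S. \<not> is_singular_at F z)"

definition contractive_on :: "complex set \<Rightarrow> ratmat \<Rightarrow> bool" where
  "contractive_on S R \<longleftrightarrow> regular_on S R \<and>
     (\<forall>z \<in> S. loewner_le (mat_adjoint (mat_eval R z) * mat_eval R z) (1\<^sub>m (dim_col R)))"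

section \<open>Weakly j-elementary functions and j-elementary factors\<close>

text \<open>The relations are required wherever the function is defined: a function of either
  class may have poles on the real axis and in the lower half-plane.\<close>

definition weakly_j_elementary :: "nat \<Rightarrow> nat \<Rightarrow> ratmat \<Rightarrow> bool" where
  "weakly_j_elementary m1 m2 W \<longleftrightarrow>
     W \<in> carrier_mat (m1 + m2) (m1 + m2) \<and> tends_at_infinity W (1\<^sub>m (m1 + m2)) \<and>
     (\<forall>z \<in> \<real>. \<not> is_singular_at W z \<longrightarrow>
        mat_adjoint (mat_eval W z) * j_mat m1 m2 * mat_eval W z = j_mat m1 m2)"

definition j_elementary_factor :: "nat \<Rightarrow> nat \<Rightarrow> ratmat \<Rightarrow> bool" where
  "j_elementary_factor m1 m2 W \<longleftrightarrow>
     W \<in> carrier_mat (m1 + m2) (m1 + m2) \<and> tends_at_infinity W (1\<^sub>m (m1 + m2)) \<and>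
     (\<forall>z \<in> upper_half_plane. \<not> is_singular_at W z \<longrightarrow>
        loewner_le (j_mat m1 m2) (mat_adjoint (mat_eval W z) * j_mat m1 m2 * mat_eval W z)) \<and>
     (\<forall>z \<in> lower_half_plane. \<not> is_singular_at W z \<longrightarrow>
        loewner_le (mat_adjoint (mat_eval W z) * j_mat m1 m2 * mat_eval W z) (j_mat m1 m2))"

definition block11 :: "nat \<Rightarrow> 'a mat \<Rightarrow> 'a mat" where
  "block11 m1 W = (case split_block W m1 m1 of (W11, W12, W21, W22) \<Rightarrow> W11)"

definition block21 :: "nat \<Rightarrow> 'a mat \<Rightarrow> 'a mat" where
  "block21 m1 W = (case split_block W m1 m1 of (W11, W12, W21, W22) \<Rightarrow> W21)"

text \<open>\<open>R = W\<^sub>2\<^sub>1 W\<^sub>1\<^sub>1\<^sup>-\<^sup>1\<close> over the field of rational functions.\<close>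

definition quotient_rel :: "nat \<Rightarrow> ratmat \<Rightarrow> ratmat \<Rightarrow> bool" where
  "quotient_rel m1 W R \<longleftrightarrow>
     invertible_mat (block11 m1 W) \<and> R = block21 m1 W * mat_inv (block11 m1 W)"

section \<open>Realizations and McMillan degree\<close>

definition const_mat :: "complex mat \<Rightarrow> ratmat" where
  "const_mat M = map_mat (\<lambda>c. Fraction_Field.Fract [:c:] 1) M"

text \<open>\<open>Fract [:0, 1:] 1\<close> is the independent variable \<open>\<lambda>\<close>, so this is the function
  \<open>D + C (\<lambda> I - A)\<^sup>-\<^sup>1 B\<close>.\<close>

definition transfer_fun :: "complex mat \<Rightarrow> complex mat \<Rightarrow> complex mat \<Rightarrow> complex mat \<Rightarrow> ratmat" where
  "transfer_fun A B C D =
     const_mat D +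
     const_mat C * mat_inv (Fraction_Field.Fract [:0, 1:] 1 \<cdot>\<^sub>m 1\<^sub>m (dim_row A) - const_mat A) * const_mat B"

definition is_realization ::
  "ratmat \<Rightarrow> nat \<Rightarrow> complex mat \<Rightarrow> complex mat \<Rightarrow> complex mat \<Rightarrow> complex mat \<Rightarrow> bool" where
  "is_realization F n A B C D \<longleftrightarrow>
     A \<in> carrier_mat n n \<and> B \<in> carrier_mat n (dim_col F) \<and>
     C \<in> carrier_mat (dim_row F) n \<and> D \<in> carrier_mat (dim_row F) (dim_col F) \<and>
     F = transfer_fun A B C D"

text \<open>Meaningful for proper functions only, since those are the functions that have a
  realization.\<close>

definition mcmillan_degree :: "ratmat \<Rightarrow> nat" where
  "mcmillan_degree F = (LEAST n. \<exists>A B C D. is_realization F n A B C D)"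

definition is_minimal_realization ::
  "ratmat \<Rightarrow> nat \<Rightarrow> complex mat \<Rightarrow> complex mat \<Rightarrow> complex mat \<Rightarrow> complex mat \<Rightarrow> bool" where
  "is_minimal_realization F n A B C D \<longleftrightarrow>
     is_realization F n A B C D \<and> n = mcmillan_degree F"

section \<open>Recovery of W from R\<close>

definition alpha_mat :: "complex mat \<Rightarrow> complex mat \<Rightarrow> complex mat \<Rightarrow> complex mat" where
  "alpha_mat A B X = A + \<i> \<cdot>\<^sub>m (B * mat_adjoint B * X)"

definition riccati_choice ::
  "nat \<Rightarrow> complex mat \<Rightarrow> complex mat \<Rightarrow> complex mat \<Rightarrow> complex mat \<Rightarrow> bool" where
  "riccati_choice n A B C X \<longleftrightarrow>
     X \<in> carrier_mat n n \<and> hermitian_mat X \<and>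
     \<i> \<cdot>\<^sub>m (X * A - mat_adjoint A * X) = mat_adjoint C * C + X * B * mat_adjoint B * X \<and>
     spectrum (alpha_mat A B X) \<subseteq> closed_lower_half_plane"

definition recovered_W ::
  "nat \<Rightarrow> nat \<Rightarrow> complex mat \<Rightarrow> complex mat \<Rightarrow> complex mat \<Rightarrow> complex mat \<Rightarrow> ratmat" where
  "recovered_W m1 m2 A B C X =
     (let \<alpha> = alpha_mat A B X;
          S\<^sub>0 = mat_inv X;
          \<gamma>\<^sub>1 = B;
          \<gamma> = - (\<i> \<cdot>\<^sub>m (S\<^sub>0 * mat_adjoint C));
          \<Lambda>\<^sub>0 = hcat \<gamma>\<^sub>1 \<gamma>
      in transfer_fun \<alpha> \<Lambda>\<^sub>0 (\<i> \<cdot>\<^sub>m (j_mat m1 m2 * mat_adjoint \<Lambda>\<^sub>0 * mat_inv S\<^sub>0)) (1\<^sub>m (m1 + m2)))"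

end

theory Submission
  imports Defs
begin

text \<open>A realization is minimal only if it is observable and controllable, so two realizations of the
  same function of minimal order are similar by a unique matrix, and every eigenvalue of the state
  matrix is a pole. The quotient \<open>W\<^sub>2\<^sub>1 W\<^sub>1\<^sub>1\<^sup>-\<^sup>1\<close> of \<open>W = I + \<Gamma> (\<lambda> - \<alpha>)\<^sup>-\<^sup>1 \<Lambda>\<close> is obtained by state feedback
  from the state matrix \<open>\<alpha>\<close>, so its degree is at most that of \<open>W\<close>. For a \<open>W\<close> of the same degree, the
  similarity between the realizations of \<open>W\<^sup>-\<^sup>1\<close> and \<open>j W(cnj \<lambda>)\<^sup>* j\<close> is, up to a factor \<open>i\<close>, a Hermitian
  solution \<open>X\<close> of the Riccati equation, and \<open>W\<close> is the function recovered from \<open>X\<close>; regularity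
  in the upper half-plane is the spectral condition on \<open>\<alpha>\<close>, which determines \<open>X\<close>. Conversely, when \<open>R\<close> is
  strictly contractive on the real axis the Hamiltonian matrix has no real eigenvalue, and its
  invariant subspace for the lower half-plane is the graph of a solution \<open>X\<close>; in the general case
  \<open>R\<close> is replaced by \<open>c R\<close> with \<open>c\<close> increasing to 1, and the solutions stay bounded.
  The sign of \<open>W\<^sup>* j W - j\<close> off the axis is read off the identity
  \<open>W(z)\<^sup>* j W(z) = j + 2 Im z N\<^sup>* X N\<close>, and \<open>X \<ge> 0\<close> follows from a Lyapunov inequality when \<open>A\<close> has its
  spectrum in the lower half-plane.\<close>

section \<open>Matrices and adjoints\<close>

text \<open>The real axis plays the role that the imaginary axis has in control theory, so the lower
  half-plane is the stable one; this is where the factors \<open>\<i>\<close> come from. Scaling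
  \<open>R\<close> is forced by real points at which \<open>R\<^sup>* R\<close> has the eigenvalue
  1: there the Hamiltonian matrix acquires a real eigenvalue and its spectrum no longer splits into
  two halves. The limit keeps only the closed half-plane condition on
  \<open>alpha_mat A B X\<close>, so uniqueness has to cope with real eigenvalues. Minimality is
  exploited through the Hautus test. Polynomials in a matrix are replaced by products of factors
  \<open>A - e\<close> along a list of eigenvalues: they turn statements about eigenvectors into
  statements about all \<open>A\<^sup>k M\<close>, and give a Gramian that is a finite sum for every
  \<open>A\<close>. Column vectors are n x 1 matrices, so that quadratic forms are 1 x 1 products
  under the same ring laws. Identities of rational matrix functions are checked at points off a
  finite set, where the inverse over the rational functions evaluates to the resolvent.\<close>

lemma dim_mat_adjoint [simp]:
  "dim_row (mat_adjoint A) = dim_col A" "dim_col (mat_adjoint A) = dim_row A"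
  by (simp_all add: mat_adjoint_def)

lemma index_mat_adjoint [simp]:
  "i < dim_col A \<Longrightarrow> j < dim_row A \<Longrightarrow> mat_adjoint A $$ (i, j) = conjugate (A $$ (j, i))"
  by (simp add: mat_adjoint_def mat_of_rows_def)

lemma mat_adjoint_carrier [simp]:
  "mat_adjoint A \<in> carrier_mat n m \<longleftrightarrow> A \<in> carrier_mat m n"
  by (metis carrier_matD carrier_matI dim_mat_adjoint)

lemma minus_carrier_iff [simp]: "A - B \<in> carrier_mat n m \<longleftrightarrow> B \<in> carrier_mat n m"
  by (metis carrier_matD carrier_matI index_minus_mat(2,3))

lemma mult_carrier_iff [simp]:
  "A * B \<in> carrier_mat n m \<longleftrightarrow> dim_row A = n \<and> dim_col B = m"
  by (metis carrier_matD carrier_matI index_mult_mat(2,3))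

text \<open>The side conditions of this family are equations between dimensions, not carrier
  memberships: no intermediate dimension has to be guessed, and the simplifier can discharge them by
  itself.\<close>

lemma mult_assoc_dim:
  fixes A B C :: "'a :: semiring_0 mat"
  shows "dim_col A = dim_row B \<Longrightarrow> dim_col B = dim_row C \<Longrightarrow> A * B * C = A * (B * C)"
  by (rule assoc_mult_mat[of _ "dim_row A" "dim_col A" _ "dim_col B" _ "dim_col C"]) auto

lemma mult_add_dim:
  fixes A B C :: "'a :: semiring_0 mat"
  shows "dim_row B = dim_row C \<Longrightarrow> dim_col B = dim_col C \<Longrightarrow> dim_col A = dim_row B \<Longrightarrow>
    A * (B + C) = A * B + A * C"
  by (rule mult_add_distrib_mat[of _ "dim_row A" "dim_col A" _ "dim_col B"]) auto

lemma add_mult_dim: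
  fixes A B C :: "'a :: semiring_0 mat"
  shows "dim_row A = dim_row B \<Longrightarrow> dim_col A = dim_col B \<Longrightarrow> dim_col B = dim_row C \<Longrightarrow>
    (A + B) * C = A * C + B * C"
  by (rule add_mult_distrib_mat[of _ "dim_row A" "dim_col A" _ _ "dim_col C"]) auto

lemma smult_mult_dim:
  fixes A B :: "'a :: comm_semiring_0 mat"
  shows "dim_col A = dim_row B \<Longrightarrow> (c \<cdot>\<^sub>m A) * B = c \<cdot>\<^sub>m (A * B)"
  by (rule mult_smult_assoc_mat[of _ "dim_row A" "dim_col A" _ "dim_col B"]) auto

lemma mult_smult_dim:
  fixes A B :: "'a :: comm_semiring_0 mat"
  shows "dim_col A = dim_row B \<Longrightarrow> A * (c \<cdot>\<^sub>m B) = c \<cdot>\<^sub>m (A * B)"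
  by (rule mult_smult_distrib[of _ "dim_row A" "dim_col A" _ "dim_col B"]) auto

text \<open>Differences and negatives are normalized to scalar multiples, so that distributivity
  over sums and scalars is all that \<open>mat_ring_simps\<close> has to know.\<close>

lemma minus_as_smult: "(A :: 'a :: ring_1 mat) - B = A + (-1) \<cdot>\<^sub>m B"
  by (rule eq_matI) auto

lemma uminus_as_smult: "- (A :: 'a :: ring_1 mat) = (-1) \<cdot>\<^sub>m A"
  by auto

lemma smult_smult_mat: "c \<cdot>\<^sub>m (d \<cdot>\<^sub>m (A :: 'a :: semigroup_mult mat)) = (c * d) \<cdot>\<^sub>m A"
  by (auto simp: mult.assoc)

lemma smult_add_dim:
  fixes A B :: "'a :: semiring mat"
  shows "dim_row A = dim_row B \<Longrightarrow> dim_col A = dim_col B \<Longrightarrow> c \<cdot>\<^sub>m (A + B) = c \<cdot>\<^sub>m A + c \<cdot>\<^sub>m B"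
  by (auto simp: distrib_left)

lemma one_smult_mat [simp]: "1 \<cdot>\<^sub>m (A :: 'a :: monoid_mult mat) = A"
  by (rule eq_matI) auto

lemma one_mult_dim [simp]: "dim_row (A :: 'a :: semiring_1 mat) = n \<Longrightarrow> 1\<^sub>m n * A = A"
  by (rule left_mult_one_mat[of _ _ "dim_col A"]) auto

lemma mult_one_dim [simp]: "dim_col (A :: 'a :: semiring_1 mat) = n \<Longrightarrow> A * 1\<^sub>m n = A"
  by (rule right_mult_one_mat[of _ "dim_row A"]) auto

lemma adjoint_mult:
  fixes A B :: "complex mat"
  assumes "dim_col A = dim_row B"
  shows "mat_adjoint (A * B) = mat_adjoint B * mat_adjoint A"
  using assms by (auto intro!: eq_matI sum.cong simp: scalar_prod_def)

lemma adjoint_add: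
  fixes A B :: "complex mat"
  assumes "dim_row A = dim_row B" "dim_col A = dim_col B"
  shows "mat_adjoint (A + B) = mat_adjoint A + mat_adjoint B"
  using assms by (auto intro!: eq_matI)

lemma adjoint_smult: "mat_adjoint (c \<cdot>\<^sub>m (A :: complex mat)) = cnj c \<cdot>\<^sub>m mat_adjoint A"
  by (auto intro!: eq_matI)

lemma adjoint_one [simp]: "mat_adjoint (1\<^sub>m n :: complex mat) = 1\<^sub>m n"
  by (auto intro!: eq_matI)

lemma adjoint_zero [simp]: "mat_adjoint (0\<^sub>m n m :: complex mat) = 0\<^sub>m m n"
  by (auto intro!: eq_matI)

lemma adjoint_adjoint [simp]: "mat_adjoint (mat_adjoint (A :: complex mat)) = A"
  by (auto intro!: eq_matI)

text \<open>Associativity is used in both directions: to the right for normal forms, and to the left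
  to expose a product such as \<open>T * A\<close> that is then rewritten. An automatic rule would
  undo the second use.\<close>

declare assoc_mult_mat [simp del]

lemmas mat_ring_simps = mult_assoc_dim mult_add_dim add_mult_dim smult_mult_dim mult_smult_dim
  minus_as_smult uminus_as_smult smult_smult_mat smult_add_dim

lemmas adjoint_simps = adjoint_mult adjoint_add adjoint_smult

lemma adjoint_mult_self_index:
  fixes M :: "complex mat"
  assumes "j < dim_col M"
  shows "(mat_adjoint M * M) $$ (j, j) = complex_of_real (\<Sum>i<dim_row M. (cmod (M $$ (i, j)))\<^sup>2)"
proof -
  have "cnj (M $$ (i, j)) * M $$ (i, j) = complex_of_real ((cmod (M $$ (i, j)))\<^sup>2)" for i
    by (metis complex_norm_square mult.commute of_real_power)
  with assms show ?thesis
    by (simp add: scalar_prod_def lessThan_atLeast0)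
qed

text \<open>The diagonal entries of \<open>M\<^sup>* M\<close> are squared column norms, so their
  vanishing kills every entry of \<open>M\<close>.\<close>

lemma adjoint_mult_self_eq_0:
  fixes M :: "complex mat"
  assumes "mat_adjoint M * M = 0\<^sub>m (dim_col M) (dim_col M)"
  shows "M = 0\<^sub>m (dim_row M) (dim_col M)"
proof (rule eq_matI)
  fix i j assume "i < dim_row (0\<^sub>m (dim_row M) (dim_col M) :: complex mat)"
    "j < dim_col (0\<^sub>m (dim_row M) (dim_col M) :: complex mat)"
  then have ij: "i < dim_row M" "j < dim_col M" by auto
  have "complex_of_real (\<Sum>i<dim_row M. (cmod (M $$ (i, j)))\<^sup>2) = 0"
    unfolding adjoint_mult_self_index[OF ij(2), symmetric] assms using ij by simp
  then have "(\<Sum>i<dim_row M. (cmod (M $$ (i, j)))\<^sup>2) = 0"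
    by (simp only: of_real_eq_0_iff)
  then have "(cmod (M $$ (i, j)))\<^sup>2 = 0"
    using ij by (subst (asm) sum_nonneg_eq_0_iff) auto
  then show "M $$ (i, j) = 0\<^sub>m (dim_row M) (dim_col M) $$ (i, j)" using ij by simp
qed auto

text \<open>A vanishing determinant would give a kernel vector. The hypothesis speaks of n x 1
  matrices, the form that vectors take in all later kernel arguments, so the kernel vector is turned
  into a single column.\<close>

lemma injective_imp_inverse:
  fixes M :: "'a :: field mat"
  assumes M: "M \<in> carrier_mat n n"
    and inj: "\<And>v. v \<in> carrier_mat n 1 \<Longrightarrow> M * v = 0\<^sub>m n 1 \<Longrightarrow> v = 0\<^sub>m n 1"
  obtains N where "N \<in> carrier_mat n n" "M * N = 1\<^sub>m n" "N * M = 1\<^sub>m n"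
proof -
  have "det M \<noteq> 0"
  proof
    assume "det M = 0"
    then obtain v where v: "v \<in> carrier_vec n" "v \<noteq> 0\<^sub>v n" "M *\<^sub>v v = 0\<^sub>v n"
      using det_0_iff_vec_prod_zero_field[OF M] by auto
    let ?V = "mat_of_cols n [v]"
    have V: "?V \<in> carrier_mat n 1" by (simp add: mat_of_cols_def)
    have "M * ?V = 0\<^sub>m n 1"
    proof (rule eq_matI)
      fix i j assume "i < dim_row (0\<^sub>m n 1 :: 'a mat)" "j < dim_col (0\<^sub>m n 1 :: 'a mat)"
      then have ij: "i < n" "j = 0" by auto
      have "vec_index (M *\<^sub>v v) i = 0" unfolding v(3) using ij by simp
      then show "(M * ?V) $$ (i, j) = 0\<^sub>m n 1 $$ (i, j)"
        using ij M v(1) by simp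
    qed (use M in auto)
    from inj[OF V this] have "col ?V 0 = col (0\<^sub>m n 1) 0" by simp
    then have "v = 0\<^sub>v n" using v by (simp add: col_mat_of_cols)
    with v show False by simp
  qed
  then obtain N where "N \<in> carrier_mat n n" "M * N = 1\<^sub>m n" "N * M = 1\<^sub>m n"
    using det_non_zero_imp_unit[OF M, of "()"] unfolding Units_def ring_mat_def by auto
  then show ?thesis using that by blast
qed

text \<open>\<open>mat_inv\<close> is read off from an option-valued elimination algorithm. A right
  inverse of a square matrix is two-sided, so \<open>M\<close> is a unit, the algorithm succeeds,
  and its result is \<open>N\<close> by uniqueness of inverses.\<close>

lemma mat_inv_eq:
  fixes M :: "'a :: field mat"
  assumes M: "M \<in> carrier_mat n n" and N: "N \<in> carrier_mat n n" and MN: "M * N = 1\<^sub>m n"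
  shows "mat_inv M = N"
proof -
  have NM: "N * M = 1\<^sub>m n" by (rule mat_mult_left_right_inverse[OF M N MN])
  have "M \<in> Units (ring_mat TYPE('a) n ())"
    using M N MN NM unfolding Units_def ring_mat_def by auto
  then obtain K where K: "mat_inverse M = Some K"
    using mat_inverse(1)[OF M, of "()"] by (cases "mat_inverse M") auto
  from mat_inverse(2)[OF M K] have K': "M * K = 1\<^sub>m n" "K \<in> carrier_mat n n" by auto
  have "K = N * M * K" using K' NM by simp
  also have "\<dots> = N" using K' M N by (simp add: mult_assoc_dim)
  finally show ?thesis by (simp add: mat_inv_def K)
qed

lemma invertible_mat_inv:
  fixes M :: "'a :: field mat"
  assumes M: "M \<in> carrier_mat n n" and inv: "invertible_mat M"
  shows "mat_inv M \<in> carrier_mat n n" "M * mat_inv M = 1\<^sub>m n" "mat_inv M * M = 1\<^sub>m n"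
proof -
  obtain N where N: "M * N = 1\<^sub>m n" "N * M = 1\<^sub>m (dim_row N)"
    using inv M unfolding invertible_mat_def inverts_mat_def by auto
  have "dim_row N = n" using arg_cong[OF N(2), of dim_col] M by simp
  moreover have "dim_col N = n" using arg_cong[OF N(1), of dim_col] by simp
  ultimately have Nc: "N \<in> carrier_mat n n" by auto
  have "mat_inv M = N" by (rule mat_inv_eq[OF M Nc N(1)])
  with N Nc show "mat_inv M \<in> carrier_mat n n" "M * mat_inv M = 1\<^sub>m n" "mat_inv M * M = 1\<^sub>m n"
    by auto
qed

lemma invertible_matI:
  assumes "M \<in> carrier_mat n n" "N \<in> carrier_mat n n" "M * N = 1\<^sub>m n" "N * M = 1\<^sub>m n"
  shows "invertible_mat M"
  using assms unfolding invertible_mat_def inverts_mat_def by auto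

lemma eigenvalue_iff:
  fixes A :: "'a :: field mat"
  assumes A: "A \<in> carrier_mat n n"
  shows "eigenvalue A t \<longleftrightarrow> (\<exists>v \<in> carrier_mat n 1. v \<noteq> 0\<^sub>m n 1 \<and> A * v = t \<cdot>\<^sub>m v)"
proof
  assume "eigenvalue A t"
  then obtain v where v: "v \<in> carrier_vec n" "v \<noteq> 0\<^sub>v n" "A *\<^sub>v v = t \<cdot>\<^sub>v v"
    using A unfolding eigenvalue_def eigenvector_def by auto
  let ?V = "mat_of_cols n [v]"
  have V: "?V \<in> carrier_mat n 1" by (simp add: mat_of_cols_def)
  have "A * ?V = t \<cdot>\<^sub>m ?V"
  proof (rule eq_matI)
    fix i j assume "i < dim_row (t \<cdot>\<^sub>m ?V)" "j < dim_col (t \<cdot>\<^sub>m ?V)"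
    then have ij: "i < n" "j = 0" by auto
    have "vec_index (A *\<^sub>v v) i = t * vec_index v i" unfolding v(3) using v(1) ij by simp
    then show "(A * ?V) $$ (i, j) = (t \<cdot>\<^sub>m ?V) $$ (i, j)"
      using ij A v(1) by (simp add: mat_of_cols_index)
  qed (use A in auto)
  moreover have "?V \<noteq> 0\<^sub>m n 1"
  proof
    assume "?V = 0\<^sub>m n 1"
    then have "col ?V 0 = col (0\<^sub>m n 1) 0" by simp
    with v show False by (simp add: col_mat_of_cols)
  qed
  ultimately show "\<exists>v \<in> carrier_mat n 1. v \<noteq> 0\<^sub>m n 1 \<and> A * v = t \<cdot>\<^sub>m v" using V by blast
next
  assume "\<exists>v \<in> carrier_mat n 1. v \<noteq> 0\<^sub>m n 1 \<and> A * v = t \<cdot>\<^sub>m v"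
  then obtain v where v: "v \<in> carrier_mat n 1" "v \<noteq> 0\<^sub>m n 1" "A * v = t \<cdot>\<^sub>m v" by blast
  have "A *\<^sub>v col v 0 = t \<cdot>\<^sub>v col v 0"
  proof (rule eq_vecI)
    fix i assume "i < dim_vec (t \<cdot>\<^sub>v col v 0)"
    then have i: "i < n" using v by simp
    have "(A * v) $$ (i, 0) = (t \<cdot>\<^sub>m v) $$ (i, 0)" using v by simp
    then show "vec_index (A *\<^sub>v col v 0) i = vec_index (t \<cdot>\<^sub>v col v 0) i" using i v(1) A by simp
  qed (use A v in auto)
  moreover have "col v 0 \<noteq> 0\<^sub>v n"
  proof
    assume 0: "col v 0 = 0\<^sub>v n"
    have "v = 0\<^sub>m n 1"
    proof (rule eq_matI)
      fix i j assume "i < dim_row (0\<^sub>m n 1 :: 'a mat)" "j < dim_col (0\<^sub>m n 1 :: 'a mat)"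
      then have ij: "i < n" "j = 0" by auto
      have "vec_index (col v 0) i = 0" using 0 ij by simp
      then show "v $$ (i, j) = 0\<^sub>m n 1 $$ (i, j)" using ij v by simp
    qed (use v in auto)
    with v show False by simp
  qed
  ultimately show "eigenvalue A t"
    using A v unfolding eigenvalue_def eigenvector_def by (auto intro!: exI[of _ "col v 0"])
qed

lemma shift_inverse:
  fixes A :: "'a :: field mat"
  assumes A: "A \<in> carrier_mat n n" and t: "\<not> eigenvalue A t"
  obtains N where "N \<in> carrier_mat n n" "(t \<cdot>\<^sub>m 1\<^sub>m n - A) * N = 1\<^sub>m n" "N * (t \<cdot>\<^sub>m 1\<^sub>m n - A) = 1\<^sub>m n"
proof (rule injective_imp_inverse)
  show "t \<cdot>\<^sub>m 1\<^sub>m n - A \<in> carrier_mat n n" using A by auto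
  fix v assume v: "v \<in> carrier_mat n 1" and 0: "(t \<cdot>\<^sub>m 1\<^sub>m n - A) * v = 0\<^sub>m n 1"
  have "A * v = t \<cdot>\<^sub>m v"
  proof (rule eq_matI)
    fix i j assume "i < dim_row (t \<cdot>\<^sub>m v)" "j < dim_col (t \<cdot>\<^sub>m v)"
    then have ij: "i < n" "j < 1" using v by auto
    have "((t \<cdot>\<^sub>m 1\<^sub>m n - A) * v) $$ (i, j) = 0" using 0 ij by simp
    then show "(A * v) $$ (i, j) = (t \<cdot>\<^sub>m v) $$ (i, j)"
      using ij A v by (simp add: mat_ring_simps del: index_mult_mat(1))
  qed (use A v in auto)
  with t v show "v = 0\<^sub>m n 1" unfolding eigenvalue_iff[OF A] by blast
qed (rule that)

section \<open>Observability\<close>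

text \<open>\<open>newton A [e\<^sub>1, \<dots>, e\<^sub>k] M\<close> is \<open>(A - e\<^sub>k) \<cdots> (A - e\<^sub>1) M\<close>; a list of eigenvalues that makes it vanish
  takes the place of the characteristic polynomial.\<close>

primrec newton :: "complex mat \<Rightarrow> complex list \<Rightarrow> complex mat \<Rightarrow> complex mat" where
  "newton A [] M = M"
| "newton A (e # es) M = newton A es (A * M - e \<cdot>\<^sub>m M)"

text \<open>If only the rows below index \<open>k + 1\<close> of \<open>M\<close> can be nonzero,
  the factor \<open>U - U $$ (k, k)\<close> also clears row \<open>k\<close>. The last relevant
  diagonal entry therefore has to be applied first, which is why the list is reversed.\<close>

lemma newton_triangular:
  fixes U :: "complex mat"
  assumes U: "U \<in> carrier_mat n n" and ut: "upper_triangular U"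
  shows "k \<le> n \<Longrightarrow> M \<in> carrier_mat n q \<Longrightarrow> (\<And>i j. k \<le> i \<Longrightarrow> i < n \<Longrightarrow> j < q \<Longrightarrow> M $$ (i, j) = 0) \<Longrightarrow>
    newton U (rev (take k (diag_mat U))) M = 0\<^sub>m n q"
proof (induction k arbitrary: M)
  case 0
  then show ?case by (auto intro!: eq_matI)
next
  case (Suc k)
  have k: "k < n" using Suc by simp
  have tk: "rev (take (Suc k) (diag_mat U)) = U $$ (k, k) # rev (take k (diag_mat U))"
    using k U by (simp add: take_Suc_conv_app_nth diag_mat_def)
  have "newton U (rev (take k (diag_mat U))) (U * M - U $$ (k, k) \<cdot>\<^sub>m M) = 0\<^sub>m n q"
  proof (rule Suc.IH)
    show "U * M - U $$ (k, k) \<cdot>\<^sub>m M \<in> carrier_mat n q" using U Suc by auto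
    fix i j assume ij: "k \<le> i" "i < n" "j < q"
    \<comment> \<open>In a row \<open>i \<ge> k\<close> only the summand \<open>l = k\<close>
      survives: triangularity removes \<open>l < k\<close>, and the zero rows of \<open>M\<close>
      remove \<open>l > k\<close>.\<close>
    have "(U * M) $$ (i, j) = (\<Sum>l = 0..<n. U $$ (i, l) * M $$ (l, j))"
      using ij U Suc.prems(2) by (simp add: scalar_prod_def)
    also have "\<dots> = (\<Sum>l = 0..<n. if l = k then U $$ (i, k) * M $$ (k, j) else 0)"
    proof (rule sum.cong[OF refl])
      fix l assume "l \<in> {0..<n}"
      then show "U $$ (i, l) * M $$ (l, j) = (if l = k then U $$ (i, k) * M $$ (k, j) else 0)"
        using ij Suc.prems(3)[of l j] upper_triangularD[OF ut, of l i] U by (cases "l < k") auto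
    qed
    also have "\<dots> = U $$ (i, k) * M $$ (k, j)" using k by simp
    also have "\<dots> = U $$ (k, k) * M $$ (i, j)"
      using ij Suc.prems(3)[of i j] upper_triangularD[OF ut, of k i] U by (cases "i = k") auto
    finally show "(U * M - U $$ (k, k) \<cdot>\<^sub>m M) $$ (i, j) = 0"
      using ij U Suc.prems(2) by (simp del: index_mult_mat(1))
  qed (use k in simp)
  then show ?case unfolding tk by simp
qed

lemma newton_similar:
  fixes A U :: "complex mat"
  assumes "A \<in> carrier_mat n n" "U \<in> carrier_mat n n" "P \<in> carrier_mat n n" "A * P = P * U"
  shows "M \<in> carrier_mat n q \<Longrightarrow> newton A es (P * M) = P * newton U es M"
proof (induction es arbitrary: M)
  case (Cons e es)
  have "A * (P * M) = P * (U * M)"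
    using assms Cons.prems by (simp add: mult_assoc_dim[symmetric])
  then have "A * (P * M) - e \<cdot>\<^sub>m (P * M) = P * (U * M - e \<cdot>\<^sub>m M)"
    using assms Cons.prems by (simp add: mat_ring_simps)
  moreover have "U * M - e \<cdot>\<^sub>m M \<in> carrier_mat n q" using assms Cons.prems by auto
  ultimately show ?case using Cons.IH by simp
qed simp

lemma schur_form:
  fixes A :: "complex mat"
  assumes A: "A \<in> carrier_mat n n" and cp: "char_poly A = (\<Prod>e\<leftarrow>es. [:- e, 1:])"
  obtains U P Q where "U \<in> carrier_mat n n" "P \<in> carrier_mat n n" "Q \<in> carrier_mat n n"
    "upper_triangular U" "diag_mat U = es" "P * Q = 1\<^sub>m n" "Q * P = 1\<^sub>m n" "A * P = P * U"
proof -
  obtain U P Q where s: "schur_decomposition A es = (U, P, Q)"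
    by (cases "schur_decomposition A es") auto
  from schur_decomposition[OF A cp s]
  have sim: "similar_mat_wit A U P Q" and ut: "upper_triangular U" and dg: "diag_mat U = es" by auto
  from similar_mat_witD2[OF A sim]
  have *: "P * Q = 1\<^sub>m n" "Q * P = 1\<^sub>m n" "A = P * U * Q" "U \<in> carrier_mat n n"
    "P \<in> carrier_mat n n" "Q \<in> carrier_mat n n" by auto
  have "P * U * Q * P = P * U" using *(1,2,4-6) by (simp add: mult_assoc_dim)
  with that[OF *(4,5,6) ut dg *(1,2)] *(3) show ?thesis by simp
qed

text \<open>In a Schur basis the factors for the diagonal entries, taken from the last to the first,
  clear the rows one after another. The list is the reversed list of roots of the characteristic
  polynomial, and it serves blocks \<open>M\<close> of every width.\<close>

lemma annihilating_eigenvalues: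
  fixes A :: "complex mat"
  assumes A: "A \<in> carrier_mat n n"
  obtains es where "\<And>e. e \<in> set es \<Longrightarrow> eigenvalue A e"
    "\<And>q M. M \<in> carrier_mat n q \<Longrightarrow> newton A es M = 0\<^sub>m n q"
proof -
  obtain es where es: "char_poly A = (\<Prod>e\<leftarrow>es. [:- e, 1:])"
    using char_poly_factorized[OF A] by blast
  obtain U P Q where s: "U \<in> carrier_mat n n" "P \<in> carrier_mat n n" "Q \<in> carrier_mat n n"
    "upper_triangular U" "diag_mat U = es" "P * Q = 1\<^sub>m n" "Q * P = 1\<^sub>m n" "A * P = P * U"
    by (rule schur_form[OF A es]) blast
  have len: "length es = n" using s by (auto simp: diag_mat_def)
  show ?thesis
  proof (rule that)
    fix e assume "e \<in> set (rev es)"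
    then have "poly (char_poly A) e = 0" unfolding es by (simp add: linear_poly_root)
    then show "eigenvalue A e" using eigenvalue_root_char_poly[OF A] by simp
  next
    fix q and M :: "complex mat" assume M: "M \<in> carrier_mat n q"
    have "M = P * (Q * M)" using s M by (simp add: mult_assoc_dim[symmetric])
    then have "newton A (rev es) M = newton A (rev es) (P * (Q * M))" by simp
    also have "\<dots> = P * newton U (rev es) (Q * M)"
      by (rule newton_similar[OF A s(1,2,8)]) (use s M in auto)
    also have "newton U (rev es) (Q * M) = 0\<^sub>m n q"
      using newton_triangular[OF s(1,4), of n "Q * M" q] s M len by auto
    finally show "newton A (rev es) M = 0\<^sub>m n q" using s by simp
  qed
qed

text \<open>Start from \<open>w = 1\<close> and apply the factors \<open>\<beta> - e\<close> in
  turn. The whole product is zero, so there is a last stage with \<open>Y * w \<noteq> 0\<close>;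
  the next factor gives \<open>(\<beta>' - e) Y w = Y (\<beta> - e) w = 0\<close>. Thus a nonzero
  intertwiner forces a common eigenvalue. This is the tool behind both the uniqueness of Riccati
  solutions and the isotropy of spectral subspaces.\<close>

lemma intertwining_eigenvalue:
  fixes Y \<beta> \<beta>' :: "complex mat"
  assumes \<beta>: "\<beta> \<in> carrier_mat k k" and \<beta>': "\<beta>' \<in> carrier_mat n n" and Y: "Y \<in> carrier_mat n k"
    and eq: "Y * \<beta> = \<beta>' * Y" and nz: "Y \<noteq> 0\<^sub>m n k"
  obtains e w where "eigenvalue \<beta> e" "w \<in> carrier_mat k k" "Y * w \<noteq> 0\<^sub>m n k"
    "\<beta>' * (Y * w) = e \<cdot>\<^sub>m (Y * w)"
proof -
  obtain es where es: "\<And>e. e \<in> set es \<Longrightarrow> eigenvalue \<beta> e"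
    "\<And>q M. M \<in> carrier_mat k q \<Longrightarrow> newton \<beta> es M = 0\<^sub>m k q"
    using annihilating_eigenvalues[OF \<beta>] by blast
  have "\<exists>e w. e \<in> set es \<and> w \<in> carrier_mat k k \<and> Y * w \<noteq> 0\<^sub>m n k \<and> \<beta>' * (Y * w) = e \<cdot>\<^sub>m (Y * w)"
    if "w \<in> carrier_mat k k" "Y * w \<noteq> 0\<^sub>m n k" "newton \<beta> es w = 0\<^sub>m k k" for w
    using that
  proof (induction es arbitrary: w)
    case Nil
    then show ?case using Y by auto
  next
    case (Cons e es)
    let ?w = "\<beta> * w - e \<cdot>\<^sub>m w"
    show ?case
    proof (cases "Y * ?w = 0\<^sub>m n k")
      case True
      have Yw: "Y * ?w = \<beta>' * (Y * w) - e \<cdot>\<^sub>m (Y * w)"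
      proof -
        have "Y * (\<beta> * w) = \<beta>' * (Y * w)"
          using eq \<beta> \<beta>' Y Cons.prems by (simp add: mult_assoc_dim[symmetric])
        then show ?thesis using \<beta> \<beta>' Y Cons.prems by (simp add: mat_ring_simps)
      qed
      have "\<beta>' * (Y * w) = e \<cdot>\<^sub>m (Y * w)"
      proof (rule eq_matI)
        fix i j assume "i < dim_row (e \<cdot>\<^sub>m (Y * w))" "j < dim_col (e \<cdot>\<^sub>m (Y * w))"
        then have ij: "i < n" "j < k" using Y Cons.prems by auto
        have "(\<beta>' * (Y * w) - e \<cdot>\<^sub>m (Y * w)) $$ (i, j) = 0"
          using True ij unfolding Yw by simp
        then show "(\<beta>' * (Y * w)) $$ (i, j) = (e \<cdot>\<^sub>m (Y * w)) $$ (i, j)"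
          using ij \<beta>' Y Cons.prems by (simp del: index_mult_mat(1))
      qed (use \<beta>' Y Cons.prems in auto)
      with Cons.prems show ?thesis by auto
    next
      case False
      from Cons.IH[OF _ False] obtain e w where "e \<in> set es" "w \<in> carrier_mat k k"
        "Y * w \<noteq> 0\<^sub>m n k" "\<beta>' * (Y * w) = e \<cdot>\<^sub>m (Y * w)"
        using Cons.prems \<beta> by auto
      then show ?thesis by auto
    qed
  qed
  from this[of "1\<^sub>m k"] Y nz es(2)[of "1\<^sub>m k" k]
  obtain e w where "e \<in> set es" "w \<in> carrier_mat k k" "Y * w \<noteq> 0\<^sub>m n k"
    "\<beta>' * (Y * w) = e \<cdot>\<^sub>m (Y * w)" by auto
  with es(1) that show ?thesis by blast
qed

section \<open>Krylov blocks \<open>A\<^sup>k M\<close> and the Hautus test\<close>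

primrec kry :: "complex mat \<Rightarrow> complex mat \<Rightarrow> nat \<Rightarrow> complex mat" where
  "kry A M 0 = M"
| "kry A M (Suc k) = A * kry A M k"

lemma kry_carrier [simp]:
  "A \<in> carrier_mat n n \<Longrightarrow> M \<in> carrier_mat n q \<Longrightarrow> kry A M k \<in> carrier_mat n q"
  by (induction k) auto

lemma dim_kry [simp]:
  "dim_row A = dim_row M \<Longrightarrow> dim_row (kry A M k) = dim_row M" "dim_col (kry A M k) = dim_col M"
  by (induction k) auto

lemma kry_kry: "kry A (kry A M l) k = kry A M (k + l)"
  by (induction k) auto

lemma kry_mult: "kry A (A * M) k = A * kry A M k"
  by (induction k) auto

lemma kry_shift:
  assumes "A \<in> carrier_mat n n" "M \<in> carrier_mat n q"
  shows "kry A (A * M - e \<cdot>\<^sub>m M) k = A * kry A M k - e \<cdot>\<^sub>m kry A M k"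
proof (induction k)
  case (Suc k)
  have "dim_row (kry A M k) = n" "dim_col (kry A M k) = q"
    using kry_carrier[OF assms, of k] by auto
  then show ?case unfolding kry.simps Suc using assms by (simp add: mat_ring_simps)
qed simp

text \<open>This is the Hautus test. Controllability of \<open>(A, B)\<close> is expressed as observability of \<open>(A\<^sup>*, B\<^sup>*)\<close>.\<close>

definition observable :: "nat \<Rightarrow> complex mat \<Rightarrow> complex mat \<Rightarrow> bool" where
  "observable n A C \<longleftrightarrow> (\<forall>q. \<forall>M \<in> carrier_mat n q. \<forall>t.
     A * M = t \<cdot>\<^sub>m M \<longrightarrow> C * M = 0\<^sub>m (dim_row C) q \<longrightarrow> M = 0\<^sub>m n q)"

lemma observableD:
  "observable n A C \<Longrightarrow> M \<in> carrier_mat n q \<Longrightarrow> A * M = t \<cdot>\<^sub>m M \<Longrightarrow> C * M = 0\<^sub>m (dim_row C) q \<Longrightarrow>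
    M = 0\<^sub>m n q"
  unfolding observable_def by blast

lemma diff_eq_0_imp_eq:
  fixes M N :: "complex mat"
  assumes "M - N = 0\<^sub>m n q" "M \<in> carrier_mat n q" "N \<in> carrier_mat n q"
  shows "M = N"
proof (rule eq_matI)
  fix i j assume "i < dim_row N" "j < dim_col N"
  then have "i < n" "j < q" using assms by auto
  moreover from this have "(M - N) $$ (i, j) = 0" using assms by simp
  ultimately show "M $$ (i, j) = N $$ (i, j)" using assms(2,3) by auto
qed (use assms in auto)

text \<open>This passes from the Hautus form to the Kalman form of observability. The hypothesis on
  \<open>M\<close> is inherited by \<open>(A - e) M\<close>, so induction along an annihilating list
  gives \<open>(A - e) M = 0\<close>; then the columns of \<open>M\<close> are eigenvectors in the
  kernel of \<open>C\<close>, and the Hautus test applies.\<close>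

lemma observable_krylov:
  assumes A: "A \<in> carrier_mat n n" and C: "C \<in> carrier_mat p n" and obs: "observable n A C"
    and M: "M \<in> carrier_mat n q" and 0: "\<And>k. C * kry A M k = 0\<^sub>m p q"
  shows "M = 0\<^sub>m n q"
proof -
  obtain es where es: "\<And>q M. M \<in> carrier_mat n q \<Longrightarrow> newton A es M = 0\<^sub>m n q"
    by (rule annihilating_eigenvalues[OF A]) (erule that)
  from es[OF M] M 0 show ?thesis
  proof (induction es arbitrary: M)
    case (Cons e es)
    have "A * M - e \<cdot>\<^sub>m M = 0\<^sub>m n q"
    proof (rule Cons.IH)
      show "newton A es (A * M - e \<cdot>\<^sub>m M) = 0\<^sub>m n q" using Cons.prems by simp
      show "A * M - e \<cdot>\<^sub>m M \<in> carrier_mat n q" using A Cons.prems by auto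
      fix k
      have d: "dim_row (kry A M k) = n" "dim_col (kry A M k) = q"
        using kry_carrier[OF A Cons.prems(2), of k] by auto
      have "C * (A * kry A M k) = 0\<^sub>m p q" "C * kry A M k = 0\<^sub>m p q"
        using Cons.prems(3)[of "Suc k"] Cons.prems(3)[of k] by simp_all
      then show "C * kry A (A * M - e \<cdot>\<^sub>m M) k = 0\<^sub>m p q"
        unfolding kry_shift[OF A Cons.prems(2)] using d A C by (simp add: mat_ring_simps)
    qed
    then have "A * M = e \<cdot>\<^sub>m M"
      by (rule diff_eq_0_imp_eq) (use A Cons.prems in auto)
    moreover have "C * M = 0\<^sub>m p q" using Cons.prems(3)[of 0] by simp
    ultimately show ?case using observableD[OF obs Cons.prems(2)] C by auto
  qed simp
qed

lemma kry_adjoint: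
  assumes "A \<in> carrier_mat n n" "B \<in> carrier_mat n m"
  shows "X \<in> carrier_mat q n \<Longrightarrow>
    mat_adjoint B * kry (mat_adjoint A) (mat_adjoint X) k = mat_adjoint (X * kry A B k)"
proof (induction k arbitrary: X)
  case 0
  then show ?case using assms by (simp add: adjoint_simps)
next
  case (Suc k)
  have d: "dim_row (kry A B k) = n" using kry_carrier[OF assms, of k] by auto
  have "kry (mat_adjoint A) (mat_adjoint X) (Suc k) = kry (mat_adjoint A) (mat_adjoint (X * A)) k"
    using Suc.prems assms by (simp add: adjoint_simps kry_mult)
  then have "mat_adjoint B * kry (mat_adjoint A) (mat_adjoint X) (Suc k) =
      mat_adjoint (X * A * kry A B k)"
    using Suc.IH[of "X * A"] Suc.prems assms by auto
  then show ?case using Suc.prems assms d by (simp add: mult_assoc_dim)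
qed

lemma adjoint_eq_0_iff:
  fixes X :: "complex mat"
  shows "mat_adjoint X = 0\<^sub>m n q \<longleftrightarrow> X = 0\<^sub>m q n"
  by (metis adjoint_adjoint adjoint_zero)

lemma controllable_krylov:
  assumes A: "A \<in> carrier_mat n n" and B: "B \<in> carrier_mat n m"
    and ctrl: "observable n (mat_adjoint A) (mat_adjoint B)"
    and X: "X \<in> carrier_mat q n" and 0: "\<And>k. X * kry A B k = 0\<^sub>m q m"
  shows "X = 0\<^sub>m q n"
proof -
  have "mat_adjoint X = 0\<^sub>m n q"
  proof (rule observable_krylov[OF _ _ ctrl])
    show "mat_adjoint B * kry (mat_adjoint A) (mat_adjoint X) k = 0\<^sub>m m q" for k
      unfolding kry_adjoint[OF A B X] 0 by simp
  qed (use A B X in auto)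
  then show ?thesis unfolding adjoint_eq_0_iff .
qed

text \<open>An observability Gramian in Newton form. Its definiteness only needs the unobservable part to
  vanish, and its products with \<open>M\<close> depend only on the coefficients \<open>C A\<^sup>k M\<close>.\<close>

primrec gram :: "complex mat \<Rightarrow> complex mat \<Rightarrow> complex mat \<Rightarrow> complex mat \<Rightarrow> complex list \<Rightarrow> complex mat" where
  "gram A1 C1 A2 C2 [] = mat_adjoint C1 * C2"
| "gram A1 C1 A2 C2 (e # es) = mat_adjoint C1 * C2 +
    mat_adjoint (A1 - e \<cdot>\<^sub>m 1\<^sub>m (dim_row A1)) * gram A1 C1 A2 C2 es * (A2 - e \<cdot>\<^sub>m 1\<^sub>m (dim_row A2))"

lemma gram_carrier:
  "A1 \<in> carrier_mat n n \<Longrightarrow> A2 \<in> carrier_mat k k \<Longrightarrow> C1 \<in> carrier_mat p n \<Longrightarrow> C2 \<in> carrier_mat p k \<Longrightarrow>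
    gram A1 C1 A2 C2 es \<in> carrier_mat n k"
  by (induction es) auto

lemma shift_mult:
  fixes A M :: "complex mat"
  assumes "A \<in> carrier_mat n n" "M \<in> carrier_mat n q"
  shows "(A - e \<cdot>\<^sub>m 1\<^sub>m n) * M = A * M - e \<cdot>\<^sub>m M"
  using assms by (simp add: mat_ring_simps)

text \<open>The left system \<open>(A, C)\<close> is a fixed observer; two right systems in states
  \<open>M1\<close> and \<open>M2\<close> with equal outputs look the same to it. Replacing each
  \<open>Mi\<close> by \<open>(Ai - e) Mi\<close> preserves equality of all outputs, which is what
  the recursion of \<open>gram\<close> asks for.\<close>

lemma gram_mult_eq:
  assumes A: "A \<in> carrier_mat n n" "C \<in> carrier_mat p n"
    and A1: "A1 \<in> carrier_mat k k" "C1 \<in> carrier_mat p k"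
    and A2: "A2 \<in> carrier_mat l l" "C2 \<in> carrier_mat p l"
  shows "M1 \<in> carrier_mat k q \<Longrightarrow> M2 \<in> carrier_mat l q \<Longrightarrow>
    (\<And>i. C1 * kry A1 M1 i = C2 * kry A2 M2 i) \<Longrightarrow>
    gram A C A1 C1 es * M1 = gram A C A2 C2 es * M2"
proof (induction es arbitrary: M1 M2)
  case Nil
  from Nil(3)[of 0] show ?case using assms Nil by (simp add: mult_assoc_dim)
next
  case (Cons e es)
  have CM: "C1 * M1 = C2 * M2" using Cons.prems(3)[of 0] by simp
  have IH: "gram A C A1 C1 es * (A1 * M1 - e \<cdot>\<^sub>m M1) = gram A C A2 C2 es * (A2 * M2 - e \<cdot>\<^sub>m M2)"
  proof (rule Cons.IH)
    fix i
    have d: "dim_row (kry A1 M1 i) = k" "dim_col (kry A1 M1 i) = q"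
      "dim_row (kry A2 M2 i) = l" "dim_col (kry A2 M2 i) = q"
      using kry_carrier[OF A1(1) Cons.prems(1), of i] kry_carrier[OF A2(1) Cons.prems(2), of i] by auto
    have "C1 * (A1 * kry A1 M1 i) = C2 * (A2 * kry A2 M2 i)" "C1 * kry A1 M1 i = C2 * kry A2 M2 i"
      using Cons.prems(3)[of "Suc i"] Cons.prems(3)[of i] by simp_all
    then show "C1 * kry A1 (A1 * M1 - e \<cdot>\<^sub>m M1) i = C2 * kry A2 (A2 * M2 - e \<cdot>\<^sub>m M2) i"
      unfolding kry_shift[OF A1(1) Cons.prems(1)] kry_shift[OF A2(1) Cons.prems(2)]
      using A1 A2 d by (simp add: mat_ring_simps)
  qed (use A1 A2 Cons.prems in auto)
  have G: "gram A C A1 C1 es \<in> carrier_mat n k" "gram A C A2 C2 es \<in> carrier_mat n l"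
    by (rule gram_carrier; use assms in auto)+
  have *: "gram A C Ai Ci (e # es) * Mi = mat_adjoint C * (Ci * Mi) +
      mat_adjoint (A - e \<cdot>\<^sub>m 1\<^sub>m n) * (gram A C Ai Ci es * (Ai * Mi - e \<cdot>\<^sub>m Mi))"
    if "Ai \<in> carrier_mat ki ki" "Ci \<in> carrier_mat p ki" "Mi \<in> carrier_mat ki q"
      "gram A C Ai Ci es \<in> carrier_mat n ki" for Ai Ci Mi ki
  proof -
    have "gram A C Ai Ci (e # es) * Mi = mat_adjoint C * Ci * Mi +
      mat_adjoint (A - e \<cdot>\<^sub>m 1\<^sub>m n) * gram A C Ai Ci es * (Ai - e \<cdot>\<^sub>m 1\<^sub>m ki) * Mi"
      using that A by (simp add: add_mult_dim)
    also have "\<dots> = mat_adjoint C * (Ci * Mi) +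
      mat_adjoint (A - e \<cdot>\<^sub>m 1\<^sub>m n) * (gram A C Ai Ci es * ((Ai - e \<cdot>\<^sub>m 1\<^sub>m ki) * Mi))"
      using that A by (simp add: mult_assoc_dim)
    finally show ?thesis using that by (simp add: shift_mult)
  qed
  show ?case
    unfolding *[OF A1 Cons.prems(1) G(1)] *[OF A2 Cons.prems(2) G(2)] IH CM ..
qed

lemma adjoint_mult_self_nonneg:
  fixes M :: "complex mat"
  assumes "j < dim_col M"
  shows "0 \<le> (mat_adjoint M * M) $$ (j, j)"
  unfolding adjoint_mult_self_index[OF assms] by (simp add: less_eq_complex_def sum_nonneg)

text \<open>Iterating this recursion writes the form as a sum of squared norms of
  \<open>C (A - e\<^sub>k) \<dots> (A - e\<^sub>1) v\<close> over the initial segments of the list,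
  the empty one included.\<close>

lemma gram_quadratic_form:
  assumes A: "A \<in> carrier_mat n n" "C \<in> carrier_mat p n" and v: "v \<in> carrier_mat n 1"
  shows "mat_adjoint v * gram A C A C (e # es) * v = mat_adjoint (C * v) * (C * v) +
    mat_adjoint (A * v - e \<cdot>\<^sub>m v) * gram A C A C es * (A * v - e \<cdot>\<^sub>m v)"
proof -
  have G: "gram A C A C es \<in> carrier_mat n n" by (rule gram_carrier; use assms in auto)
  let ?S = "A - e \<cdot>\<^sub>m 1\<^sub>m n"
  have S: "?S \<in> carrier_mat n n" using A by auto
  have "mat_adjoint v * gram A C A C (e # es) * v = mat_adjoint (C * v) * (C * v) +
    mat_adjoint (?S * v) * gram A C A C es * (?S * v)"
    using A v G S by (simp add: mult_assoc_dim mult_add_dim add_mult_dim adjoint_mult)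
  then show ?thesis unfolding shift_mult[OF A(1) v] .
qed

lemma gram_nonneg:
  assumes A: "A \<in> carrier_mat n n" "C \<in> carrier_mat p n"
  shows "v \<in> carrier_mat n 1 \<Longrightarrow> 0 \<le> (mat_adjoint v * gram A C A C es * v) $$ (0, 0)"
proof (induction es arbitrary: v)
  case Nil
  then have "mat_adjoint v * gram A C A C [] * v = mat_adjoint (C * v) * (C * v)"
    using A by (simp add: mult_assoc_dim adjoint_mult)
  then show ?case using adjoint_mult_self_nonneg[of 0 "C * v"] Nil by simp
next
  case (Cons e es)
  have G: "gram A C A C es \<in> carrier_mat n n" by (rule gram_carrier; use assms in auto)
  have w: "A * v - e \<cdot>\<^sub>m v \<in> carrier_mat n 1" using A Cons by auto
  show ?case unfolding gram_quadratic_form[OF A Cons.prems]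
    using Cons.IH[OF w] adjoint_mult_self_nonneg[of 0 "C * v"] Cons.prems A w G
    by (simp del: index_mult_mat(1))
qed

text \<open>Every square in the sum vanishes. By induction \<open>(A - e) v = 0\<close>, and the
  first square gives \<open>C v = 0\<close>, so the Hautus test yields \<open>v = 0\<close>. The
  \<open>newton\<close> hypothesis says that the full product kills \<open>v\<close>, which is the
  base of the induction.\<close>

lemma gram_quadratic_form_eq_0:
  assumes A: "A \<in> carrier_mat n n" "C \<in> carrier_mat p n" and obs: "observable n A C"
  shows "v \<in> carrier_mat n 1 \<Longrightarrow> newton A es v = 0\<^sub>m n 1 \<Longrightarrow>
    (mat_adjoint v * gram A C A C es * v) $$ (0, 0) = 0 \<Longrightarrow> v = 0\<^sub>m n 1"
proof (induction es arbitrary: v)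
  case (Cons e es)
  have G: "gram A C A C es \<in> carrier_mat n n" by (rule gram_carrier; use assms in auto)
  have w: "A * v - e \<cdot>\<^sub>m v \<in> carrier_mat n 1" using A Cons by auto
  have s: "(mat_adjoint (C * v) * (C * v)) $$ (0, 0) +
      (mat_adjoint (A * v - e \<cdot>\<^sub>m v) * gram A C A C es * (A * v - e \<cdot>\<^sub>m v)) $$ (0, 0) = 0"
    using Cons.prems(3) unfolding gram_quadratic_form[OF A Cons.prems(1)]
    using Cons.prems A w G by (simp del: index_mult_mat(1))
  with gram_nonneg[OF A w, of es] adjoint_mult_self_nonneg[of 0 "C * v"] Cons.prems
  have 0: "(mat_adjoint (C * v) * (C * v)) $$ (0, 0) = 0"
    "(mat_adjoint (A * v - e \<cdot>\<^sub>m v) * gram A C A C es * (A * v - e \<cdot>\<^sub>m v)) $$ (0, 0) = 0"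
    by (simp_all add: add_nonneg_eq_0_iff del: index_mult_mat(1))
  have "A * v - e \<cdot>\<^sub>m v = 0\<^sub>m n 1"
    by (rule Cons.IH[OF w _ 0(2)]) (use Cons.prems in simp)
  then have "A * v = e \<cdot>\<^sub>m v"
    by (rule diff_eq_0_imp_eq) (use A Cons.prems in auto)
  moreover have "C * v = 0\<^sub>m p 1"
  proof -
    have "mat_adjoint (C * v) * (C * v) = 0\<^sub>m 1 1"
      by (rule eq_matI) (use 0 Cons.prems A in \<open>auto simp del: index_mult_mat(1)\<close>)
    then show ?thesis using adjoint_mult_self_eq_0[of "C * v"] Cons.prems A by simp
  qed
  ultimately show ?case using observableD[OF obs Cons.prems(1)] A by auto
qed simp

lemma gram_inverse:
  assumes A: "A \<in> carrier_mat n n" "C \<in> carrier_mat p n" and obs: "observable n A C"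
  obtains es N where "N \<in> carrier_mat n n" "N * gram A C A C es = 1\<^sub>m n" "gram A C A C es * N = 1\<^sub>m n"
proof -
  obtain es where es: "\<And>q M. M \<in> carrier_mat n q \<Longrightarrow> newton A es M = 0\<^sub>m n q"
    by (rule annihilating_eigenvalues[OF A(1)]) (erule that)
  have G: "gram A C A C es \<in> carrier_mat n n" by (rule gram_carrier; use assms in auto)
  obtain N where "N \<in> carrier_mat n n" "gram A C A C es * N = 1\<^sub>m n" "N * gram A C A C es = 1\<^sub>m n"
  proof (rule injective_imp_inverse[OF G])
    fix v assume v: "v \<in> carrier_mat n 1" and 0: "gram A C A C es * v = 0\<^sub>m n 1"
    show "v = 0\<^sub>m n 1"
    proof (rule gram_quadratic_form_eq_0[OF A obs v es[OF v]])
      have "mat_adjoint v * gram A C A C es * v = 0\<^sub>m 1 1"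
        using 0 v G by (simp add: mult_assoc_dim)
      then show "(mat_adjoint v * gram A C A C es * v) $$ (0, 0) = 0" by simp
    qed
  qed blast
  then show ?thesis using that by blast
qed

text \<open>\<open>T\<close> is the least-squares solution of \<open>O' T = O\<close> for the
  observability matrices of the two systems, expressed through Gramians. Equal Markov parameters
  make it carry \<open>A\<^sup>l B\<close> to \<open>A'\<^sup>l B'\<close>, and controllability
  upgrades identities on these blocks to identities of matrices.\<close>

lemma state_space_isomorphism:
  assumes A: "A \<in> carrier_mat n n" and B: "B \<in> carrier_mat n m" and C: "C \<in> carrier_mat p n"
    and A': "A' \<in> carrier_mat n n" and B': "B' \<in> carrier_mat n m" and C': "C' \<in> carrier_mat p n"
    and eq: "\<And>k. C * kry A B k = C' * kry A' B' k"
    and ctrl: "observable n (mat_adjoint A) (mat_adjoint B)"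
    and obs: "observable n A C" and obs': "observable n A' C'"
  obtains T S where "T \<in> carrier_mat n n" "S \<in> carrier_mat n n" "T * S = 1\<^sub>m n" "S * T = 1\<^sub>m n"
    "T * A = A' * T" "T * B = B'" "C' * T = C"
proof -
  obtain es N where N: "N \<in> carrier_mat n n" "N * gram A' C' A' C' es = 1\<^sub>m n"
    using gram_inverse[OF A' C' obs'] by blast
  define T where "T = N * gram A' C' A C es"
  have G: "gram A' C' A C es \<in> carrier_mat n n" "gram A' C' A' C' es \<in> carrier_mat n n"
    by (rule gram_carrier; use assms in auto)+
  have T: "T \<in> carrier_mat n n" unfolding T_def using N G by auto
  have K: "kry A B l \<in> carrier_mat n m" "kry A' B' l \<in> carrier_mat n m" for l
    using A B A' B' by auto
  have TK: "T * kry A B l = kry A' B' l" for l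
  proof -
    have "gram A' C' A C es * kry A B l = gram A' C' A' C' es * kry A' B' l"
      by (rule gram_mult_eq[OF A' C' A C A' C' K]) (simp only: kry_kry eq)
    then have "T * kry A B l = N * (gram A' C' A' C' es * kry A' B' l)"
      unfolding T_def using N G K[of l] by (simp add: mult_assoc_dim)
    also have "\<dots> = kry A' B' l"
      using N G K[of l] by (simp add: mult_assoc_dim[symmetric])
    finally show ?thesis .
  qed
  have TB: "T * B = B'" using TK[of 0] by simp
  have TA: "T * A = A' * T"
  proof (rule diff_eq_0_imp_eq)
    show "T * A - A' * T = 0\<^sub>m n n"
    proof (rule controllable_krylov[OF A B ctrl])
      fix k
      have "(T * A - A' * T) * kry A B k = T * (A * kry A B k) - A' * (T * kry A B k)"
        using T A A' K[of k] by (simp add: mat_ring_simps)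
      also have "T * (A * kry A B k) = A' * kry A' B' k" using TK[of "Suc k"] by simp
      finally show "(T * A - A' * T) * kry A B k = 0\<^sub>m n m"
        unfolding TK using A' K[of k] by (auto intro!: eq_matI simp del: index_mult_mat(1))
    qed (use T A A' in auto)
  qed (use T A A' in auto)
  have CT: "C' * T = C"
  proof (rule diff_eq_0_imp_eq)
    show "C' * T - C = 0\<^sub>m p n"
    proof (rule controllable_krylov[OF A B ctrl])
      fix k
      have "(C' * T - C) * kry A B k = C' * (T * kry A B k) - C * kry A B k"
        using T C C' K[of k] by (simp add: mat_ring_simps)
      then show "(C' * T - C) * kry A B k = 0\<^sub>m p m"
        unfolding TK eq using C' K[of k] by (auto intro!: eq_matI simp del: index_mult_mat(1))
    qed (use T C C' in auto)
  qed (use T C C' in auto)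
  \<comment> \<open>If \<open>T v = 0\<close>, then
    \<open>C A\<^sup>k v = C' T A\<^sup>k v = C' A'\<^sup>k T v = 0\<close> for all
    \<open>k\<close>, so observability of the first system makes \<open>T\<close> injective.\<close>
  obtain S where "S \<in> carrier_mat n n" "T * S = 1\<^sub>m n" "S * T = 1\<^sub>m n"
  proof (rule injective_imp_inverse[OF T])
    fix v assume v: "v \<in> carrier_mat n 1" and 0: "T * v = 0\<^sub>m n 1"
    show "v = 0\<^sub>m n 1"
    proof (rule observable_krylov[OF A C obs v])
      fix k
      have Kv: "kry A v k \<in> carrier_mat n 1" using A v by simp
      have "T * kry A v k = 0\<^sub>m n 1"
      proof (induction k)
        case (Suc k)
        have d: "kry A v k \<in> carrier_mat n 1" using A v by simp
        have "T * (A * kry A v k) = A' * (T * kry A v k)"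
          using T A A' d by (simp add: mult_assoc_dim[symmetric] TA)
        then show ?case using Suc A' by simp
      qed (use 0 in simp)
      then have "C' * (T * kry A v k) = 0\<^sub>m p 1" using C' by simp
      then show "C * kry A v k = 0\<^sub>m p 1"
        using C' T Kv by (simp add: mult_assoc_dim[symmetric] CT)
    qed
  qed blast
  then show ?thesis using that T TA TB CT by blast
qed

section \<open>Values of rational functions\<close>

lemma rat_eval_Fract:
  assumes "poly q z \<noteq> 0"
  shows "rat_eval (Fract p q) z = poly p z / poly q z" "\<not> rat_pole (Fract p q) z"
proof -
  have uniq: "poly p' z / poly q' z = poly p z / poly q z"
    if "Fract p q = Fract p' q'" "poly q' z \<noteq> 0" for p' q'
  proof -
    have "q \<noteq> 0" "q' \<noteq> 0" using assms that by auto
    with that have "p * q' = p' * q" by (simp add: eq_fract)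
    then have "poly p z * poly q' z = poly p' z * poly q z" by (metis poly_mult)
    with assms that show ?thesis by (simp add: frac_eq_eq)
  qed
  show "rat_eval (Fract p q) z = poly p z / poly q z"
    unfolding rat_eval_def
  proof (rule the_equality)
    show "\<exists>pa qa. Fract p q = Fract pa qa \<and> poly qa z \<noteq> 0 \<and> poly p z / poly q z = poly pa z / poly qa z"
      using assms by blast
    fix v assume "\<exists>pa qa. Fract p q = Fract pa qa \<and> poly qa z \<noteq> 0 \<and> v = poly pa z / poly qa z"
    then show "v = poly p z / poly q z" using uniq by blast
  qed
  show "\<not> rat_pole (Fract p q) z" using assms unfolding rat_pole_def by blast
qed

lemma not_rat_poleE:
  assumes "\<not> rat_pole f z"
  obtains p q where "f = Fract p q" "poly q z \<noteq> 0" "q \<noteq> 0" "rat_eval f z = poly p z / poly q z"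
proof -
  obtain p q where "f = Fract p q" "poly q z \<noteq> 0"
    using assms unfolding rat_pole_def by blast
  moreover from this have "q \<noteq> 0" by auto
  ultimately show ?thesis using that[of p q] rat_eval_Fract(1)[of q z p] by auto
qed

lemma rat_eval_add:
  assumes "\<not> rat_pole f z" "\<not> rat_pole g z"
  shows "rat_eval (f + g) z = rat_eval f z + rat_eval g z" "\<not> rat_pole (f + g) z"
proof -
  obtain p q where f: "f = Fract p q" "poly q z \<noteq> 0" "q \<noteq> 0" "rat_eval f z = poly p z / poly q z"
    using assms(1) by (rule not_rat_poleE)
  obtain r s where g: "g = Fract r s" "poly s z \<noteq> 0" "s \<noteq> 0" "rat_eval g z = poly r z / poly s z"
    using assms(2) by (rule not_rat_poleE)
  have fg: "f + g = Fract (p * s + r * q) (q * s)" using f g by simp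
  have nz: "poly (q * s) z \<noteq> 0" using f g by simp
  show "\<not> rat_pole (f + g) z" unfolding fg by (rule rat_eval_Fract[OF nz])
  show "rat_eval (f + g) z = rat_eval f z + rat_eval g z"
    unfolding fg rat_eval_Fract[OF nz] f(4) g(4) using f(2) g(2) by (simp add: add_frac_eq)
qed

lemma rat_eval_mult:
  assumes "\<not> rat_pole f z" "\<not> rat_pole g z"
  shows "rat_eval (f * g) z = rat_eval f z * rat_eval g z" "\<not> rat_pole (f * g) z"
proof -
  obtain p q where f: "f = Fract p q" "poly q z \<noteq> 0" "q \<noteq> 0" "rat_eval f z = poly p z / poly q z"
    using assms(1) by (rule not_rat_poleE)
  obtain r s where g: "g = Fract r s" "poly s z \<noteq> 0" "s \<noteq> 0" "rat_eval g z = poly r z / poly s z"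
    using assms(2) by (rule not_rat_poleE)
  have fg: "f * g = Fract (p * r) (q * s)" using f g by simp
  have nz: "poly (q * s) z \<noteq> 0" using f g by simp
  show "\<not> rat_pole (f * g) z" unfolding fg by (rule rat_eval_Fract[OF nz])
  show "rat_eval (f * g) z = rat_eval f z * rat_eval g z"
    unfolding fg rat_eval_Fract[OF nz] f(4) g(4) by simp
qed

lemma rat_eval_0 [simp]: "rat_eval 0 z = 0" "\<not> rat_pole 0 z"
  using rat_eval_Fract[of 1 z 0] by (simp_all add: Zero_fract_def)

lemma rat_eval_1 [simp]: "rat_eval 1 z = 1" "\<not> rat_pole 1 z"
  using rat_eval_Fract[of 1 z 1] by (simp_all add: One_fract_def)

lemma rat_eval_const [simp]: "rat_eval (Fract [:c:] 1) z = c" "\<not> rat_pole (Fract [:c:] 1) z"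
  using rat_eval_Fract[of 1 z "[:c:]"] by simp_all

lemma finite_rat_pole: "finite {z. rat_pole f z}"
proof (cases f)
  case (Fract p q)
  then have "{z. rat_pole f z} \<subseteq> {z. poly q z = 0}" using rat_eval_Fract(2) by blast
  then show ?thesis using poly_roots_finite[OF Fract(2)] finite_subset by blast
qed

text \<open>After removing the finitely many zeros of the two denominators, the cross-multiplied
  difference is a polynomial with infinitely many roots. Meaningless values at poles do no harm,
  since they only occur at the removed points.\<close>

lemma ratfun_eqI:
  assumes "infinite S" "\<And>z. z \<in> S \<Longrightarrow> rat_eval f z = rat_eval g z"
  shows "f = g"
proof (cases f)
  case f: (Fract p q)
  show ?thesis
  proof (cases g)
    case g: (Fract r s)
    have "infinite (S - ({z. poly q z = 0} \<union> {z. poly s z = 0}))"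
      using assms(1) poly_roots_finite f(2) g(2) by (intro Diff_infinite_finite) auto
    moreover have "S - ({z. poly q z = 0} \<union> {z. poly s z = 0}) \<subseteq> {z. poly (p * s - r * q) z = 0}"
    proof
      fix z assume z: "z \<in> S - ({z. poly q z = 0} \<union> {z. poly s z = 0})"
      then have "poly q z \<noteq> 0" "poly s z \<noteq> 0" by auto
      moreover from this have "poly p z / poly q z = poly r z / poly s z"
        using assms(2)[of z] z rat_eval_Fract(1)[of q z p] rat_eval_Fract(1)[of s z r] f g by auto
      ultimately show "z \<in> {z. poly (p * s - r * q) z = 0}" by (simp add: frac_eq_eq)
    qed
    ultimately have "infinite {z. poly (p * s - r * q) z = 0}"
      using infinite_super by blast
    then have "p * s - r * q = 0" using poly_roots_finite by blast
    with f g show ?thesis by (simp add: eq_fract)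
  qed
qed

lemma eventually_notin_finite_at:
  fixes z :: complex
  assumes "finite S"
  shows "eventually (\<lambda>w. w \<notin> S) (at z within T)"
proof -
  have "eventually (\<lambda>w. \<forall>s\<in>S. w \<noteq> s) (at z within T)"
    using assms by (intro eventually_ball_finite) (auto intro: eventually_neq_at_within)
  then show ?thesis by (rule eventually_mono) auto
qed

lemma eventually_notin_finite_at_infinity:
  fixes S :: "complex set"
  assumes "finite S"
  shows "eventually (\<lambda>w. w \<notin> S) at_infinity"
proof -
  have "eventually (\<lambda>w. \<forall>s\<in>S. w \<noteq> s) at_infinity"
  proof (intro eventually_ball_finite ballI)
    fix s :: complex
    show "eventually (\<lambda>w. w \<noteq> s) at_infinity"
      by (rule eventually_at_infinityI[of "norm s + 1"]) auto
  qed fact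
  then show ?thesis by (rule eventually_mono) auto
qed

lemma at_infinity_complex_neq_bot: "(at_infinity :: complex filter) \<noteq> bot"
proof
  assume "(at_infinity :: complex filter) = bot"
  then have "eventually (\<lambda>z :: complex. False) at_infinity" by simp
  then obtain b where "\<And>z :: complex. b \<le> norm z \<Longrightarrow> False"
    unfolding eventually_at_infinity by blast
  from this[of "of_real \<bar>b\<bar>"] show False by (simp add: abs_ge_self)
qed

lemma rat_eval_continuous:
  assumes "\<not> rat_pole f z"
  shows "(rat_eval f \<longlongrightarrow> rat_eval f z) (at z within T)"
proof -
  obtain p q where f: "f = Fract p q" "poly q z \<noteq> 0" "q \<noteq> 0" "rat_eval f z = poly p z / poly q z"
    using assms by (rule not_rat_poleE)
  have "((\<lambda>w. poly p w / poly q w) \<longlongrightarrow> poly p z / poly q z) (at z within T)"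
    using f by (intro tendsto_intros) auto
  moreover have "eventually (\<lambda>w. w \<notin> {w. poly q w = 0}) (at z within T)"
    using poly_roots_finite[OF f(3)] by (rule eventually_notin_finite_at)
  then have "eventually (\<lambda>w. poly p w / poly q w = rat_eval f w) (at z within T)"
    by (rule eventually_mono) (simp add: rat_eval_Fract(1) f(1))
  ultimately show ?thesis unfolding f(4) by (rule Lim_transform_eventually)
qed

text \<open>Comparing orders of vanishing at \<open>z\<close> and cancelling the common power leaves
  a numerator that does not vanish at \<open>z\<close> over a denominator that does.\<close>

lemma rat_pole_unbounded:
  assumes "rat_pole f z"
  shows "filterlim (rat_eval f) at_infinity (at z within T)"
proof (cases f)
  case (Fract p q)
  have p0: "p \<noteq> 0"
  proof
    assume "p = 0"
    then have "f = 0" using Fract by (simp add: fract_collapse)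
    with assms show False by simp
  qed
  obtain p' where p': "p = [:- z, 1:] ^ order z p * p'" "\<not> [:- z, 1:] dvd p'"
    using order_decomp[OF p0] by blast
  obtain q' where q': "q = [:- z, 1:] ^ order z q * q'" "\<not> [:- z, 1:] dvd q'"
    using order_decomp[OF Fract(2)] by blast
  have nz: "poly p' z \<noteq> 0" "poly q' z \<noteq> 0" using p' q' by (auto simp: poly_eq_0_iff_dvd)
  \<comment> \<open>Otherwise the whole power of \<open>z\<close> in the denominator cancels, which
    exhibits a quotient with nonvanishing denominator and contradicts the pole.\<close>
  have lt: "order z p < order z q"
  proof (rule ccontr)
    assume "\<not> order z p < order z q"
    then have "p = [:- z, 1:] ^ order z q * ([:- z, 1:] ^ (order z p - order z q) * p')"
      using p'(1) by (metis le_add_diff_inverse linorder_not_less mult.assoc power_add)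
    then have "f = Fract ([:- z, 1:] ^ (order z p - order z q) * p') q'"
      using Fract(1) q'(1) mult_fract_cancel[of "[:- z, 1:] ^ order z q"] by (metis mult_zero_left Fract(2))
    with rat_eval_Fract(2)[OF nz(2)] assms show False by blast
  qed
  define k where "k = order z q - order z p"
  have k: "k > 0" using lt by (simp add: k_def)
  have "q = [:- z, 1:] ^ order z p * ([:- z, 1:] ^ k * q')"
    using q'(1) lt unfolding k_def by (metis le_add_diff_inverse less_imp_le mult.assoc power_add)
  moreover have "[:- z, 1:] ^ order z p \<noteq> 0" by simp
  ultimately have f: "f = Fract p' ([:- z, 1:] ^ k * q')"
    using Fract(1) p'(1) mult_fract_cancel by metis
  have q0: "[:- z, 1:] ^ k * q' \<noteq> 0" using nz by auto
  have ev: "eventually (\<lambda>w. w \<notin> {w. poly ([:- z, 1:] ^ k * q') w = 0}) (at z within T)"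
    using poly_roots_finite[OF q0] by (rule eventually_notin_finite_at)
  have "filterlim (\<lambda>w. poly p' w / poly ([:- z, 1:] ^ k * q') w) at_infinity (at z within T)"
  proof (rule filterlim_divide_at_infinity[OF _ _ nz(1)])
    show "(poly p' \<longlongrightarrow> poly p' z) (at z within T)" by (intro tendsto_intros)
    have "((\<lambda>w. poly ([:- z, 1:] ^ k * q') w) \<longlongrightarrow> poly ([:- z, 1:] ^ k * q') z) (at z within T)"
      by (intro tendsto_intros)
    moreover have "poly ([:- z, 1:] ^ k * q') z = 0" using k by simp
    ultimately have "(poly ([:- z, 1:] ^ k * q') \<longlongrightarrow> 0) (at z within T)" by metis
    then show "filterlim (poly ([:- z, 1:] ^ k * q')) (at 0) (at z within T)"
      using ev unfolding filterlim_at by simp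
  qed
  moreover have "eventually (\<lambda>w. rat_eval f w = poly p' w / poly ([:- z, 1:] ^ k * q') w) (at z within T)"
    using ev by (rule eventually_mono) (use f rat_eval_Fract(1) in blast)
  ultimately show ?thesis by (simp add: filterlim_cong[OF refl refl])
qed

text \<open>This supplies regularity of \<open>R\<close> on the real axis and in the half-plane:
  contractivity off a finite set bounds the entries by 1 and thereby excludes poles.\<close>

lemma rat_eval_bounded_imp_not_pole:
  assumes "eventually (\<lambda>w. cmod (rat_eval f w) \<le> c) (at z within T)" "at z within T \<noteq> bot"
  shows "\<not> rat_pole f z"
proof
  assume "rat_pole f z"
  from rat_pole_unbounded[OF this]
  have "eventually (\<lambda>w. \<bar>c\<bar> + 1 \<le> cmod (rat_eval f w)) (at z within T)"
    unfolding filterlim_at_infinity[OF order_refl] by auto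
  with assms(1) have "eventually (\<lambda>w. False) (at z within T)"
    by eventually_elim auto
  with assms(2) show False by simp
qed

text \<open>If the numerator had the larger degree, \<open>q / p\<close> would tend to 0 while
  \<open>p / q\<close> tends to \<open>L\<close>, although their product is 1.\<close>

lemma proper_ratfun:
  assumes "(rat_eval f \<longlongrightarrow> L) at_infinity"
  obtains p q where "f = Fract p q" "q \<noteq> 0" "degree p \<le> degree q"
proof (cases f)
  case (Fract p q)
  have "degree p \<le> degree q"
  proof (rule ccontr)
    assume "\<not> degree p \<le> degree q"
    then have dg: "degree q < degree p" and p0: "p \<noteq> 0" by auto
    have ev: "eventually (\<lambda>w. w \<notin> {w. poly (p * q) w = 0}) at_infinity"
      by (rule eventually_notin_finite_at_infinity, rule poly_roots_finite) (use Fract p0 in auto)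
    have "((\<lambda>w. rat_eval f w * (poly q w / poly p w)) \<longlongrightarrow> L * 0) at_infinity"
      by (intro tendsto_mult assms poly_divide_tendsto_0_at_infinity dg)
    moreover have "eventually (\<lambda>w. rat_eval f w * (poly q w / poly p w) = 1) at_infinity"
      using ev by (rule eventually_mono) (auto simp: Fract rat_eval_Fract(1))
    ultimately have "((\<lambda>w :: complex. 1 :: complex) \<longlongrightarrow> L * 0) at_infinity"
      by (rule Lim_transform_eventually)
    then have "1 = L * 0"
      using tendsto_unique[OF at_infinity_complex_neq_bot tendsto_const] by blast
    then show False by simp
  qed
  with Fract show ?thesis by (rule that)
qed

lemma is_singular_at_iff:
  "is_singular_at F z \<longleftrightarrow> (\<exists>i < dim_row F. \<exists>k < dim_col F. rat_pole (F $$ (i, k)) z)"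
  unfolding is_singular_at_def by (auto dest!: elements_matD intro: elements_matI[OF carrier_mat_triv])

lemma dim_mat_eval [simp]: "dim_row (mat_eval F z) = dim_row F" "dim_col (mat_eval F z) = dim_col F"
  by (simp_all add: mat_eval_def)

lemma index_mat_eval [simp]:
  "i < dim_row F \<Longrightarrow> k < dim_col F \<Longrightarrow> mat_eval F z $$ (i, k) = rat_eval (F $$ (i, k)) z"
  by (simp add: mat_eval_def)

lemma finite_is_singular_at: "finite {z. is_singular_at F z}"
proof -
  have "{z. is_singular_at F z} = (\<Union>i\<in>{..<dim_row F}. \<Union>k\<in>{..<dim_col F}. {z. rat_pole (F $$ (i, k)) z})"
    by (auto simp: is_singular_at_iff)
  then show ?thesis by (simp add: finite_rat_pole)
qed

lemma rat_eval_sum: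
  assumes "finite I" "\<And>i. i \<in> I \<Longrightarrow> \<not> rat_pole (f i) z"
  shows "rat_eval (sum f I) z = (\<Sum>i\<in>I. rat_eval (f i) z) \<and> \<not> rat_pole (sum f I) z"
  using assms by (induction I) (auto simp: rat_eval_add)

lemma mat_eval_mult:
  assumes "dim_col F = dim_row G" "\<not> is_singular_at F z" "\<not> is_singular_at G z"
  shows "mat_eval (F * G) z = mat_eval F z * mat_eval G z" "\<not> is_singular_at (F * G) z"
proof -
  have *: "rat_eval ((F * G) $$ (i, k)) z = (mat_eval F z * mat_eval G z) $$ (i, k) \<and>
      \<not> rat_pole ((F * G) $$ (i, k)) z" if ik: "i < dim_row F" "k < dim_col G" for i k
  proof -
    have e: "(F * G) $$ (i, k) = (\<Sum>l\<in>{0..<dim_row G}. F $$ (i, l) * G $$ (l, k))"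
      using ik assms(1) by (simp add: scalar_prod_def)
    have np: "\<not> rat_pole (F $$ (i, l)) z" "\<not> rat_pole (G $$ (l, k)) z" if "l \<in> {0..<dim_row G}" for l
      using assms ik that by (auto simp: is_singular_at_iff)
    have "rat_eval ((F * G) $$ (i, k)) z = (\<Sum>l\<in>{0..<dim_row G}. rat_eval (F $$ (i, l) * G $$ (l, k)) z) \<and>
        \<not> rat_pole ((F * G) $$ (i, k)) z"
      unfolding e by (rule rat_eval_sum) (use np in \<open>auto simp: rat_eval_mult\<close>)
    also have "(\<Sum>l\<in>{0..<dim_row G}. rat_eval (F $$ (i, l) * G $$ (l, k)) z) =
        (mat_eval F z * mat_eval G z) $$ (i, k)"
      using ik assms(1) np by (simp add: scalar_prod_def rat_eval_mult)
    finally show ?thesis .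
  qed
  show "mat_eval (F * G) z = mat_eval F z * mat_eval G z"
    by (rule eq_matI) (use * in \<open>auto simp del: index_mult_mat(1)\<close>)
  show "\<not> is_singular_at (F * G) z"
    using * by (auto simp: is_singular_at_iff simp del: index_mult_mat(1))
qed

lemma ratmat_eqI:
  assumes "dim_row F = dim_row G" "dim_col F = dim_col G" "infinite S"
    "\<And>z. z \<in> S \<Longrightarrow> mat_eval F z = mat_eval G z"
  shows "F = G"
proof (rule eq_matI)
  fix i k assume ik: "i < dim_row G" "k < dim_col G"
  show "F $$ (i, k) = G $$ (i, k)"
  proof (rule ratfun_eqI[OF assms(3)])
    fix z assume "z \<in> S"
    from arg_cong[OF assms(4)[OF this], of "\<lambda>M. M $$ (i, k)"]
    show "rat_eval (F $$ (i, k)) z = rat_eval (G $$ (i, k)) z" using ik assms by simp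
  qed
qed (use assms in auto)

lemma const_mat_eval [simp]:
  "mat_eval (const_mat M) z = M" "\<not> is_singular_at (const_mat M) z"
  "dim_row (const_mat M) = dim_row M" "dim_col (const_mat M) = dim_col M"
  by (auto simp: const_mat_def is_singular_at_iff intro!: eq_matI)

section \<open>Limits of matrices\<close>

text \<open>The entrywise sum norm is submultiplicative and invariant under adjoints, and for
  matrices of fixed size it controls entrywise convergence; the boundedness arguments use no more
  than that.\<close>

definition mnorm :: "complex mat \<Rightarrow> real" where
  "mnorm M = (\<Sum>i<dim_row M. \<Sum>j<dim_col M. cmod (M $$ (i, j)))"

lemma mnorm_nonneg [simp]: "0 \<le> mnorm M"
  unfolding mnorm_def by (intro sum_nonneg) auto

lemma entry_le_mnorm:
  assumes "i < dim_row M" "j < dim_col M"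
  shows "cmod (M $$ (i, j)) \<le> mnorm M"
proof -
  have "cmod (M $$ (i, j)) \<le> (\<Sum>j<dim_col M. cmod (M $$ (i, j)))"
    using assms by (intro member_le_sum) auto
  also have "\<dots> \<le> mnorm M" unfolding mnorm_def
    using assms by (intro member_le_sum[where f = "\<lambda>i. \<Sum>j<dim_col M. cmod (M $$ (i, j))"] sum_nonneg) auto
  finally show ?thesis .
qed

lemma mnorm_add:
  assumes "dim_row M = dim_row N" "dim_col M = dim_col N"
  shows "mnorm (M + N) \<le> mnorm M + mnorm N"
proof -
  have "mnorm (M + N) \<le> (\<Sum>i<dim_row N. \<Sum>j<dim_col N. cmod (M $$ (i, j)) + cmod (N $$ (i, j)))"
    unfolding mnorm_def index_add_mat(2,3) by (intro sum_mono) (simp add: norm_triangle_ineq)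
  also have "\<dots> = mnorm M + mnorm N" unfolding mnorm_def assms by (simp add: sum.distrib)
  finally show ?thesis .
qed

lemma mnorm_smult: "mnorm (c \<cdot>\<^sub>m M) = cmod c * mnorm M"
  unfolding mnorm_def by (simp add: norm_mult sum_distrib_left)

lemma mnorm_mult:
  assumes "dim_col M = dim_row N"
  shows "mnorm (M * N) \<le> mnorm M * mnorm N"
proof -
  have "(\<Sum>j<dim_col N. cmod ((M * N) $$ (i, j))) \<le> (\<Sum>l<dim_col M. cmod (M $$ (i, l))) * mnorm N"
    if i: "i < dim_row M" for i
  proof -
    have "(\<Sum>j<dim_col N. cmod ((M * N) $$ (i, j))) \<le>
        (\<Sum>j<dim_col N. \<Sum>l<dim_col M. cmod (M $$ (i, l)) * cmod (N $$ (l, j)))"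
    proof (rule sum_mono)
      fix j assume "j \<in> {..<dim_col N}"
      then have "(M * N) $$ (i, j) = (\<Sum>l<dim_col M. M $$ (i, l) * N $$ (l, j))"
        using i assms by (simp add: scalar_prod_def lessThan_atLeast0)
      then show "cmod ((M * N) $$ (i, j)) \<le> (\<Sum>l<dim_col M. cmod (M $$ (i, l)) * cmod (N $$ (l, j)))"
        by (simp add: norm_mult[symmetric] norm_sum)
    qed
    also have "\<dots> = (\<Sum>l<dim_col M. cmod (M $$ (i, l)) * (\<Sum>j<dim_col N. cmod (N $$ (l, j))))"
      by (subst sum.swap) (simp add: sum_distrib_left)
    also have "\<dots> \<le> (\<Sum>l<dim_col M. cmod (M $$ (i, l)) * mnorm N)"
    proof (intro sum_mono mult_left_mono)
      fix l assume "l \<in> {..<dim_col M}"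
      then show "(\<Sum>j<dim_col N. cmod (N $$ (l, j))) \<le> mnorm N"
        unfolding mnorm_def using assms
        by (intro member_le_sum[where f = "\<lambda>i. \<Sum>j<dim_col N. cmod (N $$ (i, j))"] sum_nonneg) auto
    qed auto
    finally show ?thesis by (simp add: sum_distrib_right)
  qed
  then have "mnorm (M * N) \<le> (\<Sum>i<dim_row M. (\<Sum>l<dim_col M. cmod (M $$ (i, l))) * mnorm N)"
    unfolding mnorm_def[of "M * N"] index_mult_mat(2,3) by (intro sum_mono) auto
  then show ?thesis unfolding mnorm_def[of M] by (simp add: sum_distrib_right)
qed

lemma mnorm_eq_0_iff: "mnorm M = 0 \<longleftrightarrow> M = 0\<^sub>m (dim_row M) (dim_col M)"
proof
  assume "mnorm M = 0"
  then show "M = 0\<^sub>m (dim_row M) (dim_col M)"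
    using entry_le_mnorm[of _ M] by (intro eq_matI) auto
next
  assume "M = 0\<^sub>m (dim_row M) (dim_col M)"
  then have "M $$ (i, j) = 0" if "i < dim_row M" "j < dim_col M" for i j
    using that by (metis index_zero_mat(1))
  then show "mnorm M = 0" unfolding mnorm_def by simp
qed

lemma mnorm_adjoint [simp]: "mnorm (mat_adjoint M) = mnorm M"
  unfolding mnorm_def by (simp, subst sum.swap, simp)

text \<open>The dimensions are fixed only eventually, because \<open>resolvent A z\<close> has known
  dimensions only where \<open>z\<close> is not an eigenvalue.\<close>

definition mat_tendsto :: "('x \<Rightarrow> complex mat) \<Rightarrow> complex mat \<Rightarrow> 'x filter \<Rightarrow> bool" where
  "mat_tendsto M L F \<longleftrightarrow>
     eventually (\<lambda>x. dim_row (M x) = dim_row L \<and> dim_col (M x) = dim_col L) F \<and>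
     (\<forall>i < dim_row L. \<forall>j < dim_col L. ((\<lambda>x. M x $$ (i, j)) \<longlongrightarrow> L $$ (i, j)) F)"

lemma mat_tendsto_entry:
  "mat_tendsto M L F \<Longrightarrow> i < dim_row L \<Longrightarrow> j < dim_col L \<Longrightarrow> ((\<lambda>x. M x $$ (i, j)) \<longlongrightarrow> L $$ (i, j)) F"
  unfolding mat_tendsto_def by blast

lemma mat_tendsto_dim:
  "mat_tendsto M L F \<Longrightarrow> eventually (\<lambda>x. dim_row (M x) = dim_row L \<and> dim_col (M x) = dim_col L) F"
  unfolding mat_tendsto_def by blast

lemma mat_tendsto_const: "mat_tendsto (\<lambda>x. M) M F"
  unfolding mat_tendsto_def by simp

lemma mat_tendsto_mult:
  assumes M: "mat_tendsto M K F" and N: "mat_tendsto N L F" and d: "dim_col K = dim_row L"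
  shows "mat_tendsto (\<lambda>x. M x * N x) (K * L) F"
  unfolding mat_tendsto_def
proof (intro conjI allI impI)
  have ev: "eventually (\<lambda>x. (dim_row (M x) = dim_row K \<and> dim_col (M x) = dim_col K) \<and>
      dim_row (N x) = dim_row L \<and> dim_col (N x) = dim_col L) F"
    using mat_tendsto_dim[OF M] mat_tendsto_dim[OF N] by (rule eventually_conj)
  then show "eventually (\<lambda>x. dim_row (M x * N x) = dim_row (K * L) \<and> dim_col (M x * N x) = dim_col (K * L)) F"
    by (rule eventually_mono) simp
  fix i j assume ij: "i < dim_row (K * L)" "j < dim_col (K * L)"
  have "((\<lambda>x. \<Sum>l = 0..<dim_row L. M x $$ (i, l) * N x $$ (l, j)) \<longlongrightarrow>
      (\<Sum>l = 0..<dim_row L. K $$ (i, l) * L $$ (l, j))) F"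
    using ij d by (intro tendsto_sum tendsto_mult mat_tendsto_entry[OF M] mat_tendsto_entry[OF N]) auto
  moreover have "eventually (\<lambda>x. (\<Sum>l = 0..<dim_row L. M x $$ (i, l) * N x $$ (l, j)) = (M x * N x) $$ (i, j)) F"
    using ev by (rule eventually_mono) (use ij d in \<open>simp add: scalar_prod_def\<close>)
  ultimately have "((\<lambda>x. (M x * N x) $$ (i, j)) \<longlongrightarrow> (\<Sum>l = 0..<dim_row L. K $$ (i, l) * L $$ (l, j))) F"
    by (rule Lim_transform_eventually)
  moreover have "(K * L) $$ (i, j) = (\<Sum>l = 0..<dim_row L. K $$ (i, l) * L $$ (l, j))"
    using ij d by (simp add: scalar_prod_def)
  ultimately show "((\<lambda>x. (M x * N x) $$ (i, j)) \<longlongrightarrow> (K * L) $$ (i, j)) F" by simp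
qed

lemma mat_tendsto_add:
  assumes M: "mat_tendsto M K F" and N: "mat_tendsto N L F"
    and d: "dim_row K = dim_row L" "dim_col K = dim_col L"
  shows "mat_tendsto (\<lambda>x. M x + N x) (K + L) F"
  unfolding mat_tendsto_def
proof (intro conjI allI impI)
  have ev: "eventually (\<lambda>x. dim_row (N x) = dim_row L \<and> dim_col (N x) = dim_col L) F"
    using mat_tendsto_dim[OF N] .
  then show "eventually (\<lambda>x. dim_row (M x + N x) = dim_row (K + L) \<and> dim_col (M x + N x) = dim_col (K + L)) F"
    by (rule eventually_mono) simp
  fix i j assume ij: "i < dim_row (K + L)" "j < dim_col (K + L)"
  have "((\<lambda>x. M x $$ (i, j) + N x $$ (i, j)) \<longlongrightarrow> K $$ (i, j) + L $$ (i, j)) F"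
    using ij d by (intro tendsto_add mat_tendsto_entry[OF M] mat_tendsto_entry[OF N]) auto
  moreover have "eventually (\<lambda>x. M x $$ (i, j) + N x $$ (i, j) = (M x + N x) $$ (i, j)) F"
    using ev by (rule eventually_mono) (use ij in simp)
  ultimately have "((\<lambda>x. (M x + N x) $$ (i, j)) \<longlongrightarrow> K $$ (i, j) + L $$ (i, j)) F"
    by (rule Lim_transform_eventually)
  then show "((\<lambda>x. (M x + N x) $$ (i, j)) \<longlongrightarrow> (K + L) $$ (i, j)) F" using ij by simp
qed

lemma mat_tendsto_smult:
  assumes M: "mat_tendsto M K F" and c: "(c \<longlongrightarrow> d) F"
  shows "mat_tendsto (\<lambda>x. c x \<cdot>\<^sub>m M x) (d \<cdot>\<^sub>m K) F"
  unfolding mat_tendsto_def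
proof (intro conjI allI impI)
  have ev: "eventually (\<lambda>x. dim_row (M x) = dim_row K \<and> dim_col (M x) = dim_col K) F"
    using mat_tendsto_dim[OF M] .
  then show "eventually (\<lambda>x. dim_row (c x \<cdot>\<^sub>m M x) = dim_row (d \<cdot>\<^sub>m K) \<and> dim_col (c x \<cdot>\<^sub>m M x) = dim_col (d \<cdot>\<^sub>m K)) F"
    by (rule eventually_mono) simp
  fix i j assume ij: "i < dim_row (d \<cdot>\<^sub>m K)" "j < dim_col (d \<cdot>\<^sub>m K)"
  have "((\<lambda>x. c x * M x $$ (i, j)) \<longlongrightarrow> d * K $$ (i, j)) F"
    using ij by (intro tendsto_mult c mat_tendsto_entry[OF M]) auto
  moreover have "eventually (\<lambda>x. c x * M x $$ (i, j) = (c x \<cdot>\<^sub>m M x) $$ (i, j)) F"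
    using ev by (rule eventually_mono) (use ij in simp)
  ultimately have "((\<lambda>x. (c x \<cdot>\<^sub>m M x) $$ (i, j)) \<longlongrightarrow> d * K $$ (i, j)) F"
    by (rule Lim_transform_eventually)
  then show "((\<lambda>x. (c x \<cdot>\<^sub>m M x) $$ (i, j)) \<longlongrightarrow> (d \<cdot>\<^sub>m K) $$ (i, j)) F" using ij by simp
qed

lemma mat_tendsto_adjoint:
  assumes M: "mat_tendsto M K F"
  shows "mat_tendsto (\<lambda>x. mat_adjoint (M x)) (mat_adjoint K) F"
  unfolding mat_tendsto_def
proof (intro conjI allI impI)
  have ev: "eventually (\<lambda>x. dim_row (M x) = dim_row K \<and> dim_col (M x) = dim_col K) F"
    using mat_tendsto_dim[OF M] .
  then show "eventually (\<lambda>x. dim_row (mat_adjoint (M x)) = dim_row (mat_adjoint K) \<and>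
      dim_col (mat_adjoint (M x)) = dim_col (mat_adjoint K)) F"
    by (rule eventually_mono) simp
  fix i j assume ij: "i < dim_row (mat_adjoint K)" "j < dim_col (mat_adjoint K)"
  have "((\<lambda>x. cnj (M x $$ (j, i))) \<longlongrightarrow> cnj (K $$ (j, i))) F"
    using ij by (intro tendsto_cnj mat_tendsto_entry[OF M]) auto
  moreover have "eventually (\<lambda>x. cnj (M x $$ (j, i)) = mat_adjoint (M x) $$ (i, j)) F"
    using ev by (rule eventually_mono) (use ij in simp)
  ultimately have "((\<lambda>x. mat_adjoint (M x) $$ (i, j)) \<longlongrightarrow> cnj (K $$ (j, i))) F"
    by (rule Lim_transform_eventually)
  then show "((\<lambda>x. mat_adjoint (M x) $$ (i, j)) \<longlongrightarrow> mat_adjoint K $$ (i, j)) F" using ij by simp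
qed

lemma mat_tendsto_unique:
  assumes "mat_tendsto M K F" "mat_tendsto M L F" "F \<noteq> bot"
    "dim_row K = dim_row L" "dim_col K = dim_col L"
  shows "K = L"
  using assms tendsto_unique[OF assms(3) mat_tendsto_entry[OF assms(1)] mat_tendsto_entry[OF assms(2)]]
  by (intro eq_matI) auto

lemma mat_tendsto_cong:
  assumes "mat_tendsto M L F" "eventually (\<lambda>x. M x = N x) F"
  shows "mat_tendsto N L F"
  unfolding mat_tendsto_def
proof (intro conjI allI impI)
  show "eventually (\<lambda>x. dim_row (N x) = dim_row L \<and> dim_col (N x) = dim_col L) F"
    using mat_tendsto_dim[OF assms(1)] assms(2) by eventually_elim simp
  fix i j assume "i < dim_row L" "j < dim_col L"
  note mat_tendsto_entry[OF assms(1) this]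
  moreover have "eventually (\<lambda>x. M x $$ (i, j) = N x $$ (i, j)) F"
    using assms(2) by eventually_elim simp
  ultimately show "((\<lambda>x. N x $$ (i, j)) \<longlongrightarrow> L $$ (i, j)) F" by (rule Lim_transform_eventually)
qed

lemma mat_eval_continuous:
  assumes "\<not> is_singular_at F z"
  shows "mat_tendsto (mat_eval F) (mat_eval F z) (at z within T)"
  using assms unfolding mat_tendsto_def by (auto simp: is_singular_at_iff intro!: rat_eval_continuous)

text \<open>This moves the form from vectors to n x 1 matrices, where it is a 1 x 1 product that the
  ring laws can normalize.\<close>

lemma loewner_le_iff:
  assumes "M \<in> carrier_mat n n" "N \<in> carrier_mat n n"
  shows "loewner_le M N \<longleftrightarrow>
    (\<forall>v \<in> carrier_mat n 1. 0 \<le> (mat_adjoint v * ((N - M) * v)) $$ (0, 0))"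
proof -
  have eq: "((N - M) *\<^sub>v col v 0) \<bullet>c col v 0 = (mat_adjoint v * ((N - M) * v)) $$ (0, 0)"
    if v: "v \<in> carrier_mat n 1" for v
  proof -
    have "((N - M) *\<^sub>v col v 0) \<bullet>c col v 0 = (\<Sum>i = 0..<n. ((N - M) * v) $$ (i, 0) * cnj (v $$ (i, 0)))"
      using v assms by (auto simp: scalar_prod_def[of "(N - M) *\<^sub>v col v 0"] intro!: sum.cong)
    also have "\<dots> = (mat_adjoint v * ((N - M) * v)) $$ (0, 0)"
      using v assms by (auto simp: scalar_prod_def[of "row (mat_adjoint v) 0"] mult.commute intro!: sum.cong)
    finally show ?thesis .
  qed
  have eq': "((N - M) *\<^sub>v u) \<bullet>c u = (mat_adjoint (mat_of_cols n [u]) * ((N - M) * mat_of_cols n [u])) $$ (0, 0)"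
    if u: "u \<in> carrier_vec n" for u
  proof -
    have "mat_of_cols n [u] \<in> carrier_mat n 1" using mat_of_cols_carrier(1)[of n "[u]"] by simp
    moreover have "col (mat_of_cols n [u]) 0 = u" using u by simp
    ultimately show ?thesis using eq[of "mat_of_cols n [u]"] by simp
  qed
  show ?thesis
  proof
    assume "loewner_le M N"
    then have "\<forall>u \<in> carrier_vec n. 0 \<le> ((N - M) *\<^sub>v u) \<bullet>c u"
      unfolding loewner_le_def using assms by auto
    then show "\<forall>v \<in> carrier_mat n 1. 0 \<le> (mat_adjoint v * ((N - M) * v)) $$ (0, 0)"
      using eq by (metis carrier_matD(1) col_dim)
  next
    assume *: "\<forall>v \<in> carrier_mat n 1. 0 \<le> (mat_adjoint v * ((N - M) * v)) $$ (0, 0)"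
    have "0 \<le> ((N - M) *\<^sub>v u) \<bullet>c u" if "u \<in> carrier_vec n" for u
      unfolding eq'[OF that] by (rule *[rule_format]) (simp add: mat_of_cols_def)
    then show "loewner_le M N" unfolding loewner_le_def using assms by blast
  qed
qed

text \<open>The order on complex numbers includes realness, so the limit of the imaginary parts has
  to be treated along with that of the real parts.\<close>

lemma complex_nonneg_limit:
  fixes f :: "'x \<Rightarrow> complex"
  assumes "(f \<longlongrightarrow> l) F" "eventually (\<lambda>x. 0 \<le> f x) F" "F \<noteq> bot"
  shows "0 \<le> l"
proof -
  have "0 \<le> Re l"
    by (rule tendsto_lowerbound[OF tendsto_Re[OF assms(1)] _ assms(3)])
      (use assms(2) in eventually_elim, simp add: less_eq_complex_def)
  moreover have "((\<lambda>x. Im (f x)) \<longlongrightarrow> 0) F"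
    by (rule tendsto_eventually) (use assms(2) in eventually_elim, simp add: less_eq_complex_def)
  then have "Im l = 0" using tendsto_unique[OF assms(3) tendsto_Im[OF assms(1)]] by blast
  ultimately show ?thesis by (simp add: less_eq_complex_def)
qed

lemma loewner_le_limit:
  assumes M: "mat_tendsto M K F" and N: "mat_tendsto N L F"
    and K: "K \<in> carrier_mat n n" and L: "L \<in> carrier_mat n n"
    and le: "eventually (\<lambda>x. loewner_le (M x) (N x)) F" and F: "F \<noteq> bot"
  shows "loewner_le K L"
  unfolding loewner_le_iff[OF K L]
proof
  fix v :: "complex mat" assume v: "v \<in> carrier_mat n 1"
  have lim: "mat_tendsto (\<lambda>x. mat_adjoint v * ((N x + (-1) \<cdot>\<^sub>m M x) * v)) (mat_adjoint v * ((L + (-1) \<cdot>\<^sub>m K) * v)) F"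
    by (intro mat_tendsto_mult mat_tendsto_add mat_tendsto_smult M N mat_tendsto_const tendsto_const)
      (use v K L in auto)
  have "((\<lambda>x. (mat_adjoint v * ((N x - M x) * v)) $$ (0, 0)) \<longlongrightarrow> (mat_adjoint v * ((L - K) * v)) $$ (0, 0)) F"
    using mat_tendsto_entry[OF lim, of 0 0] v unfolding minus_as_smult by simp
  moreover have "eventually (\<lambda>x. 0 \<le> (mat_adjoint v * ((N x - M x) * v)) $$ (0, 0)) F"
    using mat_tendsto_dim[OF M] mat_tendsto_dim[OF N] le
  proof eventually_elim
    case (elim x)
    then have "M x \<in> carrier_mat n n" "N x \<in> carrier_mat n n" using K L by (auto intro!: carrier_matI)
    from elim(3)[unfolded loewner_le_iff[OF this]] v show ?case by blast
  qed
  ultimately show "0 \<le> (mat_adjoint v * ((L - K) * v)) $$ (0, 0)"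
    using F by (rule complex_nonneg_limit)
qed

section \<open>Transfer functions\<close>

definition resolvent :: "complex mat \<Rightarrow> complex \<Rightarrow> complex mat" where
  "resolvent A z = mat_inv (z \<cdot>\<^sub>m 1\<^sub>m (dim_row A) - A)"

lemma resolvent:
  assumes A: "A \<in> carrier_mat n n" and z: "\<not> eigenvalue A z"
  shows "resolvent A z \<in> carrier_mat n n"
    "(z \<cdot>\<^sub>m 1\<^sub>m n - A) * resolvent A z = 1\<^sub>m n" "resolvent A z * (z \<cdot>\<^sub>m 1\<^sub>m n - A) = 1\<^sub>m n"
proof -
  obtain N where N: "N \<in> carrier_mat n n" "(z \<cdot>\<^sub>m 1\<^sub>m n - A) * N = 1\<^sub>m n" "N * (z \<cdot>\<^sub>m 1\<^sub>m n - A) = 1\<^sub>m n"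
    by (rule shift_inverse[OF A z])
  have "resolvent A z = N"
    unfolding resolvent_def using A N(1,2) by (intro mat_inv_eq) auto
  with N show "resolvent A z \<in> carrier_mat n n"
    "(z \<cdot>\<^sub>m 1\<^sub>m n - A) * resolvent A z = 1\<^sub>m n" "resolvent A z * (z \<cdot>\<^sub>m 1\<^sub>m n - A) = 1\<^sub>m n" by auto
qed

lemma shift_mult_left:
  fixes A M :: "complex mat"
  assumes "A \<in> carrier_mat n n" "M \<in> carrier_mat n q"
  shows "(e \<cdot>\<^sub>m 1\<^sub>m n - A) * M = e \<cdot>\<^sub>m M - A * M"
  using assms by (simp add: mat_ring_simps)

text \<open>Resolvents are not computed: a candidate \<open>Z\<close> is checked against the
  equation \<open>(z - A) Z = M\<close> instead.\<close>

lemma resolvent_unique: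
  assumes A: "A \<in> carrier_mat n n" and z: "\<not> eigenvalue A z"
    and Z: "Z \<in> carrier_mat n q" and eq: "z \<cdot>\<^sub>m Z - A * Z = M"
  shows "resolvent A z * M = Z"
proof -
  note R = resolvent[OF A z]
  have "resolvent A z * M = resolvent A z * ((z \<cdot>\<^sub>m 1\<^sub>m n - A) * Z)"
    unfolding shift_mult_left[OF A Z] eq ..
  also have "\<dots> = (resolvent A z * (z \<cdot>\<^sub>m 1\<^sub>m n - A)) * Z"
    using R(1) A Z by (simp add: mult_assoc_dim)
  finally show ?thesis unfolding R(3) using Z by simp
qed

lemma mult_resolvent:
  assumes A: "A \<in> carrier_mat n n" and z: "\<not> eigenvalue A z" and M: "M \<in> carrier_mat n q"
  shows "z \<cdot>\<^sub>m (resolvent A z * M) - A * (resolvent A z * M) = M"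
    "A * (resolvent A z * M) = z \<cdot>\<^sub>m (resolvent A z * M) + (-1) \<cdot>\<^sub>m M"
    "resolvent A z * (A * M) = A * (resolvent A z * M)"
proof -
  note R = resolvent[OF A z]
  have RM: "resolvent A z * M \<in> carrier_mat n q" using R M by auto
  have "(z \<cdot>\<^sub>m 1\<^sub>m n - A) * (resolvent A z * M) = (z \<cdot>\<^sub>m 1\<^sub>m n - A) * resolvent A z * M"
    using R(1) A M by (simp add: mult_assoc_dim)
  also have "\<dots> = M" unfolding R(2) using M by simp
  finally show 1: "z \<cdot>\<^sub>m (resolvent A z * M) - A * (resolvent A z * M) = M"
    unfolding shift_mult_left[OF A RM] .
  show "A * (resolvent A z * M) = z \<cdot>\<^sub>m (resolvent A z * M) + (-1) \<cdot>\<^sub>m M"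
  proof (rule eq_matI)
    fix i j assume "i < dim_row (z \<cdot>\<^sub>m (resolvent A z * M) + (-1) \<cdot>\<^sub>m M)"
      "j < dim_col (z \<cdot>\<^sub>m (resolvent A z * M) + (-1) \<cdot>\<^sub>m M)"
    then have ij: "i < n" "j < q" using M by auto
    have "z * (resolvent A z * M) $$ (i, j) - (A * (resolvent A z * M)) $$ (i, j) = M $$ (i, j)"
      using arg_cong[OF 1, of "\<lambda>X. X $$ (i, j)"] ij A M R(1) by (simp del: index_mult_mat(1))
    then show "(A * (resolvent A z * M)) $$ (i, j) = (z \<cdot>\<^sub>m (resolvent A z * M) + (-1) \<cdot>\<^sub>m M) $$ (i, j)"
      using ij A M R(1) by (simp add: algebra_simps del: index_mult_mat(1))
  qed (use A M R(1) in auto)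
  show "resolvent A z * (A * M) = A * (resolvent A z * M)"
  proof (rule resolvent_unique[OF A z])
    have "A * M = A * (z \<cdot>\<^sub>m (resolvent A z * M) - A * (resolvent A z * M))" unfolding 1 ..
    then show "z \<cdot>\<^sub>m (A * (resolvent A z * M)) - A * (A * (resolvent A z * M)) = A * M"
      using A M R(1) by (simp add: mat_ring_simps)
  qed (use A M R(1) in auto)
qed

text \<open>If \<open>t\<close> is not an eigenvalue of \<open>A\<close>, the adjoint of the
  resolvent identity provides a left inverse of \<open>cnj t - A\<^sup>*\<close>, which excludes
  eigenvectors there. The converse is the same statement for the adjoint.\<close>

lemma adjoint_eigenvalue:
  assumes A: "A \<in> carrier_mat n n"
  shows "eigenvalue (mat_adjoint A) (cnj t) \<longleftrightarrow> eigenvalue A t"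
proof -
  have *: "\<not> eigenvalue (mat_adjoint A) (cnj t)" if A: "A \<in> carrier_mat n n" and t: "\<not> eigenvalue A t" for A t
  proof
    assume "eigenvalue (mat_adjoint A) (cnj t)"
    then obtain v where v: "v \<in> carrier_mat n 1" "v \<noteq> 0\<^sub>m n 1" "mat_adjoint A * v = cnj t \<cdot>\<^sub>m v"
      using eigenvalue_iff[of "mat_adjoint A" n] A by auto
    note R = resolvent[OF A t]
    have "v = mat_adjoint ((t \<cdot>\<^sub>m 1\<^sub>m n - A) * resolvent A t) * v" unfolding R(2) using v by simp
    also have "\<dots> = mat_adjoint (resolvent A t) * (cnj t \<cdot>\<^sub>m v + (-1) \<cdot>\<^sub>m (mat_adjoint A * v))"
      using A R(1) v(1) by (simp add: adjoint_simps mat_ring_simps)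
    also have "cnj t \<cdot>\<^sub>m v + (-1) \<cdot>\<^sub>m (mat_adjoint A * v) = 0\<^sub>m n 1"
      unfolding v(3) using v(1) by auto
    finally have "v = 0\<^sub>m n 1" using R(1) by simp
    with v(2) show False by simp
  qed
  show ?thesis using *[of A t] *[of "mat_adjoint A" "cnj t"] A by auto
qed

lemma finite_eigenvalues:
  fixes A :: "complex mat"
  assumes "A \<in> carrier_mat n n"
  shows "finite {z. eigenvalue A z}"
  using card_finite_spectrum(1)[OF assms] unfolding spectrum_def .

lemma mat_eval_const_add:
  assumes "\<not> is_singular_at F z" "dim_row D = dim_row F" "dim_col D = dim_col F"
  shows "mat_eval (const_mat D + F) z = D + mat_eval F z" "\<not> is_singular_at (const_mat D + F) z"
  using assms
  by (auto simp: is_singular_at_iff rat_eval_add const_mat_def intro!: eq_matI)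

text \<open>This is the bridge between the field of rational functions, where
  \<open>transfer_fun\<close> takes its inverse, and complex matrices. By Cramer's rule the
  characteristic polynomial is a common denominator of the inverse, so nothing goes wrong at a point
  that is not an eigenvalue.\<close>

lemma transfer_fun_eval:
  assumes A: "A \<in> carrier_mat n n" and B: "B \<in> carrier_mat n m" and C: "C \<in> carrier_mat p n"
    and D: "D \<in> carrier_mat p m" and z: "\<not> eigenvalue A z"
  shows "mat_eval (transfer_fun A B C D) z = D + C * (resolvent A z * B)"
    "\<not> is_singular_at (transfer_fun A B C D) z"
proof -
  define L where "L = Fract [:0, 1:] 1 \<cdot>\<^sub>m 1\<^sub>m (dim_row A) - const_mat A"
  define P where "P = char_poly_matrix A"
  have P: "P \<in> carrier_mat n n" using A by (simp add: P_def)
  interpret h: inj_comm_ring_hom "to_fract :: complex poly \<Rightarrow> ratfun" by (unfold_locales) auto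
  \<comment> \<open>The adjugate of \<open>\<lambda> - A\<close> over its determinant, the inverse
    of \<open>L\<close> over the rational functions.\<close>
  define Z where "Z = map_mat (\<lambda>a. Fract a (char_poly A)) (adj_mat P)"
  have cp0: "char_poly A \<noteq> 0" using degree_monic_char_poly[OF A] by auto
  have cpz: "poly (char_poly A) z \<noteq> 0" using z eigenvalue_root_char_poly[OF A] by simp
  have LP: "L = map_mat to_fract P"
    unfolding L_def P_def char_poly_matrix_def using A
    by (intro eq_matI) (auto simp: const_mat_def to_fract_def fract_collapse one_pCons)
  have Zs: "Z = Fract 1 (char_poly A) \<cdot>\<^sub>m map_mat to_fract (adj_mat P)"
    unfolding Z_def by (intro eq_matI) (auto simp: to_fract_def)
  have Zc: "Z \<in> carrier_mat n n" "adj_mat P \<in> carrier_mat n n" using adj_mat(1)[OF P] by (auto simp: Z_def)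
  have Lc: "L \<in> carrier_mat n n" using P by (simp add: LP)
  have "L * Z = Fract 1 (char_poly A) \<cdot>\<^sub>m (map_mat to_fract P * map_mat to_fract (adj_mat P))"
    unfolding LP Zs using Zc P by (simp add: mult_smult_dim)
  also have "map_mat to_fract P * map_mat to_fract (adj_mat P) = map_mat to_fract (P * adj_mat P)"
    by (rule h.mat_hom_mult[OF P Zc(2), symmetric])
  also have "P * adj_mat P = char_poly A \<cdot>\<^sub>m 1\<^sub>m n"
    using adj_mat(2)[OF P] by (simp add: char_poly_def P_def)
  also have "Fract 1 (char_poly A) \<cdot>\<^sub>m map_mat to_fract (char_poly A \<cdot>\<^sub>m 1\<^sub>m n) = 1\<^sub>m n"
    using cp0 by (intro eq_matI) (auto simp: to_fract_def eq_fract One_fract_def Zero_fract_def)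
  finally have LZ: "L * Z = 1\<^sub>m n" .
  have inv: "mat_inv L = Z" by (rule mat_inv_eq[OF Lc Zc(1) LZ])
  have Lz: "\<not> is_singular_at L z" "mat_eval L z = z \<cdot>\<^sub>m 1\<^sub>m n - A"
  proof -
    have "rat_eval (L $$ (i, j)) z = (z \<cdot>\<^sub>m 1\<^sub>m n - A) $$ (i, j) \<and> \<not> rat_pole (L $$ (i, j)) z"
      if "i < n" "j < n" for i j
    proof -
      have "L $$ (i, j) = Fract (P $$ (i, j)) 1" using that P by (simp add: LP to_fract_def)
      moreover have "poly (P $$ (i, j)) z = (z \<cdot>\<^sub>m 1\<^sub>m n - A) $$ (i, j)"
        using that A by (auto simp: P_def char_poly_matrix_def)
      ultimately show ?thesis using rat_eval_Fract[of 1 z "P $$ (i, j)"] by simp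
    qed
    then show "\<not> is_singular_at L z" "mat_eval L z = z \<cdot>\<^sub>m 1\<^sub>m n - A"
      using Lc A by (auto simp: is_singular_at_iff intro!: eq_matI)
  qed
  have Zz: "\<not> is_singular_at Z z"
    using cpz rat_eval_Fract(2) by (auto simp: is_singular_at_iff Z_def)
  have "(z \<cdot>\<^sub>m 1\<^sub>m n - A) * mat_eval Z z = mat_eval (1\<^sub>m n) z"
    using mat_eval_mult(1)[of L Z z] Lz Zz LZ Lc Zc by simp
  also have "mat_eval (1\<^sub>m n) z = 1\<^sub>m n" by (intro eq_matI) auto
  finally have Zev: "resolvent A z = mat_eval Z z"
    unfolding resolvent_def using A Zc by (intro mat_inv_eq[of _ n]) auto
  have T: "transfer_fun A B C D = const_mat D + (const_mat C * Z * const_mat B)"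
    unfolding transfer_fun_def L_def[symmetric] inv ..
  note ns = const_mat_eval(2)
  have 1: "mat_eval (const_mat C * Z) z = C * mat_eval Z z" "\<not> is_singular_at (const_mat C * Z) z"
    using mat_eval_mult[of "const_mat C" Z z] C Zc Zz by auto
  have 2: "mat_eval (const_mat C * Z * const_mat B) z = C * mat_eval Z z * B"
    "\<not> is_singular_at (const_mat C * Z * const_mat B) z"
    using mat_eval_mult[of "const_mat C * Z" "const_mat B" z] 1 B C Zc by auto
  have 3: "C * mat_eval Z z * B = C * (mat_eval Z z * B)"
    using B C Zc by (simp add: mult_assoc_dim)
  show "mat_eval (transfer_fun A B C D) z = D + C * (resolvent A z * B)"
    "\<not> is_singular_at (transfer_fun A B C D) z"
    unfolding T Zev 3[symmetric] 2(1)[symmetric]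
    using mat_eval_const_add[OF 2(2), of D] B C D by auto
qed

lemma dim_transfer_fun:
  assumes "A \<in> carrier_mat n n" "B \<in> carrier_mat n m" "C \<in> carrier_mat p n"
  shows "transfer_fun A B C D \<in> carrier_mat p m"
  unfolding transfer_fun_def using assms by auto

lemma infinite_complex_Diff:
  fixes S :: "complex set"
  assumes "finite S"
  shows "infinite (UNIV - S)"
  using assms infinite_UNIV_char_0 by (rule Diff_infinite_finite)

lemma transfer_fun_eqI:
  assumes F: "F \<in> carrier_mat p m"
    and A: "A \<in> carrier_mat n n" and B: "B \<in> carrier_mat n m" and C: "C \<in> carrier_mat p n"
    and D: "D \<in> carrier_mat p m" and S: "finite S"
    and eq: "\<And>z. z \<notin> S \<Longrightarrow> \<not> eigenvalue A z \<Longrightarrow> mat_eval F z = D + C * (resolvent A z * B)"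
  shows "F = transfer_fun A B C D"
proof (rule ratmat_eqI)
  show "infinite (UNIV - (S \<union> {z. eigenvalue A z}))"
    using S finite_eigenvalues[OF A] by (intro infinite_complex_Diff) simp
  show "dim_row F = dim_row (transfer_fun A B C D)" "dim_col F = dim_col (transfer_fun A B C D)"
    using F dim_transfer_fun[OF A B C, of D] by auto
  fix z assume "z \<in> UNIV - (S \<union> {z. eigenvalue A z})"
  then show "mat_eval F z = mat_eval (transfer_fun A B C D) z"
    using eq transfer_fun_eval(1)[OF A B C D] by simp
qed

text \<open>\<open>T (z - A)\<^sup>-\<^sup>1 B\<close> solves the equation that defines
  \<open>(z - A')\<^sup>-\<^sup>1 B'\<close>. Since \<open>T\<close> may be rectangular, one
  statement covers a change of basis as well as the passage to an invariant subspace or to a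
  quotient.\<close>

lemma transfer_fun_intertwine:
  assumes A: "A \<in> carrier_mat n n" and B: "B \<in> carrier_mat n m" and C: "C \<in> carrier_mat p n"
    and A': "A' \<in> carrier_mat k k" and B': "B' \<in> carrier_mat k m" and C': "C' \<in> carrier_mat p k"
    and D: "D \<in> carrier_mat p m" and T: "T \<in> carrier_mat k n"
    and TA: "T * A = A' * T" and TB: "T * B = B'" and CT: "C' * T = C"
  shows "transfer_fun A B C D = transfer_fun A' B' C' D"
proof (rule transfer_fun_eqI[OF dim_transfer_fun[OF A B C] A' B' C' D finite_eigenvalues[OF A]])
  fix z assume "z \<notin> {z. eigenvalue A z}" and z': "\<not> eigenvalue A' z"
  then have z: "\<not> eigenvalue A z" by simp
  note R = resolvent[OF A z]
  have "resolvent A' z * B' = T * (resolvent A z * B)"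
  proof (rule resolvent_unique[OF A' z'])
    have "A' * (T * (resolvent A z * B)) = T * (A * (resolvent A z * B))"
      using A A' T R(1) B by (simp add: mult_assoc_dim[symmetric] TA)
    then show "z \<cdot>\<^sub>m (T * (resolvent A z * B)) - A' * (T * (resolvent A z * B)) = B'"
      unfolding mult_resolvent(2)[OF A z B]
      using A T R(1) B TB by (auto simp: mat_ring_simps intro!: eq_matI simp del: index_mult_mat(1))
  qed (use R(1) T B in auto)
  moreover have "C' * (T * (resolvent A z * B)) = C' * T * (resolvent A z * B)"
    using C' T R(1) B by (simp add: mult_assoc_dim)
  ultimately have "C' * (resolvent A' z * B') = C * (resolvent A z * B)" unfolding CT by simp
  then show "mat_eval (transfer_fun A B C D) z = D + C' * (resolvent A' z * B')"
    using transfer_fun_eval(1)[OF A B C D z] by simp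
qed

text \<open>From \<open>z R = 1 + A R\<close> for the resolvent \<open>R\<close> one gets the bound
  of its norm by a constant over \<open>cmod z - mnorm A\<close>.\<close>

lemma resolvent_tendsto_0:
  assumes A: "A \<in> carrier_mat n n"
  shows "mat_tendsto (resolvent A) (0\<^sub>m n n) at_infinity"
proof -
  have ev: "eventually (\<lambda>z. \<not> eigenvalue A z \<and> mnorm A + 1 \<le> cmod z) at_infinity"
  proof (rule eventually_conj)
    show "eventually (\<lambda>z. \<not> eigenvalue A z) at_infinity"
      using eventually_notin_finite_at_infinity[OF finite_eigenvalues[OF A]] by simp
    show "eventually (\<lambda>z. mnorm A + 1 \<le> cmod z) at_infinity"
      by (rule eventually_at_infinityI)
  qed
  have bound: "mnorm (resolvent A z) \<le> mnorm (1\<^sub>m n) / (cmod z - mnorm A)"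
    if z: "\<not> eigenvalue A z" "mnorm A + 1 \<le> cmod z" for z
  proof -
    note R = resolvent[OF A z(1)]
    have "A * resolvent A z = z \<cdot>\<^sub>m resolvent A z + (-1) \<cdot>\<^sub>m 1\<^sub>m n"
      using mult_resolvent(2)[OF A z(1), of "1\<^sub>m n" n] R(1) by simp
    then have "z \<cdot>\<^sub>m resolvent A z = 1\<^sub>m n + A * resolvent A z"
      using R(1) A by (auto intro!: eq_matI simp del: index_mult_mat(1))
    then have "cmod z * mnorm (resolvent A z) = mnorm (1\<^sub>m n + A * resolvent A z)"
      by (metis mnorm_smult)
    also have "\<dots> \<le> mnorm (1\<^sub>m n) + mnorm (A * resolvent A z)"
      using A R(1) by (intro mnorm_add) auto
    also have "mnorm (A * resolvent A z) \<le> mnorm A * mnorm (resolvent A z)"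
      using A R(1) by (intro mnorm_mult) auto
    finally have "mnorm (resolvent A z) * (cmod z - mnorm A) \<le> mnorm (1\<^sub>m n)"
      by (simp add: algebra_simps)
    with z(2) show ?thesis by (simp add: pos_le_divide_eq)
  qed
  have lim: "((\<lambda>z :: complex. mnorm (1\<^sub>m n) / (cmod z - mnorm A)) \<longlongrightarrow> 0) at_infinity"
  proof (rule tendsto_divide_0[OF tendsto_const])
    have "filterlim (\<lambda>z :: complex. (- mnorm A) + cmod z) at_top at_infinity"
      by (rule filterlim_tendsto_add_at_top[OF tendsto_const filterlim_norm_at_top])
    then show "filterlim (\<lambda>z :: complex. cmod z - mnorm A) at_infinity at_infinity"
      by (simp add: filterlim_at_top_imp_at_infinity)
  qed
  show ?thesis unfolding mat_tendsto_def
  proof (intro conjI allI impI)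
    show "eventually (\<lambda>z. dim_row (resolvent A z) = dim_row (0\<^sub>m n n :: complex mat) \<and>
        dim_col (resolvent A z) = dim_col (0\<^sub>m n n :: complex mat)) at_infinity"
      using ev by (rule eventually_mono) (use resolvent(1)[OF A] in auto)
    fix i j assume ij: "i < dim_row (0\<^sub>m n n :: complex mat)" "j < dim_col (0\<^sub>m n n :: complex mat)"
    have "((\<lambda>z. resolvent A z $$ (i, j)) \<longlongrightarrow> 0) at_infinity"
    proof (rule tendsto_norm_zero_cancel, rule tendsto_sandwich[OF _ _ tendsto_const lim])
      show "eventually (\<lambda>z. 0 \<le> norm (resolvent A z $$ (i, j))) at_infinity" by simp
      show "eventually (\<lambda>z. norm (resolvent A z $$ (i, j)) \<le> mnorm (1\<^sub>m n) / (cmod z - mnorm A)) at_infinity"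
        using ev
      proof (rule eventually_mono)
        fix z assume z: "\<not> eigenvalue A z \<and> mnorm A + 1 \<le> cmod z"
        then have "cmod (resolvent A z $$ (i, j)) \<le> mnorm (resolvent A z)"
          using ij resolvent(1)[OF A, of z] by (intro entry_le_mnorm) auto
        with bound[of z] z show "norm (resolvent A z $$ (i, j)) \<le> mnorm (1\<^sub>m n) / (cmod z - mnorm A)" by auto
      qed
    qed
    with ij show "((\<lambda>z. resolvent A z $$ (i, j)) \<longlongrightarrow> 0\<^sub>m n n $$ (i, j)) at_infinity" by simp
  qed
qed

lemma transfer_fun_tendsto:
  assumes A: "A \<in> carrier_mat n n" and B: "B \<in> carrier_mat n m" and C: "C \<in> carrier_mat p n"
    and D: "D \<in> carrier_mat p m"
  shows "mat_tendsto (mat_eval (transfer_fun A B C D)) D at_infinity"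
proof -
  have "mat_tendsto (\<lambda>z. D + C * (resolvent A z * B)) (D + C * (0\<^sub>m n n * B)) at_infinity"
    by (intro mat_tendsto_add mat_tendsto_mult mat_tendsto_const resolvent_tendsto_0[OF A])
      (use A B C D in auto)
  moreover have "D + C * (0\<^sub>m n n * B) = D" using B C D by simp
  moreover have "eventually (\<lambda>z. D + C * (resolvent A z * B) = mat_eval (transfer_fun A B C D) z) at_infinity"
    using eventually_notin_finite_at_infinity[OF finite_eigenvalues[OF A]]
    by (rule eventually_mono) (use transfer_fun_eval(1)[OF A B C D] in simp)
  ultimately show ?thesis using mat_tendsto_cong by simp
qed

lemma tends_at_infinity_iff:
  "tends_at_infinity F D \<longleftrightarrow> dim_row F = dim_row D \<and> dim_col F = dim_col D \<and>
    mat_tendsto (mat_eval F) D at_infinity"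
  unfolding tends_at_infinity_def mat_tendsto_def by (auto simp: index_mat_eval)

lemma realization_value_at_infinity:
  assumes real: "is_realization F n A B C D" and lim: "tends_at_infinity F D'"
  shows "D = D'"
proof -
  have "mat_tendsto (mat_eval F) D at_infinity"
    using transfer_fun_tendsto[of A n B "dim_col F" C "dim_row F" D] real
    unfolding is_realization_def by auto
  with lim show ?thesis
    using real at_infinity_complex_neq_bot unfolding tends_at_infinity_iff is_realization_def
    by (intro mat_tendsto_unique) auto
qed

section \<open>Minimal realizations\<close>

lemma sum_insert_index:
  assumes "k < n"
  shows "(\<Sum>j = 0..<n - 1. g (insert_index k j)) = (\<Sum>i \<in> {0..<n} - {k}. g i :: complex)"
  by (rule sum.reindex_bij_witness[of _ "delete_index k" "insert_index k"])
    (use assms in \<open>auto simp: insert_index_def delete_index_def\<close>)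

lemma mult_entry:
  assumes "i < dim_row A" "j < dim_col B" "dim_col A = dim_row B"
  shows "(A * B) $$ (i, j) = (\<Sum>l = 0..<dim_row B. A $$ (i, l) * B $$ (l, j))"
  using assms by (simp add: scalar_prod_def)

text \<open>Choose \<open>k\<close> with \<open>x $$ (k, 0) \<noteq> 0\<close>. On the hyperplane
  orthogonal to \<open>x\<close> the entry with index \<open>k\<close> is a combination of the
  others: \<open>F\<close> forgets this entry and \<open>E\<close> restores it.\<close>

lemma hyperplane_coordinates:
  fixes x :: "complex mat"
  assumes x: "x \<in> carrier_mat n 1" "x \<noteq> 0\<^sub>m n 1"
  obtains E F where "E \<in> carrier_mat n (n - 1)" "F \<in> carrier_mat (n - 1) n"
    "mat_adjoint x * E = 0\<^sub>m 1 (n - 1)"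
    "\<And>q Y. Y \<in> carrier_mat n q \<Longrightarrow> mat_adjoint x * Y = 0\<^sub>m 1 q \<Longrightarrow> E * (F * Y) = Y"
proof -
  obtain k where k: "k < n" "x $$ (k, 0) \<noteq> 0"
  proof -
    have "\<not> (\<forall>k<n. x $$ (k, 0) = 0)"
    proof
      assume "\<forall>k<n. x $$ (k, 0) = 0"
      then have "x = 0\<^sub>m n 1" using x(1) by (intro eq_matI) auto
      with x(2) show False by simp
    qed
    with that show thesis by blast
  qed
  define E where "E = mat n (n - 1) (\<lambda>(i, j). if i = k then - cnj (x $$ (insert_index k j, 0)) / cnj (x $$ (k, 0))
    else if i = insert_index k j then 1 else 0)"
  define F where "F = mat (n - 1) n (\<lambda>(j, i). if i = insert_index k j then 1 else (0 :: complex))"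
  have ins: "insert_index k j < n" "insert_index k j \<noteq> k" if "j < n - 1" for j
    using that k by (auto simp: insert_index_def)
  have Ec: "E \<in> carrier_mat n (n - 1)" "F \<in> carrier_mat (n - 1) n" by (simp_all add: E_def F_def)
  have FY: "(F * Y) $$ (j, c) = Y $$ (insert_index k j, c)"
    if "Y \<in> carrier_mat n q" "j < n - 1" "c < q" for Y j c q
  proof -
    have "(F * Y) $$ (j, c) = (\<Sum>l = 0..<n. (if l = insert_index k j then 1 else 0) * Y $$ (l, c))"
      using that Ec by (simp add: F_def scalar_prod_def)
    also have "\<dots> = (\<Sum>l = 0..<n. if l = insert_index k j then Y $$ (l, c) else 0)"
      by (rule sum.cong) auto
    finally show ?thesis using ins[OF that(2)] by simp
  qed
  show ?thesis
  proof (rule that[OF Ec])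
    show "mat_adjoint x * E = 0\<^sub>m 1 (n - 1)"
    proof (rule eq_matI)
      fix i j assume "i < dim_row (0\<^sub>m 1 (n - 1) :: complex mat)" "j < dim_col (0\<^sub>m 1 (n - 1) :: complex mat)"
      then have ij: "i = 0" "j < n - 1" by auto
      have "(mat_adjoint x * E) $$ (0, j) = (\<Sum>l = 0..<n. cnj (x $$ (l, 0)) * E $$ (l, j))"
        using x Ec ij by (simp add: scalar_prod_def)
      also have "\<dots> = cnj (x $$ (k, 0)) * E $$ (k, j) + (\<Sum>l \<in> {0..<n} - {k}. cnj (x $$ (l, 0)) * E $$ (l, j))"
        using k by (intro sum.remove) auto
      also have "(\<Sum>l \<in> {0..<n} - {k}. cnj (x $$ (l, 0)) * E $$ (l, j)) =
          (\<Sum>l \<in> {0..<n} - {k}. if l = insert_index k j then cnj (x $$ (l, 0)) else 0)"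
        using ij by (intro sum.cong) (auto simp: E_def)
      also have "\<dots> = cnj (x $$ (insert_index k j, 0))" using ins[OF ij(2)] by simp
      also have "cnj (x $$ (k, 0)) * E $$ (k, j) = - cnj (x $$ (insert_index k j, 0))"
        using k ij by (simp add: E_def)
      finally show "(mat_adjoint x * E) $$ (i, j) = 0\<^sub>m 1 (n - 1) $$ (i, j)" using ij by simp
    qed (use x Ec in auto)
  next
    fix q and Y :: "complex mat" assume Y: "Y \<in> carrier_mat n q" and 0: "mat_adjoint x * Y = 0\<^sub>m 1 q"
    show "E * (F * Y) = Y"
    proof (rule eq_matI)
      fix i c assume "i < dim_row Y" "c < dim_col Y"
      then have ic: "i < n" "c < q" using Y by auto
      have s: "(E * (F * Y)) $$ (i, c) = (\<Sum>j = 0..<n - 1. E $$ (i, j) * Y $$ (insert_index k j, c))"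
      proof -
        have "(E * (F * Y)) $$ (i, c) = (\<Sum>j = 0..<n - 1. E $$ (i, j) * (F * Y) $$ (j, c))"
          using ic Y Ec mult_entry[of i E c "F * Y"] by simp
        then show ?thesis using FY[OF Y _ ic(2)] by (simp del: index_mult_mat(1))
      qed
      show "(E * (F * Y)) $$ (i, c) = Y $$ (i, c)"
      proof (cases "i = k")
        case False
        have "(E * (F * Y)) $$ (i, c) =
            (\<Sum>j = 0..<n - 1. if i = insert_index k j then Y $$ (insert_index k j, c) else 0)"
          unfolding s using ic False by (intro sum.cong) (auto simp: E_def)
        also have "\<dots> = (\<Sum>l \<in> {0..<n} - {k}. if i = l then Y $$ (l, c) else 0)"
          by (rule sum_insert_index[OF k(1)])
        also have "\<dots> = Y $$ (i, c)" using ic False by simp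
        finally show ?thesis .
      next
        case True
        have "0 = (mat_adjoint x * Y) $$ (0, c)" unfolding 0 using ic by simp
        also have "\<dots> = (\<Sum>l = 0..<n. cnj (x $$ (l, 0)) * Y $$ (l, c))"
          using x Y ic by (simp add: scalar_prod_def)
        also have "\<dots> = cnj (x $$ (k, 0)) * Y $$ (k, c) + (\<Sum>l \<in> {0..<n} - {k}. cnj (x $$ (l, 0)) * Y $$ (l, c))"
          using k by (intro sum.remove) auto
        finally have *: "(\<Sum>l \<in> {0..<n} - {k}. cnj (x $$ (l, 0)) * Y $$ (l, c)) = - (cnj (x $$ (k, 0)) * Y $$ (k, c))"
          by (simp add: eq_neg_iff_add_eq_0 add.commute)
        have "(E * (F * Y)) $$ (i, c) =
            (\<Sum>j = 0..<n - 1. - cnj (x $$ (insert_index k j, 0)) / cnj (x $$ (k, 0)) * Y $$ (insert_index k j, c))"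
          unfolding s using ic True by (intro sum.cong) (auto simp: E_def)
        also have "\<dots> = (\<Sum>l \<in> {0..<n} - {k}. - cnj (x $$ (l, 0)) / cnj (x $$ (k, 0)) * Y $$ (l, c))"
          by (rule sum_insert_index[OF k(1), of "\<lambda>l. - cnj (x $$ (l, 0)) / cnj (x $$ (k, 0)) * Y $$ (l, c)"])
        also have "\<dots> = (\<Sum>l \<in> {0..<n} - {k}. cnj (x $$ (l, 0)) * Y $$ (l, c)) * (- 1 / cnj (x $$ (k, 0)))"
          by (simp add: sum_distrib_right sum_divide_distrib sum_negf)
        also have "\<dots> = Y $$ (k, c)" unfolding * using k by simp
        finally show ?thesis using True by simp
      qed
    qed (use Y Ec in auto)
  qed
qed

lemma is_realization_carrier:
  assumes "is_realization F n A B C D"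
  shows "A \<in> carrier_mat n n" "B \<in> carrier_mat n (dim_col F)" "C \<in> carrier_mat (dim_row F) n"
    "D \<in> carrier_mat (dim_row F) (dim_col F)" "F = transfer_fun A B C D"
  using assms unfolding is_realization_def by auto

lemma is_realizationI:
  assumes "A \<in> carrier_mat n n" "B \<in> carrier_mat n m" "C \<in> carrier_mat p n" "D \<in> carrier_mat p m"
  shows "is_realization (transfer_fun A B C D) n A B C D"
  using assms dim_transfer_fun[OF assms(1-3), of D] unfolding is_realization_def by auto

lemma mcmillan_degree_le: "is_realization F n A B C D \<Longrightarrow> mcmillan_degree F \<le> n"
  unfolding mcmillan_degree_def by (rule Least_le) blast

text \<open>A left eigenvector that annihilates \<open>B\<close> makes its orthogonal hyperplane
  invariant under \<open>A\<close> and lets it contain the range of \<open>B\<close>, so the system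
  restricts to a state space of dimension one less.\<close>

lemma transfer_fun_deflate:
  fixes A B C x :: "complex mat"
  assumes A: "A \<in> carrier_mat n n" and B: "B \<in> carrier_mat n m" and C: "C \<in> carrier_mat p n"
    and x: "x \<in> carrier_mat n 1" "x \<noteq> 0\<^sub>m n 1"
    and xA: "mat_adjoint x * A = t \<cdot>\<^sub>m mat_adjoint x" and xB: "mat_adjoint x * B = 0\<^sub>m 1 m"
  obtains E A1 B1 where "E \<in> carrier_mat n (n - 1)" "A1 \<in> carrier_mat (n - 1) (n - 1)"
    "B1 \<in> carrier_mat (n - 1) m" "E * A1 = A * E" "E * B1 = B"
proof -
  obtain E F where E: "E \<in> carrier_mat n (n - 1)" "F \<in> carrier_mat (n - 1) n"
    "mat_adjoint x * E = 0\<^sub>m 1 (n - 1)"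
    "\<And>q Y. Y \<in> carrier_mat n q \<Longrightarrow> mat_adjoint x * Y = 0\<^sub>m 1 q \<Longrightarrow> E * (F * Y) = Y"
    using hyperplane_coordinates[OF x] by blast
  have "mat_adjoint x * (A * E) = mat_adjoint x * A * E"
    using x A E(1) by (simp add: mult_assoc_dim)
  also have "\<dots> = 0\<^sub>m 1 (n - 1)" unfolding xA using x E(1,3) by (simp add: smult_mult_dim)
  finally have "E * (F * (A * E)) = A * E" using A E by (intro E(4)) auto
  moreover have "E * (F * B) = B" using B xB by (intro E(4)) auto
  ultimately show ?thesis using that[of E "F * (A * E)" "F * B"] A B E(1,2) by auto
qed

lemma eigenspace_column:
  fixes M :: "complex mat"
  assumes M: "M \<in> carrier_mat n q" "M \<noteq> 0\<^sub>m n q" and A: "A \<in> carrier_mat n n" and C: "C \<in> carrier_mat p n"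
    and AM: "A * M = t \<cdot>\<^sub>m M" and CM: "C * M = 0\<^sub>m p q"
  obtains x where "x \<in> carrier_mat n 1" "x \<noteq> 0\<^sub>m n 1" "A * x = t \<cdot>\<^sub>m x" "C * x = 0\<^sub>m p 1"
proof -
  have "\<not> (\<forall>i<n. \<forall>j<q. M $$ (i, j) = 0)"
  proof
    assume "\<forall>i<n. \<forall>j<q. M $$ (i, j) = 0"
    then have "M = 0\<^sub>m n q" using M(1) by (intro eq_matI) auto
    with M(2) show False by simp
  qed
  then obtain i j where ij: "i < n" "j < q" "M $$ (i, j) \<noteq> 0" by blast
  define e :: "complex mat" where "e = mat q 1 (\<lambda>(l, _). if l = j then 1 else 0)"
  have e: "e \<in> carrier_mat q 1" by (simp add: e_def)
  have "(M * e) $$ (i, 0) = M $$ (i, j)"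
  proof -
    have "(M * e) $$ (i, 0) = (\<Sum>l = 0..<q. M $$ (i, l) * (if l = j then 1 else 0))"
      using M ij e by (simp add: e_def scalar_prod_def)
    also have "\<dots> = (\<Sum>l = 0..<q. if l = j then M $$ (i, l) else 0)" by (rule sum.cong) auto
    finally show ?thesis using ij by simp
  qed
  then have "M * e \<noteq> 0\<^sub>m n 1" using ij by auto
  moreover have "A * (M * e) = t \<cdot>\<^sub>m (M * e)"
  proof -
    have "A * (M * e) = A * M * e" using A M e by (simp add: mult_assoc_dim)
    then show ?thesis unfolding AM using M e by (simp add: smult_mult_dim)
  qed
  moreover have "C * (M * e) = 0\<^sub>m p 1"
  proof -
    have "C * (M * e) = C * M * e" using C M e by (simp add: mult_assoc_dim)
    then show ?thesis unfolding CM using e by simp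
  qed
  ultimately show ?thesis using that[of "M * e"] M e by auto
qed

text \<open>A violation of the Hautus test yields an eigenvector along which the system can be
  deflated, and the resulting realization of order \<open>n - 1\<close> contradicts
  minimality.\<close>

lemma minimal_realization_observable:
  assumes min: "is_minimal_realization F n A B C D"
  shows "observable n A C" "observable n (mat_adjoint A) (mat_adjoint B)"
proof -
  define p m where "p = dim_row F" and "m = dim_col F"
  have real: "is_realization F n A B C D" and n: "n = mcmillan_degree F"
    using min unfolding is_minimal_realization_def by auto
  note R = is_realization_carrier[OF real, folded p_def m_def]
  note A = R(1) and B = R(2) and C = R(3) and D = R(4)
  have False if "is_realization F (n - 1) A' B' C' D'" "0 < n" for A' B' C' D'
    using mcmillan_degree_le[OF that(1)] n that(2) by simp
  \<comment> \<open>For \<open>n = 0\<close> the subtraction \<open>n - 1\<close> would not lower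
    the order; the nonzero vector excludes that case.\<close>
  moreover have "0 < n" if "x \<in> carrier_mat n 1" "x \<noteq> 0\<^sub>m n 1" for x :: "complex mat"
  proof (rule ccontr)
    assume "\<not> 0 < n"
    with that(1) have "x = 0\<^sub>m n 1" by (intro eq_matI) auto
    with that(2) show False by simp
  qed
  ultimately have no: False
    if "is_realization F (n - 1) A' B' C' D'" "x \<in> carrier_mat n 1" "x \<noteq> 0\<^sub>m n 1"
    for A' B' C' D' and x :: "complex mat" using that by blast
  show "observable n (mat_adjoint A) (mat_adjoint B)"
    unfolding observable_def
  proof (intro allI ballI impI, rule ccontr)
    fix q M t assume M: "M \<in> carrier_mat n q" "mat_adjoint A * M = t \<cdot>\<^sub>m M"
      "mat_adjoint B * M = 0\<^sub>m (dim_row (mat_adjoint B)) q" "M \<noteq> 0\<^sub>m n q"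
    obtain x where x: "x \<in> carrier_mat n 1" "x \<noteq> 0\<^sub>m n 1" "mat_adjoint A * x = t \<cdot>\<^sub>m x"
      "mat_adjoint B * x = 0\<^sub>m m 1"
      by (rule eigenspace_column[OF M(1,4), of "mat_adjoint A" "mat_adjoint B" m t]) (use A B M in auto)
    have "mat_adjoint x * A = cnj t \<cdot>\<^sub>m mat_adjoint x"
      using arg_cong[OF x(3), of mat_adjoint] A x(1) by (simp add: adjoint_simps)
    moreover have "mat_adjoint x * B = 0\<^sub>m 1 m"
      using arg_cong[OF x(4), of mat_adjoint] B x(1) by (simp add: adjoint_simps)
    ultimately obtain E A1 B1 where E: "E \<in> carrier_mat n (n - 1)" "A1 \<in> carrier_mat (n - 1) (n - 1)"
      "B1 \<in> carrier_mat (n - 1) m" "E * A1 = A * E" "E * B1 = B"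
      by (rule transfer_fun_deflate[OF A B C x(1,2)])
    have "transfer_fun A1 B1 (C * E) D = transfer_fun A B C D"
      by (rule transfer_fun_intertwine[OF E(2,3) _ A B C D E(1,4,5)]) (use C E in auto)
    then have "is_realization F (n - 1) A1 B1 (C * E) D"
      using is_realizationI[OF E(2,3) _ D, of "C * E"] C E(1) R(5) by simp
    with no x show False by blast
  qed
  show "observable n A C"
    unfolding observable_def
  proof (intro allI ballI impI, rule ccontr)
    fix q M t assume M: "M \<in> carrier_mat n q" "A * M = t \<cdot>\<^sub>m M"
      "C * M = 0\<^sub>m (dim_row C) q" "M \<noteq> 0\<^sub>m n q"
    obtain x where x: "x \<in> carrier_mat n 1" "x \<noteq> 0\<^sub>m n 1" "A * x = t \<cdot>\<^sub>m x" "C * x = 0\<^sub>m p 1"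
      by (rule eigenspace_column[OF M(1,4), of A C p t]) (use A C M in auto)
    have A': "mat_adjoint A \<in> carrier_mat n n" and C': "mat_adjoint C \<in> carrier_mat n p"
      and B': "mat_adjoint B \<in> carrier_mat m n" using A B C by auto
    have "mat_adjoint x * mat_adjoint A = cnj t \<cdot>\<^sub>m mat_adjoint x"
      using arg_cong[OF x(3), of mat_adjoint] A x(1) by (simp add: adjoint_simps)
    moreover have "mat_adjoint x * mat_adjoint C = 0\<^sub>m 1 p"
      using arg_cong[OF x(4), of mat_adjoint] C x(1) by (simp add: adjoint_simps)
    ultimately obtain E A1 C1 where E: "E \<in> carrier_mat n (n - 1)" "A1 \<in> carrier_mat (n - 1) (n - 1)"
      "C1 \<in> carrier_mat (n - 1) p" "E * A1 = mat_adjoint A * E" "E * C1 = mat_adjoint C"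
      by (rule transfer_fun_deflate[OF A' C' B' x(1,2)])
    have "mat_adjoint E * A = mat_adjoint A1 * mat_adjoint E"
      using arg_cong[OF E(4), of mat_adjoint] A E(1,2) by (simp add: adjoint_simps)
    moreover have "mat_adjoint C1 * mat_adjoint E = C"
      using arg_cong[OF E(5), of mat_adjoint] E(1,3) by (simp add: adjoint_simps)
    ultimately have "transfer_fun A B C D = transfer_fun (mat_adjoint A1) (mat_adjoint E * B) (mat_adjoint C1) D"
      by (intro transfer_fun_intertwine[OF A B C _ _ _ D, of _ "n - 1" _ _ "mat_adjoint E"]) (use B E in auto)
    then have "is_realization F (n - 1) (mat_adjoint A1) (mat_adjoint E * B) (mat_adjoint C1) D"
      using is_realizationI[of "mat_adjoint A1" "n - 1" "mat_adjoint E * B" m "mat_adjoint C1" p D] B D E R(5)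
      by simp
    with no x show False by blast
  qed
qed

text \<open>Properness has to survive the passage to a common denominator: numerator and denominator
  are always extended by the same nonzero factor, which preserves the inequality between their
  degrees.\<close>

lemma common_denominator:
  fixes S :: "ratfun set"
  assumes "finite S" "\<And>f. f \<in> S \<Longrightarrow> \<exists>p q. f = Fract p q \<and> q \<noteq> 0 \<and> degree p \<le> degree q"
  shows "\<exists>q. q \<noteq> 0 \<and> (\<forall>f\<in>S. \<exists>p. f = Fract p q \<and> degree p \<le> degree q)"
  using assms
proof (induction S)
  case (insert f S)
  then obtain q where q: "q \<noteq> 0" "\<forall>f\<in>S. \<exists>p. f = Fract p q \<and> degree p \<le> degree q" by auto
  obtain r s where f: "f = Fract r s" "s \<noteq> 0" "degree r \<le> degree s"
    using insert.prems[of f] by auto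
  have ext: "\<exists>p. Fract a b = Fract p (b * c) \<and> degree p \<le> degree (b * c)"
    if "b \<noteq> 0" "c \<noteq> 0" "degree a \<le> degree b" for a b c :: "complex poly"
    using that by (intro exI[of _ "a * c"]) (auto simp: eq_fract degree_mult_eq intro: order.trans[OF degree_mult_le])
  have "\<exists>p. g = Fract p (q * s) \<and> degree p \<le> degree (q * s)" if "g \<in> insert f S" for g
  proof (cases "g = f")
    case True
    then show ?thesis using ext[of s q r] f q by (simp add: mult.commute)
  next
    case False
    then have "g \<in> S" using that by simp
    then obtain p where "g = Fract p q" "degree p \<le> degree q" using q by auto
    then show ?thesis using ext[of q s p] f q by simp
  qed
  then show ?case using q f by (intro exI[of _ "q * s"]) auto
qed (auto intro: exI[of _ 1])

lemma sum_block_index: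
  fixes g :: "nat \<Rightarrow> complex"
  assumes "j < c"
  shows "(\<Sum>s = 0..<d * c. if s mod c = j then g (s div c) else 0) = (\<Sum>k = 0..<d. g k)"
proof -
  have "(\<Sum>s = 0..<d * c. if s mod c = j then g (s div c) else 0) =
      (\<Sum>s \<in> {s \<in> {0..<d * c}. s mod c = j}. g (s div c))"
    by (rule sum.inter_filter[symmetric]) simp
  also have "\<dots> = (\<Sum>k = 0..<d. g k)"
  proof (rule sum.reindex_bij_witness[of _ "\<lambda>k. k * c + j" "\<lambda>s. s div c"])
    fix s assume s: "s \<in> {s \<in> {0..<d * c}. s mod c = j}"
    then show "s div c * c + j = s" by (metis (lifting) div_mult_mod_eq mem_Collect_eq)
    show "s div c \<in> {0..<d}" using s assms by (auto simp: less_mult_imp_div_less)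
  next
    fix k assume k: "k \<in> {0..<d}"
    show "(k * c + j) div c = k" using assms by simp
    have "k * c + j < Suc k * c" using assms by simp
    also have "\<dots> \<le> d * c" using k by (intro mult_le_mono1) auto
    finally show "k * c + j \<in> {s \<in> {0..<d * c}. s mod c = j}" using assms by simp
  qed simp
  finally show ?thesis .
qed

lemma poly_as_sum_lessThan:
  fixes p :: "complex poly"
  assumes "\<And>k. d \<le> k \<Longrightarrow> coeff p k = 0"
  shows "poly p z = (\<Sum>k = 0..<d. coeff p k * z ^ k)"
proof -
  have "poly p z = (\<Sum>k\<le>degree p. coeff p k * z ^ k)" by (rule poly_altdef)
  also have "\<dots> = (\<Sum>k\<in>{..degree p} \<union> {0..<d}. coeff p k * z ^ k)"
    by (intro sum.mono_neutral_left) (auto simp: coeff_eq_0)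
  also have "\<dots> = (\<Sum>k = 0..<d. coeff p k * z ^ k)"
    by (intro sum.mono_neutral_right) (auto simp: assms)
  finally show ?thesis .
qed

text \<open>For a common denominator \<open>q\<close> of degree \<open>d\<close> the state is \<open>z\<^sup>k / q(z)\<close>, \<open>k < d\<close>, once for each
  input; the state index \<open>s\<close> encodes \<open>k = s div c\<close> and the input \<open>s mod c\<close>.\<close>

lemma realization_exists:
  assumes F: "F \<in> carrier_mat r c" and lim: "tends_at_infinity F D"
  shows "\<exists>n A B C. is_realization F n A B C D"
proof -
  have "\<exists>q. q \<noteq> 0 \<and> (\<forall>f \<in> elements_mat F. \<exists>p. f = Fract p q \<and> degree p \<le> degree q)"
  proof (rule common_denominator)
    have "elements_mat F = (\<lambda>(i, j). F $$ (i, j)) ` ({..<r} \<times> {..<c})"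
      using F by (auto simp: elements_mat_def)
    then show "finite (elements_mat F)" by simp
    fix f assume "f \<in> elements_mat F"
    then obtain i j where ij: "i < dim_row F" "j < dim_col F" "f = F $$ (i, j)" by blast
    then have "(rat_eval f \<longlongrightarrow> D $$ (i, j)) at_infinity"
      using lim unfolding tends_at_infinity_def by auto
    then show "\<exists>p q. f = Fract p q \<and> q \<noteq> 0 \<and> degree p \<le> degree q"
      by (rule proper_ratfun) blast
  qed
  then obtain q where q: "q \<noteq> 0" and nums: "\<forall>f \<in> elements_mat F. \<exists>p. f = Fract p q \<and> degree p \<le> degree q"
    by blast
  define d where "d = degree q"
  define l where "l = coeff q d"
  have l: "l \<noteq> 0" using q by (simp add: l_def d_def)
  obtain num where num: "\<And>f. f \<in> elements_mat F \<Longrightarrow> f = Fract (num f) q \<and> degree (num f) \<le> d"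
    using nums unfolding d_def by metis
  define N where "N i j = num (F $$ (i, j))" for i j
  have N: "F $$ (i, j) = Fract (N i j) q" "degree (N i j) \<le> d" if "i < r" "j < c" for i j
    using num[of "F $$ (i, j)"] that F unfolding N_def by (auto intro: elements_matI)
  \<comment> \<open>\<open>D'\<close> is the value at infinity, and \<open>G\<close> below is the
    numerator of the strictly proper remainder: its coefficient of degree \<open>d\<close>
    cancels.\<close>
  define D' where "D' = mat r c (\<lambda>(i, j). coeff (N i j) d / l)"
  define G where "G i j = N i j - Polynomial.smult (coeff (N i j) d / l) q" for i j
  have G: "coeff (G i j) k = 0" if "i < r" "j < c" "d \<le> k" for i j k
    using N(2)[OF that(1,2)] that l unfolding G_def l_def
    by (cases "k = d") (auto simp: coeff_eq_0 d_def)
  \<comment> \<open>A block companion matrix: every block of \<open>c\<close> states is sent to the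
    next power of \<open>z\<close>, and the last block, recognized by
    \<open>d * c \<le> s + c\<close>, is closed up with the coefficients of \<open>q\<close> divided
    by its leading coefficient.\<close>
  define A where "A = mat (d * c) (d * c) (\<lambda>(s, s').
    if s + c < d * c then (if s' = s + c then 1 else 0)
    else (if s' mod c = s mod c then - coeff q (s' div c) / l else 0))"
  define B where "B = mat (d * c) c (\<lambda>(s, j). if d * c \<le> s + c \<and> s mod c = j then 1 / l else 0)"
  define C where "C = mat r (d * c) (\<lambda>(i, s). coeff (G i (s mod c)) (s div c))"
  have carr: "A \<in> carrier_mat (d * c) (d * c)" "B \<in> carrier_mat (d * c) c" "C \<in> carrier_mat r (d * c)"
    "D' \<in> carrier_mat r c" by (simp_all add: A_def B_def C_def D'_def)
  have "F = transfer_fun A B C D'"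
  proof (rule transfer_fun_eqI[OF F carr poly_roots_finite[OF q]])
    fix z assume "z \<notin> {z. poly q z = 0}" and ev: "\<not> eigenvalue A z"
    then have qz: "poly q z \<noteq> 0" by simp
    define Z where "Z = mat (d * c) c (\<lambda>(s, j). if s mod c = j then z ^ (s div c) / poly q z else 0)"
    have Zc: "Z \<in> carrier_mat (d * c) c" by (simp add: Z_def)
    have qsum: "poly q z = (\<Sum>k = 0..<d. coeff q k * z ^ k) + l * z ^ d"
    proof -
      have "poly q z = (\<Sum>k = 0..<Suc d. coeff q k * z ^ k)"
        by (rule poly_as_sum_lessThan) (simp add: d_def coeff_eq_0)
      then show ?thesis by (simp add: l_def)
    qed
    have AZ: "(A * Z) $$ (s, j) = z * Z $$ (s, j) - B $$ (s, j)" if sj: "s < d * c" "j < c" for s j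
    proof (cases "s + c < d * c")
      case True
      have "(A * Z) $$ (s, j) = (\<Sum>t = 0..<d * c. A $$ (s, t) * Z $$ (t, j))"
        using mult_entry[of s A j Z] sj carr Zc by simp
      also have "\<dots> = (\<Sum>t = 0..<d * c. if t = s + c then Z $$ (t, j) else 0)"
        using sj True by (intro sum.cong) (auto simp: A_def)
      also have "\<dots> = Z $$ (s + c, j)" using True by simp
      also have "\<dots> = z * Z $$ (s, j)" using True sj by (simp add: Z_def)
      finally show ?thesis using True sj by (simp add: B_def)
    next
      case False
      \<comment> \<open>In the last block the power \<open>z ^ d\<close> is no state any more. It is
        recovered from \<open>l * z ^ d = q(z) - (\<Sum>k<d. coeff q k * z ^ k)\<close>, and
        division by \<open>l * q(z)\<close> leaves exactly the term \<open>1 / l\<close> that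
        \<open>B\<close> accounts for.\<close>
      define m where "m = s mod c"
      have m: "m < c" using sj by (simp add: m_def)
      have sd: "s div c = d - 1" "0 < d"
      proof -
        show "0 < d" using sj by (cases d) auto
        have "s < d * c" "(d - 1) * c \<le> s" using sj False by (auto simp: diff_mult_distrib)
        then show "s div c = d - 1"
          using \<open>0 < d\<close> by (intro div_nat_eqI) (auto simp: mult.commute)
      qed
      have "(A * Z) $$ (s, j) = (\<Sum>t = 0..<d * c. A $$ (s, t) * Z $$ (t, j))"
        using mult_entry[of s A j Z] sj carr Zc by simp
      also have "\<dots> = (\<Sum>t = 0..<d * c. if t mod c = j then
          (if m = j then - (coeff q (t div c) * z ^ (t div c)) / (l * poly q z) else 0) else 0)"
        using sj False by (intro sum.cong) (auto simp: A_def Z_def m_def)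
      also have "\<dots> = (\<Sum>k = 0..<d. if m = j then - (coeff q k * z ^ k) / (l * poly q z) else 0)"
        by (rule sum_block_index[OF sj(2)])
      also have "\<dots> = (if m = j then - (\<Sum>k = 0..<d. coeff q k * z ^ k) / (l * poly q z) else 0)"
        by (simp add: sum_negf sum_divide_distrib)
      also have "(\<Sum>k = 0..<d. coeff q k * z ^ k) = poly q z - l * z ^ d" using qsum by simp
      also have "- (poly q z - l * z ^ d) / (l * poly q z) = z ^ d / poly q z - 1 / l"
        using l qz by (simp add: field_simps)
      also have "z ^ d = z * z ^ (d - 1)" using sd(2) by (metis power_eq_if not_gr_zero)
      finally show ?thesis using sj False sd by (auto simp: Z_def B_def m_def)
    qed
    have "resolvent A z * B = Z"
    proof (rule resolvent_unique[OF carr(1) ev Zc])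
      show "z \<cdot>\<^sub>m Z - A * Z = B"
        by (rule eq_matI) (use AZ carr Zc in \<open>auto simp del: index_mult_mat(1)\<close>)
    qed
    moreover have "mat_eval F z = D' + C * Z"
    proof (rule eq_matI)
      fix i j assume "i < dim_row (D' + C * Z)" "j < dim_col (D' + C * Z)"
      then have ij: "i < r" "j < c" using carr Zc by auto
      have "(C * Z) $$ (i, j) = (\<Sum>s = 0..<d * c. C $$ (i, s) * Z $$ (s, j))"
        using mult_entry[of i C j Z] ij carr Zc by simp
      also have "\<dots> = (\<Sum>s = 0..<d * c. if s mod c = j then coeff (G i j) (s div c) * z ^ (s div c) / poly q z else 0)"
        using ij by (intro sum.cong) (auto simp: C_def Z_def)
      also have "\<dots> = (\<Sum>k = 0..<d. coeff (G i j) k * z ^ k / poly q z)"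
        by (rule sum_block_index[OF ij(2)])
      also have "\<dots> = poly (G i j) z / poly q z"
        using poly_as_sum_lessThan[of d "G i j" z] G[OF ij] by (simp add: sum_divide_distrib)
      also have "poly (G i j) z = poly (N i j) z - coeff (N i j) d / l * poly q z"
        by (simp add: G_def)
      finally have "(D' + C * Z) $$ (i, j) = poly (N i j) z / poly q z"
        using ij carr Zc qz by (simp add: D'_def diff_divide_distrib del: index_mult_mat(1))
      moreover have "mat_eval F z $$ (i, j) = poly (N i j) z / poly q z"
        using ij F N(1)[OF ij] rat_eval_Fract(1)[OF qz] by simp
      ultimately show "mat_eval F z $$ (i, j) = (D' + C * Z) $$ (i, j)" by simp
    qed (use F carr Zc in auto)
    ultimately show "mat_eval F z = D' + C * (resolvent A z * B)" by simp
  qed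
  then have real: "is_realization F (d * c) A B C D'"
    using is_realizationI[OF carr] by simp
  have "D' = D" by (rule realization_value_at_infinity[OF real lim])
  with real show ?thesis by blast
qed

lemma minimal_realization_exists:
  assumes F: "F \<in> carrier_mat r c" and lim: "tends_at_infinity F D"
  shows "\<exists>n A B C. is_minimal_realization F n A B C D"
proof -
  have "\<exists>n A B C D. is_realization F n A B C D" using realization_exists[OF F lim] by blast
  then have "\<exists>A B C D. is_realization F (mcmillan_degree F) A B C D"
    unfolding mcmillan_degree_def by (rule LeastI_ex)
  then obtain A B C D' where real: "is_realization F (mcmillan_degree F) A B C D'" by blast
  moreover have "D' = D" by (rule realization_value_at_infinity[OF real lim])
  ultimately show ?thesis unfolding is_minimal_realization_def by blast
qed

section \<open>Eigenvalues of minimal realizations are poles\<close>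

text \<open>If \<open>N (w - A)\<^sup>-\<^sup>1 M\<close> is bounded near \<open>z\<close> for sufficiently many constant matrices \<open>N\<close> and \<open>M\<close>,
  then \<open>z\<close> is not an eigenvalue of \<open>A\<close>.\<close>

definition resolvent_bounded :: "complex mat \<Rightarrow> complex \<Rightarrow> complex mat \<Rightarrow> complex mat \<Rightarrow> bool" where
  "resolvent_bounded A z N M \<longleftrightarrow> (\<exists>c. eventually (\<lambda>w. mnorm (N * (resolvent A w * M)) \<le> c) (at z))"

lemma eventually_not_eigenvalue:
  fixes A :: "complex mat"
  assumes "A \<in> carrier_mat n n"
  shows "eventually (\<lambda>w. \<not> eigenvalue A w) (at z within T)"
  using eventually_notin_finite_at[OF finite_eigenvalues[OF assms]] by simp

text \<open>Boundedness is transferred along an estimate by two bounded terms; an estimate by one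
  term is the case of a zero coefficient.\<close>

lemma resolvent_bounded_add:
  assumes A: "A \<in> carrier_mat n n" and X: "resolvent_bounded A z N1 M1" "resolvent_bounded A z N2 M2"
    and eq: "\<And>w. \<not> eigenvalue A w \<Longrightarrow>
      mnorm (N * (resolvent A w * M)) \<le> a * mnorm (N1 * (resolvent A w * M1)) + b * mnorm (N2 * (resolvent A w * M2))"
    and ab: "0 \<le> a" "0 \<le> b"
  shows "resolvent_bounded A z N M"
proof -
  obtain c1 c2 where
    c: "eventually (\<lambda>w. mnorm (N1 * (resolvent A w * M1)) \<le> c1) (at z)"
       "eventually (\<lambda>w. mnorm (N2 * (resolvent A w * M2)) \<le> c2) (at z)"
    using X unfolding resolvent_bounded_def by blast
  have "eventually (\<lambda>w. mnorm (N * (resolvent A w * M)) \<le> a * c1 + b * c2) (at z)"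
    using c eventually_not_eigenvalue[OF A]
  proof eventually_elim
    case (elim w)
    have "a * mnorm (N1 * (resolvent A w * M1)) \<le> a * c1" "b * mnorm (N2 * (resolvent A w * M2)) \<le> b * c2"
      using elim ab by (auto intro: mult_left_mono)
    with eq[OF elim(3)] show ?case by linarith
  qed
  then show ?thesis unfolding resolvent_bounded_def by blast
qed

text \<open>The factors \<open>A - e\<close> inside the Gramian commute with the resolvent and can
  be moved onto \<open>M\<close>, where the hypothesis for all \<open>A\<^sup>k M\<close> absorbs
  them.\<close>

lemma resolvent_bounded_gram:
  assumes A: "A \<in> carrier_mat n n" and C: "C \<in> carrier_mat p n"
  shows "M \<in> carrier_mat n q \<Longrightarrow> (\<And>k. resolvent_bounded A z C (kry A M k)) \<Longrightarrow>
    resolvent_bounded A z (gram A C A C es) M"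
proof (induction es arbitrary: M)
  case Nil
  have "resolvent_bounded A z C M" using Nil(2)[of 0] by simp
  from this this show ?case
  proof (rule resolvent_bounded_add[OF A])
    fix w assume w: "\<not> eigenvalue A w"
    have "mnorm (gram A C A C [] * (resolvent A w * M)) = mnorm (mat_adjoint C * (C * (resolvent A w * M)))"
      using A C Nil resolvent(1)[OF A w] by (simp add: mult_assoc_dim)
    also have "\<dots> \<le> mnorm C * mnorm (C * (resolvent A w * M))"
      using mnorm_mult[of "mat_adjoint C" "C * (resolvent A w * M)"] C by simp
    finally show "mnorm (gram A C A C [] * (resolvent A w * M)) \<le>
      mnorm C * mnorm (C * (resolvent A w * M)) + 0 * mnorm (C * (resolvent A w * M))" by simp
  qed simp_all
next
  case (Cons e es)
  let ?S = "A - e \<cdot>\<^sub>m 1\<^sub>m n" and ?M = "A * M - e \<cdot>\<^sub>m M"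
  have Mc: "?M \<in> carrier_mat n q" using A Cons.prems by auto
  have G: "gram A C A C es \<in> carrier_mat n n" by (rule gram_carrier; use A C in auto)
  have IH: "resolvent_bounded A z (gram A C A C es) ?M"
  proof (rule Cons.IH[OF Mc])
    fix k
    from Cons.prems(2)[of "Suc k"] Cons.prems(2)[of k]
    show "resolvent_bounded A z C (kry A ?M k)"
    proof (rule resolvent_bounded_add[OF A])
      fix w assume w: "\<not> eigenvalue A w"
      note R = resolvent(1)[OF A w]
      have K: "kry A M k \<in> carrier_mat n q" using A Cons.prems by simp
      have "C * (resolvent A w * kry A ?M k) =
          C * (resolvent A w * kry A M (Suc k)) + (- e) \<cdot>\<^sub>m (C * (resolvent A w * kry A M k))"
        unfolding kry_shift[OF A Cons.prems(1)] using A C K R by (simp add: mat_ring_simps)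
      then have "mnorm (C * (resolvent A w * kry A ?M k)) \<le>
          mnorm (C * (resolvent A w * kry A M (Suc k))) + mnorm ((- e) \<cdot>\<^sub>m (C * (resolvent A w * kry A M k)))"
        using mnorm_add[of "C * (resolvent A w * kry A M (Suc k))" "(- e) \<cdot>\<^sub>m (C * (resolvent A w * kry A M k))"]
          A C K by simp
      then show "mnorm (C * (resolvent A w * kry A ?M k)) \<le>
          1 * mnorm (C * (resolvent A w * kry A M (Suc k))) + cmod e * mnorm (C * (resolvent A w * kry A M k))"
        by (simp add: mnorm_smult)
    qed simp_all
  qed
  have "resolvent_bounded A z C M" using Cons.prems(2)[of 0] by simp
  from this IH show ?case
  proof (rule resolvent_bounded_add[OF A])
    fix w assume w: "\<not> eigenvalue A w"
    note R = resolvent(1)[OF A w]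
    have RM: "resolvent A w * M \<in> carrier_mat n q" using R Cons.prems by auto
    have SM: "?S * (resolvent A w * M) = resolvent A w * ?M"
      unfolding shift_mult[OF A RM] mult_resolvent(3)[OF A w Cons.prems(1), symmetric]
      using A R Cons.prems by (simp add: mat_ring_simps)
    have "gram A C A C (e # es) * (resolvent A w * M) =
        mat_adjoint C * (C * (resolvent A w * M)) + mat_adjoint ?S * (gram A C A C es * (?S * (resolvent A w * M)))"
      using A C RM G by (simp add: mult_assoc_dim add_mult_dim)
    then have "mnorm (gram A C A C (e # es) * (resolvent A w * M)) \<le>
        mnorm (mat_adjoint C * (C * (resolvent A w * M))) +
        mnorm (mat_adjoint ?S * (gram A C A C es * (resolvent A w * ?M)))"
      unfolding SM using mnorm_add[of "mat_adjoint C * (C * (resolvent A w * M))"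
        "mat_adjoint ?S * (gram A C A C es * (resolvent A w * ?M))"] A C R Cons.prems Mc by simp
    also have "mnorm (mat_adjoint C * (C * (resolvent A w * M))) \<le> mnorm C * mnorm (C * (resolvent A w * M))"
      using mnorm_mult[of "mat_adjoint C" "C * (resolvent A w * M)"] C by simp
    also have "mnorm (mat_adjoint ?S * (gram A C A C es * (resolvent A w * ?M))) \<le>
        mnorm ?S * mnorm (gram A C A C es * (resolvent A w * ?M))"
      using mnorm_mult[of "mat_adjoint ?S" "gram A C A C es * (resolvent A w * ?M)"] A G by simp
    finally show "mnorm (gram A C A C (e # es) * (resolvent A w * M)) \<le>
        mnorm C * mnorm (C * (resolvent A w * M)) + mnorm ?S * mnorm (gram A C A C es * (resolvent A w * ?M))"
      by simp
  qed simp_all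
qed

text \<open>The Gramian of an observable pair is invertible, so boundedness of its product with the
  state is boundedness of the state itself.\<close>

lemma resolvent_bounded_observable:
  assumes A: "A \<in> carrier_mat n n" and C: "C \<in> carrier_mat p n" and obs: "observable n A C"
    and M: "M \<in> carrier_mat n q" and bd: "\<And>k. resolvent_bounded A z C (kry A M k)"
  shows "resolvent_bounded A z (1\<^sub>m n) M"
proof -
  obtain es N where N: "N \<in> carrier_mat n n" "N * gram A C A C es = 1\<^sub>m n"
    using gram_inverse[OF A C obs] by blast
  have G: "gram A C A C es \<in> carrier_mat n n" by (rule gram_carrier; use A C in auto)
  have "resolvent_bounded A z (gram A C A C es) M" by (rule resolvent_bounded_gram[OF A C M bd])
  from this this show ?thesis
  proof (rule resolvent_bounded_add[OF A])
    fix w assume w: "\<not> eigenvalue A w"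
    note R = resolvent(1)[OF A w]
    have "N * (gram A C A C es * (resolvent A w * M)) = N * gram A C A C es * (resolvent A w * M)"
      using N(1) G R M by (simp add: mult_assoc_dim)
    then have "1\<^sub>m n * (resolvent A w * M) = N * (gram A C A C es * (resolvent A w * M))"
      unfolding N(2) by simp
    then show "mnorm (1\<^sub>m n * (resolvent A w * M)) \<le>
        mnorm N * mnorm (gram A C A C es * (resolvent A w * M)) + 0 * mnorm (gram A C A C es * (resolvent A w * M))"
      using mnorm_mult[of N "gram A C A C es * (resolvent A w * M)"] N G by simp
  qed simp_all
qed

lemma resolvent_adjoint:
  assumes A: "A \<in> carrier_mat n n" and w: "\<not> eigenvalue A w"
  shows "resolvent (mat_adjoint A) (cnj w) = mat_adjoint (resolvent A w)"
proof -
  note R = resolvent[OF A w]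
  have "mat_adjoint ((resolvent A w) * (w \<cdot>\<^sub>m 1\<^sub>m n - A)) = 1\<^sub>m n" unfolding R(3) by simp
  then have "(cnj w \<cdot>\<^sub>m 1\<^sub>m n - mat_adjoint A) * mat_adjoint (resolvent A w) = 1\<^sub>m n"
    using A R(1) by (simp add: adjoint_simps mat_ring_simps)
  then show ?thesis unfolding resolvent_def[of "mat_adjoint A"]
    using A R(1) by (intro mat_inv_eq[of _ n]) auto
qed

lemma eventually_at_cnj:
  assumes "eventually P (at z)"
  shows "eventually (\<lambda>w. P (cnj w)) (at (cnj z))"
proof -
  have "filterlim cnj (at z) (at (cnj z))"
    unfolding filterlim_at
  proof
    show "eventually (\<lambda>w. cnj w \<in> UNIV \<and> cnj w \<noteq> z) (at (cnj z))"
      using eventually_neq_at_within[of "cnj z" "cnj z" UNIV] by (rule eventually_mono) auto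
    show "(cnj \<longlongrightarrow> z) (at (cnj z))"
      using tendsto_cnj[OF tendsto_ident_at[of "cnj z" UNIV]] by simp
  qed
  with assms show ?thesis unfolding filterlim_iff by blast
qed

text \<open>Without a singularity at \<open>z\<close>, the product
  \<open>C (w - A)\<^sup>-\<^sup>1 B\<close> is bounded near \<open>z\<close>. The same follows with
  \<open>A\<^sup>k B\<close> in place of \<open>B\<close>; observability then removes
  \<open>C\<close>, controllability removes \<open>B\<close>, and a resolvent cannot stay bounded
  near an eigenvalue. For minimal realizations this turns regularity of a function into a condition
  on the spectrum.\<close>

theorem eigenvalue_imp_singular:
  assumes A: "A \<in> carrier_mat n n" and B: "B \<in> carrier_mat n m" and C: "C \<in> carrier_mat p n"
    and D: "D \<in> carrier_mat p m"
    and obs: "observable n A C" and ctrl: "observable n (mat_adjoint A) (mat_adjoint B)"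
    and ev: "eigenvalue A z"
  shows "is_singular_at (transfer_fun A B C D) z"
proof (rule ccontr)
  assume ns: "\<not> is_singular_at (transfer_fun A B C D) z"
  have K: "kry A B k \<in> carrier_mat n m" for k using A B by simp
  have bd: "resolvent_bounded A z C (kry A B k)" for k
  proof (induction k)
    case 0
    \<comment> \<open>The summand 1 in every entry leaves room for the values at nearby
      points.\<close>
    define c where "c = (\<Sum>i<p. \<Sum>j<m. cmod (mat_eval (transfer_fun A B C D) z $$ (i, j)) + 1)"
    have dT: "transfer_fun A B C D \<in> carrier_mat p m" by (rule dim_transfer_fun[OF A B C])
    have "eventually (\<lambda>w. \<forall>i\<in>{..<p}. \<forall>j\<in>{..<m}. cmod (mat_eval (transfer_fun A B C D) w $$ (i, j)) <
        cmod (mat_eval (transfer_fun A B C D) z $$ (i, j)) + 1) (at z)"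
    proof (intro eventually_ball_finite ballI)
      fix i j assume "i \<in> {..<p}" "j \<in> {..<m}"
      then have "((\<lambda>w. cmod (mat_eval (transfer_fun A B C D) w $$ (i, j))) \<longlongrightarrow>
          cmod (mat_eval (transfer_fun A B C D) z $$ (i, j))) (at z)"
        using mat_tendsto_entry[OF mat_eval_continuous[OF ns, of UNIV], of i j] dT by (auto intro: tendsto_norm)
      then show "eventually (\<lambda>w. cmod (mat_eval (transfer_fun A B C D) w $$ (i, j)) <
          cmod (mat_eval (transfer_fun A B C D) z $$ (i, j)) + 1) (at z)"
        by (rule order_tendstoD) simp
    qed auto
    then have "eventually (\<lambda>w. mnorm (C * (resolvent A w * B)) \<le> c + mnorm D) (at z)"
      using eventually_not_eigenvalue[OF A]
    proof eventually_elim
      case (elim w)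
      let ?T = "mat_eval (transfer_fun A B C D) w"
      note R = resolvent(1)[OF A elim(2)]
      have "C * (resolvent A w * B) = ?T + (-1) \<cdot>\<^sub>m D"
        unfolding transfer_fun_eval(1)[OF A B C D elim(2)] using B C D R
        by (auto intro!: eq_matI simp del: index_mult_mat(1))
      then have "mnorm (C * (resolvent A w * B)) \<le> mnorm ?T + mnorm D"
        using mnorm_add[of ?T "(-1) \<cdot>\<^sub>m D"] dT D by (simp add: mnorm_smult)
      moreover have "mnorm ?T \<le> c"
        unfolding mnorm_def c_def dim_mat_eval carrier_matD[OF dT]
        by (intro sum_mono less_imp_le) (use elim(1) in blast)
      ultimately show ?case by simp
    qed
    then show ?case unfolding resolvent_bounded_def by auto
  next
    case (Suc k)
    then obtain c where "eventually (\<lambda>w. mnorm (C * (resolvent A w * kry A B k)) \<le> c) (at z)"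
      unfolding resolvent_bounded_def by blast
    moreover have "eventually (\<lambda>w. cmod w < cmod z + 1) (at z)"
      by (rule order_tendstoD(2)[OF tendsto_norm[OF tendsto_ident_at]]) simp
    ultimately have "eventually (\<lambda>w. mnorm (C * (resolvent A w * kry A B (Suc k))) \<le>
        (cmod z + 1) * \<bar>c\<bar> + mnorm (C * kry A B k)) (at z)"
      using eventually_not_eigenvalue[OF A]
    proof eventually_elim
      case (elim w)
      note R = resolvent(1)[OF A elim(3)]
      have "resolvent A w * kry A B (Suc k) = w \<cdot>\<^sub>m (resolvent A w * kry A B k) + (-1) \<cdot>\<^sub>m kry A B k"
        unfolding kry.simps mult_resolvent(3)[OF A elim(3) K] by (rule mult_resolvent(2)[OF A elim(3) K])
      then have "C * (resolvent A w * kry A B (Suc k)) =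
          w \<cdot>\<^sub>m (C * (resolvent A w * kry A B k)) + (-1) \<cdot>\<^sub>m (C * kry A B k)"
        using C R K[of k] by (simp add: mat_ring_simps)
      then have "mnorm (C * (resolvent A w * kry A B (Suc k))) \<le>
          cmod w * mnorm (C * (resolvent A w * kry A B k)) + mnorm (C * kry A B k)"
        using mnorm_add[of "w \<cdot>\<^sub>m (C * (resolvent A w * kry A B k))" "(-1) \<cdot>\<^sub>m (C * kry A B k)"] C R K[of k]
        by (simp add: mnorm_smult)
      also have "cmod w * mnorm (C * (resolvent A w * kry A B k)) \<le> (cmod z + 1) * \<bar>c\<bar>"
        using elim by (intro mult_mono) auto
      finally show ?case by simp
    qed
    then show ?case unfolding resolvent_bounded_def by blast
  qed
  have bd1: "resolvent_bounded A z (1\<^sub>m n) (kry A B k)" for k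
    by (rule resolvent_bounded_observable[OF A C obs K]) (simp only: kry_kry bd)
  \<comment> \<open>Controllability is observability of the adjoint pair, so the same lemma is
    applied at \<open>cnj z\<close>: taking adjoints converts the bounds on
    \<open>(w - A)\<^sup>-\<^sup>1 A\<^sup>k B\<close> into bounds on the outputs of the adjoint
    system started at the identity.\<close>
  have "resolvent_bounded (mat_adjoint A) (cnj z) (1\<^sub>m n) (1\<^sub>m n)"
  proof (rule resolvent_bounded_observable[OF _ _ ctrl])
    fix k
    obtain c where "eventually (\<lambda>w. mnorm (1\<^sub>m n * (resolvent A w * kry A B k)) \<le> c) (at z)"
      using bd1[of k] unfolding resolvent_bounded_def by blast
    from eventually_conj[OF this eventually_not_eigenvalue[OF A]]
    have "eventually (\<lambda>w. mnorm (1\<^sub>m n * (resolvent A (cnj w) * kry A B k)) \<le> c \<and> \<not> eigenvalue A (cnj w)) (at (cnj z))"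
      by (rule eventually_at_cnj)
    then have "eventually (\<lambda>w. mnorm (mat_adjoint B * (resolvent (mat_adjoint A) w * kry (mat_adjoint A) (1\<^sub>m n) k)) \<le> c) (at (cnj z))"
    proof eventually_elim
      case (elim w)
      then have w: "\<not> eigenvalue A (cnj w)" by simp
      note R = resolvent(1)[OF A w]
      have comm: "resolvent A (cnj w) * kry A B k = kry A (resolvent A (cnj w) * B) k" for k
      proof (induction k)
        case (Suc k)
        show ?case unfolding kry.simps mult_resolvent(3)[OF A w K] Suc ..
      qed simp
      have "mat_adjoint B * (resolvent (mat_adjoint A) w * kry (mat_adjoint A) (1\<^sub>m n) k) =
          mat_adjoint (resolvent A (cnj w) * B) * kry (mat_adjoint A) (mat_adjoint (1\<^sub>m n)) k"
      proof -
        have "kry (mat_adjoint A) (1\<^sub>m n) k \<in> carrier_mat n n" using A by simp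
        then show ?thesis
          using resolvent_adjoint[OF A w] A B R by (simp add: adjoint_simps mult_assoc_dim)
      qed
      also have "\<dots> = mat_adjoint (1\<^sub>m n * kry A (resolvent A (cnj w) * B) k)"
        by (rule kry_adjoint[OF A]) (use R B in auto)
      finally show ?case using elim by (simp add: comm)
    qed
    then show "resolvent_bounded (mat_adjoint A) (cnj z) (mat_adjoint B) (kry (mat_adjoint A) (1\<^sub>m n) k)"
      unfolding resolvent_bounded_def by blast
  qed (use A B in auto)
  then obtain c where c: "eventually (\<lambda>w. mnorm (1\<^sub>m n * (resolvent (mat_adjoint A) w * 1\<^sub>m n)) \<le> c) (at (cnj z))"
    unfolding resolvent_bounded_def by blast
  have A': "mat_adjoint A \<in> carrier_mat n n" using A by simp
  obtain x where x: "x \<in> carrier_mat n 1" "x \<noteq> 0\<^sub>m n 1" "mat_adjoint A * x = cnj z \<cdot>\<^sub>m x"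
    using ev eigenvalue_iff[OF A', of "cnj z"] adjoint_eigenvalue[OF A] by auto
  \<comment> \<open>On an eigenvector for \<open>cnj z\<close> the resolvent acts as division by
    \<open>w - cnj z\<close>, so a bound on it forces the norm of \<open>x\<close> to zero.\<close>
  have "eventually (\<lambda>w. mnorm x \<le> cmod (w - cnj z) * (\<bar>c\<bar> * mnorm x)) (at (cnj z))"
    using c eventually_not_eigenvalue[OF A']
  proof eventually_elim
    case (elim w)
    note R = resolvent(1)[OF A' elim(2)]
    have "resolvent (mat_adjoint A) w * ((w - cnj z) \<cdot>\<^sub>m x) = x"
    proof (rule resolvent_unique[OF A' elim(2) x(1)])
      show "w \<cdot>\<^sub>m x - mat_adjoint A * x = (w - cnj z) \<cdot>\<^sub>m x"
        unfolding x(3) using x(1) by (auto intro!: eq_matI simp: algebra_simps)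
    qed
    then have "mnorm x = cmod (w - cnj z) * mnorm (resolvent (mat_adjoint A) w * x)"
      using R x(1) by (metis carrier_matD mnorm_smult mult_smult_dim)
    also have "mnorm (resolvent (mat_adjoint A) w * x) \<le> mnorm (resolvent (mat_adjoint A) w) * mnorm x"
      using R x(1) by (intro mnorm_mult) auto
    also have "mnorm (resolvent (mat_adjoint A) w) \<le> \<bar>c\<bar>" using elim(1) R by simp
    finally show ?case by (simp add: mult_left_mono mult_right_mono)
  qed
  moreover have "((\<lambda>w. cmod (w - cnj z) * (\<bar>c\<bar> * mnorm x)) \<longlongrightarrow> cmod (cnj z - cnj z) * (\<bar>c\<bar> * mnorm x)) (at (cnj z))"
    by (intro tendsto_intros)
  ultimately have "mnorm x \<le> cmod (cnj z - cnj z) * (\<bar>c\<bar> * mnorm x)"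
    by (intro tendsto_lowerbound[where F = "at (cnj z)"]) auto
  then have "mnorm x = 0" using mnorm_nonneg[of x] by simp
  with x show False by (simp add: mnorm_eq_0_iff)
qed

section \<open>The Riccati equation\<close>

definition riccati_eq :: "complex mat \<Rightarrow> complex mat \<Rightarrow> complex mat \<Rightarrow> complex mat \<Rightarrow> bool" where
  "riccati_eq A B C X \<longleftrightarrow>
     \<i> \<cdot>\<^sub>m (X * A - mat_adjoint A * X) = mat_adjoint C * C + X * B * mat_adjoint B * X"

text \<open>Solved for \<open>A\<^sup>* X\<close>, the equation becomes a rewrite rule with which
  the simplifier can normalize expressions in \<open>X\<close>.\<close>

lemma riccati_eq_iff:
  assumes A: "A \<in> carrier_mat n n" and B: "B \<in> carrier_mat n m" and C: "C \<in> carrier_mat p n"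
    and X: "X \<in> carrier_mat n n"
  shows "riccati_eq A B C X \<longleftrightarrow>
    mat_adjoint A * X = X * A + (\<i> \<cdot>\<^sub>m (mat_adjoint C * C) + \<i> \<cdot>\<^sub>m (X * (B * (mat_adjoint B * X))))"
proof -
  have assoc: "X * B * mat_adjoint B * X = X * (B * (mat_adjoint B * X))"
    using A B C X by (simp add: mult_assoc_dim)
  have *: "\<i> * (a - b) = c + d \<longleftrightarrow> b = a + (\<i> * c + \<i> * d)" for a b c d :: complex
  proof
    assume "\<i> * (a - b) = c + d"
    then have "- (a - b) = \<i> * (c + d)" by (metis i_squared mult.assoc mult_minus1)
    then show "b = a + (\<i> * c + \<i> * d)" by (simp add: algebra_simps)
  next
    assume "b = a + (\<i> * c + \<i> * d)"
    then have "a - b = - \<i> * (c + d)" by (simp add: algebra_simps)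
    then have "\<i> * (a - b) = \<i> * (- \<i> * (c + d))" by (rule arg_cong)
    also have "\<dots> = c + d" by (simp flip: mult.assoc)
    finally show "\<i> * (a - b) = c + d" .
  qed
  show ?thesis unfolding riccati_eq_def assoc
    using A B C X by (auto simp: mat_eq_iff * simp del: index_mult_mat(1))
qed

lemma alpha_mat_eq:
  assumes "A \<in> carrier_mat n n" "B \<in> carrier_mat n m" "X \<in> carrier_mat n n"
  shows "alpha_mat A B X = A + \<i> \<cdot>\<^sub>m (B * (mat_adjoint B * X))" "alpha_mat A B X \<in> carrier_mat n n"
  unfolding alpha_mat_def using assms by (auto simp: mult_assoc_dim)

text \<open>Subtracting the two equations cancels \<open>C\<^sup>* C\<close>, and the mixed term
  \<open>Z B B\<^sup>* X\<close> occurs with the same sign on both sides.\<close>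

lemma riccati_intertwine:
  assumes A: "A \<in> carrier_mat n n" and B: "B \<in> carrier_mat n m" and C: "C \<in> carrier_mat p n"
    and X: "X \<in> carrier_mat n n" "riccati_eq A B C X"
    and Z: "Z \<in> carrier_mat n n" "mat_adjoint Z = Z" "riccati_eq A B C Z"
  shows "(X - Z) * alpha_mat A B X = mat_adjoint (alpha_mat A B Z) * (X - Z)"
proof -
  have 1: "mat_adjoint A * X = X * A + (\<i> \<cdot>\<^sub>m (mat_adjoint C * C) + \<i> \<cdot>\<^sub>m (X * (B * (mat_adjoint B * X))))"
    using X(2) riccati_eq_iff[OF A B C X(1)] by blast
  have 2: "mat_adjoint A * Z = Z * A + (\<i> \<cdot>\<^sub>m (mat_adjoint C * C) + \<i> \<cdot>\<^sub>m (Z * (B * (mat_adjoint B * Z))))"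
    using Z(3) riccati_eq_iff[OF A B C Z(1)] by blast
  have 3: "mat_adjoint (alpha_mat A B Z) = mat_adjoint A + (- \<i>) \<cdot>\<^sub>m (Z * (B * mat_adjoint B))"
    unfolding alpha_mat_eq(1)[OF A B Z(1)] using A B Z by (simp add: adjoint_simps mult_assoc_dim)
  show ?thesis unfolding 3 alpha_mat_eq(1)[OF A B X(1)] using A B C X(1) Z(1)
    by (auto simp: mat_ring_simps 1 2 algebra_simps intro!: eq_matI simp del: index_mult_mat(1))
qed

lemma alpha_mat_diff:
  assumes "A \<in> carrier_mat n n" "B \<in> carrier_mat n m" "X \<in> carrier_mat n n" "Z \<in> carrier_mat n n"
  shows "alpha_mat A B X = alpha_mat A B Z + \<i> \<cdot>\<^sub>m (B * (mat_adjoint B * (X - Z)))"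
  unfolding alpha_mat_eq(1)[OF assms(1-3)] alpha_mat_eq(1)[OF assms(1,2,4)] using assms
  by (auto simp: mat_ring_simps intro!: eq_matI simp del: index_mult_mat(1))

text \<open>A nonzero difference of two solutions intertwines one closed-loop matrix with the
  adjoint of the other, so some \<open>e\<close> is an eigenvalue of the first while
  \<open>cnj e\<close> is one of the second. Both lie in the closed lower half-plane, hence
  \<open>e\<close> is real. Real eigenvalues are then excluded by controllability.\<close>

lemma riccati_unique:
  assumes A: "A \<in> carrier_mat n n" and B: "B \<in> carrier_mat n m" and C: "C \<in> carrier_mat p n"
    and ctrl: "observable n (mat_adjoint A) (mat_adjoint B)"
    and X: "X \<in> carrier_mat n n" "mat_adjoint X = X" "riccati_eq A B C X"
    and Z: "Z \<in> carrier_mat n n" "mat_adjoint Z = Z" "riccati_eq A B C Z"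
    and eX: "\<And>e. eigenvalue (alpha_mat A B X) e \<Longrightarrow> Im e \<le> 0"
    and eZ: "\<And>e. eigenvalue (alpha_mat A B Z) e \<Longrightarrow> Im e \<le> 0"
  shows "X = Z"
proof (rule ccontr)
  assume ne: "X \<noteq> Z"
  define Y \<alpha> \<beta> where "Y = X - Z" and "\<alpha> = alpha_mat A B X" and "\<beta> = alpha_mat A B Z"
  have Y: "Y \<in> carrier_mat n n" "mat_adjoint Y = Y" "Y \<noteq> 0\<^sub>m n n"
    using X Z ne diff_eq_0_imp_eq[of X Z n n] by (auto simp: Y_def minus_as_smult adjoint_simps)
  have c: "\<alpha> \<in> carrier_mat n n" "\<beta> \<in> carrier_mat n n"
    unfolding \<alpha>_def \<beta>_def using alpha_mat_eq(2)[OF A B] X Z by auto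
  have inter: "Y * \<alpha> = mat_adjoint \<beta> * Y"
    unfolding Y_def \<alpha>_def \<beta>_def by (rule riccati_intertwine[OF A B C X(1,3) Z])
  obtain e w where e: "eigenvalue \<alpha> e" and w: "w \<in> carrier_mat n n" "Y * w \<noteq> 0\<^sub>m n n"
    "mat_adjoint \<beta> * (Y * w) = e \<cdot>\<^sub>m (Y * w)"
    by (rule intertwining_eigenvalue[OF c(1) _ Y(1) inter Y(3)]) (use c(2) in auto)
  define u where "u = Y * w"
  have u: "u \<in> carrier_mat n n" "u \<noteq> 0\<^sub>m n n" "mat_adjoint \<beta> * u = e \<cdot>\<^sub>m u"
    using Y w by (auto simp: u_def)
  have "eigenvalue \<beta> (cnj e)"
  proof (rule ccontr)
    assume "\<not> eigenvalue \<beta> (cnj e)"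
    then have ne: "\<not> eigenvalue (mat_adjoint \<beta>) e" using adjoint_eigenvalue[OF c(2), of "cnj e"] by simp
    have "resolvent (mat_adjoint \<beta>) e * 0\<^sub>m n n = u"
      by (rule resolvent_unique[OF _ ne u(1)]) (use c u in \<open>auto intro!: eq_matI\<close>)
    with resolvent(1)[OF _ ne, of n] c u show False by simp
  qed
  with eZ e eX have "Im e = 0" unfolding \<alpha>_def \<beta>_def by fastforce
  then have re: "cnj e = e" by (simp add: complex_eq_iff)
  have ab: "\<alpha> = \<beta> + \<i> \<cdot>\<^sub>m (B * (mat_adjoint B * Y))"
    unfolding \<alpha>_def \<beta>_def Y_def by (rule alpha_mat_diff[OF A B X(1) Z(1)])
  \<comment> \<open>Evaluate \<open>u\<^sup>* \<alpha> w\<close> twice: the intertwining relation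
    gives \<open>e u\<^sup>* w\<close>, and so does \<open>u\<^sup>* \<beta> w\<close> because
    \<open>e\<close> is real. The matrices differ by \<open>\<i> B B\<^sup>* Y\<close> and
    \<open>Y w = u\<close>, so the difference of the two forms is \<open>\<i>\<close> times
    \<open>(B\<^sup>* u)\<^sup>* B\<^sup>* u\<close>.\<close>
  have "mat_adjoint B * u = 0\<^sub>m m n"
  proof -
    have ub: "mat_adjoint u * \<beta> = e \<cdot>\<^sub>m mat_adjoint u"
      using arg_cong[OF u(3), of mat_adjoint] c u(1) re by (simp add: adjoint_simps)
    have uw: "mat_adjoint u = mat_adjoint w * Y" using w Y by (simp add: u_def adjoint_simps)
    have "mat_adjoint w * (Y * \<alpha>) * w = mat_adjoint w * (mat_adjoint \<beta> * Y) * w" unfolding inter ..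
    then have "mat_adjoint w * Y * \<alpha> * w = mat_adjoint w * (mat_adjoint \<beta> * (Y * w))"
      using w Y c by (simp add: mult_assoc_dim)
    then have 1: "mat_adjoint u * \<alpha> * w = e \<cdot>\<^sub>m (mat_adjoint w * u)"
      unfolding uw[symmetric] w(3) u_def[symmetric] using w u by (simp add: mult_smult_dim)
    have wu: "mat_adjoint w * u = mat_adjoint u * w"
      unfolding uw using w Y by (simp add: mult_assoc_dim u_def)
    have "mat_adjoint u * \<alpha> * w = mat_adjoint u * \<beta> * w + \<i> \<cdot>\<^sub>m (mat_adjoint (mat_adjoint B * u) * (mat_adjoint B * u))"
      unfolding ab using B c u w Y by (simp add: adjoint_simps mat_ring_simps u_def)
    then have "e \<cdot>\<^sub>m (mat_adjoint u * w) = e \<cdot>\<^sub>m (mat_adjoint u * w) +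
        \<i> \<cdot>\<^sub>m (mat_adjoint (mat_adjoint B * u) * (mat_adjoint B * u))"
      unfolding 1 ub wu using u w by (simp add: smult_mult_dim)
    then have "mat_adjoint (mat_adjoint B * u) * (mat_adjoint B * u) = 0\<^sub>m n n"
      using B u w by (auto simp: mat_eq_iff simp del: index_mult_mat(1))
    then show ?thesis using adjoint_mult_self_eq_0[of "mat_adjoint B * u"] B u by simp
  qed
  \<comment> \<open>On vectors killed by \<open>B\<^sup>*\<close> the feedback term disappears, so
    \<open>u\<close> consists of eigenvectors of \<open>A\<^sup>*\<close> that violate the Hautus
    test unless they vanish.\<close>
  moreover have "mat_adjoint A * u = e \<cdot>\<^sub>m u"
  proof -
    have "mat_adjoint \<beta> = mat_adjoint A + (- \<i>) \<cdot>\<^sub>m (Z * (B * mat_adjoint B))"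
      unfolding \<beta>_def alpha_mat_eq(1)[OF A B Z(1)] using A B Z by (simp add: adjoint_simps mult_assoc_dim)
    then have "mat_adjoint \<beta> * u = mat_adjoint A * u + (- \<i>) \<cdot>\<^sub>m (Z * (B * (mat_adjoint B * u)))"
      using A B Z u by (simp add: mat_ring_simps)
    then have "mat_adjoint \<beta> * u = mat_adjoint A * u"
      unfolding calculation using A B Z u by (auto intro!: eq_matI simp del: index_mult_mat(1))
    then show ?thesis using u(3) by simp
  qed
  ultimately have "u = 0\<^sub>m n n" using observableD[OF ctrl u(1)] B by auto
  with u(2) show False by simp
qed

text \<open>For \<open>X v = 0\<close>, testing the equation with \<open>v\<close> gives
  \<open>C v = 0\<close>, and what is left of it gives \<open>X A v = 0\<close>. The kernel of
  \<open>X\<close> is therefore \<open>A\<close>-invariant and contained in the kernel of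
  \<open>C\<close>, hence trivial by observability.\<close>

lemma riccati_solution_invertible:
  assumes A: "A \<in> carrier_mat n n" and B: "B \<in> carrier_mat n m" and C: "C \<in> carrier_mat p n"
    and obs: "observable n A C"
    and X: "X \<in> carrier_mat n n" "mat_adjoint X = X" "riccati_eq A B C X"
  obtains S where "S \<in> carrier_mat n n" "X * S = 1\<^sub>m n" "S * X = 1\<^sub>m n"
proof (rule injective_imp_inverse[OF X(1)])
  have ric: "mat_adjoint A * X = X * A + (\<i> \<cdot>\<^sub>m (mat_adjoint C * C) + \<i> \<cdot>\<^sub>m (X * (B * (mat_adjoint B * X))))"
    using X(3) riccati_eq_iff[OF A B C X(1)] by blast
  have step: "C * v = 0\<^sub>m p 1 \<and> X * (A * v) = 0\<^sub>m n 1" if v: "v \<in> carrier_mat n 1" and 0: "X * v = 0\<^sub>m n 1" for v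
  proof -
    have vX: "mat_adjoint v * X = 0\<^sub>m 1 n"
      using arg_cong[OF 0, of mat_adjoint] X v by (simp add: adjoint_simps)
    have "mat_adjoint A * X * v = X * A * v + (\<i> \<cdot>\<^sub>m (mat_adjoint C * C * v) + \<i> \<cdot>\<^sub>m (X * (B * (mat_adjoint B * X)) * v))"
      unfolding ric using A B C X v by (simp add: add_mult_dim smult_mult_dim)
    then have eq: "mat_adjoint A * (X * v) = X * (A * v) +
        (\<i> \<cdot>\<^sub>m (mat_adjoint C * (C * v)) + \<i> \<cdot>\<^sub>m (X * (B * (mat_adjoint B * (X * v)))))"
      using A B C X v by (simp add: mult_assoc_dim)
    then have eq': "0\<^sub>m n 1 = X * (A * v) + \<i> \<cdot>\<^sub>m (mat_adjoint C * (C * v))"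
      unfolding 0 using A B C X v by simp
    then have "mat_adjoint v * 0\<^sub>m n 1 = mat_adjoint v * (X * (A * v) + \<i> \<cdot>\<^sub>m (mat_adjoint C * (C * v)))" by simp
    also have "\<dots> = mat_adjoint v * X * (A * v) + \<i> \<cdot>\<^sub>m (mat_adjoint (C * v) * (C * v))"
      using A C X v by (simp add: mat_ring_simps adjoint_simps)
    finally have "0\<^sub>m 1 1 = \<i> \<cdot>\<^sub>m (mat_adjoint (C * v) * (C * v))"
      unfolding vX using A C v by simp
    then have "mat_adjoint (C * v) * (C * v) = 0\<^sub>m 1 1"
      using C v by (auto simp: mat_eq_iff simp del: index_mult_mat(1))
    then have Cv: "C * v = 0\<^sub>m p 1" using adjoint_mult_self_eq_0[of "C * v"] C v by simp
    moreover have "X * (A * v) = 0\<^sub>m n 1" using eq' unfolding Cv using C X v A by simp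
    ultimately show ?thesis by blast
  qed
  fix v assume v: "v \<in> carrier_mat n 1" and 0: "X * v = 0\<^sub>m n 1"
  have "X * kry A v k = 0\<^sub>m n 1" for k
  proof (induction k)
    case (Suc k)
    then show ?case using step[of "kry A v k"] A v by simp
  qed (use 0 in simp)
  then have "C * kry A v k = 0\<^sub>m p 1" for k using step[of "kry A v k"] A v by simp
  then show "v = 0\<^sub>m n 1" by (rule observable_krylov[OF A C obs v])
qed (rule that)

section \<open>Invariant subspaces of the Hamiltonian matrix\<close>

lemma prod_list_filter:
  fixes f :: "'a \<Rightarrow> 'b :: comm_monoid_mult"
  shows "prod_list (map f (filter P xs @ filter (\<lambda>x. \<not> P x) xs)) = prod_list (map f xs)"
  by (induction xs) (simp_all add: ac_simps)

text \<open>The Schur decomposition realizes the roots on the diagonal in the prescribed order. The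
  first \<open>k\<close> columns of its basis span an invariant subspace on which \<open>H\<close>
  acts by the leading triangular block, and the first \<open>k\<close> rows of the inverse basis
  give a left inverse of these columns.\<close>

lemma leading_invariant_subspace:
  fixes H :: "complex mat"
  assumes H: "H \<in> carrier_mat N N" and cp: "char_poly H = (\<Prod>e\<leftarrow>es1 @ es2. [:- e, 1:])"
  defines "k \<equiv> length es1"
  obtains V L \<alpha> where "V \<in> carrier_mat N k" "L \<in> carrier_mat k N" "\<alpha> \<in> carrier_mat k k"
    "L * V = 1\<^sub>m k" "H * V = V * \<alpha>" "\<And>e. eigenvalue \<alpha> e \<Longrightarrow> e \<in> set es1"
proof -
  obtain U P Q where s: "U \<in> carrier_mat N N" "P \<in> carrier_mat N N" "Q \<in> carrier_mat N N"
    "upper_triangular U" "diag_mat U = es1 @ es2" "P * Q = 1\<^sub>m N" "Q * P = 1\<^sub>m N" "H * P = P * U"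
    by (rule schur_form[OF H cp])
  have len: "length (diag_mat U) = N" using s(1) by (simp add: diag_mat_def)
  then have kN: "k \<le> N" unfolding s(5) k_def by simp
  define V where "V = mat N k (\<lambda>(i, j). P $$ (i, j))"
  define L where "L = mat k N (\<lambda>(i, j). Q $$ (i, j))"
  define \<alpha> where "\<alpha> = mat k k (\<lambda>(i, j). U $$ (i, j))"
  have c: "V \<in> carrier_mat N k" "L \<in> carrier_mat k N" "\<alpha> \<in> carrier_mat k k"
    by (simp_all add: V_def L_def \<alpha>_def)
  have "L * V = 1\<^sub>m k"
  proof (rule eq_matI)
    fix i j assume "i < dim_row (1\<^sub>m k :: complex mat)" "j < dim_col (1\<^sub>m k :: complex mat)"
    then have ij: "i < k" "j < k" by auto
    have "(L * V) $$ (i, j) = (Q * P) $$ (i, j)"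
      using ij kN c s mult_entry[of i L j V] mult_entry[of i Q j P]
      by (simp add: V_def L_def del: index_mult_mat(1))
    then show "(L * V) $$ (i, j) = 1\<^sub>m k $$ (i, j)" unfolding s(7) using ij kN by simp
  qed (use c in auto)
  moreover have "H * V = V * \<alpha>"
  proof (rule eq_matI)
    fix i j assume "i < dim_row (V * \<alpha>)" "j < dim_col (V * \<alpha>)"
    then have ij: "i < N" "j < k" using c by auto
    have "(H * V) $$ (i, j) = (H * P) $$ (i, j)"
      using ij kN c s H mult_entry[of i H j V] mult_entry[of i H j P]
      by (simp add: V_def del: index_mult_mat(1))
    also have "\<dots> = (\<Sum>l = 0..<N. P $$ (i, l) * U $$ (l, j))"
      unfolding s(8) using ij kN s mult_entry[of i P j U] by simp
    also have "\<dots> = (\<Sum>l = 0..<k. P $$ (i, l) * U $$ (l, j))"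
      using kN ij s(1) upper_triangularD[OF s(4)] by (intro sum.mono_neutral_right) auto
    also have "\<dots> = (V * \<alpha>) $$ (i, j)"
      using ij c mult_entry[of i V j \<alpha>] by (simp add: V_def \<alpha>_def del: index_mult_mat(1))
    finally show "(H * V) $$ (i, j) = (V * \<alpha>) $$ (i, j)" .
  qed (use H c in auto)
  moreover have "e \<in> set es1" if "eigenvalue \<alpha> e" for e
  proof -
    have ut: "upper_triangular \<alpha>"
      using s(1,4) kN by (auto simp: \<alpha>_def upper_triangular_def)
    have "diag_mat \<alpha> = es1"
    proof (rule nth_equalityI)
      show "length (diag_mat \<alpha>) = length es1" using c by (simp add: diag_mat_def k_def)
      fix i assume "i < length (diag_mat \<alpha>)"
      then have i: "i < k" using c by (simp add: diag_mat_def)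
      have "diag_mat U ! i = U $$ (i, i)" using i kN s(1) by (simp add: diag_mat_def)
      then show "diag_mat \<alpha> ! i = es1 ! i"
        using i unfolding s(5) by (simp add: diag_mat_def nth_append k_def \<alpha>_def)
    qed
    then have "char_poly \<alpha> = (\<Prod>e\<leftarrow>es1. [:- e, 1:])" using char_poly_upper_triangular[OF c(3) ut] by simp
    moreover have "poly (char_poly \<alpha>) e = 0" using that eigenvalue_root_char_poly[OF c(3)] by simp
    moreover have "poly (\<Prod>e\<leftarrow>xs. [:- e, 1:]) e = 0 \<longrightarrow> e \<in> set xs" for xs :: "complex list"
      by (induction xs) auto
    ultimately show ?thesis by simp
  qed
  ultimately show ?thesis using that[OF c] by blast
qed

text \<open>If \<open>k > n\<close>, padding with zero rows gives a square injective matrix, hence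
  an invertible one, that has a zero row.\<close>

lemma injective_imp_le:
  fixes V :: "complex mat"
  assumes V: "V \<in> carrier_mat n k" and inj: "\<And>w. w \<in> carrier_mat k 1 \<Longrightarrow> V * w = 0\<^sub>m n 1 \<Longrightarrow> w = 0\<^sub>m k 1"
  shows "k \<le> n"
proof (rule ccontr)
  assume "\<not> k \<le> n"
  then have kn: "n < k" by simp
  define M where "M = mat k k (\<lambda>(i, j). if i < n then V $$ (i, j) else 0)"
  have M: "M \<in> carrier_mat k k" by (simp add: M_def)
  obtain N where N: "N \<in> carrier_mat k k" "M * N = 1\<^sub>m k"
  proof (rule injective_imp_inverse[OF M])
    fix w assume w: "w \<in> carrier_mat k 1" and 0: "M * w = 0\<^sub>m k 1"
    show "w = 0\<^sub>m k 1"
    proof (rule inj[OF w], rule eq_matI)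
      fix i j assume "i < dim_row (0\<^sub>m n 1 :: complex mat)" "j < dim_col (0\<^sub>m n 1 :: complex mat)"
      then have ij: "i < n" "j = 0" by auto
      have "(V * w) $$ (i, j) = (M * w) $$ (i, j)"
        using ij kn V M w mult_entry[of i V j w] mult_entry[of i M j w] by (simp add: M_def del: index_mult_mat(1))
      then show "(V * w) $$ (i, j) = 0\<^sub>m n 1 $$ (i, j)" unfolding 0 using ij kn by simp
    qed (use V w in auto)
  qed blast
  have "(M * N) $$ (n, n) = 0"
    using kn M N(1) mult_entry[of n M n N] by (simp add: M_def del: index_mult_mat(1))
  then show False unfolding N(2) using kn by simp
qed

text \<open>The columns of \<open>(V\<^sub>1, V\<^sub>2)\<close> span an invariant subspace of the Hamiltonian matrix
  \<open>[[A, i B B\<^sup>*], [- i C\<^sup>* C, A\<^sup>*]]\<close>; \<open>V\<^sub>1\<^sup>* V\<^sub>2 = V\<^sub>2\<^sup>* V\<^sub>1\<close> says that it is isotropic.\<close>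

lemma hamiltonian_isotropic:
  assumes A: "A \<in> carrier_mat n n" and B: "B \<in> carrier_mat n m" and C: "C \<in> carrier_mat p n"
    and V: "V1 \<in> carrier_mat n k" "V2 \<in> carrier_mat n k" and \<alpha>: "\<alpha> \<in> carrier_mat k k"
    and e1: "V1 * \<alpha> = A * V1 + \<i> \<cdot>\<^sub>m (B * (mat_adjoint B * V2))"
    and e2: "V2 * \<alpha> = (- \<i>) \<cdot>\<^sub>m (mat_adjoint C * (C * V1)) + mat_adjoint A * V2"
    and ev: "\<And>e f. eigenvalue \<alpha> e \<Longrightarrow> eigenvalue \<alpha> f \<Longrightarrow> e \<noteq> cnj f"
  shows "mat_adjoint V1 * V2 = mat_adjoint V2 * V1"
proof (rule ccontr)
  assume ne: "mat_adjoint V1 * V2 \<noteq> mat_adjoint V2 * V1"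
  \<comment> \<open>The Hamiltonian structure gives \<open>\<alpha>\<^sup>* G = G \<alpha>\<close>,
    while the hypothesis on the spectrum says that \<open>\<alpha>\<close> and
    \<open>\<alpha>\<^sup>*\<close> have no eigenvalue in common.\<close>
  define G where "G = mat_adjoint V1 * V2 - mat_adjoint V2 * V1"
  have G: "G \<in> carrier_mat k k" "G \<noteq> 0\<^sub>m k k"
    using V ne diff_eq_0_imp_eq[of "mat_adjoint V1 * V2" "mat_adjoint V2 * V1" k k] by (auto simp: G_def)
  have d1: "mat_adjoint \<alpha> * mat_adjoint V1 = mat_adjoint V1 * mat_adjoint A + (- \<i>) \<cdot>\<^sub>m (mat_adjoint V2 * (B * mat_adjoint B))"
    using arg_cong[OF e1, of mat_adjoint] A B V \<alpha> by (simp add: adjoint_simps mult_assoc_dim)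
  have d2: "mat_adjoint \<alpha> * mat_adjoint V2 = \<i> \<cdot>\<^sub>m (mat_adjoint V1 * (mat_adjoint C * C)) + mat_adjoint V2 * A"
    using arg_cong[OF e2, of mat_adjoint] A B C V \<alpha> by (simp add: adjoint_simps mult_assoc_dim)
  have "mat_adjoint \<alpha> * G = mat_adjoint \<alpha> * mat_adjoint V1 * V2 - mat_adjoint \<alpha> * mat_adjoint V2 * V1"
    unfolding G_def using V \<alpha> by (simp add: mat_ring_simps)
  also have "\<dots> = mat_adjoint V1 * (V2 * \<alpha>) - mat_adjoint V2 * (V1 * \<alpha>)"
    unfolding d1 d2 e1 e2 using A B C V
    by (auto simp: mat_ring_simps intro!: eq_matI simp del: index_mult_mat(1))
  also have "\<dots> = G * \<alpha>"
    unfolding G_def using V \<alpha> by (simp add: mat_ring_simps)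
  finally have inter: "G * \<alpha> = mat_adjoint \<alpha> * G" ..
  obtain e w where e: "eigenvalue \<alpha> e" and w: "w \<in> carrier_mat k k" "G * w \<noteq> 0\<^sub>m k k"
    "mat_adjoint \<alpha> * (G * w) = e \<cdot>\<^sub>m (G * w)"
    by (rule intertwining_eigenvalue[OF \<alpha> _ G(1) inter G(2)]) (use \<alpha> in auto)
  have \<alpha>': "mat_adjoint \<alpha> \<in> carrier_mat k k" using \<alpha> by simp
  have "\<not> eigenvalue \<alpha> (cnj e)" using ev[OF _ e, of "cnj e"] by auto
  then have ne: "\<not> eigenvalue (mat_adjoint \<alpha>) e" using adjoint_eigenvalue[OF \<alpha>, of "cnj e"] by simp
  have Gw: "G * w \<in> carrier_mat k k" using G w by auto
  have "resolvent (mat_adjoint \<alpha>) e * 0\<^sub>m k k = G * w"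
    by (rule resolvent_unique[OF \<alpha>' ne Gw]) (use Gw in \<open>auto simp: w(3) intro!: eq_matI simp del: index_mult_mat(1)\<close>)
  with resolvent(1)[OF \<alpha>' ne] w show False by simp
qed

text \<open>For \<open>V1 x = 0\<close>, isotropy applied to \<open>x\<close> and
  \<open>\<alpha> x\<close> yields \<open>B\<^sup>* V2 x = 0\<close>. Then the kernel of
  \<open>V1\<close> is \<open>\<alpha>\<close>-invariant and \<open>V2\<close> carries
  \<open>\<alpha>\<close> on it to \<open>A\<^sup>*\<close>, so controllability forces
  \<open>V2 w = 0\<close>. The subspace is thus a graph over its first component.\<close>

lemma hamiltonian_graph:
  assumes A: "A \<in> carrier_mat n n" and B: "B \<in> carrier_mat n m" and C: "C \<in> carrier_mat p n"
    and ctrl: "observable n (mat_adjoint A) (mat_adjoint B)"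
    and V: "V1 \<in> carrier_mat n k" "V2 \<in> carrier_mat n k" and \<alpha>: "\<alpha> \<in> carrier_mat k k"
    and e1: "V1 * \<alpha> = A * V1 + \<i> \<cdot>\<^sub>m (B * (mat_adjoint B * V2))"
    and e2: "V2 * \<alpha> = (- \<i>) \<cdot>\<^sub>m (mat_adjoint C * (C * V1)) + mat_adjoint A * V2"
    and iso: "mat_adjoint V1 * V2 = mat_adjoint V2 * V1"
    and inj: "\<And>w. w \<in> carrier_mat k 1 \<Longrightarrow> V1 * w = 0\<^sub>m n 1 \<Longrightarrow> V2 * w = 0\<^sub>m n 1 \<Longrightarrow> w = 0\<^sub>m k 1"
    and w: "w \<in> carrier_mat k 1" and V1w: "V1 * w = 0\<^sub>m n 1"
  shows "w = 0\<^sub>m k 1"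
proof -
  have step: "mat_adjoint B * (V2 * x) = 0\<^sub>m m 1 \<and> V1 * (\<alpha> * x) = 0\<^sub>m n 1 \<and>
      V2 * (\<alpha> * x) = mat_adjoint A * (V2 * x)"
    if x: "x \<in> carrier_mat k 1" and 0: "V1 * x = 0\<^sub>m n 1" for x
  proof -
    have "V1 * \<alpha> * x = A * V1 * x + \<i> \<cdot>\<^sub>m (B * (mat_adjoint B * V2) * x)"
      unfolding e1 using A B V x by (simp add: add_mult_dim smult_mult_dim)
    then have "V1 * (\<alpha> * x) = A * (V1 * x) + \<i> \<cdot>\<^sub>m (B * (mat_adjoint B * (V2 * x)))"
      using A B V \<alpha> x by (simp add: mult_assoc_dim)
    then have 1: "V1 * (\<alpha> * x) = \<i> \<cdot>\<^sub>m (B * (mat_adjoint B * (V2 * x)))"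
      unfolding 0 using A B V x by simp
    have "V2 * \<alpha> * x = (- \<i>) \<cdot>\<^sub>m (mat_adjoint C * (C * V1) * x) + mat_adjoint A * V2 * x"
      unfolding e2 using A C V x by (simp add: add_mult_dim smult_mult_dim)
    then have "V2 * (\<alpha> * x) = (- \<i>) \<cdot>\<^sub>m (mat_adjoint C * (C * (V1 * x))) + mat_adjoint A * (V2 * x)"
      using A C V \<alpha> x by (simp add: mult_assoc_dim)
    then have 2: "V2 * (\<alpha> * x) = mat_adjoint A * (V2 * x)"
      unfolding 0 using A C V x by simp
    have V1x: "mat_adjoint x * mat_adjoint V1 = 0\<^sub>m 1 n"
      using arg_cong[OF 0, of mat_adjoint] V x by (simp add: adjoint_simps)
    have "mat_adjoint x * mat_adjoint V1 * V2 * (\<alpha> * x) = mat_adjoint x * (mat_adjoint V1 * V2) * (\<alpha> * x)"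
      using V x \<alpha> by (simp add: mult_assoc_dim)
    also have "\<dots> = mat_adjoint (V2 * x) * (V1 * (\<alpha> * x))"
      unfolding iso using V x \<alpha> by (simp add: mult_assoc_dim adjoint_simps)
    also have "\<dots> = \<i> \<cdot>\<^sub>m (mat_adjoint (mat_adjoint B * (V2 * x)) * (mat_adjoint B * (V2 * x)))"
      unfolding 1 using B V x by (simp add: mat_ring_simps adjoint_simps)
    finally have "\<i> \<cdot>\<^sub>m (mat_adjoint (mat_adjoint B * (V2 * x)) * (mat_adjoint B * (V2 * x))) = 0\<^sub>m 1 1"
      unfolding V1x using V x \<alpha> by simp
    then have "mat_adjoint (mat_adjoint B * (V2 * x)) * (mat_adjoint B * (V2 * x)) = 0\<^sub>m 1 1"
      using B V x by (auto simp: mat_eq_iff simp del: index_mult_mat(1))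
    then have 3: "mat_adjoint B * (V2 * x) = 0\<^sub>m m 1"
      using adjoint_mult_self_eq_0[of "mat_adjoint B * (V2 * x)"] B V x by simp
    with 1 2 B show ?thesis by simp
  qed
  have kry: "V1 * kry \<alpha> w i = 0\<^sub>m n 1 \<and> V2 * kry \<alpha> w i = kry (mat_adjoint A) (V2 * w) i" for i
  proof (induction i)
    case (Suc i)
    then show ?case using step[of "kry \<alpha> w i"] \<alpha> w by simp
  qed (use V1w in simp)
  have "V2 * w = 0\<^sub>m n 1"
  proof (rule observable_krylov[OF _ _ ctrl])
    fix i
    show "mat_adjoint B * kry (mat_adjoint A) (V2 * w) i = 0\<^sub>m m 1"
      using kry[of i] step[of "kry \<alpha> w i"] \<alpha> w by auto
  qed (use A B V w in auto)
  with inj[OF w V1w] show ?thesis by blast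
qed

text \<open>For \<open>X = V2 V1\<^sup>-\<^sup>1\<close> isotropy is hermiticity. The first block
  row says that the closed-loop matrix is similar to \<open>\<alpha>\<close>, and the second one
  then becomes the Riccati equation.\<close>

lemma riccati_from_graph:
  assumes A: "A \<in> carrier_mat n n" and B: "B \<in> carrier_mat n m" and C: "C \<in> carrier_mat p n"
    and V: "V1 \<in> carrier_mat n n" "V2 \<in> carrier_mat n n" and \<alpha>: "\<alpha> \<in> carrier_mat n n"
    and e1: "V1 * \<alpha> = A * V1 + \<i> \<cdot>\<^sub>m (B * (mat_adjoint B * V2))"
    and e2: "V2 * \<alpha> = (- \<i>) \<cdot>\<^sub>m (mat_adjoint C * (C * V1)) + mat_adjoint A * V2"
    and iso: "mat_adjoint V1 * V2 = mat_adjoint V2 * V1"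
    and W: "W \<in> carrier_mat n n" "V1 * W = 1\<^sub>m n" "W * V1 = 1\<^sub>m n"
  shows "mat_adjoint (V2 * W) = V2 * W" "riccati_eq A B C (V2 * W)"
    "\<And>e. eigenvalue (alpha_mat A B (V2 * W)) e \<Longrightarrow> eigenvalue \<alpha> e"
proof -
  let ?X = "V2 * W"
  have X: "?X \<in> carrier_mat n n" using V W by auto
  have adjW: "mat_adjoint W * mat_adjoint V1 = 1\<^sub>m n"
    using arg_cong[OF W(2), of mat_adjoint] V W(1) by (simp add: adjoint_simps)
  have "mat_adjoint ?X = mat_adjoint W * (mat_adjoint V2 * (V1 * W))"
    unfolding W(2) using V W by (simp add: adjoint_simps)
  also have "\<dots> = mat_adjoint W * (mat_adjoint V2 * V1) * W" using V W by (simp add: mult_assoc_dim)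
  also have "\<dots> = mat_adjoint W * mat_adjoint V1 * (V2 * W)"
    unfolding iso[symmetric] using V W by (simp add: mult_assoc_dim)
  finally show "mat_adjoint ?X = ?X" unfolding adjW using V W by simp
  have "alpha_mat A B ?X = A * (V1 * W) + \<i> \<cdot>\<^sub>m (B * (mat_adjoint B * (V2 * W)))"
    unfolding alpha_mat_eq(1)[OF A B X] W(2) using A by simp
  also have "\<dots> = (A * V1 + \<i> \<cdot>\<^sub>m (B * (mat_adjoint B * V2))) * W"
    using A B V W by (simp add: mat_ring_simps)
  finally have al: "alpha_mat A B ?X = V1 * \<alpha> * W" unfolding e1[symmetric] .
  have "?X * alpha_mat A B ?X = V2 * (W * V1) * \<alpha> * W"
    unfolding al using V W(1) \<alpha> by (simp add: mult_assoc_dim)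
  also have "\<dots> = ((- \<i>) \<cdot>\<^sub>m (mat_adjoint C * (C * V1)) + mat_adjoint A * V2) * W"
    unfolding W(3) e2[symmetric] using V by simp
  also have "\<dots> = (- \<i>) \<cdot>\<^sub>m (mat_adjoint C * (C * (V1 * W))) + mat_adjoint A * ?X"
    using A C V W by (simp add: mat_ring_simps)
  finally have "?X * alpha_mat A B ?X = (- \<i>) \<cdot>\<^sub>m (mat_adjoint C * C) + mat_adjoint A * ?X"
    unfolding W(2) using C by simp
  moreover have "?X * alpha_mat A B ?X = ?X * A + \<i> \<cdot>\<^sub>m (?X * (B * (mat_adjoint B * ?X)))"
    unfolding alpha_mat_eq(1)[OF A B X] using A B V W by (simp add: mat_ring_simps)
  ultimately have eq: "?X * A + \<i> \<cdot>\<^sub>m (?X * (B * (mat_adjoint B * ?X))) =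
      (- \<i>) \<cdot>\<^sub>m (mat_adjoint C * C) + mat_adjoint A * ?X" by simp
  show "riccati_eq A B C ?X"
    unfolding riccati_eq_iff[OF A B C X]
  proof (rule eq_matI)
    fix i j assume "i < dim_row (?X * A + (\<i> \<cdot>\<^sub>m (mat_adjoint C * C) + \<i> \<cdot>\<^sub>m (?X * (B * (mat_adjoint B * ?X)))))"
      "j < dim_col (?X * A + (\<i> \<cdot>\<^sub>m (mat_adjoint C * C) + \<i> \<cdot>\<^sub>m (?X * (B * (mat_adjoint B * ?X)))))"
    then have ij: "i < n" "j < n" using V W by auto
    show "(mat_adjoint A * ?X) $$ (i, j) =
      (?X * A + (\<i> \<cdot>\<^sub>m (mat_adjoint C * C) + \<i> \<cdot>\<^sub>m (?X * (B * (mat_adjoint B * ?X))))) $$ (i, j)"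
      using arg_cong[OF eq, of "\<lambda>M. M $$ (i, j)"] ij A B C V W
      by (simp add: algebra_simps del: index_mult_mat(1))
  qed (use A V W in auto)
  fix e assume "eigenvalue (alpha_mat A B ?X) e"
  then obtain v where v: "v \<in> carrier_mat n 1" "v \<noteq> 0\<^sub>m n 1" "alpha_mat A B ?X * v = e \<cdot>\<^sub>m v"
    using eigenvalue_iff[OF alpha_mat_eq(2)[OF A B X]] by blast
  have "\<alpha> * (W * v) = W * V1 * (\<alpha> * (W * v))" unfolding W(3) using V W v \<alpha> by simp
  also have "\<dots> = W * (V1 * \<alpha> * W * v)" using V W(1) \<alpha> v(1) by (simp add: mult_assoc_dim)
  also have "\<dots> = e \<cdot>\<^sub>m (W * v)" unfolding al[symmetric] v(3) using W v by (simp add: mult_smult_dim)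
  finally have "\<alpha> * (W * v) = e \<cdot>\<^sub>m (W * v)" .
  moreover have "W * v \<noteq> 0\<^sub>m n 1"
  proof
    assume 0: "W * v = 0\<^sub>m n 1"
    have "v = V1 * W * v" unfolding W(2) using v by simp
    also have "\<dots> = V1 * (W * v)" using V W(1) v(1) by (simp add: mult_assoc_dim)
    finally show False unfolding 0 using V v(2) by simp
  qed
  ultimately show "eigenvalue \<alpha> e"
    unfolding eigenvalue_iff[OF \<alpha>] using W v by (intro bexI[of _ "W * v"]) auto
qed

definition top_rows :: "nat \<Rightarrow> complex mat \<Rightarrow> complex mat" where
  "top_rows n V = mat n (dim_col V) (\<lambda>(i, j). V $$ (i, j))"

definition bottom_rows :: "nat \<Rightarrow> complex mat \<Rightarrow> complex mat" where
  "bottom_rows n V = mat n (dim_col V) (\<lambda>(i, j). V $$ (n + i, j))"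

lemma rows_carrier:
  assumes "V \<in> carrier_mat (n + n) k"
  shows "top_rows n V \<in> carrier_mat n k" "bottom_rows n V \<in> carrier_mat n k"
  using assms by (auto simp: top_rows_def bottom_rows_def)

lemma sum_double_index:
  fixes f :: "nat \<Rightarrow> complex"
  shows "(\<Sum>l = 0..<n + n. f l) = (\<Sum>l = 0..<n. f l) + (\<Sum>l = 0..<n. f (n + l))"
proof -
  have "(\<Sum>l = 0..<n + n. f l) = (\<Sum>l = 0..<n. f l) + (\<Sum>l = n..<n + n. f l)"
    by (rule sum.atLeastLessThan_concat[symmetric]) auto
  also have "(\<Sum>l = n..<n + n. f l) = (\<Sum>l = 0..<n. f (n + l))"
    using sum.shift_bounds_nat_ivl[of f 0 n n] by (simp add: add.commute)
  finally show ?thesis .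
qed

lemma four_block_mult_rows:
  fixes E F G H :: "complex mat"
  assumes c: "E \<in> carrier_mat n n" "F \<in> carrier_mat n n" "G \<in> carrier_mat n n" "H \<in> carrier_mat n n"
    and V: "V \<in> carrier_mat (n + n) k"
  shows "top_rows n (four_block_mat E F G H * V) = E * top_rows n V + F * bottom_rows n V"
    "bottom_rows n (four_block_mat E F G H * V) = G * top_rows n V + H * bottom_rows n V"
proof -
  let ?M = "four_block_mat E F G H"
  have M: "?M \<in> carrier_mat (n + n) (n + n)" using c by auto
  note R = rows_carrier[OF V]
  have *: "(K * top_rows n V + L * bottom_rows n V) $$ (i, j) =
      (\<Sum>l = 0..<n. K $$ (i, l) * V $$ (l, j)) + (\<Sum>l = 0..<n. L $$ (i, l) * V $$ (n + l, j))"
    if "K \<in> carrier_mat n n" "L \<in> carrier_mat n n" "i < n" "j < k" for K L i j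
    using that R V mult_entry[of i K j "top_rows n V"] mult_entry[of i L j "bottom_rows n V"]
    by (simp add: top_rows_def bottom_rows_def del: index_mult_mat(1))
  show "top_rows n (?M * V) = E * top_rows n V + F * bottom_rows n V"
  proof (rule eq_matI)
    fix i j assume "i < dim_row (E * top_rows n V + F * bottom_rows n V)"
      "j < dim_col (E * top_rows n V + F * bottom_rows n V)"
    then have ij: "i < n" "j < k" using c R by auto
    have "top_rows n (?M * V) $$ (i, j) = (?M * V) $$ (i, j)" using ij M V by (simp add: top_rows_def del: index_mult_mat(1))
    also have "\<dots> = (\<Sum>l = 0..<n + n. ?M $$ (i, l) * V $$ (l, j))"
      by (rule mult_entry[of i ?M j V, unfolded carrier_matD(1)[OF V]]) (use ij M V c in auto)
    also have "\<dots> = (E * top_rows n V + F * bottom_rows n V) $$ (i, j)"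
      unfolding *[OF c(1,2) ij] sum_double_index using c ij by simp
    finally show "top_rows n (?M * V) $$ (i, j) = (E * top_rows n V + F * bottom_rows n V) $$ (i, j)" .
  qed (use c V R in \<open>auto simp: top_rows_def\<close>)
  show "bottom_rows n (?M * V) = G * top_rows n V + H * bottom_rows n V"
  proof (rule eq_matI)
    fix i j assume "i < dim_row (G * top_rows n V + H * bottom_rows n V)"
      "j < dim_col (G * top_rows n V + H * bottom_rows n V)"
    then have ij: "i < n" "j < k" using c R by auto
    have "bottom_rows n (?M * V) $$ (i, j) = (?M * V) $$ (n + i, j)" using ij M V by (simp add: bottom_rows_def del: index_mult_mat(1))
    also have "\<dots> = (\<Sum>l = 0..<n + n. ?M $$ (n + i, l) * V $$ (l, j))"
      by (rule mult_entry[of "n + i" ?M j V, unfolded carrier_matD(1)[OF V]]) (use ij M V c in auto)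
    also have "\<dots> = (G * top_rows n V + H * bottom_rows n V) $$ (i, j)"
      unfolding *[OF c(3,4) ij] sum_double_index using c ij by simp
    finally show "bottom_rows n (?M * V) $$ (i, j) = (G * top_rows n V + H * bottom_rows n V) $$ (i, j)" .
  qed (use c V R in \<open>auto simp: bottom_rows_def\<close>)
qed

lemma rows_mult:
  assumes V: "V \<in> carrier_mat (n + n) k" and M: "M \<in> carrier_mat k l"
  shows "top_rows n (V * M) = top_rows n V * M" "bottom_rows n (V * M) = bottom_rows n V * M"
  using V M by (auto simp: top_rows_def bottom_rows_def mult_entry intro!: eq_matI simp del: index_mult_mat(1))

lemma rows_eq_0:
  assumes V: "V \<in> carrier_mat (n + n) k" and "top_rows n V = 0\<^sub>m n k" "bottom_rows n V = 0\<^sub>m n k"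
  shows "V = 0\<^sub>m (n + n) k"
proof (rule eq_matI)
  fix i j assume "i < dim_row (0\<^sub>m (n + n) k :: complex mat)" "j < dim_col (0\<^sub>m (n + n) k :: complex mat)"
  then have ij: "i < n + n" "j < k" by auto
  show "V $$ (i, j) = 0\<^sub>m (n + n) k $$ (i, j)"
  proof (cases "i < n")
    case True
    with arg_cong[OF assms(2), of "\<lambda>M. M $$ (i, j)"] ij V show ?thesis by (simp add: top_rows_def)
  next
    case False
    with arg_cong[OF assms(3), of "\<lambda>M. M $$ (i - n, j)"] ij V show ?thesis by (simp add: bottom_rows_def)
  qed
qed (use V in auto)

text \<open>The hypothesis \<open>strict\<close> says that 1 is not an eigenvalue of
  \<open>G\<^sup>* G\<close> for the value \<open>G\<close> of the transfer function at a real
  point, which keeps the spectrum of \<open>H\<close> off the axis. The spectral subspaces for both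
  half-planes are graphs, so each has dimension at most \<open>n\<close>; as the dimensions add up
  to \<open>n + n\<close>, both equal \<open>n\<close>. This takes the place of a count of
  multiplicities in the symmetric spectrum.\<close>

lemma riccati_strict:
  assumes A: "A \<in> carrier_mat n n" and B: "B \<in> carrier_mat n m" and C: "C \<in> carrier_mat p n"
    and ctrl: "observable n (mat_adjoint A) (mat_adjoint B)"
    and real: "\<And>t. Im t = 0 \<Longrightarrow> \<not> eigenvalue A t"
    and strict: "\<And>t b. Im t = 0 \<Longrightarrow> b \<in> carrier_mat m 1 \<Longrightarrow>
      b = mat_adjoint (C * (resolvent A t * B)) * (C * (resolvent A t * B) * b) \<Longrightarrow> b = 0\<^sub>m m 1"
  obtains X where "X \<in> carrier_mat n n" "mat_adjoint X = X" "riccati_eq A B C X"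
    "\<And>e. eigenvalue (alpha_mat A B X) e \<Longrightarrow> Im e < 0"
proof -
  define H where "H = four_block_mat A (\<i> \<cdot>\<^sub>m (B * mat_adjoint B)) ((- \<i>) \<cdot>\<^sub>m (mat_adjoint C * C)) (mat_adjoint A)"
  have blocks: "A \<in> carrier_mat n n" "\<i> \<cdot>\<^sub>m (B * mat_adjoint B) \<in> carrier_mat n n"
    "(- \<i>) \<cdot>\<^sub>m (mat_adjoint C * C) \<in> carrier_mat n n" "mat_adjoint A \<in> carrier_mat n n" using A B C by auto
  have H: "H \<in> carrier_mat (n + n) (n + n)" using blocks by (simp add: H_def)
  have Hrows: "A * top_rows n V + \<i> \<cdot>\<^sub>m (B * (mat_adjoint B * bottom_rows n V)) = top_rows n V * M"
      "(- \<i>) \<cdot>\<^sub>m (mat_adjoint C * (C * top_rows n V)) + mat_adjoint A * bottom_rows n V = bottom_rows n V * M"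
    if V: "V \<in> carrier_mat (n + n) k" and M: "M \<in> carrier_mat k k" and HV: "H * V = V * M" for V M k
  proof -
    note R = rows_carrier[OF V]
    show "A * top_rows n V + \<i> \<cdot>\<^sub>m (B * (mat_adjoint B * bottom_rows n V)) = top_rows n V * M"
      unfolding rows_mult(1)[OF V M, symmetric] HV[symmetric] H_def four_block_mult_rows(1)[OF blocks V]
      using A B R by (simp add: smult_mult_dim mult_assoc_dim)
    show "(- \<i>) \<cdot>\<^sub>m (mat_adjoint C * (C * top_rows n V)) + mat_adjoint A * bottom_rows n V = bottom_rows n V * M"
      unfolding rows_mult(2)[OF V M, symmetric] HV[symmetric] H_def four_block_mult_rows(2)[OF blocks V]
      using A C R by (simp add: smult_mult_dim mult_assoc_dim)
  qed
  \<comment> \<open>At a real \<open>t\<close> both components of an eigenvector are expressed by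
    resolvents through \<open>b = B\<^sup>* y\<close>, and eliminating them leaves
    \<open>b = G\<^sup>* G b\<close>.\<close>
  have nr: "Im t \<noteq> 0" if ev: "eigenvalue H t" for t
  proof
    assume t: "Im t = 0"
    then have ct: "cnj t = t" by (simp add: complex_eq_iff)
    obtain v where v: "v \<in> carrier_mat (n + n) 1" "v \<noteq> 0\<^sub>m (n + n) 1" "H * v = t \<cdot>\<^sub>m v"
      using ev eigenvalue_iff[OF H] by blast
    have "H * v = v * (t \<cdot>\<^sub>m 1\<^sub>m 1)" using v by (simp add: mult_smult_dim)
    note E = Hrows[OF v(1) _ this]
    define x y where "x = top_rows n v" and "y = bottom_rows n v"
    have xy: "x \<in> carrier_mat n 1" "y \<in> carrier_mat n 1" using rows_carrier[OF v(1)] by (auto simp: x_def y_def)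
    have E1: "A * x + \<i> \<cdot>\<^sub>m (B * (mat_adjoint B * y)) = t \<cdot>\<^sub>m x"
      and E2: "(- \<i>) \<cdot>\<^sub>m (mat_adjoint C * (C * x)) + mat_adjoint A * y = t \<cdot>\<^sub>m y"
      using E xy by (simp_all add: x_def[symmetric] y_def[symmetric] mult_smult_dim)
    note nt = real[OF t]
    have nt': "\<not> eigenvalue (mat_adjoint A) t" using adjoint_eigenvalue[OF A, of t] nt ct by simp
    note Rt = resolvent(1)[OF A nt]
    have Radj: "resolvent (mat_adjoint A) t = mat_adjoint (resolvent A t)"
      using resolvent_adjoint[OF A nt] ct by simp
    define b where "b = mat_adjoint B * y"
    have b: "b \<in> carrier_mat m 1" using B xy by (simp add: b_def)
    have x: "x = resolvent A t * (\<i> \<cdot>\<^sub>m (B * b))"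
      by (rule resolvent_unique[OF A nt xy(1), symmetric])
        (use A B b xy in \<open>auto simp: E1[symmetric] b_def[symmetric] intro!: eq_matI simp del: index_mult_mat(1)\<close>)
    have y: "y = mat_adjoint (resolvent A t) * ((- \<i>) \<cdot>\<^sub>m (mat_adjoint C * (C * x)))"
      unfolding Radj[symmetric]
      by (rule resolvent_unique[OF blocks(4) nt' xy(2), symmetric])
        (use A C xy in \<open>auto simp: E2[symmetric] intro!: eq_matI simp del: index_mult_mat(1)\<close>)
    have Cx: "C * x = \<i> \<cdot>\<^sub>m (C * (resolvent A t * B) * b)"
      unfolding x using B C Rt b by (simp add: mat_ring_simps)
    have "b = mat_adjoint B * (mat_adjoint (resolvent A t) * ((- \<i>) \<cdot>\<^sub>m (mat_adjoint C * (C * x))))"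
      unfolding y[symmetric] b_def ..
    also have "\<dots> = mat_adjoint (C * (resolvent A t * B)) * (C * (resolvent A t * B) * b)"
      unfolding Cx using B C Rt b by (simp add: mat_ring_simps adjoint_simps)
    finally have b0: "b = 0\<^sub>m m 1" by (rule strict[OF t b])
    have "x = 0\<^sub>m n 1" unfolding x b0 using B Rt by simp
    moreover from this have "y = 0\<^sub>m n 1" using y C Rt by simp
    ultimately have "v = 0\<^sub>m (n + n) 1" unfolding x_def y_def by (rule rows_eq_0[OF v(1)])
    with v(2) show False by simp
  qed
  obtain es where es: "char_poly H = (\<Prod>e\<leftarrow>es. [:- e, 1:])" "length es = n + n"
    using char_poly_factorized[OF H] by blast
  have esroot: "eigenvalue H e" if "e \<in> set es" for e
    using that eigenvalue_root_char_poly[OF H] by (simp add: es(1) linear_poly_root)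
  define lo hi where "lo = filter (\<lambda>e. Im e < 0) es" and "hi = filter (\<lambda>e. \<not> Im e < 0) es"
  have len: "length lo + length hi = n + n"
    unfolding lo_def hi_def using es(2) by (simp add: sum_length_filter_compl)
  have cp1: "char_poly H = (\<Prod>e\<leftarrow>lo @ hi. [:- e, 1:])"
    unfolding es(1) lo_def hi_def by (rule prod_list_filter[symmetric])
  then have cp2: "char_poly H = (\<Prod>e\<leftarrow>hi @ lo. [:- e, 1:])" by (simp add: mult.commute)
  have graph: "\<exists>V1 V2 \<alpha>. V1 \<in> carrier_mat n (length l) \<and> V2 \<in> carrier_mat n (length l) \<and> \<alpha> \<in> carrier_mat (length l) (length l) \<and>
      V1 * \<alpha> = A * V1 + \<i> \<cdot>\<^sub>m (B * (mat_adjoint B * V2)) \<and>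
      V2 * \<alpha> = (- \<i>) \<cdot>\<^sub>m (mat_adjoint C * (C * V1)) + mat_adjoint A * V2 \<and>
      mat_adjoint V1 * V2 = mat_adjoint V2 * V1 \<and>
      (\<forall>w \<in> carrier_mat (length l) 1. V1 * w = 0\<^sub>m n 1 \<longrightarrow> w = 0\<^sub>m (length l) 1) \<and>
      (\<forall>e. eigenvalue \<alpha> e \<longrightarrow> e \<in> set l)"
    if cp: "char_poly H = (\<Prod>e\<leftarrow>l @ l'. [:- e, 1:])" and sep: "\<forall>e \<in> set l. \<forall>f \<in> set l. e \<noteq> cnj f" for l l'
  proof -
    define k where "k = length l"
    obtain V L \<alpha> where V: "V \<in> carrier_mat (n + n) k" "L \<in> carrier_mat k (n + n)" "\<alpha> \<in> carrier_mat k k"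
      "L * V = 1\<^sub>m k" "H * V = V * \<alpha>" "\<And>e. eigenvalue \<alpha> e \<Longrightarrow> e \<in> set l"
      unfolding k_def by (rule leading_invariant_subspace[OF H cp]) blast
    define V1 V2 where "V1 = top_rows n V" and "V2 = bottom_rows n V"
    have c: "V1 \<in> carrier_mat n k" "V2 \<in> carrier_mat n k" using rows_carrier[OF V(1)] by (auto simp: V1_def V2_def)
    note e12 = Hrows[OF V(1,3,5), symmetric, folded V1_def V2_def]
    have iso: "mat_adjoint V1 * V2 = mat_adjoint V2 * V1"
      by (rule hamiltonian_isotropic[OF A B C c V(3) e12]) (use V(6) sep in blast)
    have inj: "w = 0\<^sub>m k 1" if w: "w \<in> carrier_mat k 1" "V1 * w = 0\<^sub>m n 1" "V2 * w = 0\<^sub>m n 1" for w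
    proof -
      have "V * w = 0\<^sub>m (n + n) 1"
        by (rule rows_eq_0) (use w V rows_mult[OF V(1) w(1)] in \<open>auto simp: V1_def V2_def\<close>)
      then have "L * (V * w) = 0\<^sub>m k 1" using V by simp
      moreover have "L * (V * w) = L * V * w" using V(1,2) w(1) by (simp add: mult_assoc_dim)
      ultimately show ?thesis unfolding V(4) using w by simp
    qed
    have "\<forall>w \<in> carrier_mat k 1. V1 * w = 0\<^sub>m n 1 \<longrightarrow> w = 0\<^sub>m k 1"
      using hamiltonian_graph[OF A B C ctrl c V(3) e12 iso inj] by blast
    then show ?thesis using c V(3,6) e12 iso unfolding k_def by blast
  qed
  obtain V1 V2 \<alpha> where V: "V1 \<in> carrier_mat n (length lo)" "V2 \<in> carrier_mat n (length lo)"
    "\<alpha> \<in> carrier_mat (length lo) (length lo)"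
    "V1 * \<alpha> = A * V1 + \<i> \<cdot>\<^sub>m (B * (mat_adjoint B * V2))"
    "V2 * \<alpha> = (- \<i>) \<cdot>\<^sub>m (mat_adjoint C * (C * V1)) + mat_adjoint A * V2"
    "mat_adjoint V1 * V2 = mat_adjoint V2 * V1"
    "\<And>w. w \<in> carrier_mat (length lo) 1 \<Longrightarrow> V1 * w = 0\<^sub>m n 1 \<Longrightarrow> w = 0\<^sub>m (length lo) 1"
    "\<And>e. eigenvalue \<alpha> e \<Longrightarrow> e \<in> set lo"
  proof -
    have "\<forall>e \<in> set lo. \<forall>f \<in> set lo. e \<noteq> cnj f"
      unfolding lo_def by fastforce
    from graph[OF cp1 this] show ?thesis
      by (elim exE conjE) (rule that; blast)
  qed
  \<comment> \<open>The subspace for the upper half-plane serves only to bound its dimension by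
    \<open>n\<close>.\<close>
  obtain V1' :: "complex mat" where V': "V1' \<in> carrier_mat n (length hi)"
    "\<And>w. w \<in> carrier_mat (length hi) 1 \<Longrightarrow> V1' * w = 0\<^sub>m n 1 \<Longrightarrow> w = 0\<^sub>m (length hi) 1"
  proof -
    have "\<forall>e \<in> set hi. \<forall>f \<in> set hi. e \<noteq> cnj f"
    proof (intro ballI notI)
      fix e f assume ef: "e \<in> set hi" "f \<in> set hi" "e = cnj f"
      then have "0 \<le> Im e" "0 \<le> Im f" "Im e \<noteq> 0" using nr esroot by (auto simp: hi_def)
      with ef(3) show False by simp
    qed
    from graph[OF cp2 this] show ?thesis
    proof (elim exE conjE)
      fix V1' :: "complex mat" assume "V1' \<in> carrier_mat n (length hi)"
        "\<forall>w \<in> carrier_mat (length hi) 1. V1' * w = 0\<^sub>m n 1 \<longrightarrow> w = 0\<^sub>m (length hi) 1"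
      then show ?thesis using that by blast
    qed
  qed
  have "length lo \<le> n" by (rule injective_imp_le[OF V(1,7)])
  moreover have "length hi \<le> n" by (rule injective_imp_le[OF V'])
  ultimately have ll: "length lo = n" using len by simp
  note V = V[unfolded ll]
  obtain W where W: "W \<in> carrier_mat n n" "V1 * W = 1\<^sub>m n" "W * V1 = 1\<^sub>m n"
    by (rule injective_imp_inverse[OF V(1,7)])
  show ?thesis
  proof (rule that[of "V2 * W"])
    show "V2 * W \<in> carrier_mat n n" using V W by auto
    note G = riccati_from_graph[OF A B C V(1-6) W]
    show "mat_adjoint (V2 * W) = V2 * W" "riccati_eq A B C (V2 * W)" by (rule G)+
    fix e assume "eigenvalue (alpha_mat A B (V2 * W)) e"
    with G(3) V(8) have "e \<in> set lo" by blast
    then show "Im e < 0" by (simp add: lo_def)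
  qed
qed

section \<open>Compactness and passage to the limit in the Riccati equation\<close>

lemma bounded_real_subsequence:
  fixes f :: "nat \<Rightarrow> real"
  assumes "\<And>k. \<bar>f k\<bar> \<le> K"
  obtains r l where "strict_mono (r :: nat \<Rightarrow> nat)" "(\<lambda>k. f (r k)) \<longlonglongrightarrow> l"
proof -
  obtain r where r: "strict_mono (r :: nat \<Rightarrow> nat)" "monoseq (\<lambda>k. f (r k))"
    using seq_monosub[of f] by blast
  have "Bseq (\<lambda>k. f (r k))" using assms by (intro BseqI'[of _ K]) auto
  then have "convergent (\<lambda>k. f (r k))" using r(2) by (rule Bseq_monoseq_convergent)
  then show ?thesis using that[OF r(1)] unfolding convergent_def by blast
qed

lemma bounded_complex_subsequence:
  fixes f :: "nat \<Rightarrow> complex"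
  assumes "\<And>k. cmod (f k) \<le> K"
  obtains r l where "strict_mono (r :: nat \<Rightarrow> nat)" "(\<lambda>k. f (r k)) \<longlonglongrightarrow> l"
proof -
  have "\<bar>Re (f k)\<bar> \<le> K" for k using abs_Re_le_cmod assms by (rule order_trans)
  then obtain r a where r: "strict_mono (r :: nat \<Rightarrow> nat)" "(\<lambda>k. Re (f (r k))) \<longlonglongrightarrow> a"
    by (rule bounded_real_subsequence)
  have "\<bar>Im (f (r k))\<bar> \<le> K" for k using abs_Im_le_cmod assms by (rule order_trans)
  then obtain s b where s: "strict_mono (s :: nat \<Rightarrow> nat)" "(\<lambda>k. Im (f (r (s k)))) \<longlonglongrightarrow> b"
    by (rule bounded_real_subsequence)
  have "(\<lambda>k. Re (f (r (s k)))) \<longlonglongrightarrow> a"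
    using LIMSEQ_subseq_LIMSEQ[OF r(2) s(1)] by (simp add: o_def)
  with s(2) have "(\<lambda>k. Complex (Re (f (r (s k)))) (Im (f (r (s k))))) \<longlonglongrightarrow> Complex a b"
    by (intro tendsto_Complex)
  then show ?thesis using that[of "r \<circ> s"] r(1) s(1) by (simp add: strict_mono_o)
qed

lemma bounded_family_subsequence:
  fixes f :: "nat \<Rightarrow> 'i \<Rightarrow> complex"
  assumes "finite I" "\<And>k i. i \<in> I \<Longrightarrow> cmod (f k i) \<le> K"
  shows "\<exists>r L. strict_mono (r :: nat \<Rightarrow> nat) \<and> (\<forall>i\<in>I. (\<lambda>k. f (r k) i) \<longlonglongrightarrow> L i)"
  using assms
proof (induction I)
  case empty
  then show ?case by (intro exI[of _ id]) (auto simp: strict_mono_def)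
next
  case (insert x I)
  then obtain r L where r: "strict_mono (r :: nat \<Rightarrow> nat)" "\<forall>i\<in>I. (\<lambda>k. f (r k) i) \<longlonglongrightarrow> L i" by auto
  have "cmod (f (r k) x) \<le> K" for k using insert.prems by simp
  then obtain s l where s: "strict_mono (s :: nat \<Rightarrow> nat)" "(\<lambda>k. f (r (s k)) x) \<longlonglongrightarrow> l"
    by (rule bounded_complex_subsequence)
  have "(\<lambda>k. f (r (s k)) i) \<longlonglongrightarrow> L i" if "i \<in> I" for i
    using LIMSEQ_subseq_LIMSEQ[OF r(2)[rule_format, OF that] s(1)] by (simp add: o_def)
  moreover have "strict_mono (\<lambda>k. r (s k))" using strict_mono_o[OF r(1) s(1)] by (simp add: o_def)
  ultimately show ?case using s(2) insert.hyps
    by (intro exI[of _ "\<lambda>k. r (s k)"] exI[of _ "L(x := l)"]) auto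
qed

lemma bounded_mat_subsequence:
  assumes M: "\<And>k. M k \<in> carrier_mat n m" and bd: "\<And>k. mnorm (M k) \<le> K"
  obtains r L where "strict_mono (r :: nat \<Rightarrow> nat)" "L \<in> carrier_mat n m"
    "mat_tendsto (\<lambda>k. M (r k)) L sequentially"
proof -
  have "\<exists>r L. strict_mono (r :: nat \<Rightarrow> nat) \<and>
      (\<forall>i\<in>{..<n} \<times> {..<m}. (\<lambda>k. M (r k) $$ i) \<longlonglongrightarrow> L i)"
  proof (rule bounded_family_subsequence)
    fix k i assume "i \<in> {..<n} \<times> {..<m}"
    then obtain a b where "i = (a, b)" "a < n" "b < m" by auto
    then show "cmod (M k $$ i) \<le> K"
      using entry_le_mnorm[of a "M k" b] M[of k] bd[of k] by auto
  qed simp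
  then obtain r L where "strict_mono (r :: nat \<Rightarrow> nat)"
    "\<forall>i\<in>{..<n} \<times> {..<m}. (\<lambda>k. M (r k) $$ i) \<longlonglongrightarrow> L i" by blast
  then show ?thesis
    by (intro that[of r "mat n m L"]) (auto simp: mat_tendsto_def carrier_matD[OF M])
qed

lemma mnorm_tendsto:
  assumes M: "mat_tendsto M L F"
  shows "((\<lambda>x. mnorm (M x)) \<longlongrightarrow> mnorm L) F"
proof -
  have "((\<lambda>x. \<Sum>i<dim_row L. \<Sum>j<dim_col L. cmod (M x $$ (i, j))) \<longlongrightarrow> mnorm L) F"
    unfolding mnorm_def by (intro tendsto_sum tendsto_norm mat_tendsto_entry[OF M]) auto
  moreover have "eventually (\<lambda>x. (\<Sum>i<dim_row L. \<Sum>j<dim_col L. cmod (M x $$ (i, j))) = mnorm (M x)) F"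
    using mat_tendsto_dim[OF M] by (rule eventually_mono) (simp add: mnorm_def)
  ultimately show ?thesis by (rule Lim_transform_eventually)
qed

text \<open>For \<open>e\<close> above the axis every root \<open>a\<close> of the approximating
  characteristic polynomials has \<open>cmod (e - a) \<ge> Im e\<close>. Their values at
  \<open>e\<close> thus stay away from zero, whereas they converge to the value of the limit
  polynomial, which is zero at an eigenvalue. No continuity of single eigenvalues enters.\<close>

lemma eigenvalue_limit_lower:
  assumes M: "\<And>k. M k \<in> carrier_mat n n" and L: "L \<in> carrier_mat n n"
    and lim: "mat_tendsto M L sequentially"
    and ev: "\<And>k e. eigenvalue (M k) e \<Longrightarrow> Im e \<le> 0"
    and e: "eigenvalue L e"
  shows "Im e \<le> 0"
proof (rule ccontr)
  assume pos: "\<not> Im e \<le> 0"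
  have detlim: "(\<lambda>k. det (N k)) \<longlonglongrightarrow> det K"
    if N: "\<And>k. N k \<in> carrier_mat n n" "K \<in> carrier_mat n n" "mat_tendsto N K sequentially" for N K
    unfolding det_def'[OF N(1)] det_def'[OF N(2)] using N(2)
    by (intro tendsto_sum tendsto_mult tendsto_const tendsto_prod mat_tendsto_entry[OF N(3)])
      (auto dest: permutes_in_image)
  have cp: "poly (char_poly N) e = det (e \<cdot>\<^sub>m 1\<^sub>m n + (-1) \<cdot>\<^sub>m N)" if N: "N \<in> carrier_mat n n" for N :: "complex mat"
    unfolding char_poly_def by (rule poly_det_cong[of _ n]) (use N in \<open>auto simp: char_poly_matrix_def\<close>)
  have "(\<lambda>k. poly (char_poly (M k)) e) \<longlonglongrightarrow> poly (char_poly L) e"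
    unfolding cp[OF M] cp[OF L]
    by (rule detlim) (use M L in \<open>auto intro!: mat_tendsto_add mat_tendsto_smult mat_tendsto_const lim\<close>)
  moreover have "poly (char_poly L) e = 0" using e eigenvalue_root_char_poly[OF L] by simp
  moreover have "(Im e) ^ n \<le> cmod (poly (char_poly (M k)) e)" for k
  proof -
    obtain es where es: "char_poly (M k) = (\<Prod>a\<leftarrow>es. [:- a, 1:])" "length es = n"
      using char_poly_factorized[OF M] by blast
    have "\<forall>a \<in> set es. Im a \<le> 0"
      using ev[of k] eigenvalue_root_char_poly[OF M] by (simp add: es(1) linear_poly_root)
    then have "(Im e) ^ length es \<le> cmod (poly (\<Prod>a\<leftarrow>es. [:- a, 1:]) e)"
    proof (induction es)
      case (Cons a es)
      have "Im e \<le> Im (e - a)" using Cons.prems by simp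
      also have "\<dots> \<le> cmod (e - a)" using abs_Im_le_cmod[of "e - a"] by simp
      finally have "Im e * Im e ^ length es \<le> cmod (e - a) * cmod (poly (\<Prod>a\<leftarrow>es. [:- a, 1:]) e)"
        using Cons pos by (intro mult_mono) auto
      then show ?case by (simp add: norm_mult[symmetric] algebra_simps)
    qed simp
    then show ?thesis using es by simp
  qed
  ultimately have "(Im e) ^ n \<le> cmod 0"
    by (intro tendsto_lowerbound[OF tendsto_norm, where F = sequentially]) auto
  moreover have "0 < (Im e) ^ n" using pos by simp
  ultimately show False by simp
qed

lemma columns_eq_0:
  fixes M :: "complex mat"
  assumes M: "M \<in> carrier_mat n m" and 0: "\<And>e. e \<in> carrier_mat m 1 \<Longrightarrow> M * e = 0\<^sub>m n 1"
  shows "M = 0\<^sub>m n m"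
proof (rule ccontr)
  assume ne: "M \<noteq> 0\<^sub>m n m"
  have "\<not> (\<forall>i<n. \<forall>j<m. M $$ (i, j) = 0)"
  proof
    assume "\<forall>i<n. \<forall>j<m. M $$ (i, j) = 0"
    then have "M = 0\<^sub>m n m" using M by (intro eq_matI) auto
    with ne show False by simp
  qed
  then obtain i j where ij: "i < n" "j < m" "M $$ (i, j) \<noteq> 0" by blast
  define e :: "complex mat" where "e = mat m 1 (\<lambda>(l, _). if l = j then 1 else 0)"
  have e: "e \<in> carrier_mat m 1" by (simp add: e_def)
  have "(M * e) $$ (i, 0) = (\<Sum>l = 0..<m. M $$ (i, l) * e $$ (l, 0))"
    using mult_entry[of i M 0 e] M e ij by simp
  also have "\<dots> = (\<Sum>l = 0..<m. if l = j then M $$ (i, l) else 0)" by (rule sum.cong) (auto simp: e_def)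
  also have "\<dots> = M $$ (i, j)" using ij by simp
  finally show False unfolding 0[OF e] using ij by simp
qed

text \<open>Evaluated at \<open>v - \<epsilon> Q v\<close>, the form equals
  \<open>- 2 \<epsilon> a + \<epsilon>\<^sup>2 b\<close>, where \<open>a\<close> is the squared norm
  of \<open>Q v\<close>. Nonnegativity for small \<open>\<epsilon>\<close> leaves only
  \<open>a = 0\<close>.\<close>

lemma psd_kernel:
  fixes Q :: "complex mat"
  assumes Q: "Q \<in> carrier_mat n n" "mat_adjoint Q = Q"
    and psd: "\<And>v. v \<in> carrier_mat n 1 \<Longrightarrow> 0 \<le> (mat_adjoint v * (Q * v)) $$ (0, 0)"
    and v: "v \<in> carrier_mat n 1" and 0: "mat_adjoint v * (Q * v) = 0\<^sub>m 1 1"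
  shows "Q * v = 0\<^sub>m n 1"
proof -
  define u where "u = Q * v"
  have u: "u \<in> carrier_mat n 1" using Q v by (auto simp: u_def)
  define a b where "a = Re ((mat_adjoint u * u) $$ (0, 0))" and "b = Re ((mat_adjoint u * (Q * u)) $$ (0, 0))"
  have ab: "0 \<le> a" "0 \<le> b"
    using adjoint_mult_self_nonneg[of 0 u] psd[OF u] u unfolding a_def b_def by (auto simp: less_eq_complex_def)
  have form: "0 \<le> - 2 * \<epsilon> * a + \<epsilon> ^ 2 * b" for \<epsilon> :: real
  proof -
    let ?e = "complex_of_real (- \<epsilon>)"
    have uv: "mat_adjoint v * (Q * u) = mat_adjoint u * u"
      using Q v u unfolding u_def by (simp add: adjoint_simps mult_assoc_dim)
    have "mat_adjoint (v + ?e \<cdot>\<^sub>m u) * (Q * (v + ?e \<cdot>\<^sub>m u)) =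
        mat_adjoint v * (Q * v) + ?e \<cdot>\<^sub>m (mat_adjoint v * (Q * u)) + ?e \<cdot>\<^sub>m (mat_adjoint u * (Q * v)) +
        (?e * ?e) \<cdot>\<^sub>m (mat_adjoint u * (Q * u))"
      using Q(1) v u
      by (auto simp: adjoint_simps mat_ring_simps algebra_simps intro!: eq_matI simp del: index_mult_mat(1))
    also have "\<dots> = ?e \<cdot>\<^sub>m (mat_adjoint u * u) + ?e \<cdot>\<^sub>m (mat_adjoint u * u) + (?e * ?e) \<cdot>\<^sub>m (mat_adjoint u * (Q * u))"
      unfolding 0 uv unfolding u_def[symmetric] using u Q(1) by simp
    finally have eq: "mat_adjoint (v + ?e \<cdot>\<^sub>m u) * (Q * (v + ?e \<cdot>\<^sub>m u)) =
      ?e \<cdot>\<^sub>m (mat_adjoint u * u) + ?e \<cdot>\<^sub>m (mat_adjoint u * u) + (?e * ?e) \<cdot>\<^sub>m (mat_adjoint u * (Q * u))" .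
    have "0 \<le> Re ((mat_adjoint (v + ?e \<cdot>\<^sub>m u) * (Q * (v + ?e \<cdot>\<^sub>m u))) $$ (0, 0))"
      using psd[of "v + ?e \<cdot>\<^sub>m u"] u v by (simp add: less_eq_complex_def del: index_mult_mat(1))
    also have "\<dots> = - 2 * \<epsilon> * a + \<epsilon> ^ 2 * b"
      unfolding eq a_def b_def using u Q by (simp add: power2_eq_square del: index_mult_mat(1))
    finally show ?thesis .
  qed
  have "a = 0"
  proof (rule ccontr)
    assume "a \<noteq> 0"
    with ab have a: "0 < a" by simp
    \<comment> \<open>This choice makes \<open>?e * b < a\<close>, so the linear term outweighs the
      quadratic one; the 1 covers \<open>b = 0\<close>.\<close>
    let ?e = "a / (b + 1)"
    have e: "0 < ?e" using a ab by simp
    have "?e * b < a" using a ab by (simp add: field_simps)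
    then have "?e * (?e * b) < ?e * (2 * a)" using e a by (intro mult_strict_left_mono) auto
    with form[of ?e] show False by (simp add: power2_eq_square mult.assoc mult.commute mult.left_commute)
  qed
  have "mat_adjoint u * u = 0\<^sub>m 1 1"
  proof (rule eq_matI)
    fix i j assume "i < dim_row (0\<^sub>m 1 1 :: complex mat)" "j < dim_col (0\<^sub>m 1 1 :: complex mat)"
    then have "i = 0" "j = 0" by auto
    moreover have "(mat_adjoint u * u) $$ (0, 0) = 0"
      using \<open>a = 0\<close> adjoint_mult_self_nonneg[of 0 u] u unfolding a_def
      by (simp add: less_eq_complex_def complex_eq_iff)
    ultimately show "(mat_adjoint u * u) $$ (i, j) = 0\<^sub>m 1 1 $$ (i, j)" by simp
  qed (use u in auto)
  then show ?thesis using adjoint_mult_self_eq_0[of u] u by (simp add: u_def)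
qed

lemma kry_mult_right:
  assumes "A \<in> carrier_mat n n" "B \<in> carrier_mat n m" "E \<in> carrier_mat m q"
  shows "kry A (B * E) k = kry A B k * E"
  using assms by (induction k) (auto simp: mult_assoc_dim)

text \<open>If solutions were unbounded, a limit \<open>Y\<close> of normalized solutions would satisfy \<open>Y B = 0\<close> and
  \<open>i (Y A - A\<^sup>* Y) \<ge> 0\<close>; then the kernel of \<open>Y\<close> is \<open>A\<close>-invariant and controllability gives \<open>Y = 0\<close>.\<close>

lemma riccati_solutions_bounded:
  fixes c :: "nat \<Rightarrow> real"
  assumes A: "A \<in> carrier_mat n n" and B: "B \<in> carrier_mat n m" and C: "C \<in> carrier_mat p n"
    and ctrl: "observable n (mat_adjoint A) (mat_adjoint B)"
    and X: "\<And>k. X k \<in> carrier_mat n n" "\<And>k. mat_adjoint (X k) = X k"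
    and ric: "\<And>k. mat_adjoint A * X k = X k * A + ((\<i> * complex_of_real (c k)) \<cdot>\<^sub>m (mat_adjoint C * C) +
      \<i> \<cdot>\<^sub>m (X k * (B * (mat_adjoint B * X k))))"
    and c: "\<And>k. 0 \<le> c k" "\<And>k. c k \<le> 1"
  shows "\<exists>K. \<forall>k. mnorm (X k) \<le> K"
proof (rule ccontr)
  assume "\<not> (\<exists>K. \<forall>k. mnorm (X k) \<le> K)"
  then have "\<forall>j. \<exists>k. real (Suc j) < mnorm (X k)" by (meson not_le)
  then obtain g where g: "\<And>j. real (Suc j) < mnorm (X (g j))" by metis
  define x where "x j = mnorm (X (g j))" for j
  have x: "real (Suc j) < x j" for j using g by (simp add: x_def)
  have x0: "0 < x j" for j using x[of j] by linarith
  define Y where "Y j = complex_of_real (1 / x j) \<cdot>\<^sub>m X (g j)" for j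
  have Y: "Y j \<in> carrier_mat n n" "mat_adjoint (Y j) = Y j" for j
    using X by (auto simp: Y_def adjoint_smult)
  have Y1: "mnorm (Y j) = 1" for j using x0[of j] unfolding Y_def mnorm_smult by (simp add: x_def norm_divide)
  obtain r Z where r: "strict_mono (r :: nat \<Rightarrow> nat)" and Z: "Z \<in> carrier_mat n n"
    and lim: "mat_tendsto (\<lambda>k. Y (r k)) Z sequentially"
    using bounded_mat_subsequence[of Y n n 1] Y(1) Y1 by (metis order_refl)
  have Zadj: "mat_adjoint Z = Z"
    by (rule mat_tendsto_unique[OF _ lim]) (use mat_tendsto_adjoint[OF lim] Y(2) Z in auto)
  have Z1: "mnorm Z = 1"
    using tendsto_unique[OF _ mnorm_tendsto[OF lim], of 1] by (simp add: Y1)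
  have xlim: "(\<lambda>k. 1 / x (r k)) \<longlonglongrightarrow> 0"
  proof (rule tendsto_sandwich[OF _ _ tendsto_const])
    show "eventually (\<lambda>k. 0 \<le> 1 / x (r k)) sequentially" using x0 by (simp add: less_imp_le)
    show "eventually (\<lambda>k. 1 / x (r k) \<le> inverse (real (Suc k))) sequentially"
    proof (rule always_eventually, rule allI)
      fix k
      have "real (Suc k) \<le> real (Suc (r k))" using seq_suble[OF r, of k] by simp
      then have "real (Suc k) \<le> x (r k)" using x[of "r k"] by linarith
      then show "1 / x (r k) \<le> inverse (real (Suc k))" by (simp add: inverse_eq_divide frac_le)
    qed
    show "(\<lambda>k. inverse (real (Suc k))) \<longlonglongrightarrow> 0" by (rule LIMSEQ_inverse_real_of_nat)
  qed
  have clim: "(\<lambda>k. (1 / x (r k)) * ((1 / x (r k)) * c (g (r k)))) \<longlonglongrightarrow> 0"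
  proof (rule tendsto_sandwich[OF _ _ tendsto_const])
    show "(\<lambda>k. (1 / x (r k)) * (1 / x (r k))) \<longlonglongrightarrow> 0" using tendsto_mult[OF xlim xlim] by simp
    show "eventually (\<lambda>k. 0 \<le> (1 / x (r k)) * ((1 / x (r k)) * c (g (r k)))) sequentially"
      using x0 c by (intro always_eventually allI mult_nonneg_nonneg) (auto simp: less_imp_le)
    show "eventually (\<lambda>k. (1 / x (r k)) * ((1 / x (r k)) * c (g (r k))) \<le> (1 / x (r k)) * (1 / x (r k))) sequentially"
      using x0 c by (intro always_eventually allI mult_left_mono mult_left_le) (auto simp: less_imp_le)
  qed
  \<comment> \<open>After normalization by \<open>x j\<close> the constant term is divided by
    \<open>x j\<close>, while the quadratic term, rewritten in \<open>Y j\<close>, is multiplied by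
    it.\<close>
  have Yeq: "mat_adjoint A * Y j = Y j * A + ((\<i> * complex_of_real (1 / x j * c (g j))) \<cdot>\<^sub>m (mat_adjoint C * C) +
      (\<i> * complex_of_real (x j)) \<cdot>\<^sub>m (Y j * (B * (mat_adjoint B * Y j))))" for j
  proof -
    let ?t = "complex_of_real (1 / x j)"
    have t: "complex_of_real (x j) * (?t * ?t) = ?t" using x0[of j] by simp
    have "mat_adjoint A * Y j = ?t \<cdot>\<^sub>m (mat_adjoint A * X (g j))"
      unfolding Y_def using A X(1)[of "g j"] by (simp add: mult_smult_dim)
    also have "\<dots> = ?t \<cdot>\<^sub>m (X (g j) * A) + ((\<i> * (?t * complex_of_real (c (g j)))) \<cdot>\<^sub>m (mat_adjoint C * C) +
        (\<i> * (complex_of_real (x j) * (?t * ?t))) \<cdot>\<^sub>m (X (g j) * (B * (mat_adjoint B * X (g j)))))"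
      unfolding ric t using A B C X(1)[of "g j"]
      by (auto simp: algebra_simps intro!: eq_matI simp del: index_mult_mat(1))
    also have "\<dots> = Y j * A + ((\<i> * complex_of_real (1 / x j * c (g j))) \<cdot>\<^sub>m (mat_adjoint C * C) +
      (\<i> * complex_of_real (x j)) \<cdot>\<^sub>m (Y j * (B * (mat_adjoint B * Y j))))"
      unfolding Y_def using A B X(1)[of "g j"] by (simp add: mult_smult_dim smult_mult_dim smult_smult_mat mult.assoc)
    finally show ?thesis .
  qed
  \<comment> \<open>Dividing the normalized equation once more by \<open>x j\<close> isolates the
    quadratic term, and all other terms tend to zero because the \<open>Y j\<close> have norm
    1.\<close>
  have ZB: "Z * (B * (mat_adjoint B * Z)) = 0\<^sub>m n n"
  proof (rule mat_tendsto_unique)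
    show "mat_tendsto (\<lambda>k. Y (r k) * (B * (mat_adjoint B * Y (r k)))) (Z * (B * (mat_adjoint B * Z))) sequentially"
      by (intro mat_tendsto_mult lim mat_tendsto_const) (use B Z in auto)
    have 0: "((0 * \<i>) \<cdot>\<^sub>m (Z * A) + ((0 * - \<i>) \<cdot>\<^sub>m (mat_adjoint A * Z) + 0 \<cdot>\<^sub>m ((-1) \<cdot>\<^sub>m (mat_adjoint C * C)))) = 0\<^sub>m n n"
      using A C Z by (auto intro!: eq_matI simp del: index_mult_mat(1))
    have "mat_tendsto (\<lambda>k. (complex_of_real (1 / x (r k)) * \<i>) \<cdot>\<^sub>m (Y (r k) * A) +
        ((complex_of_real (1 / x (r k)) * - \<i>) \<cdot>\<^sub>m (mat_adjoint A * Y (r k)) +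
        complex_of_real ((1 / x (r k)) * ((1 / x (r k)) * c (g (r k)))) \<cdot>\<^sub>m ((-1) \<cdot>\<^sub>m (mat_adjoint C * C)))) (0\<^sub>m n n) sequentially"
      unfolding 0[symmetric] by (intro mat_tendsto_mult mat_tendsto_add mat_tendsto_smult lim mat_tendsto_const tendsto_mult tendsto_const
        tendsto_of_real[OF xlim, unfolded of_real_0] tendsto_of_real[OF clim, unfolded of_real_0]) (use A C Z in auto)
    moreover have "(complex_of_real (1 / x j) * \<i>) \<cdot>\<^sub>m (Y j * A) + ((complex_of_real (1 / x j) * - \<i>) \<cdot>\<^sub>m (mat_adjoint A * Y j) +
        complex_of_real ((1 / x j) * ((1 / x j) * c (g j))) \<cdot>\<^sub>m ((-1) \<cdot>\<^sub>m (mat_adjoint C * C))) = Y j * (B * (mat_adjoint B * Y j))" for j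
      unfolding Yeq using A B C Y(1)[of j] x0[of j]
      by (auto simp: algebra_simps intro!: eq_matI simp del: index_mult_mat(1))
    ultimately show "mat_tendsto (\<lambda>k. Y (r k) * (B * (mat_adjoint B * Y (r k)))) (0\<^sub>m n n) sequentially" by simp
  qed (use B Z in auto)
  have "mat_adjoint (mat_adjoint B * Z) * (mat_adjoint B * Z) = 0\<^sub>m n n"
    using ZB B Z Zadj by (simp add: adjoint_simps mult_assoc_dim)
  then have "mat_adjoint B * Z = 0\<^sub>m m n"
    using adjoint_mult_self_eq_0[of "mat_adjoint B * Z"] B Z by simp
  from arg_cong[OF this, of mat_adjoint] have ZB0: "Z * B = 0\<^sub>m n m"
    using B Z Zadj by (simp add: adjoint_simps)
  define Q where "Q = \<i> \<cdot>\<^sub>m (Z * A) + (- \<i>) \<cdot>\<^sub>m (mat_adjoint A * Z)"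
  have Q: "Q \<in> carrier_mat n n" using A Z by (auto simp: Q_def)
  have Qadj: "mat_adjoint Q = Q"
    unfolding Q_def using A Z Zadj
    by (auto simp: adjoint_simps intro!: eq_matI simp del: index_mult_mat(1) index_mat_adjoint)
  have psd: "0 \<le> (mat_adjoint v * (Q * v)) $$ (0, 0)" if v: "v \<in> carrier_mat n 1" for v
  proof (rule complex_nonneg_limit)
    have "mat_tendsto (\<lambda>k. mat_adjoint v * ((\<i> \<cdot>\<^sub>m (Y (r k) * A) + (- \<i>) \<cdot>\<^sub>m (mat_adjoint A * Y (r k))) * v)) (mat_adjoint v * (Q * v)) sequentially"
      unfolding Q_def by (intro mat_tendsto_mult mat_tendsto_add mat_tendsto_smult lim mat_tendsto_const tendsto_const) (use A Z v in auto)
    from mat_tendsto_entry[OF this, of 0 0] v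
    show "(\<lambda>k. (mat_adjoint v * ((\<i> \<cdot>\<^sub>m (Y (r k) * A) + (- \<i>) \<cdot>\<^sub>m (mat_adjoint A * Y (r k))) * v)) $$ (0, 0))
        \<longlonglongrightarrow> (mat_adjoint v * (Q * v)) $$ (0, 0)" by (simp del: index_mult_mat(1))
    have "0 \<le> (mat_adjoint v * ((\<i> \<cdot>\<^sub>m (Y j * A) + (- \<i>) \<cdot>\<^sub>m (mat_adjoint A * Y j)) * v)) $$ (0, 0)" for j
    proof -
      let ?u = "C * v" and ?w = "mat_adjoint B * (Y j * v)"
      have "\<i> \<cdot>\<^sub>m (Y j * A) + (- \<i>) \<cdot>\<^sub>m (mat_adjoint A * Y j) =
          complex_of_real (1 / x j * c (g j)) \<cdot>\<^sub>m (mat_adjoint C * C) + complex_of_real (x j) \<cdot>\<^sub>m (Y j * (B * (mat_adjoint B * Y j)))"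
        unfolding Yeq using A B C Y(1)[of j]
        by (auto simp: algebra_simps intro!: eq_matI simp del: index_mult_mat(1))
      then have "mat_adjoint v * ((\<i> \<cdot>\<^sub>m (Y j * A) + (- \<i>) \<cdot>\<^sub>m (mat_adjoint A * Y j)) * v) =
          complex_of_real (1 / x j * c (g j)) \<cdot>\<^sub>m (mat_adjoint ?u * ?u) + complex_of_real (x j) \<cdot>\<^sub>m (mat_adjoint ?w * ?w)"
        using A B C Y[of j] v by (simp add: adjoint_simps mat_ring_simps)
      moreover have "0 \<le> complex_of_real (1 / x j * c (g j)) * (mat_adjoint ?u * ?u) $$ (0, 0)"
        using adjoint_mult_self_nonneg[of 0 ?u] v x0[of j] c[of "g j"]
        by (intro mult_nonneg_nonneg) (auto simp: less_eq_complex_def)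
      moreover have "0 \<le> complex_of_real (x j) * (mat_adjoint ?w * ?w) $$ (0, 0)"
        using adjoint_mult_self_nonneg[of 0 ?w] v x0[of j] Y(1)[of j]
        by (intro mult_nonneg_nonneg) (auto simp: less_eq_complex_def)
      ultimately show ?thesis using v C B Y(1)[of j] by (simp del: index_mult_mat(1))
    qed
    then show "eventually (\<lambda>k. 0 \<le> (mat_adjoint v * ((\<i> \<cdot>\<^sub>m (Y (r k) * A) + (- \<i>) \<cdot>\<^sub>m (mat_adjoint A * Y (r k))) * v)) $$ (0, 0)) sequentially"
      by simp
  qed simp
  \<comment> \<open>On the kernel of \<open>Z\<close> the semidefinite form of \<open>Q\<close>
    vanishes, so \<open>Q v = 0\<close>; and there \<open>Q v\<close> is
    \<open>\<i> Z A v\<close>.\<close>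
  have step: "Z * (A * v) = 0\<^sub>m n 1" if v: "v \<in> carrier_mat n 1" and 0: "Z * v = 0\<^sub>m n 1" for v
  proof -
    have vZ: "mat_adjoint v * Z = 0\<^sub>m 1 n"
      using arg_cong[OF 0, of mat_adjoint] Z Zadj v by (simp add: adjoint_simps)
    have Qv: "Q * v = \<i> \<cdot>\<^sub>m (Z * (A * v)) + (- \<i>) \<cdot>\<^sub>m (mat_adjoint A * (Z * v))"
      unfolding Q_def using A Z v by (simp add: mat_ring_simps)
    then have Qv: "Q * v = \<i> \<cdot>\<^sub>m (Z * (A * v))"
      unfolding 0 using A Z v by (auto intro!: eq_matI simp del: index_mult_mat(1))
    have "mat_adjoint v * (Q * v) = \<i> \<cdot>\<^sub>m (mat_adjoint v * Z * (A * v))"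
      unfolding Qv using A Z v by (simp add: mult_smult_dim mult_assoc_dim)
    then have "mat_adjoint v * (Q * v) = 0\<^sub>m 1 1" unfolding vZ using A v by simp
    with psd_kernel[OF Q Qadj psd v] have "\<i> \<cdot>\<^sub>m (Z * (A * v)) = 0\<^sub>m n 1" unfolding Qv by blast
    then show ?thesis using A Z v by (auto simp: mat_eq_iff simp del: index_mult_mat(1))
  qed
  have "Z = 0\<^sub>m n n"
  proof (rule controllable_krylov[OF A B ctrl Z])
    fix k
    show "Z * kry A B k = 0\<^sub>m n m"
    proof (rule columns_eq_0)
      show "Z * kry A B k \<in> carrier_mat n m" using A B Z by simp
      fix e :: "complex mat" assume e: "e \<in> carrier_mat m 1"
      have Be: "B * e \<in> carrier_mat n 1" using B e by auto
      have "Z * kry A (B * e) k = 0\<^sub>m n 1" for k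
      proof (induction k)
        case 0
        have "Z * (B * e) = Z * B * e" using Z B e by (simp add: mult_assoc_dim)
        then show ?case unfolding ZB0 using e by simp
      next
        case (Suc k)
        then show ?case using step[of "kry A (B * e) k"] kry_carrier[OF A Be] by simp
      qed
      then have "Z * (kry A B k * e) = 0\<^sub>m n 1" unfolding kry_mult_right[OF A B e] .
      then show "Z * kry A B k * e = 0\<^sub>m n 1"
        using A B Z e by (simp add: mult_assoc_dim)
    qed
  qed
  then have "mnorm Z = 0" using mnorm_eq_0_iff[of Z] Z by simp
  with Z1 show False by simp
qed

text \<open>Scaling \<open>C\<close> by \<open>s k < 1\<close> makes the contraction strict at every
  real point, and the solutions of the scaled equations have a convergent subsequence. Strict
  inequalities for the closed-loop spectrum weaken to the closed half-plane in the limit.\<close>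

theorem riccati_exists:
  assumes A: "A \<in> carrier_mat n n" and B: "B \<in> carrier_mat n m" and C: "C \<in> carrier_mat p n"
    and ctrl: "observable n (mat_adjoint A) (mat_adjoint B)"
    and real: "\<And>t. Im t = 0 \<Longrightarrow> \<not> eigenvalue A t"
    and contr: "\<And>t b. Im t = 0 \<Longrightarrow> b \<in> carrier_mat m 1 \<Longrightarrow>
      (mat_adjoint (C * (resolvent A t * B) * b) * (C * (resolvent A t * B) * b)) $$ (0, 0) \<le> (mat_adjoint b * b) $$ (0, 0)"
  obtains X where "X \<in> carrier_mat n n" "mat_adjoint X = X" "riccati_eq A B C X"
    "\<And>e. eigenvalue (alpha_mat A B X) e \<Longrightarrow> Im e \<le> 0"
proof -
  \<comment> \<open>The shift by two keeps \<open>s k\<close> in \<open>{1/2..<1}\<close> and lets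
    it tend to 1; the equation itself contains only the square \<open>c k\<close>.\<close>
  define s where "s k = 1 - inverse (real (Suc (Suc k)))" for k
  have s: "0 \<le> s k" "s k < 1" for k
    unfolding s_def by (simp_all add: inverse_le_1_iff)
  define c where "c k = s k * s k" for k
  have c: "0 \<le> c k" "c k \<le> 1" for k using s[of k] by (auto simp: c_def intro: mult_le_one)
  have "(\<lambda>k. inverse (real (Suc (Suc k)))) \<longlonglongrightarrow> 0"
    using LIMSEQ_Suc[OF LIMSEQ_inverse_real_of_nat] .
  from tendsto_diff[OF tendsto_const[of "1 :: real"] this] have "s \<longlonglongrightarrow> 1" by (simp add: s_def[abs_def])
  from tendsto_mult[OF this this] have clim: "c \<longlonglongrightarrow> 1" by (simp add: c_def[abs_def])
  have "\<exists>X. X \<in> carrier_mat n n \<and> mat_adjoint X = X \<and>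
      riccati_eq A B (complex_of_real (s k) \<cdot>\<^sub>m C) X \<and> (\<forall>e. eigenvalue (alpha_mat A B X) e \<longrightarrow> Im e \<le> 0)" for k
  proof -
    have C': "complex_of_real (s k) \<cdot>\<^sub>m C \<in> carrier_mat p n" using C by simp
    show ?thesis
    proof (rule riccati_strict[OF A B C' ctrl real])
      fix t b assume t: "Im t = 0" and b: "b \<in> carrier_mat m 1"
        and eq: "b = mat_adjoint (complex_of_real (s k) \<cdot>\<^sub>m C * (resolvent A t * B)) *
          (complex_of_real (s k) \<cdot>\<^sub>m C * (resolvent A t * B) * b)"
      note R = resolvent(1)[OF A real[OF t]]
      let ?g = "C * (resolvent A t * B) * b"
      have g: "?g \<in> carrier_mat p 1" using C b by simp
      have "b = complex_of_real (c k) \<cdot>\<^sub>m (mat_adjoint (C * (resolvent A t * B)) * ?g)"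
        by (subst eq) (use B C R b in \<open>simp add: adjoint_simps mat_ring_simps c_def\<close>)
      then have "mat_adjoint b * b = mat_adjoint b * (complex_of_real (c k) \<cdot>\<^sub>m (mat_adjoint (C * (resolvent A t * B)) * ?g))"
        by simp
      also have "\<dots> = complex_of_real (c k) \<cdot>\<^sub>m (mat_adjoint ?g * ?g)"
        using B C R b by (simp add: adjoint_simps mat_ring_simps)
      finally have bb: "mat_adjoint b * b = complex_of_real (c k) \<cdot>\<^sub>m (mat_adjoint ?g * ?g)" .
      \<comment> \<open>With the squared norms \<open>\<beta>\<close> of \<open>b\<close> and
        \<open>\<gamma>\<close> of its image,
        \<open>\<beta> = c k * \<gamma> \<le> c k * \<beta>\<close> and \<open>c k < 1\<close> force
        \<open>\<beta> = 0\<close>.\<close>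
      define \<beta> \<gamma> where "\<beta> = Re ((mat_adjoint b * b) $$ (0, 0))" and "\<gamma> = Re ((mat_adjoint ?g * ?g) $$ (0, 0))"
      have "\<beta> = c k * \<gamma>"
        using arg_cong[OF bb, of "\<lambda>M. Re (M $$ (0, 0))"] g by (simp add: \<beta>_def \<gamma>_def del: index_mult_mat(1))
      moreover have "\<gamma> \<le> \<beta>" using contr[OF t b] by (simp add: \<beta>_def \<gamma>_def less_eq_complex_def)
      moreover have "0 \<le> \<beta>" using adjoint_mult_self_nonneg[of 0 b] b by (simp add: \<beta>_def less_eq_complex_def)
      moreover have "c k < 1"
      proof -
        have "s k * s k \<le> s k * 1" using s[of k] by (intro mult_left_mono) auto
        then show ?thesis using s(2)[of k] by (simp add: c_def)
      qed
      moreover have "c k * \<gamma> \<le> c k * \<beta>" using c(1)[of k] calculation(2) by (rule mult_left_mono[rotated])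
      ultimately have "(1 - c k) * \<beta> \<le> 0" "0 < 1 - c k" "0 \<le> \<beta>" by (simp_all add: algebra_simps)
      then have "\<beta> = 0" by (simp add: mult_le_0_iff)
      have "mat_adjoint b * b = 0\<^sub>m 1 1"
      proof (rule eq_matI)
        fix i j assume "i < dim_row (0\<^sub>m 1 1 :: complex mat)" "j < dim_col (0\<^sub>m 1 1 :: complex mat)"
        then have "i = 0" "j = 0" by auto
        moreover have "(mat_adjoint b * b) $$ (0, 0) = 0"
          using \<open>\<beta> = 0\<close> adjoint_mult_self_nonneg[of 0 b] b unfolding \<beta>_def
          by (simp add: less_eq_complex_def complex_eq_iff)
        ultimately show "(mat_adjoint b * b) $$ (i, j) = 0\<^sub>m 1 1 $$ (i, j)" by simp
      qed (use b in auto)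
      then show "b = 0\<^sub>m m 1" using adjoint_mult_self_eq_0[of b] b by simp
    next
      fix X assume X: "X \<in> carrier_mat n n" "mat_adjoint X = X"
        "riccati_eq A B (complex_of_real (s k) \<cdot>\<^sub>m C) X"
        "\<And>e. eigenvalue (alpha_mat A B X) e \<Longrightarrow> Im e < 0"
      then show ?thesis by (intro exI[of _ X] conjI allI impI) (auto intro: less_imp_le)
    qed
  qed
  then obtain X where X: "\<And>k. X k \<in> carrier_mat n n" "\<And>k. mat_adjoint (X k) = X k"
    "\<And>k. riccati_eq A B (complex_of_real (s k) \<cdot>\<^sub>m C) (X k)"
    "\<And>k e. eigenvalue (alpha_mat A B (X k)) e \<Longrightarrow> Im e \<le> 0" by metis
  have ric: "mat_adjoint A * X k = X k * A + ((\<i> * complex_of_real (c k)) \<cdot>\<^sub>m (mat_adjoint C * C) +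
      \<i> \<cdot>\<^sub>m (X k * (B * (mat_adjoint B * X k))))" for k
  proof -
    have C': "complex_of_real (s k) \<cdot>\<^sub>m C \<in> carrier_mat p n" using C by simp
    have "\<i> \<cdot>\<^sub>m (mat_adjoint (complex_of_real (s k) \<cdot>\<^sub>m C) * (complex_of_real (s k) \<cdot>\<^sub>m C)) =
        (\<i> * complex_of_real (c k)) \<cdot>\<^sub>m (mat_adjoint C * C)"
      using C by (simp add: adjoint_simps mat_ring_simps c_def)
    then show ?thesis using X(3)[of k] unfolding riccati_eq_iff[OF A B C' X(1)] by simp
  qed
  obtain K where K: "\<And>k. mnorm (X k) \<le> K"
    using riccati_solutions_bounded[where X = X and c = c, OF A B C ctrl X(1,2) ric c] by blast
  obtain r Z where r: "strict_mono (r :: nat \<Rightarrow> nat)" and Z: "Z \<in> carrier_mat n n"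
    and lim: "mat_tendsto (\<lambda>k. X (r k)) Z sequentially"
    by (rule bounded_mat_subsequence[OF X(1) K])
  have Zadj: "mat_adjoint Z = Z"
    by (rule mat_tendsto_unique[OF _ lim]) (use mat_tendsto_adjoint[OF lim] X(2) Z in auto)
  have crlim: "(\<lambda>k. \<i> * complex_of_real (c (r k))) \<longlonglongrightarrow> \<i> * complex_of_real 1"
    using LIMSEQ_subseq_LIMSEQ[OF clim r] by (intro tendsto_intros) (simp add: o_def)
  have "mat_adjoint A * Z = Z * A + ((\<i> * complex_of_real 1) \<cdot>\<^sub>m (mat_adjoint C * C) + \<i> \<cdot>\<^sub>m (Z * (B * (mat_adjoint B * Z))))"
  proof (rule mat_tendsto_unique)
    show "mat_tendsto (\<lambda>k. mat_adjoint A * X (r k)) (mat_adjoint A * Z) sequentially"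
      by (intro mat_tendsto_mult lim mat_tendsto_const) (use A Z in auto)
    show "mat_tendsto (\<lambda>k. mat_adjoint A * X (r k))
        (Z * A + ((\<i> * complex_of_real 1) \<cdot>\<^sub>m (mat_adjoint C * C) + \<i> \<cdot>\<^sub>m (Z * (B * (mat_adjoint B * Z))))) sequentially"
      unfolding ric by (intro mat_tendsto_mult mat_tendsto_add mat_tendsto_smult lim mat_tendsto_const tendsto_const crlim)
        (use A B C Z in auto)
  qed (use A B C Z in auto)
  then have ricZ: "riccati_eq A B C Z" unfolding riccati_eq_iff[OF A B C Z] by simp
  have alim: "mat_tendsto (\<lambda>k. alpha_mat A B (X (r k))) (alpha_mat A B Z) sequentially"
    unfolding alpha_mat_eq(1)[OF A B X(1)] alpha_mat_eq(1)[OF A B Z]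
    by (intro mat_tendsto_mult mat_tendsto_add mat_tendsto_smult lim mat_tendsto_const tendsto_const) (use A B Z in auto)
  show ?thesis
    by (rule that[OF Z Zadj ricZ], rule eigenvalue_limit_lower[OF _ _ alim])
      (use alpha_mat_eq(2)[OF A B] X(1,4) Z in auto)
qed

section \<open>The Lyapunov inequality\<close>

text \<open>With \<open>w = (U - e) v\<close> one has
  \<open>U\<^sup>k\<^sup>+\<^sup>1 v = e U\<^sup>k v + U\<^sup>k w\<close>, so a geometric bound for
  \<open>w\<close> passes to \<open>v\<close> as long as \<open>cmod e < \<rho>\<close>. Induction
  along the eigenvalue list thus replaces a Jordan form estimate.\<close>

lemma geometric_krylov_bound:
  fixes U :: "complex mat"
  assumes U: "U \<in> carrier_mat n n" and \<rho>: "0 < \<rho>"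
  shows "v \<in> carrier_mat n 1 \<Longrightarrow> newton U es v = 0\<^sub>m n 1 \<Longrightarrow> (\<And>e. e \<in> set es \<Longrightarrow> cmod e < \<rho>) \<Longrightarrow>
    \<exists>c. 0 \<le> c \<and> (\<forall>k. mnorm (kry U v k) \<le> c * \<rho> ^ k)"
proof (induction es arbitrary: v)
  case Nil
  then have "v = 0\<^sub>m n 1" by simp
  have "kry U v k = 0\<^sub>m n 1" for k using U by (induction k) (auto simp: \<open>v = 0\<^sub>m n 1\<close>)
  moreover have "mnorm (0\<^sub>m n 1) = 0" unfolding mnorm_eq_0_iff by simp
  ultimately show ?case by (intro exI[of _ 0]) simp
next
  case (Cons e es)
  let ?w = "U * v - e \<cdot>\<^sub>m v"
  have w: "?w \<in> carrier_mat n 1" using U Cons.prems by auto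
  obtain c where c: "0 \<le> c" "\<And>k. mnorm (kry U ?w k) \<le> c * \<rho> ^ k"
    using Cons.IH[OF w] Cons.prems by auto
  have e: "cmod e < \<rho>" using Cons.prems by simp
  \<comment> \<open>The second argument of the maximum makes
    \<open>cmod e * d + c \<le> d * \<rho>\<close>, which is the induction step in \<open>k\<close>;
    the first one is the case \<open>k = 0\<close>.\<close>
  define d where "d = max (mnorm v) (c / (\<rho> - cmod e))"
  have d: "mnorm v \<le> d" "c \<le> d * (\<rho> - cmod e)" "0 \<le> d"
    using e mnorm_nonneg[of v] unfolding d_def by (auto simp: pos_divide_le_eq[symmetric] le_max_iff_disj)
  have "mnorm (kry U v k) \<le> d * \<rho> ^ k" for k
  proof (induction k)
    case (Suc k)
    have K: "kry U v k \<in> carrier_mat n 1" using U Cons.prems by simp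
    have "kry U v (Suc k) = e \<cdot>\<^sub>m kry U v k + kry U ?w k"
      unfolding kry_shift[OF U Cons.prems(1)] kry.simps using K U
      by (auto intro!: eq_matI simp del: index_mult_mat(1))
    then have "mnorm (kry U v (Suc k)) \<le> mnorm (e \<cdot>\<^sub>m kry U v k) + mnorm (kry U ?w k)"
      using mnorm_add[of "e \<cdot>\<^sub>m kry U v k" "kry U ?w k"] kry_carrier[OF U w, of k] K by simp
    also have "\<dots> \<le> cmod e * (d * \<rho> ^ k) + c * \<rho> ^ k"
      unfolding mnorm_smult using Suc c(2) by (intro add_mono mult_left_mono) auto
    also have "\<dots> \<le> cmod e * (d * \<rho> ^ k) + d * (\<rho> - cmod e) * \<rho> ^ k"
      using d(2) \<rho> by (intro add_left_mono mult_right_mono) auto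
    also have "\<dots> = d * \<rho> ^ Suc k" by (simp add: algebra_simps)
    finally show ?case .
  qed (use d in simp)
  then show ?case using d(3) by blast
qed

lemma quadratic_form_le:
  assumes "X \<in> carrier_mat n n" "v \<in> carrier_mat n 1"
  shows "cmod ((mat_adjoint v * (X * v)) $$ (0, 0)) \<le> mnorm X * (mnorm v * mnorm v)"
proof -
  have "cmod ((mat_adjoint v * (X * v)) $$ (0, 0)) \<le> mnorm (mat_adjoint v * (X * v))"
    using assms by (intro entry_le_mnorm) auto
  also have "\<dots> \<le> mnorm (mat_adjoint v) * mnorm (X * v)" using assms by (intro mnorm_mult) auto
  also have "\<dots> \<le> mnorm v * (mnorm X * mnorm v)"
    using assms mnorm_mult[of X v] by (auto intro!: mult_left_mono)
  finally show ?thesis by (simp add: mult_ac)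
qed

text \<open>The Cayley transform \<open>U = (A + i)(A - i)\<^sup>-\<^sup>1\<close> turns the Lyapunov inequality into
  \<open>X \<ge> U\<^sup>* X U\<close>, and the powers of \<open>U\<close> tend to zero.\<close>

theorem lyapunov_nonneg:
  fixes A X :: "complex mat"
  assumes A: "A \<in> carrier_mat n n" and X: "X \<in> carrier_mat n n"
    and ev: "\<And>e. eigenvalue A e \<Longrightarrow> Im e < 0"
    and psd: "\<And>v. v \<in> carrier_mat n 1 \<Longrightarrow>
      0 \<le> Re ((mat_adjoint v * ((\<i> \<cdot>\<^sub>m (X * A) + (- \<i>) \<cdot>\<^sub>m (mat_adjoint A * X)) * v)) $$ (0, 0))"
    and v: "v \<in> carrier_mat n 1"
  shows "0 \<le> Re ((mat_adjoint v * (X * v)) $$ (0, 0))"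
proof -
  have ni: "\<not> eigenvalue A \<i>" using ev[of \<i>] by auto
  define R where "R = resolvent A \<i>"
  have R: "R \<in> carrier_mat n n" using resolvent(1)[OF A ni] by (simp add: R_def)
  define U where "U = (-1) \<cdot>\<^sub>m ((A + \<i> \<cdot>\<^sub>m 1\<^sub>m n) * R)"
  have U: "U \<in> carrier_mat n n" using A R by (simp add: U_def)
  \<comment> \<open>With \<open>y = R x\<close>, these are \<open>x = (\<i> - A) y\<close> and
    \<open>U x = - (A + \<i>) y\<close>.\<close>
  have split: "x = \<i> \<cdot>\<^sub>m (R * x) + (-1) \<cdot>\<^sub>m (A * (R * x)) \<and> U * x = (-1) \<cdot>\<^sub>m (A * (R * x)) + (- \<i>) \<cdot>\<^sub>m (R * x)"
    if x: "x \<in> carrier_mat n 1" for x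
  proof
    show "x = \<i> \<cdot>\<^sub>m (R * x) + (-1) \<cdot>\<^sub>m (A * (R * x))"
      using mult_resolvent(1)[OF A ni x] unfolding R_def minus_as_smult by simp
    show "U * x = (-1) \<cdot>\<^sub>m (A * (R * x)) + (- \<i>) \<cdot>\<^sub>m (R * x)"
      unfolding U_def using A R x by (simp add: mat_ring_simps)
  qed
  have Uev: "cmod \<mu> < 1" if \<mu>: "eigenvalue U \<mu>" for \<mu>
  proof -
    obtain x where x: "x \<in> carrier_mat n 1" "x \<noteq> 0\<^sub>m n 1" "U * x = \<mu> \<cdot>\<^sub>m x"
      using \<mu> eigenvalue_iff[OF U] by blast
    define y where "y = R * x"
    have y: "y \<in> carrier_mat n 1" using R x by (simp add: y_def)
    note S = split[OF x(1), folded y_def]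
    have y0: "y \<noteq> 0\<^sub>m n 1"
    proof
      assume 0: "y = 0\<^sub>m n 1"
      have "x = \<i> \<cdot>\<^sub>m y + (-1) \<cdot>\<^sub>m (A * y)" using S by blast
      then have "x = 0\<^sub>m n 1" unfolding 0 using A by simp
      with x(2) show False by simp
    qed
    have "\<mu> \<cdot>\<^sub>m (\<i> \<cdot>\<^sub>m y + (-1) \<cdot>\<^sub>m (A * y)) = (-1) \<cdot>\<^sub>m (A * y) + (- \<i>) \<cdot>\<^sub>m y"
      using S x(3) by metis
    then have eq: "(\<mu> - 1) * (A * y) $$ (i, 0) = (\<i> * (\<mu> + 1)) * y $$ (i, 0)" if "i < n" for i
      using that A y by (auto simp: mat_eq_iff algebra_simps simp del: index_mult_mat(1))
    have "\<mu> \<noteq> 1"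
    proof
      assume "\<mu> = 1"
      with eq have "y = 0\<^sub>m n 1" using y by (intro eq_matI) auto
      with y0 show False by simp
    qed
    \<comment> \<open>The inverse Cayley transform of \<open>\<mu>\<close>: it is an eigenvalue of
      \<open>A\<close>, so it lies below the axis and is closer to \<open>- \<i>\<close> than to
      \<open>\<i>\<close>. This is \<open>cmod \<mu> < 1\<close>.\<close>
    define a where "a = \<i> * (\<mu> + 1) / (\<mu> - 1)"
    have "A * y = a \<cdot>\<^sub>m y"
    proof (rule eq_matI)
      fix i j assume "i < dim_row (a \<cdot>\<^sub>m y)" "j < dim_col (a \<cdot>\<^sub>m y)"
      then have ij: "i < n" "j = 0" using y by auto
      show "(A * y) $$ (i, j) = (a \<cdot>\<^sub>m y) $$ (i, j)"
        using eq[OF ij(1)] ij y \<open>\<mu> \<noteq> 1\<close> by (simp add: a_def field_simps del: index_mult_mat(1))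
    qed (use A y in auto)
    then have "eigenvalue A a" using eigenvalue_iff[OF A] y y0 by blast
    then have "Im a < 0" by (rule ev)
    have "\<mu> * (a - \<i>) = a + \<i>" using \<open>\<mu> \<noteq> 1\<close> by (simp add: a_def field_simps)
    then have "cmod \<mu> * cmod (a - \<i>) = cmod (a + \<i>)" by (metis norm_mult)
    moreover have "(cmod (a + \<i>))\<^sup>2 < (cmod (a - \<i>))\<^sup>2"
      using \<open>Im a < 0\<close> unfolding cmod_power2 by (simp add: power2_eq_square algebra_simps)
    then have "cmod (a + \<i>) < cmod (a - \<i>)" by (rule power_less_imp_less_base) simp
    ultimately show ?thesis by (metis mult_le_cancel_right1 norm_ge_zero not_le)
  qed
  define q where "q x = Re ((mat_adjoint x * (X * x)) $$ (0, 0))" for x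
  have dec: "q (U * x) \<le> q x" if x: "x \<in> carrier_mat n 1" for x
  proof -
    define y where "y = R * x"
    have y: "y \<in> carrier_mat n 1" using R x by (simp add: y_def)
    note S = split[OF x, folded y_def]
    let ?x = "\<i> \<cdot>\<^sub>m y + (-1) \<cdot>\<^sub>m (A * y)" and ?u = "(-1) \<cdot>\<^sub>m (A * y) + (- \<i>) \<cdot>\<^sub>m y"
    \<comment> \<open>Expanding both forms in \<open>y\<close>, the pure terms agree and the mixed
      terms differ by twice the Lyapunov form, so passing from \<open>x\<close> to
      \<open>U x\<close> cannot increase the form of \<open>X\<close>.\<close>
    have eq: "mat_adjoint ?x * (X * ?x) = mat_adjoint ?u * (X * ?u) +
        2 \<cdot>\<^sub>m (mat_adjoint y * ((\<i> \<cdot>\<^sub>m (X * A) + (- \<i>) \<cdot>\<^sub>m (mat_adjoint A * X)) * y))"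
      using A X y
      by (auto simp: adjoint_simps mat_ring_simps algebra_simps intro!: eq_matI simp del: index_mult_mat(1))
    have "q ?x = q ?u + 2 * Re ((mat_adjoint y * ((\<i> \<cdot>\<^sub>m (X * A) + (- \<i>) \<cdot>\<^sub>m (mat_adjoint A * X)) * y)) $$ (0, 0))"
      unfolding q_def eq using y A X by (simp del: index_mult_mat(1))
    with psd[OF y] S show ?thesis by (metis add_increasing2 order_refl mult_nonneg_nonneg zero_le_numeral)
  qed
  obtain es where es: "\<And>e. e \<in> set es \<Longrightarrow> eigenvalue U e" "\<And>q M. M \<in> carrier_mat n q \<Longrightarrow> newton U es M = 0\<^sub>m n q"
    using annihilating_eigenvalues[OF U] by blast
  \<comment> \<open>The inserted 0 covers an empty list of eigenvalues. The midpoint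
    \<open>\<rho>\<close> of \<open>r\<close> and 1 exceeds every modulus strictly, as the geometric
    bound requires.\<close>
  define r where "r = Max (insert 0 (cmod ` set es))"
  have r: "0 \<le> r" "r < 1" "\<And>e. e \<in> set es \<Longrightarrow> cmod e \<le> r"
    unfolding r_def using es(1) Uev by (auto intro: Max_ge)
  define \<rho> where "\<rho> = (r + 1) / 2"
  have \<rho>: "0 < \<rho>" "\<rho> < 1" "\<And>e. e \<in> set es \<Longrightarrow> cmod e < \<rho>" using r unfolding \<rho>_def by force+
  obtain c where c: "0 \<le> c" "\<And>k. mnorm (kry U v k) \<le> c * \<rho> ^ k"
    using geometric_krylov_bound[OF U \<rho>(1) v es(2)[OF v] \<rho>(3)] by blast
  have qle: "q (kry U v k) \<le> q v" for k
  proof (induction k)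
    case (Suc k)
    then show ?case using dec[of "kry U v k"] U v by (simp add: order_trans)
  qed simp
  have lower: "- (mnorm X * ((c * \<rho> ^ k) * (c * \<rho> ^ k))) \<le> q v" for k
  proof -
    have K: "kry U v k \<in> carrier_mat n 1" using U v by simp
    have "- q (kry U v k) \<le> cmod ((mat_adjoint (kry U v k) * (X * kry U v k)) $$ (0, 0))"
      unfolding q_def using abs_Re_le_cmod[of "(mat_adjoint (kry U v k) * (X * kry U v k)) $$ (0, 0)"] by linarith
    also have "\<dots> \<le> mnorm X * (mnorm (kry U v k) * mnorm (kry U v k))" by (rule quadratic_form_le[OF X K])
    also have "\<dots> \<le> mnorm X * ((c * \<rho> ^ k) * (c * \<rho> ^ k))"
      using c \<rho>(1) by (intro mult_left_mono mult_mono) auto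
    finally show ?thesis using qle[of k] by linarith
  qed
  have "(\<lambda>k. - (mnorm X * ((c * \<rho> ^ k) * (c * \<rho> ^ k)))) \<longlonglongrightarrow> - (mnorm X * ((c * 0) * (c * 0)))"
    using \<rho> by (intro tendsto_intros LIMSEQ_realpow_zero) auto
  then have "- (mnorm X * ((c * 0) * (c * 0))) \<le> q v"
    by (rule tendsto_upperbound) (use lower in auto)
  then show ?thesis by (simp add: q_def)
qed

section \<open>Block structure and the form j\<close>

text \<open>The isometric embeddings of the two coordinate blocks. Blocks of a matrix become
  products with them, so block computations reduce to ring identities and the four relations in
  \<open>emb_products\<close>.\<close>

definition emb1 :: "nat \<Rightarrow> nat \<Rightarrow> complex mat" where
  "emb1 m1 m2 = mat (m1 + m2) m1 (\<lambda>(i, j). if i = j then 1 else 0)"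

definition emb2 :: "nat \<Rightarrow> nat \<Rightarrow> complex mat" where
  "emb2 m1 m2 = mat (m1 + m2) m2 (\<lambda>(i, j). if i = m1 + j then 1 else 0)"

lemma emb_carrier [simp]:
  "emb1 m1 m2 \<in> carrier_mat (m1 + m2) m1" "emb2 m1 m2 \<in> carrier_mat (m1 + m2) m2"
  by (simp_all add: emb1_def emb2_def)

lemma dim_emb [simp]:
  "dim_row (emb1 m1 m2) = m1 + m2" "dim_col (emb1 m1 m2) = m1"
  "dim_row (emb2 m1 m2) = m1 + m2" "dim_col (emb2 m1 m2) = m2"
  by (simp_all add: emb1_def emb2_def)

lemma adjoint_emb_mult_index:
  assumes M: "M \<in> carrier_mat (m1 + m2) q" and j: "j < q"
  shows "i < m1 \<Longrightarrow> (mat_adjoint (emb1 m1 m2) * M) $$ (i, j) = M $$ (i, j)"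
    "k < m2 \<Longrightarrow> (mat_adjoint (emb2 m1 m2) * M) $$ (k, j) = M $$ (m1 + k, j)"
proof -
  assume i: "i < m1"
  have "(mat_adjoint (emb1 m1 m2) * M) $$ (i, j) = (\<Sum>l = 0..<m1 + m2. mat_adjoint (emb1 m1 m2) $$ (i, l) * M $$ (l, j))"
    using mult_entry[of i "mat_adjoint (emb1 m1 m2)" j M] M i j by simp
  also have "\<dots> = (\<Sum>l = 0..<m1 + m2. if l = i then M $$ (l, j) else 0)"
    using i by (intro sum.cong) (auto simp: emb1_def)
  finally show "(mat_adjoint (emb1 m1 m2) * M) $$ (i, j) = M $$ (i, j)" using i by simp
next
  assume k: "k < m2"
  have "(mat_adjoint (emb2 m1 m2) * M) $$ (k, j) = (\<Sum>l = 0..<m1 + m2. mat_adjoint (emb2 m1 m2) $$ (k, l) * M $$ (l, j))"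
    using mult_entry[of k "mat_adjoint (emb2 m1 m2)" j M] M k j by simp
  also have "\<dots> = (\<Sum>l = 0..<m1 + m2. if l = m1 + k then M $$ (l, j) else 0)"
    using k by (intro sum.cong) (auto simp: emb2_def)
  finally show "(mat_adjoint (emb2 m1 m2) * M) $$ (k, j) = M $$ (m1 + k, j)" using k by simp
qed

lemma mult_emb_index:
  assumes M: "M \<in> carrier_mat q (m1 + m2)" and i: "i < q"
  shows "j < m1 \<Longrightarrow> (M * emb1 m1 m2) $$ (i, j) = M $$ (i, j)"
    "k < m2 \<Longrightarrow> (M * emb2 m1 m2) $$ (i, k) = M $$ (i, m1 + k)"
proof -
  assume j: "j < m1"
  have "(M * emb1 m1 m2) $$ (i, j) = (\<Sum>l = 0..<m1 + m2. M $$ (i, l) * emb1 m1 m2 $$ (l, j))"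
    using mult_entry[of i M j "emb1 m1 m2"] M i j by simp
  also have "\<dots> = (\<Sum>l = 0..<m1 + m2. if l = j then M $$ (i, l) else 0)"
    using j by (intro sum.cong) (auto simp: emb1_def)
  finally show "(M * emb1 m1 m2) $$ (i, j) = M $$ (i, j)" using j by simp
next
  assume k: "k < m2"
  have "(M * emb2 m1 m2) $$ (i, k) = (\<Sum>l = 0..<m1 + m2. M $$ (i, l) * emb2 m1 m2 $$ (l, k))"
    using mult_entry[of i M k "emb2 m1 m2"] M i k by simp
  also have "\<dots> = (\<Sum>l = 0..<m1 + m2. if l = m1 + k then M $$ (i, l) else 0)"
    using k by (intro sum.cong) (auto simp: emb2_def)
  finally show "(M * emb2 m1 m2) $$ (i, k) = M $$ (i, m1 + k)" using k by simp
qed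

lemma mult_adjoint_emb_index:
  assumes i: "i < q" and j: "j < m1 + m2"
  shows "M \<in> carrier_mat q m1 \<Longrightarrow> (M * mat_adjoint (emb1 m1 m2)) $$ (i, j) = (if j < m1 then M $$ (i, j) else 0)"
    "N \<in> carrier_mat q m2 \<Longrightarrow> (N * mat_adjoint (emb2 m1 m2)) $$ (i, j) = (if j < m1 then 0 else N $$ (i, j - m1))"
proof -
  assume M: "M \<in> carrier_mat q m1"
  have "(M * mat_adjoint (emb1 m1 m2)) $$ (i, j) = (\<Sum>l = 0..<m1. M $$ (i, l) * mat_adjoint (emb1 m1 m2) $$ (l, j))"
    using mult_entry[of i M j "mat_adjoint (emb1 m1 m2)"] M i j by simp
  also have "\<dots> = (\<Sum>l = 0..<m1. if l = j then M $$ (i, l) else 0)"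
    using j by (intro sum.cong) (auto simp: emb1_def)
  finally show "(M * mat_adjoint (emb1 m1 m2)) $$ (i, j) = (if j < m1 then M $$ (i, j) else 0)" by simp
next
  assume N: "N \<in> carrier_mat q m2"
  have "(N * mat_adjoint (emb2 m1 m2)) $$ (i, j) = (\<Sum>l = 0..<m2. N $$ (i, l) * mat_adjoint (emb2 m1 m2) $$ (l, j))"
    using mult_entry[of i N j "mat_adjoint (emb2 m1 m2)"] N i j by simp
  also have "\<dots> = (\<Sum>l = 0..<m2. if l = j - m1 then (if j < m1 then 0 else N $$ (i, l)) else 0)"
    using j by (intro sum.cong) (auto simp: emb2_def)
  finally show "(N * mat_adjoint (emb2 m1 m2)) $$ (i, j) = (if j < m1 then 0 else N $$ (i, j - m1))" using j by auto
qed

lemma emb_products: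
  "mat_adjoint (emb1 m1 m2) * emb1 m1 m2 = 1\<^sub>m m1" "mat_adjoint (emb2 m1 m2) * emb2 m1 m2 = 1\<^sub>m m2"
  "mat_adjoint (emb1 m1 m2) * emb2 m1 m2 = 0\<^sub>m m1 m2" "mat_adjoint (emb2 m1 m2) * emb1 m1 m2 = 0\<^sub>m m2 m1"
  by (rule eq_matI;
    simp add: adjoint_emb_mult_index[OF emb_carrier(1)] adjoint_emb_mult_index[OF emb_carrier(2)] del: index_mult_mat(1);
    simp add: emb1_def emb2_def)+

lemma hcat_eq:
  fixes M N :: "complex mat"
  assumes "M \<in> carrier_mat q m1" "N \<in> carrier_mat q m2"
  shows "hcat M N = M * mat_adjoint (emb1 m1 m2) + N * mat_adjoint (emb2 m1 m2)"
proof (rule eq_matI)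
  fix i j assume "i < dim_row (M * mat_adjoint (emb1 m1 m2) + N * mat_adjoint (emb2 m1 m2))"
    "j < dim_col (M * mat_adjoint (emb1 m1 m2) + N * mat_adjoint (emb2 m1 m2))"
  then have ij: "i < q" "j < m1 + m2" using assms by auto
  then show "hcat M N $$ (i, j) = (M * mat_adjoint (emb1 m1 m2) + N * mat_adjoint (emb2 m1 m2)) $$ (i, j)"
    using assms mult_adjoint_emb_index(1)[OF ij assms(1)] mult_adjoint_emb_index(2)[OF ij assms(2)]
    by (simp add: hcat_def del: index_mult_mat(1))
qed (use assms in \<open>auto simp: hcat_def\<close>)

lemma j_mat_eq:
  "j_mat m1 m2 = emb1 m1 m2 * mat_adjoint (emb1 m1 m2) + (-1) \<cdot>\<^sub>m (emb2 m1 m2 * mat_adjoint (emb2 m1 m2))"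
proof (rule eq_matI)
  fix i j assume "i < dim_row (emb1 m1 m2 * mat_adjoint (emb1 m1 m2) + (-1) \<cdot>\<^sub>m (emb2 m1 m2 * mat_adjoint (emb2 m1 m2)))"
    "j < dim_col (emb1 m1 m2 * mat_adjoint (emb1 m1 m2) + (-1) \<cdot>\<^sub>m (emb2 m1 m2 * mat_adjoint (emb2 m1 m2)))"
  then have ij: "i < m1 + m2" "j < m1 + m2" by auto
  then show "j_mat m1 m2 $$ (i, j) = (emb1 m1 m2 * mat_adjoint (emb1 m1 m2) + (-1) \<cdot>\<^sub>m (emb2 m1 m2 * mat_adjoint (emb2 m1 m2))) $$ (i, j)"
    using mult_adjoint_emb_index(1)[OF ij emb_carrier(1)] mult_adjoint_emb_index(2)[OF ij emb_carrier(2)]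
    by (auto simp: j_mat_def emb1_def emb2_def simp del: index_mult_mat(1))
qed (auto simp: j_mat_def)

lemma one_mat_emb:
  "1\<^sub>m (m1 + m2) = emb1 m1 m2 * mat_adjoint (emb1 m1 m2) + emb2 m1 m2 * mat_adjoint (emb2 m1 m2)"
proof (rule eq_matI)
  fix i j assume "i < dim_row (emb1 m1 m2 * mat_adjoint (emb1 m1 m2) + emb2 m1 m2 * mat_adjoint (emb2 m1 m2))"
    "j < dim_col (emb1 m1 m2 * mat_adjoint (emb1 m1 m2) + emb2 m1 m2 * mat_adjoint (emb2 m1 m2))"
  then have ij: "i < m1 + m2" "j < m1 + m2" by auto
  then show "1\<^sub>m (m1 + m2) $$ (i, j) = (emb1 m1 m2 * mat_adjoint (emb1 m1 m2) + emb2 m1 m2 * mat_adjoint (emb2 m1 m2)) $$ (i, j)"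
    using mult_adjoint_emb_index(1)[OF ij emb_carrier(1)] mult_adjoint_emb_index(2)[OF ij emb_carrier(2)]
    by (auto simp: emb1_def emb2_def simp del: index_mult_mat(1))
qed auto

lemma j_mat_facts:
  "j_mat m1 m2 \<in> carrier_mat (m1 + m2) (m1 + m2)" "mat_adjoint (j_mat m1 m2) = j_mat m1 m2"
  "mat_adjoint (emb1 m1 m2) * j_mat m1 m2 = mat_adjoint (emb1 m1 m2)"
  "mat_adjoint (emb2 m1 m2) * j_mat m1 m2 = (-1) \<cdot>\<^sub>m mat_adjoint (emb2 m1 m2)"
  "j_mat m1 m2 * emb1 m1 m2 = emb1 m1 m2"
  "j_mat m1 m2 * emb2 m1 m2 = (-1) \<cdot>\<^sub>m emb2 m1 m2"
  "j_mat m1 m2 * j_mat m1 m2 = 1\<^sub>m (m1 + m2)"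
proof -
  show c: "j_mat m1 m2 \<in> carrier_mat (m1 + m2) (m1 + m2)" by (auto simp: j_mat_eq)
  show s: "mat_adjoint (j_mat m1 m2) = j_mat m1 m2" unfolding j_mat_eq by (simp add: adjoint_simps)
  show l1: "j_mat m1 m2 * emb1 m1 m2 = emb1 m1 m2" and l2: "j_mat m1 m2 * emb2 m1 m2 = (-1) \<cdot>\<^sub>m emb2 m1 m2"
    unfolding j_mat_eq by (auto simp: mat_ring_simps emb_products intro!: eq_matI)
  show "mat_adjoint (emb1 m1 m2) * j_mat m1 m2 = mat_adjoint (emb1 m1 m2)"
    using arg_cong[OF l1, of mat_adjoint] c s by (simp add: adjoint_simps)
  show "mat_adjoint (emb2 m1 m2) * j_mat m1 m2 = (-1) \<cdot>\<^sub>m mat_adjoint (emb2 m1 m2)"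
    using arg_cong[OF l2, of mat_adjoint] c s by (simp add: adjoint_simps)
  have "j_mat m1 m2 * j_mat m1 m2 = j_mat m1 m2 * emb1 m1 m2 * mat_adjoint (emb1 m1 m2) +
      (-1) \<cdot>\<^sub>m (j_mat m1 m2 * emb2 m1 m2 * mat_adjoint (emb2 m1 m2))"
    using c by (subst (2) j_mat_eq) (simp add: mat_ring_simps)
  then show "j_mat m1 m2 * j_mat m1 m2 = 1\<^sub>m (m1 + m2)"
    unfolding l1 l2 one_mat_emb by (simp add: smult_mult_dim smult_smult_mat)
qed

lemma j_mat_cancel:
  "dim_row M = m1 + m2 \<Longrightarrow> j_mat m1 m2 * (j_mat m1 m2 * M) = M"
  using mult_assoc_dim[of "j_mat m1 m2" "j_mat m1 m2" M] j_mat_facts(1,7)[of m1 m2] by simp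

section \<open>Blocks of \<open>W\<close>, the form identity and state feedback\<close>

lemma block_carrier:
  assumes "W \<in> carrier_mat (m1 + m2) (m1 + m2)"
  shows "block11 m1 W = mat m1 m1 (\<lambda>(i, j). W $$ (i, j))"
    "block21 m1 W = mat m2 m1 (\<lambda>(i, j). W $$ (m1 + i, j))"
  using assms by (auto simp: block11_def block21_def split_block_def Let_def add.commute intro!: eq_matI)

lemma block_eval:
  fixes W :: ratmat
  assumes W: "W \<in> carrier_mat (m1 + m2) (m1 + m2)"
  shows "mat_eval (block11 m1 W) z = mat_adjoint (emb1 m1 m2) * (mat_eval W z * emb1 m1 m2)"
    "mat_eval (block21 m1 W) z = mat_adjoint (emb2 m1 m2) * (mat_eval W z * emb1 m1 m2)"
proof -
  let ?w = "mat_eval W z"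
  have w: "?w \<in> carrier_mat (m1 + m2) (m1 + m2)" using W by auto
  have we: "?w * emb1 m1 m2 \<in> carrier_mat (m1 + m2) m1" using W by simp
  show "mat_eval (block11 m1 W) z = mat_adjoint (emb1 m1 m2) * (?w * emb1 m1 m2)"
    by (rule eq_matI) (use W in \<open>auto simp: block_carrier[OF W] adjoint_emb_mult_index(1)[OF we]
      mult_emb_index(1)[OF w] simp del: index_mult_mat(1)\<close>)
  show "mat_eval (block21 m1 W) z = mat_adjoint (emb2 m1 m2) * (?w * emb1 m1 m2)"
    by (rule eq_matI) (use W in \<open>auto simp: block_carrier[OF W] adjoint_emb_mult_index(2)[OF we]
      mult_emb_index(1)[OF w] simp del: index_mult_mat(1)\<close>)
qed

text \<open>Here \<open>N\<close> is the state
  \<open>(z - \<alpha>)\<^sup>-\<^sup>1 \<Lambda>\<close>. Sandwiching the Lyapunov equation between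
  \<open>N\<^sup>*\<close> and \<open>N\<close> and replacing \<open>\<alpha> N\<close> by
  \<open>z N - \<Lambda>\<close> expresses the quadratic term \<open>P\<close> of
  \<open>W\<^sup>* J W\<close> through \<open>X\<close>. Its linear terms cancel those of the
  expansion, and \<open>z - cnj z\<close> leaves the factor \<open>2 * Im z\<close>.\<close>

lemma j_form_identity:
  fixes J :: "complex mat"
  assumes J: "J \<in> carrier_mat m m" "mat_adjoint J = J" "J * J = 1\<^sub>m m"
    and \<alpha>: "\<alpha> \<in> carrier_mat n n" and X: "X \<in> carrier_mat n n" "mat_adjoint X = X"
    and L: "\<Lambda> \<in> carrier_mat n m"
    and lyap: "X * \<alpha> = mat_adjoint \<alpha> * X + \<i> \<cdot>\<^sub>m (X * (\<Lambda> * (J * (mat_adjoint \<Lambda> * X))))"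
    and N: "N \<in> carrier_mat n m" "\<alpha> * N = z \<cdot>\<^sub>m N + (-1) \<cdot>\<^sub>m \<Lambda>"
  defines "W \<equiv> 1\<^sub>m m + \<i> \<cdot>\<^sub>m (J * (mat_adjoint \<Lambda> * X)) * N"
  shows "mat_adjoint W * (J * W) = J + complex_of_real (2 * Im z) \<cdot>\<^sub>m (mat_adjoint N * (X * N))"
proof -
  have JJ: "J * (J * M) = M" if "dim_row M = m" for M
    using mult_assoc_dim[of J J M] J that by simp
  have Nadj: "mat_adjoint N * mat_adjoint \<alpha> = cnj z \<cdot>\<^sub>m mat_adjoint N + (-1) \<cdot>\<^sub>m mat_adjoint \<Lambda>"
    using arg_cong[OF N(2), of mat_adjoint] N(1) L \<alpha> by (simp add: adjoint_simps)
  have e1: "mat_adjoint N * (X * \<alpha>) * N = z \<cdot>\<^sub>m (mat_adjoint N * (X * N)) + (-1) \<cdot>\<^sub>m (mat_adjoint N * (X * \<Lambda>))"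
  proof -
    have "mat_adjoint N * (X * \<alpha>) * N = mat_adjoint N * (X * (\<alpha> * N))"
      using N(1) X(1) \<alpha> by (simp add: mult_assoc_dim)
    then show ?thesis unfolding N(2) using N(1) X(1) L by (simp add: mat_ring_simps)
  qed
  have e2: "mat_adjoint N * (mat_adjoint \<alpha> * X) * N = cnj z \<cdot>\<^sub>m (mat_adjoint N * (X * N)) + (-1) \<cdot>\<^sub>m (mat_adjoint \<Lambda> * (X * N))"
  proof -
    have "mat_adjoint N * (mat_adjoint \<alpha> * X) * N = mat_adjoint N * mat_adjoint \<alpha> * (X * N)"
      using N(1) X(1) \<alpha> by (simp add: mult_assoc_dim)
    then show ?thesis unfolding Nadj using N(1) X(1) L by (simp add: mat_ring_simps)
  qed
  define P where "P = mat_adjoint N * (X * (\<Lambda> * (J * (mat_adjoint \<Lambda> * (X * N)))))"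
  have "mat_adjoint N * (X * \<alpha>) * N = mat_adjoint N * (mat_adjoint \<alpha> * X) * N + \<i> \<cdot>\<^sub>m P"
    unfolding lyap P_def using N(1) X(1) L J(1) \<alpha> by (simp add: mat_ring_simps)
  then have *: "z \<cdot>\<^sub>m (mat_adjoint N * (X * N)) + (-1) \<cdot>\<^sub>m (mat_adjoint N * (X * \<Lambda>)) =
      cnj z \<cdot>\<^sub>m (mat_adjoint N * (X * N)) + (-1) \<cdot>\<^sub>m (mat_adjoint \<Lambda> * (X * N)) + \<i> \<cdot>\<^sub>m P"
    unfolding e1 e2 .
  have Pc: "P \<in> carrier_mat m m" using N by (simp add: P_def)
  have zz: "z - cnj z = \<i> * complex_of_real (2 * Im z)" by (simp add: complex_eq_iff)
  have Peq: "P = complex_of_real (2 * Im z) \<cdot>\<^sub>m (mat_adjoint N * (X * N)) + \<i> \<cdot>\<^sub>m (mat_adjoint N * (X * \<Lambda>)) +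
      (- \<i>) \<cdot>\<^sub>m (mat_adjoint \<Lambda> * (X * N))"
  proof (rule eq_matI)
    fix i j assume "i < dim_row (complex_of_real (2 * Im z) \<cdot>\<^sub>m (mat_adjoint N * (X * N)) + \<i> \<cdot>\<^sub>m (mat_adjoint N * (X * \<Lambda>)) +
      (- \<i>) \<cdot>\<^sub>m (mat_adjoint \<Lambda> * (X * N)))"
      "j < dim_col (complex_of_real (2 * Im z) \<cdot>\<^sub>m (mat_adjoint N * (X * N)) + \<i> \<cdot>\<^sub>m (mat_adjoint N * (X * \<Lambda>)) +
      (- \<i>) \<cdot>\<^sub>m (mat_adjoint \<Lambda> * (X * N)))"
    then have ij: "i < m" "j < m" using N L by auto
    let ?a = "(mat_adjoint N * (X * N)) $$ (i, j)" and ?b = "(mat_adjoint N * (X * \<Lambda>)) $$ (i, j)"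
      and ?c = "(mat_adjoint \<Lambda> * (X * N)) $$ (i, j)" and ?p = "P $$ (i, j)"
    have "z * ?a - ?b = cnj z * ?a - ?c + \<i> * ?p"
      using arg_cong[OF *, of "\<lambda>M. M $$ (i, j)"] ij N L X Pc by (simp del: index_mult_mat(1))
    then have "\<i> * ?p = (z - cnj z) * ?a - ?b + ?c" by (simp add: algebra_simps)
    then have "\<i> * ?p = \<i> * (complex_of_real (2 * Im z) * ?a + \<i> * ?b - \<i> * ?c)"
      unfolding zz by (simp add: algebra_simps)
    then have "?p = complex_of_real (2 * Im z) * ?a + \<i> * ?b - \<i> * ?c" by (metis complex_i_not_zero mult_cancel_left)
    then show "P $$ (i, j) = (complex_of_real (2 * Im z) \<cdot>\<^sub>m (mat_adjoint N * (X * N)) + \<i> \<cdot>\<^sub>m (mat_adjoint N * (X * \<Lambda>)) +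
      (- \<i>) \<cdot>\<^sub>m (mat_adjoint \<Lambda> * (X * N))) $$ (i, j)"
      using ij N L X by (simp del: index_mult_mat(1))
  qed (use Pc N L in auto)
  have "mat_adjoint W * (J * W) = J + \<i> \<cdot>\<^sub>m (mat_adjoint \<Lambda> * (X * N)) + (- \<i>) \<cdot>\<^sub>m (mat_adjoint N * (X * \<Lambda>)) + P"
  proof -
    have 1: "J * W = J + \<i> \<cdot>\<^sub>m (mat_adjoint \<Lambda> * (X * N))"
      unfolding W_def using J(1) N(1) X(1) L by (simp add: mat_ring_simps JJ)
    have 2: "mat_adjoint W = 1\<^sub>m m + (- \<i>) \<cdot>\<^sub>m (mat_adjoint N * (X * (\<Lambda> * J)))"
      unfolding W_def using J N(1) X L by (simp add: mat_ring_simps adjoint_simps)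
    show ?thesis unfolding 1 2 P_def using J(1) N(1) X(1) L J(3)
      by (auto simp: mat_ring_simps intro!: eq_matI simp del: index_mult_mat(1))
  qed
  then show ?thesis unfolding Peq using J N L X
    by (auto intro!: eq_matI simp del: index_mult_mat(1))
qed

text \<open>Both identities rest on \<open>(z - A)\<^sup>-\<^sup>1 B = (z -
  \<alpha>)\<^sup>-\<^sup>1 B (1 - K (z - A)\<^sup>-\<^sup>1 B)\<close>. The first is the usual
  inverse of a system with identity feedthrough; the second says that multiplying by this inverse
  amounts to state feedback and leaves input and output matrices alone.\<close>

lemma feedback_transfer:
  assumes \<alpha>: "\<alpha> \<in> carrier_mat n n" and B: "B \<in> carrier_mat n m" and K: "K \<in> carrier_mat m n"
    and C: "C \<in> carrier_mat p n"
  defines "A \<equiv> \<alpha> - B * K"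
  shows "transfer_fun \<alpha> B K (1\<^sub>m m) * transfer_fun A B ((-1) \<cdot>\<^sub>m K) (1\<^sub>m m) = 1\<^sub>m m"
    "transfer_fun \<alpha> B C (0\<^sub>m p m) * transfer_fun A B ((-1) \<cdot>\<^sub>m K) (1\<^sub>m m) = transfer_fun A B C (0\<^sub>m p m)"
proof -
  have A: "A \<in> carrier_mat n n" using \<alpha> B K by (simp add: A_def)
  have K': "(-1) \<cdot>\<^sub>m K \<in> carrier_mat m n" using K by simp
  let ?S = "UNIV - ({z. eigenvalue \<alpha> z} \<union> {z. eigenvalue A z})"
  have inf: "infinite ?S"
    using finite_eigenvalues[OF A] finite_eigenvalues[OF \<alpha>] by (intro infinite_complex_Diff) simp
  have key: "resolvent A z * B = resolvent \<alpha> z * B * (1\<^sub>m m + (-1) \<cdot>\<^sub>m (K * (resolvent A z * B)))"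
    if z: "z \<in> ?S" for z
  proof -
    have z': "\<not> eigenvalue \<alpha> z" "\<not> eigenvalue A z" using z by auto
    note R = resolvent(1)[OF \<alpha> z'(1)] resolvent(1)[OF A z'(2)]
    define M where "M = resolvent A z * B"
    have M: "M \<in> carrier_mat n m" using R B by (simp add: M_def)
    have "z \<cdot>\<^sub>m M - A * M = B" unfolding M_def by (rule mult_resolvent(1)[OF A z'(2) B])
    moreover have "A * M = \<alpha> * M + (-1) \<cdot>\<^sub>m (B * (K * M))"
      unfolding A_def using \<alpha> B K M by (simp add: mat_ring_simps)
    ultimately have eq: "z \<cdot>\<^sub>m M - (\<alpha> * M + (-1) \<cdot>\<^sub>m (B * (K * M))) = B" by simp
    have "z \<cdot>\<^sub>m M - \<alpha> * M = B * (1\<^sub>m m + (-1) \<cdot>\<^sub>m (K * M))"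
    proof (rule eq_matI)
      fix i j assume "i < dim_row (B * (1\<^sub>m m + (-1) \<cdot>\<^sub>m (K * M)))" "j < dim_col (B * (1\<^sub>m m + (-1) \<cdot>\<^sub>m (K * M)))"
      then have ij: "i < n" "j < m" using B M by auto
      have "B * (1\<^sub>m m + (-1) \<cdot>\<^sub>m (K * M)) = B + (-1) \<cdot>\<^sub>m (B * (K * M))"
        using B K M by (simp add: mat_ring_simps)
      then show "(z \<cdot>\<^sub>m M - \<alpha> * M) $$ (i, j) = (B * (1\<^sub>m m + (-1) \<cdot>\<^sub>m (K * M))) $$ (i, j)"
        using arg_cong[OF eq, of "\<lambda>M. M $$ (i, j)"] ij \<alpha> B K M by (simp add: algebra_simps del: index_mult_mat(1))
    qed (use \<alpha> B M in auto)
    then have "resolvent \<alpha> z * (B * (1\<^sub>m m + (-1) \<cdot>\<^sub>m (K * M))) = M"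
      by (rule resolvent_unique[OF \<alpha> z'(1) M])
    then show ?thesis unfolding M_def[symmetric] using R B K M by (simp add: mult_assoc_dim)
  qed
  have D: "1\<^sub>m m \<in> carrier_mat m m" "0\<^sub>m p m \<in> carrier_mat p m" by simp_all
  note T = transfer_fun_eval[OF \<alpha> B K D(1)] transfer_fun_eval[OF \<alpha> B C D(2)]
    transfer_fun_eval[OF A B K' D(1)] transfer_fun_eval[OF A B C D(2)]
  have dims: "transfer_fun \<alpha> B K (1\<^sub>m m) \<in> carrier_mat m m" "transfer_fun A B ((-1) \<cdot>\<^sub>m K) (1\<^sub>m m) \<in> carrier_mat m m"
    "transfer_fun \<alpha> B C (0\<^sub>m p m) \<in> carrier_mat p m" "transfer_fun A B C (0\<^sub>m p m) \<in> carrier_mat p m"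
    using dim_transfer_fun \<alpha> A B C K K' by blast+
  show "transfer_fun \<alpha> B K (1\<^sub>m m) * transfer_fun A B ((-1) \<cdot>\<^sub>m K) (1\<^sub>m m) = 1\<^sub>m m"
  proof (rule ratmat_eqI[OF _ _ inf])
    fix z assume z: "z \<in> ?S"
    then have z': "\<not> eigenvalue \<alpha> z" "\<not> eigenvalue A z" by auto
    note R = resolvent(1)[OF \<alpha> z'(1)] resolvent(1)[OF A z'(2)]
    define M N where "M = resolvent A z * B" and "N = resolvent \<alpha> z * B"
    have MN: "M \<in> carrier_mat n m" "N \<in> carrier_mat n m" using R B by (auto simp: M_def N_def)
    have k: "N * (1\<^sub>m m + (-1) \<cdot>\<^sub>m (K * M)) = M" using key[OF z] by (simp add: M_def N_def)
    have "mat_eval (transfer_fun \<alpha> B K (1\<^sub>m m) * transfer_fun A B ((-1) \<cdot>\<^sub>m K) (1\<^sub>m m)) z =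
        (1\<^sub>m m + K * N) * (1\<^sub>m m + (-1) \<cdot>\<^sub>m K * M)"
      using mat_eval_mult(1)[of "transfer_fun \<alpha> B K (1\<^sub>m m)" "transfer_fun A B ((-1) \<cdot>\<^sub>m K) (1\<^sub>m m)" z] dims T z'
      by (simp add: M_def N_def)
    also have "(1\<^sub>m m + K * N) * (1\<^sub>m m + (-1) \<cdot>\<^sub>m K * M) =
        1\<^sub>m m + (-1) \<cdot>\<^sub>m (K * M) + K * (N * (1\<^sub>m m + (-1) \<cdot>\<^sub>m (K * M)))"
    proof -
      have s: "(-1) \<cdot>\<^sub>m K * M = (-1) \<cdot>\<^sub>m (K * M)" using K MN by (simp add: smult_mult_dim)
      have "1\<^sub>m m + (-1) \<cdot>\<^sub>m (K * M) \<in> carrier_mat m m" using K MN by simp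
      then show ?thesis unfolding s using K MN by (simp add: add_mult_dim mult_assoc_dim)
    qed
    also have "\<dots> = 1\<^sub>m m" unfolding k using K MN by (auto intro!: eq_matI simp del: index_mult_mat(1))
    finally show "mat_eval (transfer_fun \<alpha> B K (1\<^sub>m m) * transfer_fun A B ((-1) \<cdot>\<^sub>m K) (1\<^sub>m m)) z = mat_eval (1\<^sub>m m) z"
      by (auto intro!: eq_matI)
  qed (use dims in auto)
  show "transfer_fun \<alpha> B C (0\<^sub>m p m) * transfer_fun A B ((-1) \<cdot>\<^sub>m K) (1\<^sub>m m) = transfer_fun A B C (0\<^sub>m p m)"
  proof (rule ratmat_eqI[OF _ _ inf])
    fix z assume z: "z \<in> ?S"
    then have z': "\<not> eigenvalue \<alpha> z" "\<not> eigenvalue A z" by auto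
    note R = resolvent(1)[OF \<alpha> z'(1)] resolvent(1)[OF A z'(2)]
    define M N where "M = resolvent A z * B" and "N = resolvent \<alpha> z * B"
    have MN: "M \<in> carrier_mat n m" "N \<in> carrier_mat n m" using R B by (auto simp: M_def N_def)
    have k: "N * (1\<^sub>m m + (-1) \<cdot>\<^sub>m (K * M)) = M" using key[OF z] by (simp add: M_def N_def)
    have s: "(-1) \<cdot>\<^sub>m K * M = (-1) \<cdot>\<^sub>m (K * M)" using K MN by (simp add: smult_mult_dim)
    have "mat_eval (transfer_fun \<alpha> B C (0\<^sub>m p m) * transfer_fun A B ((-1) \<cdot>\<^sub>m K) (1\<^sub>m m)) z =
        (0\<^sub>m p m + C * N) * (1\<^sub>m m + (-1) \<cdot>\<^sub>m K * M)"
      using mat_eval_mult(1)[of "transfer_fun \<alpha> B C (0\<^sub>m p m)" "transfer_fun A B ((-1) \<cdot>\<^sub>m K) (1\<^sub>m m)" z] dims T z'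
      by (simp add: M_def N_def)
    also have "\<dots> = C * (N * (1\<^sub>m m + (-1) \<cdot>\<^sub>m (K * M)))"
      unfolding s using C K MN by (simp add: mult_assoc_dim)
    also have "\<dots> = 0\<^sub>m p m + C * M" unfolding k using C MN by simp
    finally show "mat_eval (transfer_fun \<alpha> B C (0\<^sub>m p m) * transfer_fun A B ((-1) \<cdot>\<^sub>m K) (1\<^sub>m m)) z =
        mat_eval (transfer_fun A B C (0\<^sub>m p m)) z"
      using T z' by (simp add: M_def)
  qed (use dims in auto)
qed

lemma transfer_fun_blocks:
  assumes \<alpha>: "\<alpha> \<in> carrier_mat n n" and Bw: "Bw \<in> carrier_mat n (m1 + m2)" and Cw: "Cw \<in> carrier_mat (m1 + m2) n"
  shows "block11 m1 (transfer_fun \<alpha> Bw Cw (1\<^sub>m (m1 + m2))) =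
      transfer_fun \<alpha> (Bw * emb1 m1 m2) (mat_adjoint (emb1 m1 m2) * Cw) (1\<^sub>m m1)"
    "block21 m1 (transfer_fun \<alpha> Bw Cw (1\<^sub>m (m1 + m2))) =
      transfer_fun \<alpha> (Bw * emb1 m1 m2) (mat_adjoint (emb2 m1 m2) * Cw) (0\<^sub>m m2 m1)"
proof -
  let ?W = "transfer_fun \<alpha> Bw Cw (1\<^sub>m (m1 + m2))"
  have W: "?W \<in> carrier_mat (m1 + m2) (m1 + m2)" by (rule dim_transfer_fun[OF \<alpha> Bw Cw])
  have ev: "mat_eval ?W z = 1\<^sub>m (m1 + m2) + Cw * (resolvent \<alpha> z * Bw)" if "\<not> eigenvalue \<alpha> z" for z
    by (rule transfer_fun_eval(1)[OF \<alpha> Bw Cw _ that]) simp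
  show "block11 m1 ?W = transfer_fun \<alpha> (Bw * emb1 m1 m2) (mat_adjoint (emb1 m1 m2) * Cw) (1\<^sub>m m1)"
  proof (rule transfer_fun_eqI[OF _ \<alpha> _ _ _ finite.emptyI])
    fix z assume z: "\<not> eigenvalue \<alpha> z"
    show "mat_eval (block11 m1 ?W) z = 1\<^sub>m m1 + mat_adjoint (emb1 m1 m2) * Cw * (resolvent \<alpha> z * (Bw * emb1 m1 m2))"
      unfolding block_eval[OF W] ev[OF z] using resolvent(1)[OF \<alpha> z] Bw Cw
      by (simp add: add_mult_dim mult_add_dim mult_assoc_dim emb_products)
  qed (use \<alpha> Bw Cw in \<open>auto simp: block_carrier[OF W]\<close>)
  show "block21 m1 ?W = transfer_fun \<alpha> (Bw * emb1 m1 m2) (mat_adjoint (emb2 m1 m2) * Cw) (0\<^sub>m m2 m1)"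
  proof (rule transfer_fun_eqI[OF _ \<alpha> _ _ _ finite.emptyI])
    fix z assume z: "\<not> eigenvalue \<alpha> z"
    show "mat_eval (block21 m1 ?W) z = 0\<^sub>m m2 m1 + mat_adjoint (emb2 m1 m2) * Cw * (resolvent \<alpha> z * (Bw * emb1 m1 m2))"
      unfolding block_eval[OF W] ev[OF z] using resolvent(1)[OF \<alpha> z] Bw Cw
      by (simp add: add_mult_dim mult_add_dim mult_assoc_dim emb_products)
  qed (use \<alpha> Bw Cw in \<open>auto simp: block_carrier[OF W]\<close>)
qed

text \<open>The blocks \<open>W\<^sub>1\<^sub>1\<close> and \<open>W\<^sub>2\<^sub>1\<close> share
  state matrix and input, so dividing by the first is state feedback with gain
  \<open>mat_adjoint (emb1 m1 m2) * Cw\<close>. Invertibility of \<open>W\<^sub>1\<^sub>1\<close>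
  comes for free from its identity feedthrough.\<close>

lemma quotient_rel_realization:
  assumes \<alpha>: "\<alpha> \<in> carrier_mat n n" and Bw: "Bw \<in> carrier_mat n (m1 + m2)" and Cw: "Cw \<in> carrier_mat (m1 + m2) n"
  defines "B \<equiv> Bw * emb1 m1 m2"
  defines "A \<equiv> \<alpha> - B * (mat_adjoint (emb1 m1 m2) * Cw)"
  shows "quotient_rel m1 (transfer_fun \<alpha> Bw Cw (1\<^sub>m (m1 + m2))) R \<longleftrightarrow>
    R = transfer_fun A B (mat_adjoint (emb2 m1 m2) * Cw) (0\<^sub>m m2 m1)"
proof -
  let ?K = "mat_adjoint (emb1 m1 m2) * Cw" and ?C = "mat_adjoint (emb2 m1 m2) * Cw"
  have c: "B \<in> carrier_mat n m1" "?K \<in> carrier_mat m1 n" "?C \<in> carrier_mat m2 n"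
    using Bw Cw by (auto simp: B_def)
  note F = feedback_transfer[OF \<alpha> c, folded A_def]
  let ?G = "transfer_fun \<alpha> B ?K (1\<^sub>m m1)" and ?G' = "transfer_fun A B ((-1) \<cdot>\<^sub>m ?K) (1\<^sub>m m1)"
  have G: "?G \<in> carrier_mat m1 m1" by (rule dim_transfer_fun[OF \<alpha> c(1,2)])
  have A: "A \<in> carrier_mat n n" using c by (simp add: A_def)
  have K': "(-1) \<cdot>\<^sub>m ?K \<in> carrier_mat m1 n" using c by simp
  have G': "?G' \<in> carrier_mat m1 m1" by (rule dim_transfer_fun[OF A c(1) K'])
  have inv: "invertible_mat ?G"
    by (rule invertible_matI[OF G G' F(1) mat_mult_left_right_inverse[OF G G' F(1)]])
  have "mat_inv ?G = ?G'" by (rule mat_inv_eq[OF G G' F(1)])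
  then show ?thesis
    unfolding quotient_rel_def transfer_fun_blocks[OF \<alpha> Bw Cw] B_def[symmetric] using inv F(2) by auto
qed

section \<open>Contractivity and its extension across exceptional points\<close>

lemma at_within_neq_bot_half_planes:
  "z \<in> \<real> \<Longrightarrow> at z within \<real> \<noteq> (bot :: complex filter)"
  "z \<in> upper_half_plane \<Longrightarrow> at z within upper_half_plane \<noteq> bot"
  "z \<in> lower_half_plane \<Longrightarrow> at z within lower_half_plane \<noteq> bot"
proof -
  have *: "at z within T \<noteq> bot" if T: "\<And>d :: real. 0 < d \<Longrightarrow> z + complex_of_real d * c \<in> T" and c: "cmod c = 1" for T c
  proof
    assume "at z within T = bot"
    then have "eventually (\<lambda>x. False) (at z within T)" by simp
    then obtain d where d: "0 < d" "\<And>x. x \<in> T \<Longrightarrow> x \<noteq> z \<Longrightarrow> dist x z < d \<Longrightarrow> False"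
      unfolding eventually_at by auto
    show False
    proof (rule d(2)[OF T[of "d / 2"]])
      show "z + complex_of_real (d / 2) * c \<noteq> z" using d c by auto
      show "dist (z + complex_of_real (d / 2) * c) z < d" using d c by (simp add: dist_norm norm_mult)
    qed (use d in simp)
  qed
  show "z \<in> \<real> \<Longrightarrow> at z within \<real> \<noteq> bot" by (rule *[where c = 1]) auto
  show "z \<in> upper_half_plane \<Longrightarrow> at z within upper_half_plane \<noteq> bot"
    by (rule *[where c = \<i>]) (auto simp: upper_half_plane_def)
  show "z \<in> lower_half_plane \<Longrightarrow> at z within lower_half_plane \<noteq> bot"
    by (rule *[where c = "- \<i>"]) (auto simp: lower_half_plane_def)
qed

lemma eventually_within_Diff_finite:
  fixes z :: complex
  assumes "finite S" "\<And>w. w \<in> T \<Longrightarrow> w \<notin> S \<Longrightarrow> P w"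
  shows "eventually P (at z within T)"
proof -
  have "eventually (\<lambda>w. w \<in> T) (at z within T)" unfolding eventually_at_filter by simp
  with eventually_notin_finite_at[OF assms(1)] show ?thesis
    by eventually_elim (use assms(2) in blast)
qed

lemma contraction_iff:
  fixes R :: "complex mat"
  assumes R: "R \<in> carrier_mat p m"
  shows "loewner_le (mat_adjoint R * R) (1\<^sub>m m) \<longleftrightarrow>
    (\<forall>v \<in> carrier_mat m 1. (mat_adjoint (R * v) * (R * v)) $$ (0, 0) \<le> (mat_adjoint v * v) $$ (0, 0))"
proof -
  have "(mat_adjoint v * ((1\<^sub>m m - mat_adjoint R * R) * v)) $$ (0, 0) =
      (mat_adjoint v * v) $$ (0, 0) - (mat_adjoint (R * v) * (R * v)) $$ (0, 0)" if v: "v \<in> carrier_mat m 1" for v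
  proof -
    have "mat_adjoint v * ((1\<^sub>m m - mat_adjoint R * R) * v) = mat_adjoint v * v + (-1) \<cdot>\<^sub>m (mat_adjoint (R * v) * (R * v))"
      using R v by (simp add: mat_ring_simps adjoint_simps)
    then show ?thesis using R v by (simp del: index_mult_mat(1))
  qed
  moreover have "mat_adjoint R * R \<in> carrier_mat m m" using R by simp
  ultimately show ?thesis by (simp add: loewner_le_iff[of _ m] del: index_mult_mat(1))
qed

text \<open>Applied to a unit vector, the contraction bounds the norm of a column and hence each of
  its entries.\<close>

lemma contraction_entry_le:
  fixes R :: "complex mat"
  assumes R: "R \<in> carrier_mat p m" and le: "loewner_le (mat_adjoint R * R) (1\<^sub>m m)" and ij: "i < p" "j < m"
  shows "cmod (R $$ (i, j)) \<le> 1"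
proof -
  define e :: "complex mat" where "e = mat m 1 (\<lambda>(l, _). if l = j then 1 else 0)"
  have e: "e \<in> carrier_mat m 1" by (simp add: e_def)
  have ee: "(mat_adjoint e * e) $$ (0, 0) = 1"
  proof -
    have "(\<Sum>l<m. (cmod (e $$ (l, 0)))\<^sup>2) = (\<Sum>l<m. if l = j then 1 else 0)"
      by (rule sum.cong) (auto simp: e_def)
    then show ?thesis using adjoint_mult_self_index[of 0 e] e ij by simp
  qed
  have Re: "(R * e) $$ (i, 0) = R $$ (i, j)"
  proof -
    have "(R * e) $$ (i, 0) = (\<Sum>l = 0..<m. R $$ (i, l) * e $$ (l, 0))"
      using mult_entry[of i R 0 e] R e ij by simp
    also have "\<dots> = (\<Sum>l = 0..<m. if l = j then R $$ (i, l) else 0)" by (rule sum.cong) (auto simp: e_def)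
    finally show ?thesis using ij by simp
  qed
  have "(\<Sum>l<p. (cmod ((R * e) $$ (l, 0)))\<^sup>2) \<le> 1"
    using le[unfolded contraction_iff[OF R]] e ee adjoint_mult_self_index[of 0 "R * e"] R
    by (auto simp: less_eq_complex_def simp del: index_mult_mat(1))
  moreover have "(cmod ((R * e) $$ (i, 0)))\<^sup>2 \<le> (\<Sum>l<p. (cmod ((R * e) $$ (l, 0)))\<^sup>2)"
    using ij by (intro member_le_sum) auto
  ultimately have "(cmod (R $$ (i, j)))\<^sup>2 \<le> 1" unfolding Re by simp
  then show ?thesis by (simp add: power_le_one_iff)
qed

text \<open>Near a point of \<open>T\<close> the entries are bounded by 1 off a finite set, which
  excludes poles; once the function is known to be continuous at the point, the inequality extends
  to it. Limits are taken within \<open>T\<close>, so its points must not be isolated.\<close>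

lemma contractive_on_cofinite:
  assumes R: "R \<in> carrier_mat p m" and S: "finite S"
    and T: "\<And>z. z \<in> T \<Longrightarrow> at z within T \<noteq> bot"
    and le: "\<And>z. z \<in> T \<Longrightarrow> z \<notin> S \<Longrightarrow> loewner_le (mat_adjoint (mat_eval R z) * mat_eval R z) (1\<^sub>m m)"
  shows "contractive_on T R"
proof -
  have c: "mat_eval R z \<in> carrier_mat p m" for z using R by (intro carrier_matI) auto
  have ns: "\<not> is_singular_at R z" if z: "z \<in> T" for z
  proof -
    have "\<not> rat_pole (R $$ (i, j)) z" if ij: "i < p" "j < m" for i j
    proof (rule rat_eval_bounded_imp_not_pole[OF _ T[OF z]])
      show "eventually (\<lambda>w. cmod (rat_eval (R $$ (i, j)) w) \<le> 1) (at z within T)"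
        using contraction_entry_le[OF c le ij] ij R by (intro eventually_within_Diff_finite[OF S]) auto
    qed
    then show ?thesis using R by (auto simp: is_singular_at_iff)
  qed
  have "loewner_le (mat_adjoint (mat_eval R z) * mat_eval R z) (1\<^sub>m m)" if z: "z \<in> T" for z
  proof (rule loewner_le_limit[OF _ mat_tendsto_const _ _ _ T[OF z]])
    note C = mat_eval_continuous[OF ns[OF z], of T]
    show "mat_tendsto (\<lambda>w. mat_adjoint (mat_eval R w) * mat_eval R w) (mat_adjoint (mat_eval R z) * mat_eval R z) (at z within T)"
      by (intro mat_tendsto_mult mat_tendsto_adjoint C) (use c in auto)
    show "eventually (\<lambda>w. loewner_le (mat_adjoint (mat_eval R w) * mat_eval R w) (1\<^sub>m m)) (at z within T)"
      using le by (rule eventually_within_Diff_finite[OF S])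
  qed (use R in auto)
  then show ?thesis unfolding contractive_on_def regular_on_def using ns R by auto
qed

lemma loewner_le_refl:
  assumes "M \<in> carrier_mat n n"
  shows "loewner_le M M"
proof -
  have "M - M = 0\<^sub>m n n" using assms by auto
  then show ?thesis unfolding loewner_le_iff[OF assms assms] using assms by auto
qed

lemma j_form_limit:
  fixes W :: ratmat
  assumes W: "W \<in> carrier_mat (m1 + m2) (m1 + m2)" and z: "\<not> is_singular_at W z"
  shows "mat_tendsto (\<lambda>w. mat_adjoint (mat_eval W w) * j_mat m1 m2 * mat_eval W w)
      (mat_adjoint (mat_eval W z) * j_mat m1 m2 * mat_eval W z) (at z within T)"
  by (intro mat_tendsto_mult mat_tendsto_adjoint mat_eval_continuous[OF z] mat_tendsto_const)
    (use W j_mat_facts(1)[of m1 m2] in auto)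

text \<open>Restricted to the first coordinate block, the inequality reads
  \<open>a\<^sup>* a - c\<^sup>* c \<ge> 1\<close> for the first block column of \<open>W\<close>.
  Hence \<open>a\<close> is injective and the norm of \<open>c u\<close> is at most that of
  \<open>a u\<close>, which is contractivity of \<open>c a\<^sup>-\<^sup>1\<close>.\<close>

lemma contractive_quotient:
  assumes W: "W \<in> carrier_mat (m1 + m2) (m1 + m2)" "tends_at_infinity W (1\<^sub>m (m1 + m2))"
    and real: "is_realization W n \<alpha> Bw Cw (1\<^sub>m (m1 + m2))" and R: "quotient_rel m1 W R"
    and T: "\<And>z. z \<in> T \<Longrightarrow> at z within T \<noteq> bot"
    and jle: "\<And>z. z \<in> T \<Longrightarrow> \<not> is_singular_at W z \<Longrightarrow>
      loewner_le (j_mat m1 m2) (mat_adjoint (mat_eval W z) * j_mat m1 m2 * mat_eval W z)"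
  shows "contractive_on T R"
proof -
  define E1 E2 where "E1 = emb1 m1 m2" and "E2 = emb2 m1 m2"
  have E: "E1 \<in> carrier_mat (m1 + m2) m1" "E2 \<in> carrier_mat (m1 + m2) m2" by (auto simp: E1_def E2_def)
  have \<alpha>: "\<alpha> \<in> carrier_mat n n" and Bw: "Bw \<in> carrier_mat n (m1 + m2)" and Cw: "Cw \<in> carrier_mat (m1 + m2) n"
    and Wt: "W = transfer_fun \<alpha> Bw Cw (1\<^sub>m (m1 + m2))"
    using is_realization_carrier[OF real] W(1) by auto
  have inv: "invertible_mat (block11 m1 W)" and Req: "R = block21 m1 W * mat_inv (block11 m1 W)"
    using R unfolding quotient_rel_def by auto
  have b: "block11 m1 W \<in> carrier_mat m1 m1" "block21 m1 W \<in> carrier_mat m2 m1"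
    by (simp_all add: block_carrier[OF W(1)])
  note I = invertible_mat_inv[OF b(1) inv]
  have Rc: "R \<in> carrier_mat m2 m1" unfolding Req using b I by simp
  have RW: "R * block11 m1 W = block21 m1 W"
    unfolding Req using b I by (simp add: mult_assoc_dim)
  define S where "S = {z. is_singular_at W z} \<union> {z. is_singular_at R z}"
  show ?thesis
  proof (rule contractive_on_cofinite[OF Rc _ T])
    show "finite S" unfolding S_def by (simp add: finite_is_singular_at)
    fix z assume z: "z \<in> T" "z \<notin> S"
    then have ns: "\<not> is_singular_at W z" "\<not> is_singular_at R z" by (auto simp: S_def)
    define w r where "w = mat_eval W z" and "r = mat_eval R z"
    have wr: "w \<in> carrier_mat (m1 + m2) (m1 + m2)" "r \<in> carrier_mat m2 m1"
      using W Rc by (auto simp: w_def r_def)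
    have ns': "\<not> is_singular_at (block11 m1 W) z"
      using ns(1) W(1) by (auto simp: is_singular_at_iff block_carrier[OF W(1)])
    have "r * mat_eval (block11 m1 W) z = mat_eval (block21 m1 W) z"
      using mat_eval_mult(1)[OF _ ns(2) ns'] RW b Rc by (simp add: r_def)
    then have rw: "r * (mat_adjoint E1 * (w * E1)) = mat_adjoint E2 * (w * E1)"
      unfolding block_eval[OF W(1)] by (simp add: w_def E1_def E2_def)
    define a c where "a = mat_adjoint E1 * (w * E1)" and "c = mat_adjoint E2 * (w * E1)"
    have ac: "a \<in> carrier_mat m1 m1" "c \<in> carrier_mat m2 m1" using E by (auto simp: a_def c_def)
    have J: "j_mat m1 m2 \<in> carrier_mat (m1 + m2) (m1 + m2)" by (rule j_mat_facts)
    \<comment> \<open>The form inequality is tested on \<open>E1 * v\<close>, where \<open>j\<close>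
      acts as the identity.\<close>
    have ineq: "Re ((mat_adjoint v * v) $$ (0, 0)) + Re ((mat_adjoint (c * v) * (c * v)) $$ (0, 0)) \<le>
        Re ((mat_adjoint (a * v) * (a * v)) $$ (0, 0))" if v: "v \<in> carrier_mat m1 1" for v
    proof -
      let ?M = "mat_adjoint w * j_mat m1 m2 * w"
      have "loewner_le (j_mat m1 m2) ?M" using jle[OF z(1) ns(1)] by (simp add: w_def)
      moreover have "?M \<in> carrier_mat (m1 + m2) (m1 + m2)" using wr by simp
      moreover have "E1 * v \<in> carrier_mat (m1 + m2) 1" using E v by simp
      ultimately have le: "0 \<le> (mat_adjoint (E1 * v) * ((?M - j_mat m1 m2) * (E1 * v))) $$ (0, 0)"
        using loewner_le_iff[OF J] by blast
      have jj: "mat_adjoint E1 * j_mat m1 m2 * E1 = 1\<^sub>m m1"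
        unfolding E1_def j_mat_facts by (rule emb_products)
      have "mat_adjoint (E1 * v) * ((?M - j_mat m1 m2) * (E1 * v)) =
          mat_adjoint v * (mat_adjoint (w * E1) * (j_mat m1 m2 * (w * E1)) * v) +
          (-1) \<cdot>\<^sub>m (mat_adjoint v * (mat_adjoint E1 * j_mat m1 m2 * E1 * v))"
        using J wr(1) E(1) v by (simp add: mat_ring_simps adjoint_simps)
      also have "mat_adjoint (w * E1) * (j_mat m1 m2 * (w * E1)) = mat_adjoint a * a + (-1) \<cdot>\<^sub>m (mat_adjoint c * c)"
        unfolding j_mat_eq a_def c_def E1_def[symmetric] E2_def[symmetric]
        using wr(1) E by (simp add: mat_ring_simps adjoint_simps)
      also have "mat_adjoint v * ((mat_adjoint a * a + (-1) \<cdot>\<^sub>m (mat_adjoint c * c)) * v) =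
          mat_adjoint (a * v) * (a * v) + (-1) \<cdot>\<^sub>m (mat_adjoint (c * v) * (c * v))"
        using ac v by (simp add: mat_ring_simps adjoint_simps)
      finally have eq: "mat_adjoint (E1 * v) * ((?M - j_mat m1 m2) * (E1 * v)) =
          mat_adjoint (a * v) * (a * v) + (-1) \<cdot>\<^sub>m (mat_adjoint (c * v) * (c * v)) + (-1) \<cdot>\<^sub>m (mat_adjoint v * v)"
        unfolding jj using v by simp
      show ?thesis using le unfolding eq using ac v by (simp add: less_eq_complex_def del: index_mult_mat(1))
    qed
    have nn: "0 \<le> Re ((mat_adjoint v * v) $$ (0, 0))" if "v \<in> carrier_mat k 1" for v k
      using adjoint_mult_self_nonneg[of 0 v] that by (simp add: less_eq_complex_def)
    obtain i where i: "i \<in> carrier_mat m1 m1" "a * i = 1\<^sub>m m1"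
    proof (rule injective_imp_inverse[OF ac(1)])
      fix v assume v: "v \<in> carrier_mat m1 1" and 0: "a * v = 0\<^sub>m m1 1"
      have "Re ((mat_adjoint v * v) $$ (0, 0)) \<le> 0"
        using ineq[OF v] nn[of "c * v" m2] ac v unfolding 0 by (simp del: index_mult_mat(1))
      with nn[OF v] have "Re ((mat_adjoint v * v) $$ (0, 0)) = 0" by simp
      moreover have "Im ((mat_adjoint v * v) $$ (0, 0)) = 0"
        using adjoint_mult_self_nonneg[of 0 v] v by (simp add: less_eq_complex_def)
      ultimately have "mat_adjoint v * v = 0\<^sub>m (dim_col v) (dim_col v)"
        using v by (auto intro!: eq_matI simp: complex_eq_iff simp del: index_mult_mat(1))
      then show "v = 0\<^sub>m m1 1" using adjoint_mult_self_eq_0[of v] v by simp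
    qed blast
    show "loewner_le (mat_adjoint (mat_eval R z) * mat_eval R z) (1\<^sub>m m1)"
      unfolding r_def[symmetric] contraction_iff[OF wr(2)]
    proof
      fix v :: "complex mat" assume v: "v \<in> carrier_mat m1 1"
      define u where "u = i * v"
      have u: "u \<in> carrier_mat m1 1" using i v by (simp add: u_def)
      have "a * u = a * i * v" unfolding u_def using ac i(1) v by (simp add: mult_assoc_dim)
      then have au: "a * u = v" unfolding i(2) using v by simp
      have "r * (a * u) = r * a * u" using wr ac u by (simp add: mult_assoc_dim)
      then have ru: "r * v = c * u" unfolding au rw[folded a_def c_def] .
      have "Re ((mat_adjoint (c * u) * (c * u)) $$ (0, 0)) \<le> Re ((mat_adjoint v * v) $$ (0, 0))"
        using ineq[OF u] nn[OF u] unfolding au by linarith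
      moreover have "Im ((mat_adjoint (c * u) * (c * u)) $$ (0, 0)) = 0" "Im ((mat_adjoint v * v) $$ (0, 0)) = 0"
        using adjoint_mult_self_nonneg[of 0 "c * u"] adjoint_mult_self_nonneg[of 0 v] u v
        by (simp_all add: less_eq_complex_def)
      ultimately show "(mat_adjoint (r * v) * (r * v)) $$ (0, 0) \<le> (mat_adjoint v * v) $$ (0, 0)"
        unfolding ru by (simp add: less_eq_complex_def)
    qed
  qed
qed

section \<open>Recovery of W\<close>

lemma riccati_choice_iff:
  "riccati_choice n A B C X \<longleftrightarrow> X \<in> carrier_mat n n \<and> mat_adjoint X = X \<and> riccati_eq A B C X \<and>
    (\<forall>e. eigenvalue (alpha_mat A B X) e \<longrightarrow> Im e \<le> 0)"
  unfolding riccati_choice_def hermitian_mat_def riccati_eq_def spectrum_def closed_lower_half_plane_def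
  by auto

text \<open>This is \<open>\<Lambda>\<^sub>0\<close> from \<open>recovered_W\<close>, with
  \<open>S\<close> standing for the inverse of \<open>X\<close>; the concatenation is written with
  embeddings so that the ring laws apply.\<close>

definition \<Lambda>_mat :: "nat \<Rightarrow> nat \<Rightarrow> complex mat \<Rightarrow> complex mat \<Rightarrow> complex mat \<Rightarrow> complex mat" where
  "\<Lambda>_mat m1 m2 B C S = B * mat_adjoint (emb1 m1 m2) + ((- \<i>) \<cdot>\<^sub>m (S * mat_adjoint C)) * mat_adjoint (emb2 m1 m2)"

lemma recovered_W_eq:
  assumes B: "B \<in> carrier_mat n m1" and C: "C \<in> carrier_mat m2 n"
    and X: "X \<in> carrier_mat n n" and S: "S \<in> carrier_mat n n" "X * S = 1\<^sub>m n" "S * X = 1\<^sub>m n"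
  shows "recovered_W m1 m2 A B C X = transfer_fun (alpha_mat A B X) (\<Lambda>_mat m1 m2 B C S)
      (\<i> \<cdot>\<^sub>m (j_mat m1 m2 * (mat_adjoint (\<Lambda>_mat m1 m2 B C S) * X))) (1\<^sub>m (m1 + m2))"
proof -
  have 1: "mat_inv X = S" by (rule mat_inv_eq[OF X S(1,2)])
  have 2: "mat_inv S = X" by (rule mat_inv_eq[OF S(1) X S(3)])
  have g: "- (\<i> \<cdot>\<^sub>m (S * mat_adjoint C)) = (- \<i>) \<cdot>\<^sub>m (S * mat_adjoint C)"
    by (simp add: uminus_as_smult smult_smult_mat)
  have "(- \<i>) \<cdot>\<^sub>m (S * mat_adjoint C) \<in> carrier_mat n m2" using S C by simp
  from hcat_eq[OF B this] have 3: "hcat B (- (\<i> \<cdot>\<^sub>m (S * mat_adjoint C))) = \<Lambda>_mat m1 m2 B C S"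
    unfolding g \<Lambda>_mat_def .
  have L: "\<Lambda>_mat m1 m2 B C S \<in> carrier_mat n (m1 + m2)" using B S C by (simp add: \<Lambda>_mat_def)
  have "j_mat m1 m2 * mat_adjoint (\<Lambda>_mat m1 m2 B C S) * X = j_mat m1 m2 * (mat_adjoint (\<Lambda>_mat m1 m2 B C S) * X)"
    using L X j_mat_facts(1)[of m1 m2] by (simp add: mult_assoc_dim)
  then show ?thesis unfolding recovered_W_def Let_def 1 2 3 by simp
qed

text \<open>The two block rows of the output matrix \<open>\<Gamma>\<close> are the feedback gain
  \<open>\<i> B\<^sup>* X\<close> and the matrix \<open>C\<close>: these are the data that lead back
  to the realization of \<open>R\<close>. The last identity is what turns the Riccati equation for
  \<open>A\<close> into a Lyapunov equation for \<open>alpha_mat A B X\<close>.\<close>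

lemma \<Lambda>_mat_facts:
  assumes B: "B \<in> carrier_mat n m1" and C: "C \<in> carrier_mat m2 n"
    and X: "X \<in> carrier_mat n n" "mat_adjoint X = X"
    and S: "S \<in> carrier_mat n n" "X * S = 1\<^sub>m n" "S * X = 1\<^sub>m n"
  defines "\<Lambda> \<equiv> \<Lambda>_mat m1 m2 B C S"
  defines "\<Gamma> \<equiv> \<i> \<cdot>\<^sub>m (j_mat m1 m2 * (mat_adjoint \<Lambda> * X))"
  shows "\<Lambda> \<in> carrier_mat n (m1 + m2)" "\<Gamma> \<in> carrier_mat (m1 + m2) n" "\<Lambda> * emb1 m1 m2 = B"
    "mat_adjoint (emb1 m1 m2) * \<Gamma> = \<i> \<cdot>\<^sub>m (mat_adjoint B * X)" "mat_adjoint (emb2 m1 m2) * \<Gamma> = C"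
    "X * (\<Lambda> * (j_mat m1 m2 * (mat_adjoint \<Lambda> * X))) = X * (B * (mat_adjoint B * X)) + (-1) \<cdot>\<^sub>m (mat_adjoint C * C)"
proof -
  let ?E1 = "emb1 m1 m2" and ?E2 = "emb2 m1 m2" and ?J = "j_mat m1 m2"
  note J = j_mat_facts[of m1 m2]
  define \<gamma> where "\<gamma> = (- \<i>) \<cdot>\<^sub>m (S * mat_adjoint C)"
  have g: "\<gamma> \<in> carrier_mat n m2" using S C by (simp add: \<gamma>_def)
  have L_eq: "\<Lambda> = B * mat_adjoint ?E1 + \<gamma> * mat_adjoint ?E2" by (simp add: \<Lambda>_def \<Lambda>_mat_def \<gamma>_def)
  show L: "\<Lambda> \<in> carrier_mat n (m1 + m2)" using B g by (simp add: L_eq)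
  show G: "\<Gamma> \<in> carrier_mat (m1 + m2) n" using J(1) X by (simp add: \<Gamma>_def)
  show LE1: "\<Lambda> * ?E1 = B" unfolding L_eq using B g by (simp add: add_mult_dim mult_assoc_dim emb_products)
  have LE2: "\<Lambda> * ?E2 = \<gamma>" unfolding L_eq using B g by (simp add: add_mult_dim mult_assoc_dim emb_products)
  have Xg: "X * \<gamma> = (- \<i>) \<cdot>\<^sub>m mat_adjoint C"
  proof -
    have "X * \<gamma> = (- \<i>) \<cdot>\<^sub>m (X * S * mat_adjoint C)"
      unfolding \<gamma>_def using X(1) S(1) C by (simp add: mult_smult_dim mult_assoc_dim)
    then show ?thesis unfolding S(2) using C by simp
  qed
  have gX: "mat_adjoint \<gamma> * X = \<i> \<cdot>\<^sub>m C"
    using arg_cong[OF Xg, of mat_adjoint] X g by (simp add: adjoint_simps)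
  have LX: "mat_adjoint ?E1 * (mat_adjoint \<Lambda> * X) = mat_adjoint B * X"
    "mat_adjoint ?E2 * (mat_adjoint \<Lambda> * X) = \<i> \<cdot>\<^sub>m C"
  proof -
    have "mat_adjoint ?E1 * (mat_adjoint \<Lambda> * X) = mat_adjoint (\<Lambda> * ?E1) * X"
      using L X(1) by (simp add: adjoint_simps mult_assoc_dim)
    then show "mat_adjoint ?E1 * (mat_adjoint \<Lambda> * X) = mat_adjoint B * X" unfolding LE1 .
    have "mat_adjoint ?E2 * (mat_adjoint \<Lambda> * X) = mat_adjoint (\<Lambda> * ?E2) * X"
      using L X(1) by (simp add: adjoint_simps mult_assoc_dim)
    then show "mat_adjoint ?E2 * (mat_adjoint \<Lambda> * X) = \<i> \<cdot>\<^sub>m C" unfolding LE2 gX .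
  qed
  have "mat_adjoint ?E1 * \<Gamma> = \<i> \<cdot>\<^sub>m (mat_adjoint ?E1 * ?J * (mat_adjoint \<Lambda> * X))"
    unfolding \<Gamma>_def using L X(1) J(1) by (simp add: mult_smult_dim mult_assoc_dim)
  then show "mat_adjoint ?E1 * \<Gamma> = \<i> \<cdot>\<^sub>m (mat_adjoint B * X)" unfolding J(3) LX .
  have "mat_adjoint ?E2 * \<Gamma> = \<i> \<cdot>\<^sub>m (mat_adjoint ?E2 * ?J * (mat_adjoint \<Lambda> * X))"
    unfolding \<Gamma>_def using L X(1) J(1) by (simp add: mult_smult_dim mult_assoc_dim)
  also have "\<dots> = \<i> \<cdot>\<^sub>m ((-1) \<cdot>\<^sub>m (mat_adjoint ?E2 * (mat_adjoint \<Lambda> * X)))"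
    unfolding J(4) using L X(1) by (simp add: smult_mult_dim)
  finally show "mat_adjoint ?E2 * \<Gamma> = C" unfolding LX by (simp add: smult_smult_mat)
  have "X * (\<Lambda> * (?J * (mat_adjoint \<Lambda> * X))) =
      X * (\<Lambda> * (?E1 * (mat_adjoint ?E1 * (mat_adjoint \<Lambda> * X)))) +
      (-1) \<cdot>\<^sub>m (X * (\<Lambda> * (?E2 * (mat_adjoint ?E2 * (mat_adjoint \<Lambda> * X)))))"
    unfolding j_mat_eq using L X(1) by (simp add: mat_ring_simps)
  also have "\<dots> = X * (\<Lambda> * ?E1 * (mat_adjoint B * X)) + (-1) \<cdot>\<^sub>m (X * (\<Lambda> * ?E2) * (\<i> \<cdot>\<^sub>m C))"
    unfolding LX using L X(1) B C by (simp add: mult_assoc_dim)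
  also have "\<dots> = X * (B * (mat_adjoint B * X)) + (-1) \<cdot>\<^sub>m (mat_adjoint C * C)"
    unfolding LE1 LE2 Xg using C by (simp add: mat_ring_simps)
  finally show "X * (\<Lambda> * (?J * (mat_adjoint \<Lambda> * X))) = X * (B * (mat_adjoint B * X)) + (-1) \<cdot>\<^sub>m (mat_adjoint C * C)" .
qed

lemma hermitian_form_real:
  fixes X :: "complex mat"
  assumes X: "X \<in> carrier_mat n n" "mat_adjoint X = X" and v: "v \<in> carrier_mat n 1"
  shows "Im ((mat_adjoint v * (X * v)) $$ (0, 0)) = 0"
proof -
  have "mat_adjoint (mat_adjoint v * (X * v)) = mat_adjoint v * (X * v)"
    using X v by (simp add: adjoint_simps mult_assoc_dim)
  from arg_cong[OF this, of "\<lambda>M. M $$ (0, 0)"]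
  have "cnj ((mat_adjoint v * (X * v)) $$ (0, 0)) = (mat_adjoint v * (X * v)) $$ (0, 0)"
    using v by (simp del: index_mult_mat(1))
  then show ?thesis by (simp add: complex_eq_iff del: index_mult_mat(1))
qed

text \<open>Removing the feedback \<open>B (\<i> B\<^sup>* X)\<close> from \<open>\<alpha>\<close>
  gives back \<open>A\<close>, so the quotient is the transfer function of \<open>(A, B, C)\<close>.
  The remaining properties come from the spectral condition and from the form identity, whose
  right-hand side differs from \<open>j\<close> by \<open>2 * Im z\<close> times a form of
  \<open>X\<close>.\<close>

lemma recovered_W_properties:
  assumes A: "A \<in> carrier_mat n n" and B: "B \<in> carrier_mat n m1" and C: "C \<in> carrier_mat m2 n"
    and ric: "riccati_choice n A B C X"
    and S: "S \<in> carrier_mat n n" "X * S = 1\<^sub>m n" "S * X = 1\<^sub>m n"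
  defines "W \<equiv> recovered_W m1 m2 A B C X"
  shows "W \<in> carrier_mat (m1 + m2) (m1 + m2)" "tends_at_infinity W (1\<^sub>m (m1 + m2))"
    "weakly_j_elementary m1 m2 W" "regular_on upper_half_plane W"
    "quotient_rel m1 W (transfer_fun A B C (0\<^sub>m m2 m1))"
    "\<exists>\<alpha> Bw Cw. is_realization W n \<alpha> Bw Cw (1\<^sub>m (m1 + m2))"
    "(\<And>v. v \<in> carrier_mat n 1 \<Longrightarrow> 0 \<le> Re ((mat_adjoint v * (X * v)) $$ (0, 0))) \<Longrightarrow> j_elementary_factor m1 m2 W"
proof -
  let ?J = "j_mat m1 m2" and ?m = "m1 + m2"
  note J = j_mat_facts[of m1 m2]
  have X: "X \<in> carrier_mat n n" "mat_adjoint X = X" and req: "riccati_eq A B C X"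
    and ev: "\<And>e. eigenvalue (alpha_mat A B X) e \<Longrightarrow> Im e \<le> 0"
    using ric unfolding riccati_choice_iff by auto
  define \<alpha> \<Lambda> where "\<alpha> = alpha_mat A B X" and "\<Lambda> = \<Lambda>_mat m1 m2 B C S"
  define \<Gamma> where "\<Gamma> = \<i> \<cdot>\<^sub>m (?J * (mat_adjoint \<Lambda> * X))"
  note F = \<Lambda>_mat_facts[OF B C X S, folded \<Lambda>_def, folded \<Gamma>_def]
  have \<alpha>: "\<alpha> \<in> carrier_mat n n" unfolding \<alpha>_def by (rule alpha_mat_eq(2)[OF A B X(1)])
  have \<alpha>eq: "\<alpha> = A + \<i> \<cdot>\<^sub>m (B * (mat_adjoint B * X))" unfolding \<alpha>_def by (rule alpha_mat_eq(1)[OF A B X(1)])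
  have Weq: "W = transfer_fun \<alpha> \<Lambda> \<Gamma> (1\<^sub>m ?m)"
    unfolding W_def recovered_W_eq[OF B C X(1) S] \<alpha>_def \<Lambda>_def \<Gamma>_def ..
  have one: "1\<^sub>m ?m \<in> carrier_mat ?m ?m" by simp
  show W: "W \<in> carrier_mat ?m ?m" unfolding Weq by (rule dim_transfer_fun[OF \<alpha> F(1,2)])
  show tends: "tends_at_infinity W (1\<^sub>m ?m)"
    unfolding tends_at_infinity_iff using W transfer_fun_tendsto[OF \<alpha> F(1,2) one] by (auto simp: Weq)
  show "\<exists>\<alpha> Bw Cw. is_realization W n \<alpha> Bw Cw (1\<^sub>m ?m)"
    unfolding Weq using is_realizationI[OF \<alpha> F(1,2) one] by blast
  note evW = transfer_fun_eval[OF \<alpha> F(1,2) one, folded Weq]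
  show reg: "regular_on upper_half_plane W"
    unfolding regular_on_def upper_half_plane_def
  proof
    fix z :: complex assume "z \<in> {z. 0 < Im z}"
    then have "\<not> eigenvalue \<alpha> z" using ev[of z] unfolding \<alpha>_def by auto
    then show "\<not> is_singular_at W z" by (rule evW(2))
  qed
  show "quotient_rel m1 W (transfer_fun A B C (0\<^sub>m m2 m1))"
  proof -
    have "\<alpha> - B * (\<i> \<cdot>\<^sub>m (mat_adjoint B * X)) = A"
      unfolding \<alpha>eq using A B X(1) by (auto simp: mult_smult_dim intro!: eq_matI simp del: index_mult_mat(1))
    then show ?thesis
      unfolding Weq quotient_rel_realization[OF \<alpha> F(1,2)] F(3-5) by simp
  qed
  have lyap: "X * \<alpha> = mat_adjoint \<alpha> * X + \<i> \<cdot>\<^sub>m (X * (\<Lambda> * (?J * (mat_adjoint \<Lambda> * X))))"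
  proof -
    have 1: "mat_adjoint \<alpha> = mat_adjoint A + (- \<i>) \<cdot>\<^sub>m (X * (B * mat_adjoint B))"
      unfolding \<alpha>eq using A B X by (simp add: adjoint_simps mult_assoc_dim)
    have 2: "mat_adjoint A * X = X * A + (\<i> \<cdot>\<^sub>m (mat_adjoint C * C) + \<i> \<cdot>\<^sub>m (X * (B * (mat_adjoint B * X))))"
      using req riccati_eq_iff[OF A B C X(1)] by blast
    show ?thesis unfolding F(6) 1 unfolding \<alpha>eq using A B C X(1)
      by (auto simp: mat_ring_simps 2 algebra_simps intro!: eq_matI simp del: index_mult_mat(1))
  qed
  define N where "N z = resolvent \<alpha> z * \<Lambda>" for z
  have form: "mat_adjoint (mat_eval W z) * ?J * mat_eval W z =
      ?J + complex_of_real (2 * Im z) \<cdot>\<^sub>m (mat_adjoint (N z) * (X * N z))" and Nc: "N z \<in> carrier_mat n ?m"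
    if z: "\<not> eigenvalue \<alpha> z" for z
  proof -
    show Nc: "N z \<in> carrier_mat n ?m" unfolding N_def using resolvent(1)[OF \<alpha> z] F(1) by simp
    have aN: "\<alpha> * N z = z \<cdot>\<^sub>m N z + (-1) \<cdot>\<^sub>m \<Lambda>" unfolding N_def by (rule mult_resolvent(2)[OF \<alpha> z F(1)])
    have "mat_eval W z = 1\<^sub>m ?m + \<i> \<cdot>\<^sub>m (?J * (mat_adjoint \<Lambda> * X)) * N z"
      using evW(1)[OF z] by (simp add: N_def \<Gamma>_def)
    moreover have "mat_adjoint (mat_eval W z) * ?J * mat_eval W z = mat_adjoint (mat_eval W z) * (?J * mat_eval W z)"
      using W J(1) by (simp add: mult_assoc_dim)
    ultimately show "mat_adjoint (mat_eval W z) * ?J * mat_eval W z =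
      ?J + complex_of_real (2 * Im z) \<cdot>\<^sub>m (mat_adjoint (N z) * (X * N z))"
      using j_form_identity[OF J(1,2,7) \<alpha> X F(1) lyap Nc aN] by simp
  qed
  let ?Q = "\<lambda>z. mat_adjoint (mat_eval W z) * ?J * mat_eval W z"
  have fin: "finite {z. eigenvalue \<alpha> z}" by (rule finite_eigenvalues[OF \<alpha>])
  show "weakly_j_elementary m1 m2 W"
    unfolding weakly_j_elementary_def
  proof (intro conjI W tends ballI impI)
    fix z :: complex assume z: "z \<in> \<real>" and ns: "\<not> is_singular_at W z"
    show "?Q z = ?J"
    proof (rule mat_tendsto_unique[OF j_form_limit[OF W ns]])
      show "at z within \<real> \<noteq> bot" by (rule at_within_neq_bot_half_planes(1)[OF z])
      \<comment> \<open>The form identity is available only off the eigenvalues of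
        \<open>\<alpha>\<close>. A real eigenvalue at which \<open>W\<close> is nevertheless regular
        is reached by a limit along the axis.\<close>
      have "eventually (\<lambda>w. ?J = ?Q w) (at z within \<real>)"
      proof (rule eventually_within_Diff_finite[OF fin])
        fix w :: complex assume "w \<in> \<real>" "w \<notin> {z. eigenvalue \<alpha> z}"
        then have "Im w = 0" "\<not> eigenvalue \<alpha> w" by (auto simp: complex_is_Real_iff)
        then show "?J = ?Q w" using form[of w] Nc[of w] J(1) by (auto intro!: eq_matI simp del: index_mult_mat(1))
      qed
      with mat_tendsto_const show "mat_tendsto ?Q ?J (at z within \<real>)" by (rule mat_tendsto_cong)
    qed (use W J(1) in auto)
  qed
  assume psd: "\<And>v. v \<in> carrier_mat n 1 \<Longrightarrow> 0 \<le> Re ((mat_adjoint v * (X * v)) $$ (0, 0))"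
  have Qc: "?Q z \<in> carrier_mat ?m ?m" for z using W by simp
  \<comment> \<open>The sign \<open>s\<close>, taken as 1 or -1, treats both half-planes at
    once.\<close>
  have diff: "0 \<le> complex_of_real s * (mat_adjoint v * ((?Q z - ?J) * v)) $$ (0, 0)"
    if z: "\<not> eigenvalue \<alpha> z" and v: "v \<in> carrier_mat ?m 1" and s: "0 \<le> s * Im z" for z v s
  proof -
    have Nv: "N z * v \<in> carrier_mat n 1" using Nc[OF z] v by simp
    have "?Q z - ?J = complex_of_real (2 * Im z) \<cdot>\<^sub>m (mat_adjoint (N z) * (X * N z))"
      unfolding form[OF z] using J(1) Nc[OF z] by (auto intro!: eq_matI simp del: index_mult_mat(1))
    then have "mat_adjoint v * ((?Q z - ?J) * v) =
        complex_of_real (2 * Im z) \<cdot>\<^sub>m (mat_adjoint (N z * v) * (X * (N z * v)))"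
      using Nc[OF z] X(1) v by (simp add: mat_ring_simps adjoint_simps)
    then have e: "(mat_adjoint v * ((?Q z - ?J) * v)) $$ (0, 0) =
        complex_of_real (2 * Im z) * (mat_adjoint (N z * v) * (X * (N z * v))) $$ (0, 0)"
      using v by (simp del: index_mult_mat(1))
    have "0 \<le> (s * Im z) * Re ((mat_adjoint (N z * v) * (X * (N z * v))) $$ (0, 0))"
      using s psd[OF Nv] by (rule mult_nonneg_nonneg)
    then show ?thesis unfolding e using hermitian_form_real[OF X Nv]
      by (simp add: less_eq_complex_def algebra_simps del: index_mult_mat(1))
  qed
  show "j_elementary_factor m1 m2 W"
    unfolding j_elementary_factor_def
  proof (intro conjI W tends ballI impI)
    fix z assume z: "z \<in> upper_half_plane" and ns: "\<not> is_singular_at W z"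
    show "loewner_le ?J (?Q z)"
    proof (rule loewner_le_limit[OF mat_tendsto_const j_form_limit[OF W ns] J(1) Qc _ at_within_neq_bot_half_planes(2)[OF z]])
      show "eventually (\<lambda>w. loewner_le ?J (?Q w)) (at z within upper_half_plane)"
      proof (rule eventually_within_Diff_finite[OF fin])
        fix w assume w: "w \<in> upper_half_plane" "w \<notin> {z. eigenvalue \<alpha> z}"
        then show "loewner_le ?J (?Q w)"
          unfolding loewner_le_iff[OF J(1) Qc] using diff[of w _ 1] by (simp add: upper_half_plane_def)
      qed
    qed
  next
    fix z assume z: "z \<in> lower_half_plane" and ns: "\<not> is_singular_at W z"
    show "loewner_le (?Q z) ?J"
    proof (rule loewner_le_limit[OF j_form_limit[OF W ns] mat_tendsto_const Qc J(1) _ at_within_neq_bot_half_planes(3)[OF z]])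
      show "eventually (\<lambda>w. loewner_le (?Q w) ?J) (at z within lower_half_plane)"
      proof (rule eventually_within_Diff_finite[OF fin])
        fix w assume w: "w \<in> lower_half_plane" "w \<notin> {z. eigenvalue \<alpha> z}"
        have "(mat_adjoint v * ((?J - ?Q w) * v)) $$ (0, 0) = complex_of_real (-1) * (mat_adjoint v * ((?Q w - ?J) * v)) $$ (0, 0)"
          if v: "v \<in> carrier_mat ?m 1" for v
        proof -
          have "?J - ?Q w = (-1) \<cdot>\<^sub>m (?Q w - ?J)"
            using J(1) W by (auto intro!: eq_matI simp del: index_mult_mat(1))
          then have "mat_adjoint v * ((?J - ?Q w) * v) = (-1) \<cdot>\<^sub>m (mat_adjoint v * ((?Q w - ?J) * v))"
            using J(1) v by (simp add: smult_mult_dim mult_smult_dim)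
          then show ?thesis using v by (simp del: index_mult_mat(1))
        qed
        with w show "loewner_le (?Q w) ?J"
          unfolding loewner_le_iff[OF Qc J(1)] using diff[of w _ "-1"] by (simp add: lower_half_plane_def)
      qed
    qed
  qed
qed

section \<open>From \<open>W\<close> back to the Riccati equation\<close>

lemma markov_parameters:
  assumes A: "A \<in> carrier_mat n n" and B: "B \<in> carrier_mat n m" and C: "C \<in> carrier_mat p n"
    and A': "A' \<in> carrier_mat k k" and B': "B' \<in> carrier_mat k m" and C': "C' \<in> carrier_mat p k"
    and D: "D \<in> carrier_mat p m" and eq: "transfer_fun A B C D = transfer_fun A' B' C' D"
  shows "C * kry A B l = C' * kry A' B' l"
proof -
  have K: "kry A B l \<in> carrier_mat n m" "kry A' B' l \<in> carrier_mat k m" for l using A B A' B' by auto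
  \<comment> \<open>Since \<open>z (z - A)\<^sup>-\<^sup>1 M = M + (z - A)\<^sup>-\<^sup>1 A
    M\<close>, the leading coefficient at infinity is \<open>C M\<close>. Subtracting it leaves the
    same situation with \<open>A M\<close>, so the coefficients can be compared one after
    another.\<close>
  have lim: "mat_tendsto (\<lambda>z. z \<cdot>\<^sub>m (C * (resolvent A z * M))) (C * M) at_infinity"
    if A: "A \<in> carrier_mat n n" and C: "C \<in> carrier_mat p n" and M: "M \<in> carrier_mat n m" for A C M n
  proof -
    have "mat_tendsto (\<lambda>z. C * M + C * (resolvent A z * (A * M))) (C * M + C * (0\<^sub>m n n * (A * M))) at_infinity"
      by (intro mat_tendsto_add mat_tendsto_mult mat_tendsto_const resolvent_tendsto_0[OF A]) (use A C M in auto)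
    moreover have "C * M + C * (0\<^sub>m n n * (A * M)) = C * M" using A C M by simp
    moreover have "eventually (\<lambda>z. C * M + C * (resolvent A z * (A * M)) = z \<cdot>\<^sub>m (C * (resolvent A z * M))) at_infinity"
      using eventually_notin_finite_at_infinity[OF finite_eigenvalues[OF A]]
    proof (rule eventually_mono)
      fix z assume "z \<notin> {z. eigenvalue A z}"
      then have z: "\<not> eigenvalue A z" by simp
      have "resolvent A z * (A * M) = z \<cdot>\<^sub>m (resolvent A z * M) + (-1) \<cdot>\<^sub>m M"
        unfolding mult_resolvent(3)[OF A z M] by (rule mult_resolvent(2)[OF A z M])
      then have "C * (resolvent A z * (A * M)) = z \<cdot>\<^sub>m (C * (resolvent A z * M)) + (-1) \<cdot>\<^sub>m (C * M)"
        using C M resolvent(1)[OF A z] by (simp add: mat_ring_simps)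
      then show "C * M + C * (resolvent A z * (A * M)) = z \<cdot>\<^sub>m (C * (resolvent A z * M))"
        using C M resolvent(1)[OF A z] by (auto intro!: eq_matI simp del: index_mult_mat(1))
    qed
    ultimately show ?thesis using mat_tendsto_cong by simp
  qed
  have fin: "finite ({z. eigenvalue A z} \<union> {z. eigenvalue A' z})"
    using finite_eigenvalues[OF A] finite_eigenvalues[OF A'] by simp
  have "(\<forall>z. \<not> eigenvalue A z \<longrightarrow> \<not> eigenvalue A' z \<longrightarrow>
      C * (resolvent A z * kry A B l) = C' * (resolvent A' z * kry A' B' l)) \<and> C * kry A B l = C' * kry A' B' l" for l
  proof (induction l)
    have step: "C * kry A B l = C' * kry A' B' l"
      if *: "\<And>z. \<not> eigenvalue A z \<Longrightarrow> \<not> eigenvalue A' z \<Longrightarrow>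
        C * (resolvent A z * kry A B l) = C' * (resolvent A' z * kry A' B' l)" for l
    proof (rule mat_tendsto_unique)
      show "mat_tendsto (\<lambda>z. z \<cdot>\<^sub>m (C * (resolvent A z * kry A B l))) (C * kry A B l) at_infinity"
        by (rule lim[OF A C K(1)])
      have "eventually (\<lambda>z. z \<cdot>\<^sub>m (C' * (resolvent A' z * kry A' B' l)) = z \<cdot>\<^sub>m (C * (resolvent A z * kry A B l))) at_infinity"
        using eventually_notin_finite_at_infinity[OF fin] by (rule eventually_mono) (use * in auto)
      with lim[OF A' C' K(2)] show "mat_tendsto (\<lambda>z. z \<cdot>\<^sub>m (C * (resolvent A z * kry A B l))) (C' * kry A' B' l) at_infinity"
        by (rule mat_tendsto_cong)
    qed (use at_infinity_complex_neq_bot A B C A' B' C' in auto)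
    {
      case 0
      have "C * (resolvent A z * B) = C' * (resolvent A' z * B')" if z: "\<not> eigenvalue A z" "\<not> eigenvalue A' z" for z
      proof -
        have e: "D + C * (resolvent A z * B) = D + C' * (resolvent A' z * B')"
          using arg_cong[OF eq, of "\<lambda>F. mat_eval F z"]
          unfolding transfer_fun_eval(1)[OF A B C D z(1)] transfer_fun_eval(1)[OF A' B' C' D z(2)] .
        show ?thesis
        proof (rule eq_matI)
          fix i j assume "i < dim_row (C' * (resolvent A' z * B'))" "j < dim_col (C' * (resolvent A' z * B'))"
          then show "(C * (resolvent A z * B)) $$ (i, j) = (C' * (resolvent A' z * B')) $$ (i, j)"
            using arg_cong[OF e, of "\<lambda>M. M $$ (i, j)"] B C B' C' by (simp del: index_mult_mat(1))
        qed (use B C B' C' in auto)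
      qed
      then show ?case using step[of 0] by simp
    next
      case (Suc l)
      have "C * (resolvent A z * kry A B (Suc l)) = C' * (resolvent A' z * kry A' B' (Suc l))"
        if z: "\<not> eigenvalue A z" "\<not> eigenvalue A' z" for z
      proof -
        have *: "C * (resolvent A z * (A * M)) = z \<cdot>\<^sub>m (C * (resolvent A z * M)) + (-1) \<cdot>\<^sub>m (C * M)"
          if A: "A \<in> carrier_mat n n" and C: "C \<in> carrier_mat p n" and M: "M \<in> carrier_mat n m"
            and z: "\<not> eigenvalue A z" for A C M n
          unfolding mult_resolvent(3)[OF A z M] mult_resolvent(2)[OF A z M]
          using C M resolvent(1)[OF A z] by (simp add: mat_ring_simps)
        show ?thesis unfolding kry.simps *[OF A C K(1) z(1)] *[OF A' C' K(2) z(2)] using Suc z by simp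
      qed
      then show ?case using step[of "Suc l"] by blast
    }
  qed
  then show ?thesis by blast
qed

text \<open>State feedback does not change the size of the state matrix, so a minimal realization of
  \<open>W\<close> provides one of \<open>R\<close> of the same order.\<close>

lemma mcmillan_degree_quotient_le:
  assumes W: "W \<in> carrier_mat (m1 + m2) (m1 + m2)" "tends_at_infinity W (1\<^sub>m (m1 + m2))"
    and R: "quotient_rel m1 W R"
  shows "mcmillan_degree R \<le> mcmillan_degree W"
proof -
  obtain n \<alpha> Bw Cw where min: "is_minimal_realization W n \<alpha> Bw Cw (1\<^sub>m (m1 + m2))"
    using minimal_realization_exists[OF W] by blast
  then have real: "is_realization W n \<alpha> Bw Cw (1\<^sub>m (m1 + m2))" and n: "n = mcmillan_degree W"
    unfolding is_minimal_realization_def by auto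
  have \<alpha>: "\<alpha> \<in> carrier_mat n n" and Bw: "Bw \<in> carrier_mat n (m1 + m2)" and Cw: "Cw \<in> carrier_mat (m1 + m2) n"
    and Wt: "W = transfer_fun \<alpha> Bw Cw (1\<^sub>m (m1 + m2))"
    using is_realization_carrier[OF real] W(1) by auto
  have Bc: "Bw * emb1 m1 m2 \<in> carrier_mat n m1" using Bw by simp
  have Ac: "\<alpha> - Bw * emb1 m1 m2 * (mat_adjoint (emb1 m1 m2) * Cw) \<in> carrier_mat n n"
    using Bw Cw by simp
  have Cc: "mat_adjoint (emb2 m1 m2) * Cw \<in> carrier_mat m2 n" using Cw by simp
  have "R = transfer_fun (\<alpha> - Bw * emb1 m1 m2 * (mat_adjoint (emb1 m1 m2) * Cw)) (Bw * emb1 m1 m2)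
      (mat_adjoint (emb2 m1 m2) * Cw) (0\<^sub>m m2 m1)"
    using R quotient_rel_realization[OF \<alpha> Bw Cw] unfolding Wt by blast
  then have "is_realization R n (\<alpha> - Bw * emb1 m1 m2 * (mat_adjoint (emb1 m1 m2) * Cw)) (Bw * emb1 m1 m2)
      (mat_adjoint (emb2 m1 m2) * Cw) (0\<^sub>m m2 m1)"
    using is_realizationI[OF Ac Bc Cc] by simp
  then show ?thesis using mcmillan_degree_le n by blast
qed

lemma infinite_reals: "infinite (\<real> :: complex set)"
proof -
  have "inj complex_of_real" by (simp add: inj_def)
  then have "infinite (range complex_of_real)" using infinite_UNIV_char_0[where 'a = real] finite_imageD by blast
  then show ?thesis by (simp add: Reals_def)
qed

lemma observable_left_mult:
  assumes "observable n A C" "\<And>q M. M \<in> carrier_mat n q \<Longrightarrow> K * M = 0\<^sub>m (dim_row K) q \<Longrightarrow> C * M = 0\<^sub>m (dim_row C) q"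
  shows "observable n A K"
  using assms unfolding observable_def by blast

text \<open>Since \<open>W\<close> is \<open>j\<close>-unitary, \<open>j W\<^sup>~ j = W\<^sup>-\<^sup>1\<close>; comparing the two realizations of this function gives a
  skew-hermitian state space isomorphism \<open>T\<close>, and \<open>X = i T\<close> solves the Riccati equation.\<close>

lemma j_unitary_realization:
  assumes \<alpha>: "\<alpha> \<in> carrier_mat n n" and Bw: "Bw \<in> carrier_mat n (m1 + m2)" and Cw: "Cw \<in> carrier_mat (m1 + m2) n"
    and W: "weakly_j_elementary m1 m2 W" and Wt: "W = transfer_fun \<alpha> Bw Cw (1\<^sub>m (m1 + m2))"
    and obs: "observable n \<alpha> Cw" and ctrl: "observable n (mat_adjoint \<alpha>) (mat_adjoint Bw)"
  obtains X S where "X \<in> carrier_mat n n" "mat_adjoint X = X" "S \<in> carrier_mat n n" "X * S = 1\<^sub>m n" "S * X = 1\<^sub>m n"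
    "Cw = \<i> \<cdot>\<^sub>m (j_mat m1 m2 * (mat_adjoint Bw * X))"
    "X * \<alpha> = mat_adjoint \<alpha> * X + \<i> \<cdot>\<^sub>m (mat_adjoint Cw * (j_mat m1 m2 * Cw))"
proof -
  let ?J = "j_mat m1 m2" and ?m = "m1 + m2"
  note J = j_mat_facts[of m1 m2]
  \<comment> \<open>The matrices \<open>\<beta>\<close>, \<open>Bw\<close>, \<open>Cm\<close>
    realize the inverse of \<open>W\<close>, and \<open>\<alpha>\<^sup>*\<close>, \<open>B'\<close>,
    \<open>C'\<close> realize the function whose value at real points is
    \<open>j W(z)\<^sup>* j\<close>.\<close>
  define \<beta> where "\<beta> = \<alpha> - Bw * Cw"
  define Cm where "Cm = (-1) \<cdot>\<^sub>m Cw"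
  define B' where "B' = mat_adjoint Cw * ?J"
  define C' where "C' = ?J * mat_adjoint Bw"
  have one: "1\<^sub>m ?m \<in> carrier_mat ?m ?m" by simp
  have c: "\<beta> \<in> carrier_mat n n" "Cm \<in> carrier_mat ?m n" "B' \<in> carrier_mat n ?m" "C' \<in> carrier_mat ?m n"
    "mat_adjoint \<alpha> \<in> carrier_mat n n"
    using \<alpha> Bw Cw J(1) by (auto simp: \<beta>_def Cm_def B'_def C'_def)
  let ?V = "transfer_fun \<beta> Bw Cm (1\<^sub>m ?m)" and ?G = "transfer_fun (mat_adjoint \<alpha>) B' C' (1\<^sub>m ?m)"
  have dims: "W \<in> carrier_mat ?m ?m" "?V \<in> carrier_mat ?m ?m" "?G \<in> carrier_mat ?m ?m"
    unfolding Wt using dim_transfer_fun[OF \<alpha> Bw Cw] dim_transfer_fun[OF c(1) Bw c(2)] dim_transfer_fun[OF c(5,3,4)] by auto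
  have WV: "W * ?V = 1\<^sub>m ?m"
    using feedback_transfer(1)[OF \<alpha> Bw Cw Cw] unfolding Wt \<beta>_def Cm_def .
  have GW: "?G * W = 1\<^sub>m ?m"
  proof (rule ratmat_eqI)
    let ?S = "{z. eigenvalue \<alpha> z} \<union> {z. eigenvalue (mat_adjoint \<alpha>) z}"
    have "finite ?S" using finite_eigenvalues[OF \<alpha>] finite_eigenvalues[OF c(5)] by simp
    then show "infinite ((\<real> :: complex set) - ?S)" using infinite_reals by (rule Diff_infinite_finite)
    fix z :: complex assume "z \<in> \<real> - ?S"
    then have z: "z \<in> \<real>" "\<not> eigenvalue \<alpha> z" "\<not> eigenvalue (mat_adjoint \<alpha>) z" by auto
    note evW = transfer_fun_eval[OF \<alpha> Bw Cw one z(2), folded Wt]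
    note evG = transfer_fun_eval[OF c(5,3,4) one z(3)]
    have cz: "cnj z = z" using z(1) by (simp add: Reals_cnj_iff)
    have Radj: "resolvent (mat_adjoint \<alpha>) z = mat_adjoint (resolvent \<alpha> z)"
      using resolvent_adjoint[OF \<alpha> z(2)] cz by simp
    note R = resolvent(1)[OF \<alpha> z(2)]
    have "mat_eval ?G z = ?J * mat_adjoint (mat_eval W z) * ?J"
      unfolding evW(1) evG(1) Radj unfolding B'_def C'_def using J(1,7) R Bw Cw
      by (simp add: mat_ring_simps adjoint_simps)
    then have "mat_eval (?G * W) z = ?J * mat_adjoint (mat_eval W z) * ?J * mat_eval W z"
      using mat_eval_mult(1)[OF _ evG(2) evW(2)] dims by simp
    also have "\<dots> = ?J * (mat_adjoint (mat_eval W z) * ?J * mat_eval W z)"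
      using J(1) dims by (simp add: mult_assoc_dim)
    also have "mat_adjoint (mat_eval W z) * ?J * mat_eval W z = ?J"
      using W z(1) evW(2) unfolding weakly_j_elementary_def by blast
    finally show "mat_eval (?G * W) z = mat_eval (1\<^sub>m ?m) z"
      unfolding J(7) by (auto intro!: eq_matI)
  qed (use dims in auto)
  have "?G = ?G * (W * ?V)" unfolding WV using dims by simp
  also have "\<dots> = ?V" using dims by (simp add: mult_assoc_dim[symmetric] GW)
  finally have GV: "?V = ?G" by simp
  \<comment> \<open>Feedback through \<open>Bw * Cw\<close> is invisible on vectors killed by
    \<open>Cw\<close>, and its adjoint on vectors killed by \<open>Bw\<^sup>*\<close>; so the Hautus
    conditions pass from \<open>\<alpha>\<close> to \<open>\<beta>\<close>.\<close>
  have obs\<beta>: "observable n \<beta> Cm"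
    unfolding observable_def
  proof (intro allI ballI impI)
    fix q M t assume M: "M \<in> carrier_mat n q" "\<beta> * M = t \<cdot>\<^sub>m M" "Cm * M = 0\<^sub>m (dim_row Cm) q"
    have "(-1) \<cdot>\<^sub>m (Cw * M) = 0\<^sub>m ?m q" using M(1,3) Cw by (simp add: Cm_def smult_mult_dim)
    then have CM: "Cw * M = 0\<^sub>m ?m q" using M(1) Cw by (auto simp: mat_eq_iff simp del: index_mult_mat(1))
    have "\<beta> * M = \<alpha> * M + (-1) \<cdot>\<^sub>m (Bw * (Cw * M))"
      unfolding \<beta>_def using \<alpha> Bw Cw M(1) by (simp add: mat_ring_simps)
    then have "\<alpha> * M = t \<cdot>\<^sub>m M" unfolding M(2) CM using \<alpha> Bw M(1) by (simp add: mat_eq_iff)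
    then show "M = 0\<^sub>m n q" using observableD[OF obs M(1)] CM Cw by simp
  qed
  have ctrl\<beta>: "observable n (mat_adjoint \<beta>) (mat_adjoint Bw)"
    unfolding observable_def
  proof (intro allI ballI impI)
    fix q M t assume M: "M \<in> carrier_mat n q" "mat_adjoint \<beta> * M = t \<cdot>\<^sub>m M"
      "mat_adjoint Bw * M = 0\<^sub>m (dim_row (mat_adjoint Bw)) q"
    have "mat_adjoint \<beta> * M = mat_adjoint \<alpha> * M + (-1) \<cdot>\<^sub>m (mat_adjoint Cw * (mat_adjoint Bw * M))"
      unfolding \<beta>_def using \<alpha> Bw Cw M(1) by (simp add: mat_ring_simps adjoint_simps)
    then have "mat_adjoint \<alpha> * M = t \<cdot>\<^sub>m M" unfolding M(2,3) using \<alpha> Bw Cw M(1) by (simp add: mat_eq_iff)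
    then show "M = 0\<^sub>m n q" using observableD[OF ctrl M(1) _ M(3)] by blast
  qed
  have obs': "observable n (mat_adjoint \<alpha>) C'"
  proof (rule observable_left_mult[OF ctrl])
    fix q and M :: "complex mat" assume M: "M \<in> carrier_mat n q" and 0: "C' * M = 0\<^sub>m (dim_row C') q"
    have "?J * (C' * M) = ?J * (?J * (mat_adjoint Bw * M))"
      unfolding C'_def using J(1) Bw M by (simp add: mult_assoc_dim)
    then have "?J * (C' * M) = mat_adjoint Bw * M" using Bw by (simp add: j_mat_cancel)
    then show "mat_adjoint Bw * M = 0\<^sub>m (dim_row (mat_adjoint Bw)) q" unfolding 0 using J(1) Bw c by simp
  qed
  obtain T U where T: "T \<in> carrier_mat n n" "U \<in> carrier_mat n n" "T * U = 1\<^sub>m n" "U * T = 1\<^sub>m n"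
    "T * \<beta> = mat_adjoint \<alpha> * T" "T * Bw = B'" "C' * T = Cm"
    by (rule state_space_isomorphism[OF c(1) Bw c(2,5,3,4) markov_parameters[OF c(1) Bw c(2,5,3,4) one GV] ctrl\<beta> obs\<beta> obs'])
  have T\<alpha>: "T * \<alpha> = mat_adjoint \<alpha> * T + mat_adjoint Cw * (?J * Cw)"
  proof -
    have "T * \<beta> = T * \<alpha> + (-1) \<cdot>\<^sub>m (T * Bw * Cw)"
      unfolding \<beta>_def using T(1) \<alpha> Bw Cw by (simp add: mat_ring_simps)
    then have e: "mat_adjoint \<alpha> * T = T * \<alpha> + (-1) \<cdot>\<^sub>m (mat_adjoint Cw * (?J * Cw))"
      unfolding T(5,6) B'_def using Cw J(1) by (simp add: mult_assoc_dim)
    show ?thesis unfolding e using T(1) \<alpha> Cw J(1) by (auto intro!: eq_matI simp del: index_mult_mat(1))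
  qed
  have T\<alpha>': "mat_adjoint \<alpha> * mat_adjoint T = mat_adjoint T * \<alpha> + mat_adjoint Cw * (?J * Cw)"
    using arg_cong[OF T\<alpha>, of mat_adjoint] T(1) \<alpha> Cw J(1,2) by (simp add: adjoint_simps mult_assoc_dim)
  have CT: "Cw = (-1) \<cdot>\<^sub>m (?J * (mat_adjoint Bw * T))"
  proof -
    have "(-1) \<cdot>\<^sub>m (C' * T) = (-1) \<cdot>\<^sub>m Cm" unfolding T(7) ..
    then show ?thesis unfolding Cm_def C'_def using J(1) Bw T(1) by (simp add: smult_smult_mat mult_assoc_dim)
  qed
  \<comment> \<open>Skewness of \<open>T\<close> is the vanishing of \<open>Y\<close>. Combining the
    relations for \<open>T\<close> with their adjoints gives \<open>Y Bw = 0\<close> and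
    \<open>Y \<alpha> = \<alpha>\<^sup>* Y\<close>, so \<open>Y\<close> annihilates every
    \<open>\<alpha>\<^sup>k Bw\<close>, and controllability gives \<open>Y = 0\<close>.\<close>
  define Y where "Y = T + mat_adjoint T"
  have Y: "Y \<in> carrier_mat n n" "mat_adjoint Y = Y"
    using T(1) by (auto simp: Y_def adjoint_simps intro!: eq_matI)
  have TB: "T * Bw = mat_adjoint Cw * ?J" using T(6) by (simp add: B'_def)
  have TB': "mat_adjoint T * Bw = (-1) \<cdot>\<^sub>m (mat_adjoint Cw * ?J)"
  proof -
    have "?J * Cw = (-1) \<cdot>\<^sub>m (mat_adjoint Bw * T)"
      by (subst CT) (use J(1) Bw T(1) in \<open>simp add: mult_smult_dim j_mat_cancel\<close>)
    from arg_cong[OF this, of mat_adjoint] have "mat_adjoint Cw * ?J = (-1) \<cdot>\<^sub>m (mat_adjoint T * Bw)"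
      using J(1,2) Cw Bw T(1) by (simp add: adjoint_simps)
    then show ?thesis by (simp add: smult_smult_mat)
  qed
  have YB: "Y * Bw = 0\<^sub>m n ?m"
  proof -
    have "Y * Bw = T * Bw + mat_adjoint T * Bw" unfolding Y_def using T(1) Bw by (simp add: add_mult_dim)
    then show ?thesis unfolding TB TB' using Cw J(1) by (auto intro!: eq_matI simp del: index_mult_mat(1))
  qed
  have Y\<alpha>: "Y * \<alpha> = mat_adjoint \<alpha> * Y"
  proof -
    have "Y * \<alpha> = T * \<alpha> + mat_adjoint T * \<alpha>" unfolding Y_def using T(1) \<alpha> by (simp add: add_mult_dim)
    also have "\<dots> = mat_adjoint \<alpha> * T + mat_adjoint \<alpha> * mat_adjoint T"
      unfolding T\<alpha> T\<alpha>' using T(1) \<alpha> Cw J(1) by (auto intro!: eq_matI simp del: index_mult_mat(1))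
    also have "\<dots> = mat_adjoint \<alpha> * Y" unfolding Y_def using T(1) \<alpha> by (simp add: mult_add_dim)
    finally show ?thesis .
  qed
  have "Y = 0\<^sub>m n n"
  proof (rule controllable_krylov[OF \<alpha> Bw ctrl Y(1)])
    fix k
    show "Y * kry \<alpha> Bw k = 0\<^sub>m n ?m"
    proof (induction k)
      case (Suc k)
      have K: "kry \<alpha> Bw k \<in> carrier_mat n ?m" using \<alpha> Bw by simp
      have "Y * (\<alpha> * kry \<alpha> Bw k) = Y * \<alpha> * kry \<alpha> Bw k" using Y(1) \<alpha> K by (simp add: mult_assoc_dim)
      also have "\<dots> = mat_adjoint \<alpha> * (Y * kry \<alpha> Bw k)" unfolding Y\<alpha> using Y(1) \<alpha> K by (simp add: mult_assoc_dim)
      finally show ?case unfolding Suc using \<alpha> by simp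
    qed (simp add: YB)
  qed
  then have skew: "mat_adjoint T = (-1) \<cdot>\<^sub>m T"
    using T(1) unfolding Y_def by (auto simp: mat_eq_iff add_eq_0_iff simp del: index_mat_adjoint)
  define X where "X = \<i> \<cdot>\<^sub>m T"
  show ?thesis
  proof (rule that[of X "(- \<i>) \<cdot>\<^sub>m U"])
    show "X \<in> carrier_mat n n" "(- \<i>) \<cdot>\<^sub>m U \<in> carrier_mat n n" using T by (auto simp: X_def)
    show "mat_adjoint X = X" unfolding X_def adjoint_smult skew by (simp add: smult_smult_mat)
    show "X * ((- \<i>) \<cdot>\<^sub>m U) = 1\<^sub>m n" "((- \<i>) \<cdot>\<^sub>m U) * X = 1\<^sub>m n"
      unfolding X_def using T(1-4) by (simp_all add: smult_mult_dim mult_smult_dim smult_smult_mat)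
    show "Cw = \<i> \<cdot>\<^sub>m (?J * (mat_adjoint Bw * X))"
      by (subst CT) (use J(1) Bw T(1) in \<open>simp add: X_def mult_smult_dim smult_smult_mat\<close>)
    have "X * \<alpha> = \<i> \<cdot>\<^sub>m (T * \<alpha>)" unfolding X_def using T(1) \<alpha> by (simp add: smult_mult_dim)
    then show "X * \<alpha> = mat_adjoint \<alpha> * X + \<i> \<cdot>\<^sub>m (mat_adjoint Cw * (?J * Cw))"
      unfolding T\<alpha> X_def using T(1) \<alpha> Cw J(1) by (simp add: mat_ring_simps)
  qed
qed

text \<open>Equality of degrees makes the realization of \<open>R\<close> obtained from a minimal
  one of \<open>W\<close> minimal as well. It is then similar to the given \<open>(A, B, C)\<close>,
  and after this change of basis \<open>W\<close> and \<open>R\<close> are described by the same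
  matrices.\<close>

lemma recovered_from_quotient:
  assumes W: "weakly_j_elementary m1 m2 W" "regular_on upper_half_plane W" and R: "quotient_rel m1 W R"
    and deg: "mcmillan_degree W = mcmillan_degree R"
    and min: "is_minimal_realization R n A B C (0\<^sub>m m2 m1)"
  shows "\<exists>X. riccati_choice n A B C X \<and> W = recovered_W m1 m2 A B C X"
proof -
  let ?E1 = "emb1 m1 m2" and ?E2 = "emb2 m1 m2" and ?J = "j_mat m1 m2" and ?m = "m1 + m2"
  note J = j_mat_facts[of m1 m2]
  have Wc: "W \<in> carrier_mat ?m ?m" and Wt: "tends_at_infinity W (1\<^sub>m ?m)"
    using W(1) unfolding weakly_j_elementary_def by auto
  have realR: "is_realization R n A B C (0\<^sub>m m2 m1)" and n: "n = mcmillan_degree R"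
    using min unfolding is_minimal_realization_def by auto
  obtain \<alpha>0 B0 C0 where minW0: "is_minimal_realization W n \<alpha>0 B0 C0 (1\<^sub>m ?m)"
    using minimal_realization_exists[OF Wc Wt] deg n unfolding is_minimal_realization_def by auto
  then have realW0: "is_realization W n \<alpha>0 B0 C0 (1\<^sub>m ?m)" unfolding is_minimal_realization_def by blast
  have c0: "\<alpha>0 \<in> carrier_mat n n" "B0 \<in> carrier_mat n ?m" "C0 \<in> carrier_mat ?m n"
    "W = transfer_fun \<alpha>0 B0 C0 (1\<^sub>m ?m)"
    using is_realization_carrier[OF realW0] Wc by auto
  define A0 where "A0 = \<alpha>0 - B0 * ?E1 * (mat_adjoint ?E1 * C0)"
  have R0: "R = transfer_fun A0 (B0 * ?E1) (mat_adjoint ?E2 * C0) (0\<^sub>m m2 m1)"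
    using R quotient_rel_realization[OF c0(1-3)] unfolding c0(4) A0_def by blast
  have c1: "A0 \<in> carrier_mat n n" "B0 * ?E1 \<in> carrier_mat n m1" "mat_adjoint ?E2 * C0 \<in> carrier_mat m2 n"
    using c0 by (auto simp: A0_def)
  have Rc: "R \<in> carrier_mat m2 m1" unfolding R0 by (rule dim_transfer_fun[OF c1])
  have A: "A \<in> carrier_mat n n" and B: "B \<in> carrier_mat n m1" and C: "C \<in> carrier_mat m2 n"
    and Req: "R = transfer_fun A B C (0\<^sub>m m2 m1)"
    using is_realization_carrier[OF realR] Rc by auto
  have zero: "0\<^sub>m m2 m1 \<in> carrier_mat m2 m1" by simp
  have min0: "is_minimal_realization R n A0 (B0 * ?E1) (mat_adjoint ?E2 * C0) (0\<^sub>m m2 m1)"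
    using is_realizationI[OF c1 zero] n unfolding is_minimal_realization_def R0[symmetric] by blast
  note obs0 = minimal_realization_observable[OF min0]
  note obs1 = minimal_realization_observable[OF min]
  obtain T U where T: "T \<in> carrier_mat n n" "U \<in> carrier_mat n n" "T * U = 1\<^sub>m n" "U * T = 1\<^sub>m n"
    "T * A0 = A * T" "T * (B0 * ?E1) = B" "C * T = mat_adjoint ?E2 * C0"
  proof (rule state_space_isomorphism[OF c1 A B C _ obs0(2,1) obs1(1)])
    show "mat_adjoint ?E2 * C0 * kry A0 (B0 * ?E1) k = C * kry A B k" for k
      by (rule markov_parameters[OF c1 A B C zero]) (use R0 Req in simp)
  qed
  \<comment> \<open>The realization of \<open>W\<close> in the coordinates of the given realization
    of \<open>R\<close>: its input on the first block is \<open>B\<close>, and its output on the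
    second block is \<open>C\<close>.\<close>
  define \<alpha> Bw Cw where "\<alpha> = T * \<alpha>0 * U" and "Bw = T * B0" and "Cw = C0 * U"
  have c: "\<alpha> \<in> carrier_mat n n" "Bw \<in> carrier_mat n ?m" "Cw \<in> carrier_mat ?m n"
    using c0 T(1,2) by (auto simp: \<alpha>_def Bw_def Cw_def)
  have one: "1\<^sub>m ?m \<in> carrier_mat ?m ?m" by simp
  have inter: "T * \<alpha>0 = \<alpha> * T" "Cw * T = C0"
  proof -
    have "\<alpha> * T = T * \<alpha>0 * (U * T)" unfolding \<alpha>_def using c0(1) T(1,2) by (simp add: mult_assoc_dim)
    then show "T * \<alpha>0 = \<alpha> * T" unfolding T(4) using c0(1) T(1) by simp
    have "Cw * T = C0 * (U * T)" unfolding Cw_def using c0(3) T(1,2) by (simp add: mult_assoc_dim)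
    then show "Cw * T = C0" unfolding T(4) using c0(3) by simp
  qed
  have Weq: "W = transfer_fun \<alpha> Bw Cw (1\<^sub>m ?m)"
    unfolding c0(4) by (rule transfer_fun_intertwine[OF c0(1-3) c one T(1) inter(1) _ inter(2)]) (simp add: Bw_def)
  have minW: "is_minimal_realization W n \<alpha> Bw Cw (1\<^sub>m ?m)"
    using is_realizationI[OF c one] minW0 unfolding is_minimal_realization_def Weq[symmetric] by blast
  note obsW = minimal_realization_observable[OF minW]
  have BE: "Bw * ?E1 = B" unfolding Bw_def using T(1,6) c0(2) by (simp add: mult_assoc_dim)
  have EC: "mat_adjoint ?E2 * Cw = C"
  proof -
    have "mat_adjoint ?E2 * Cw = C * T * U" unfolding Cw_def T(7) using c0(3) T(2) by (simp add: mult_assoc_dim)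
    also have "\<dots> = C * (T * U)" using C T(1,2) by (simp add: mult_assoc_dim)
    finally show ?thesis unfolding T(3) using C by simp
  qed
  have Aeq: "\<alpha> = A + B * (mat_adjoint ?E1 * Cw)"
  proof -
    have "A = A * (T * U)" unfolding T(3) using A by simp
    also have "\<dots> = T * A0 * U" unfolding T(5) using A T(1,2) by (simp add: mult_assoc_dim)
    also have "\<dots> = \<alpha> + (-1) \<cdot>\<^sub>m (T * (B0 * ?E1) * (mat_adjoint ?E1 * Cw))"
      unfolding A0_def \<alpha>_def Cw_def using c0 T(1,2) by (simp add: mat_ring_simps)
    finally have e: "A = \<alpha> + (-1) \<cdot>\<^sub>m (B * (mat_adjoint ?E1 * Cw))" unfolding T(6) .
    show ?thesis unfolding e using c B by (auto intro!: eq_matI simp del: index_mult_mat(1))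
  qed
  obtain X S where X: "X \<in> carrier_mat n n" "mat_adjoint X = X" and S: "S \<in> carrier_mat n n" "X * S = 1\<^sub>m n" "S * X = 1\<^sub>m n"
    and CX: "Cw = \<i> \<cdot>\<^sub>m (?J * (mat_adjoint Bw * X))"
    and lyap: "X * \<alpha> = mat_adjoint \<alpha> * X + \<i> \<cdot>\<^sub>m (mat_adjoint Cw * (?J * Cw))"
    by (rule j_unitary_realization[OF c W(1) Weq obsW])
  \<comment> \<open>The feedback gain hidden in \<open>Cw\<close> is that of the Riccati closed
    loop, so \<open>\<alpha>\<close> is \<open>alpha_mat A B X\<close>. The second block of
    \<open>Bw\<close> is determined by \<open>C\<close> in the same way.\<close>
  have K: "mat_adjoint ?E1 * Cw = \<i> \<cdot>\<^sub>m (mat_adjoint B * X)"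
  proof -
    have "mat_adjoint ?E1 * Cw = \<i> \<cdot>\<^sub>m (mat_adjoint ?E1 * ?J * (mat_adjoint Bw * X))"
      unfolding CX using J(1) c X(1) by (simp add: mult_smult_dim mult_assoc_dim)
    also have "\<dots> = \<i> \<cdot>\<^sub>m (mat_adjoint (Bw * ?E1) * X)"
      unfolding J(3) using c X(1) by (simp add: adjoint_simps mult_assoc_dim)
    finally show ?thesis unfolding BE .
  qed
  define \<gamma> where "\<gamma> = Bw * ?E2"
  have g: "\<gamma> \<in> carrier_mat n m2" using c by (simp add: \<gamma>_def)
  have "C = (- \<i>) \<cdot>\<^sub>m (mat_adjoint \<gamma> * X)"
  proof -
    have "mat_adjoint ?E2 * Cw = \<i> \<cdot>\<^sub>m (mat_adjoint ?E2 * ?J * (mat_adjoint Bw * X))"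
      unfolding CX using J(1) c X(1) by (simp add: mult_smult_dim mult_assoc_dim)
    also have "\<dots> = (- \<i>) \<cdot>\<^sub>m (mat_adjoint (Bw * ?E2) * X)"
      unfolding J(4) using c X(1) by (simp add: adjoint_simps mult_assoc_dim smult_mult_dim smult_smult_mat)
    finally show ?thesis unfolding EC \<gamma>_def .
  qed
  from arg_cong[OF this, of mat_adjoint] have Cadj: "mat_adjoint C = \<i> \<cdot>\<^sub>m (X * \<gamma>)"
    using X g by (simp add: adjoint_simps)
  have geq: "\<gamma> = (- \<i>) \<cdot>\<^sub>m (S * mat_adjoint C)"
  proof -
    have "(- \<i>) \<cdot>\<^sub>m (S * mat_adjoint C) = S * X * \<gamma>"
      unfolding Cadj using X(1) S(1) g by (simp add: mult_smult_dim smult_smult_mat mult_assoc_dim)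
    then show ?thesis unfolding S(3) using g by simp
  qed
  have Leq: "Bw = \<Lambda>_mat m1 m2 B C S"
  proof -
    have "Bw = Bw * (?E1 * mat_adjoint ?E1 + ?E2 * mat_adjoint ?E2)"
      unfolding one_mat_emb[symmetric] using c by simp
    also have "\<dots> = Bw * ?E1 * mat_adjoint ?E1 + Bw * ?E2 * mat_adjoint ?E2"
      using c by (simp add: mult_add_dim mult_assoc_dim)
    finally show ?thesis unfolding BE \<gamma>_def[symmetric] \<Lambda>_mat_def geq[symmetric] .
  qed
  have al: "\<alpha> = alpha_mat A B X"
    unfolding alpha_mat_eq(1)[OF A B X(1)] by (subst Aeq) (use B X(1) in \<open>simp add: K mult_smult_dim\<close>)
  have "W = recovered_W m1 m2 A B C X"
    unfolding recovered_W_eq[OF B C X(1) S] al[symmetric] Leq[symmetric] CX[symmetric] by (rule Weq)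
  moreover have "riccati_choice n A B C X"
    unfolding riccati_choice_iff
  proof (intro conjI X allI impI)
    show "riccati_eq A B C X"
      unfolding riccati_eq_iff[OF A B C X(1)]
    proof -
      have CJC: "mat_adjoint Cw * (?J * Cw) = X * (B * (mat_adjoint B * X)) + (-1) \<cdot>\<^sub>m (mat_adjoint C * C)"
      proof -
        have "mat_adjoint Cw * (?J * Cw) = mat_adjoint (mat_adjoint ?E1 * Cw) * (mat_adjoint ?E1 * Cw) +
            (-1) \<cdot>\<^sub>m (mat_adjoint (mat_adjoint ?E2 * Cw) * (mat_adjoint ?E2 * Cw))"
          unfolding j_mat_eq using c by (simp add: mat_ring_simps adjoint_simps)
        also have "\<dots> = X * (B * (mat_adjoint B * X)) + (-1) \<cdot>\<^sub>m (mat_adjoint C * C)"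
          unfolding EC K using B X by (simp add: mat_ring_simps adjoint_simps)
        finally show ?thesis .
      qed
      have al': "\<alpha> = A + \<i> \<cdot>\<^sub>m (B * (mat_adjoint B * X))" unfolding al by (rule alpha_mat_eq(1)[OF A B X(1)])
      have 1: "X * \<alpha> = X * A + \<i> \<cdot>\<^sub>m (X * (B * (mat_adjoint B * X)))"
        unfolding al' using A B X(1) by (simp add: mat_ring_simps)
      have 2: "mat_adjoint \<alpha> * X = mat_adjoint A * X + (- \<i>) \<cdot>\<^sub>m (X * (B * (mat_adjoint B * X)))"
        unfolding al' using A B X by (simp add: mat_ring_simps adjoint_simps)
      show "mat_adjoint A * X = X * A + (\<i> \<cdot>\<^sub>m (mat_adjoint C * C) + \<i> \<cdot>\<^sub>m (X * (B * (mat_adjoint B * X))))"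
      proof (rule eq_matI)
        fix i j assume "i < dim_row (X * A + (\<i> \<cdot>\<^sub>m (mat_adjoint C * C) + \<i> \<cdot>\<^sub>m (X * (B * (mat_adjoint B * X)))))"
          "j < dim_col (X * A + (\<i> \<cdot>\<^sub>m (mat_adjoint C * C) + \<i> \<cdot>\<^sub>m (X * (B * (mat_adjoint B * X)))))"
        then have ij: "i < n" "j < n" using X by auto
        show "(mat_adjoint A * X) $$ (i, j) = (X * A + (\<i> \<cdot>\<^sub>m (mat_adjoint C * C) + \<i> \<cdot>\<^sub>m (X * (B * (mat_adjoint B * X))))) $$ (i, j)"
          using arg_cong[OF lyap[unfolded 1 2 CJC], of "\<lambda>M. M $$ (i, j)"] ij A B C X(1)
          by (simp add: algebra_simps del: index_mult_mat(1))
      qed (use A X in auto)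
    qed
    \<comment> \<open>By minimality an eigenvalue of the closed-loop matrix is a singularity of
      \<open>W\<close>, so regularity in the upper half-plane is the spectral condition.\<close>
    fix e assume "eigenvalue (alpha_mat A B X) e"
    then have "is_singular_at W e"
      unfolding Weq al[symmetric] by (intro eigenvalue_imp_singular[OF c one obsW])
    then have "e \<notin> upper_half_plane" using W(2) unfolding regular_on_def by blast
    then show "Im e \<le> 0" by (simp add: upper_half_plane_def)
  qed
  ultimately show ?thesis by blast
qed

section \<open>Existence, uniqueness and positivity for a given \<open>R\<close>\<close>

lemma riccati_choice_exists:
  assumes R: "R \<in> carrier_mat m2 m1" "contractive_on \<real> R" and min: "is_minimal_realization R n A B C (0\<^sub>m m2 m1)"
  shows "\<exists>!X. riccati_choice n A B C X"
proof -
  have real: "is_realization R n A B C (0\<^sub>m m2 m1)"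
    using min unfolding is_minimal_realization_def by blast
  have A: "A \<in> carrier_mat n n" and B: "B \<in> carrier_mat n m1" and C: "C \<in> carrier_mat m2 n"
    and Req: "R = transfer_fun A B C (0\<^sub>m m2 m1)"
    using is_realization_carrier[OF real] R by auto
  have zero: "0\<^sub>m m2 m1 \<in> carrier_mat m2 m1" by simp
  note obs = minimal_realization_observable[OF min]
  \<comment> \<open>Contractivity on the axis includes regularity there; minimality translates this
    into the absence of real eigenvalues of \<open>A\<close>, so the resolvent exists at every real
    point.\<close>
  have ne: "\<not> eigenvalue A t" if t: "Im t = 0" for t
  proof
    assume "eigenvalue A t"
    then have "is_singular_at R t" unfolding Req by (rule eigenvalue_imp_singular[OF A B C zero obs])
    moreover have "t \<in> \<real>" using t by (simp add: complex_is_Real_iff)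
    ultimately show False using R(2) unfolding contractive_on_def regular_on_def by blast
  qed
  have contr: "(mat_adjoint (C * (resolvent A t * B) * b) * (C * (resolvent A t * B) * b)) $$ (0, 0) \<le> (mat_adjoint b * b) $$ (0, 0)"
    if t: "Im t = 0" and b: "b \<in> carrier_mat m1 1" for t b
  proof -
    have G: "C * (resolvent A t * B) \<in> carrier_mat m2 m1" using B C by simp
    have "mat_eval R t = C * (resolvent A t * B)"
      unfolding Req transfer_fun_eval(1)[OF A B C zero ne[OF t]] using G by simp
    moreover have "t \<in> \<real>" using t by (simp add: complex_is_Real_iff)
    ultimately have "loewner_le (mat_adjoint (C * (resolvent A t * B)) * (C * (resolvent A t * B))) (1\<^sub>m m1)"
      using R unfolding contractive_on_def by auto
    with b show ?thesis unfolding contraction_iff[OF G] by blast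
  qed
  have "\<exists>X. riccati_choice n A B C X"
  proof (rule riccati_exists[OF A B C obs(2) ne contr])
    fix X assume "X \<in> carrier_mat n n" "mat_adjoint X = X" "riccati_eq A B C X"
      "\<And>e. eigenvalue (alpha_mat A B X) e \<Longrightarrow> Im e \<le> 0"
    then have "riccati_choice n A B C X" unfolding riccati_choice_iff by simp
    then show "\<exists>X. riccati_choice n A B C X" ..
  qed
  moreover have "X = Z" if "riccati_choice n A B C X" "riccati_choice n A B C Z" for X Z
    by (rule riccati_unique[OF A B C obs(2)]) (use that[unfolded riccati_choice_iff] in blast)+
  ultimately show ?thesis by blast
qed

text \<open>The degree of \<open>W\<close> is at most \<open>n\<close> by its realization with state
  matrix \<open>alpha_mat A B X\<close>, and at least that of \<open>R\<close> because passing to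
  the quotient cannot raise the degree; the latter is \<open>n\<close> by minimality.\<close>

lemma recovered_W_correct:
  assumes R: "R \<in> carrier_mat m2 m1" and min: "is_minimal_realization R n A B C (0\<^sub>m m2 m1)"
    and ric: "riccati_choice n A B C X"
  defines "W \<equiv> recovered_W m1 m2 A B C X"
  shows "invertible_mat X" "weakly_j_elementary m1 m2 W" "regular_on upper_half_plane W"
    "mcmillan_degree W = mcmillan_degree R" "quotient_rel m1 W R"
proof -
  have real: "is_realization R n A B C (0\<^sub>m m2 m1)" and n: "n = mcmillan_degree R"
    using min unfolding is_minimal_realization_def by auto
  have A: "A \<in> carrier_mat n n" and B: "B \<in> carrier_mat n m1" and C: "C \<in> carrier_mat m2 n"
    and Req: "R = transfer_fun A B C (0\<^sub>m m2 m1)"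
    using is_realization_carrier[OF real] R by auto
  note obs = minimal_realization_observable[OF min]
  have X: "X \<in> carrier_mat n n" "mat_adjoint X = X" "riccati_eq A B C X"
    using ric unfolding riccati_choice_iff by auto
  obtain S where S: "S \<in> carrier_mat n n" "X * S = 1\<^sub>m n" "S * X = 1\<^sub>m n"
    by (rule riccati_solution_invertible[OF A B C obs(1) X])
  show "invertible_mat X" by (rule invertible_matI[OF X(1) S])
  note P = recovered_W_properties[OF A B C ric S, folded W_def]
  show "weakly_j_elementary m1 m2 W" "regular_on upper_half_plane W" by (rule P)+
  show q: "quotient_rel m1 W R" unfolding Req by (rule P(5))
  have "mcmillan_degree W \<le> n" using P(6) mcmillan_degree_le by blast
  moreover have "mcmillan_degree R \<le> mcmillan_degree W" by (rule mcmillan_degree_quotient_le[OF P(1,2) q])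
  ultimately show "mcmillan_degree W = mcmillan_degree R" using n by simp
qed

text \<open>The quotient exists because \<open>W\<close> tends to the identity, so that a
  realization has identity feedthrough. On the axis \<open>j\<close>-unitarity is the equality case
  of the inequality from which contractivity was derived.\<close>

lemma quotient_of_weakly_j_elementary:
  assumes W: "weakly_j_elementary m1 m2 W"
  shows "\<exists>R \<in> carrier_mat m2 m1. quotient_rel m1 W R"
    "quotient_rel m1 W R \<Longrightarrow> R \<in> carrier_mat m2 m1 \<and> contractive_on \<real> R \<and> tends_at_infinity R (0\<^sub>m m2 m1)"
proof -
  have Wc: "W \<in> carrier_mat (m1 + m2) (m1 + m2)" and Wt: "tends_at_infinity W (1\<^sub>m (m1 + m2))"
    using W unfolding weakly_j_elementary_def by auto
  obtain n \<alpha> Bw Cw where real: "is_realization W n \<alpha> Bw Cw (1\<^sub>m (m1 + m2))"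
    using realization_exists[OF Wc Wt] by blast
  have c: "\<alpha> \<in> carrier_mat n n" "Bw \<in> carrier_mat n (m1 + m2)" "Cw \<in> carrier_mat (m1 + m2) n"
    and Weq: "W = transfer_fun \<alpha> Bw Cw (1\<^sub>m (m1 + m2))"
    using is_realization_carrier[OF real] Wc by auto
  define B where "B = Bw * emb1 m1 m2"
  define A where "A = \<alpha> - B * (mat_adjoint (emb1 m1 m2) * Cw)"
  define C where "C = mat_adjoint (emb2 m1 m2) * Cw"
  have c': "A \<in> carrier_mat n n" "B \<in> carrier_mat n m1" "C \<in> carrier_mat m2 n"
    using c by (auto simp: A_def B_def C_def)
  have zero: "0\<^sub>m m2 m1 \<in> carrier_mat m2 m1" by simp
  have q: "quotient_rel m1 W R \<longleftrightarrow> R = transfer_fun A B C (0\<^sub>m m2 m1)" for R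
    unfolding Weq A_def B_def C_def by (rule quotient_rel_realization[OF c])
  have Tc: "transfer_fun A B C (0\<^sub>m m2 m1) \<in> carrier_mat m2 m1" by (rule dim_transfer_fun[OF c'])
  then show "\<exists>R \<in> carrier_mat m2 m1. quotient_rel m1 W R" using q by blast
  assume R: "quotient_rel m1 W R"
  have "contractive_on \<real> R"
  proof (rule contractive_quotient[OF Wc Wt real R at_within_neq_bot_half_planes(1)])
    fix z :: complex assume "z \<in> \<real>" "\<not> is_singular_at W z"
    then have "mat_adjoint (mat_eval W z) * j_mat m1 m2 * mat_eval W z = j_mat m1 m2"
      using W unfolding weakly_j_elementary_def by blast
    then show "loewner_le (j_mat m1 m2) (mat_adjoint (mat_eval W z) * j_mat m1 m2 * mat_eval W z)"
      using loewner_le_refl[OF j_mat_facts(1)] by simp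
  qed
  moreover have "tends_at_infinity R (0\<^sub>m m2 m1)"
    using R Tc transfer_fun_tendsto[OF c' zero] unfolding q tends_at_infinity_iff by auto
  ultimately show "R \<in> carrier_mat m2 m1 \<and> contractive_on \<real> R \<and> tends_at_infinity R (0\<^sub>m m2 m1)"
    using R Tc unfolding q by simp
qed

text \<open>Relative to one minimal realization of \<open>R\<close>, both functions are recovered
  from Riccati solutions with the spectral condition, and there is only one such solution.\<close>

lemma recovered_W_unique:
  assumes R: "R \<in> carrier_mat m2 m1" "contractive_on \<real> R" "tends_at_infinity R (0\<^sub>m m2 m1)"
    and W: "weakly_j_elementary m1 m2 W" "regular_on upper_half_plane W" "quotient_rel m1 W R"
      "mcmillan_degree W = mcmillan_degree R"
    and V: "weakly_j_elementary m1 m2 V" "regular_on upper_half_plane V" "quotient_rel m1 V R"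
      "mcmillan_degree V = mcmillan_degree R"
  shows "W = V"
proof -
  obtain n A B C where min: "is_minimal_realization R n A B C (0\<^sub>m m2 m1)"
    using minimal_realization_exists[OF R(1,3)] by blast
  obtain X where X: "riccati_choice n A B C X" "W = recovered_W m1 m2 A B C X"
    using recovered_from_quotient[OF W min] by blast
  obtain Y where Y: "riccati_choice n A B C Y" "V = recovered_W m1 m2 A B C Y"
    using recovered_from_quotient[OF V min] by blast
  note ex1 = riccati_choice_exists[OF R(1,2) min]
  have "X = Y" by (rule trans[OF the1_equality[OF ex1 X(1), symmetric] the1_equality[OF ex1 Y(1)]])
  then show ?thesis unfolding X(2) Y(2) by (rule arg_cong)
qed

text \<open>Regularity of \<open>R\<close> on the axis and above it pushes the spectrum of
  \<open>A\<close> into the open lower half-plane. The Riccati equation then is a Lyapunov equation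
  with right-hand side \<open>C\<^sup>* C + X B B\<^sup>* X\<close>, so \<open>X\<close> is
  nonnegative. A vector on which its form vanishes lies in its kernel, and \<open>X\<close> is
  invertible by observability.\<close>

lemma riccati_choice_pos_def:
  assumes R: "R \<in> carrier_mat m2 m1" "contractive_on \<real> R" "contractive_on upper_half_plane R"
    and min: "is_minimal_realization R n A B C (0\<^sub>m m2 m1)" and ric: "riccati_choice n A B C X"
  shows "pos_def_mat X" "j_elementary_factor m1 m2 (recovered_W m1 m2 A B C X)"
proof -
  have real: "is_realization R n A B C (0\<^sub>m m2 m1)"
    using min unfolding is_minimal_realization_def by blast
  have A: "A \<in> carrier_mat n n" and B: "B \<in> carrier_mat n m1" and C: "C \<in> carrier_mat m2 n"
    and Req: "R = transfer_fun A B C (0\<^sub>m m2 m1)"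
    using is_realization_carrier[OF real] R by auto
  have zero: "0\<^sub>m m2 m1 \<in> carrier_mat m2 m1" by simp
  note obs = minimal_realization_observable[OF min]
  have X: "X \<in> carrier_mat n n" "mat_adjoint X = X" "riccati_eq A B C X"
    using ric unfolding riccati_choice_iff by auto
  obtain S where S: "S \<in> carrier_mat n n" "X * S = 1\<^sub>m n" "S * X = 1\<^sub>m n"
    by (rule riccati_solution_invertible[OF A B C obs(1) X])
  have ev: "Im e < 0" if "eigenvalue A e" for e
  proof (rule ccontr)
    assume "\<not> Im e < 0"
    then have "e \<in> \<real> \<or> e \<in> upper_half_plane" by (auto simp: complex_is_Real_iff upper_half_plane_def)
    moreover have "is_singular_at R e" unfolding Req by (rule eigenvalue_imp_singular[OF A B C zero obs that])
    ultimately show False using R(2,3) unfolding contractive_on_def regular_on_def by blast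
  qed
  have nonneg: "0 \<le> Re ((mat_adjoint v * (X * v)) $$ (0, 0))" if v: "v \<in> carrier_mat n 1" for v
  proof (rule lyapunov_nonneg[OF A X(1) ev _ v])
    fix v :: "complex mat" assume v: "v \<in> carrier_mat n 1"
    have ric': "mat_adjoint A * X = X * A + (\<i> \<cdot>\<^sub>m (mat_adjoint C * C) + \<i> \<cdot>\<^sub>m (X * (B * (mat_adjoint B * X))))"
      using X(3) riccati_eq_iff[OF A B C X(1)] by blast
    have "\<i> \<cdot>\<^sub>m (X * A) + (- \<i>) \<cdot>\<^sub>m (mat_adjoint A * X) = mat_adjoint C * C + X * (B * (mat_adjoint B * X))"
      unfolding ric' using A B C X(1) by (auto simp: algebra_simps intro!: eq_matI simp del: index_mult_mat(1))
    then have "mat_adjoint v * ((\<i> \<cdot>\<^sub>m (X * A) + (- \<i>) \<cdot>\<^sub>m (mat_adjoint A * X)) * v) =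
        mat_adjoint (C * v) * (C * v) + mat_adjoint (mat_adjoint B * (X * v)) * (mat_adjoint B * (X * v))"
      using A B C X v by (simp add: mat_ring_simps adjoint_simps)
    then show "0 \<le> Re ((mat_adjoint v * ((\<i> \<cdot>\<^sub>m (X * A) + (- \<i>) \<cdot>\<^sub>m (mat_adjoint A * X)) * v)) $$ (0, 0))"
      using adjoint_mult_self_nonneg[of 0 "C * v"] adjoint_mult_self_nonneg[of 0 "mat_adjoint B * (X * v)"] v B C
      by (simp add: less_eq_complex_def del: index_mult_mat(1))
  qed
  show "j_elementary_factor m1 m2 (recovered_W m1 m2 A B C X)"
    by (rule recovered_W_properties(7)[OF A B C ric S nonneg])
  have nonneg': "0 \<le> (mat_adjoint v * (X * v)) $$ (0, 0)" if v: "v \<in> carrier_mat n 1" for v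
    using nonneg[OF v] hermitian_form_real[OF X(1,2) v] by (simp add: less_eq_complex_def)
  show "pos_def_mat X"
    unfolding pos_def_mat_def hermitian_mat_def
  proof (intro conjI ballI impI)
    show "square_mat X" "mat_adjoint X = X" using X by auto
    fix v :: "complex vec" assume "v \<in> carrier_vec (dim_row X)" "v \<noteq> 0\<^sub>v (dim_row X)"
    then have v: "v \<in> carrier_vec n" "v \<noteq> 0\<^sub>v n" using X by auto
    define V where "V = mat_of_cols n [v]"
    have V: "V \<in> carrier_mat n 1" using mat_of_cols_carrier(1)[of n "[v]"] by (simp add: V_def)
    have col: "col V 0 = v" using v by (simp add: V_def)
    have "(X *\<^sub>v v) \<bullet>c v = (\<Sum>i = 0..<n. (X * V) $$ (i, 0) * cnj (V $$ (i, 0)))"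
      unfolding col[symmetric] using V X(1) by (auto simp: scalar_prod_def[of "X *\<^sub>v col V 0"] intro!: sum.cong)
    also have "\<dots> = (mat_adjoint V * (X * V)) $$ (0, 0)"
      using V X(1) by (auto simp: scalar_prod_def[of "row (mat_adjoint V) 0"] mult.commute intro!: sum.cong)
    finally have form: "(X *\<^sub>v v) \<bullet>c v = (mat_adjoint V * (X * V)) $$ (0, 0)" .
    have "(mat_adjoint V * (X * V)) $$ (0, 0) \<noteq> 0"
    proof
      assume 0: "(mat_adjoint V * (X * V)) $$ (0, 0) = 0"
      have "mat_adjoint V * (X * V) = 0\<^sub>m 1 1"
        by (rule eq_matI) (use 0 V in \<open>auto simp del: index_mult_mat(1)\<close>)
      with psd_kernel[OF X(1,2) nonneg' V] have "X * V = 0\<^sub>m n 1" by blast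
      then have "S * X * V = 0\<^sub>m n 1" using S(1) X(1) V by (simp add: mult_assoc_dim)
      then have "V = 0\<^sub>m n 1" unfolding S(3) using V by simp
      then have "col V 0 = 0\<^sub>v n" by simp
      with v(2) show False unfolding col by simp
    qed
    with nonneg'[OF V] show "0 < (X *\<^sub>v v) \<bullet>c v" unfolding form by (simp add: le_less)
  qed
qed

lemma j_elementary_factor_quotient:
  assumes W: "j_elementary_factor m1 m2 W" and R: "quotient_rel m1 W R"
  shows "contractive_on upper_half_plane R"
proof -
  have Wc: "W \<in> carrier_mat (m1 + m2) (m1 + m2)" and Wt: "tends_at_infinity W (1\<^sub>m (m1 + m2))"
    using W unfolding j_elementary_factor_def by auto
  obtain n \<alpha> Bw Cw where real: "is_realization W n \<alpha> Bw Cw (1\<^sub>m (m1 + m2))"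
    using realization_exists[OF Wc Wt] by blast
  show ?thesis
    by (rule contractive_quotient[OF Wc Wt real R at_within_neq_bot_half_planes(2)])
      (use W in \<open>auto simp: j_elementary_factor_def\<close>)
qed

theorem theorem1p1:
  fixes m1 m2 :: nat
  shows
    \<comment> \<open>(i). Without the degree condition W is not determined by R: for every m1, m2 > 0 both
        the identity and diag(1, ..., 1, (z - i) / (z + i)) are weakly j-elementary and regular
        in the upper half-plane with R = 0. The class in which R determines W is the one of (ii),
        where W and R have the same McMillan degree.\<close>
    "(\<forall>W. weakly_j_elementary m1 m2 W \<and> regular_on upper_half_plane W \<longrightarrow>
        (\<exists>R \<in> carrier_mat m2 m1. quotient_rel m1 W R) \<and>
        (\<forall>R. quotient_rel m1 W R \<longrightarrow>
           contractive_on \<real> R \<and> tends_at_infinity R (0\<^sub>m m2 m1) \<and>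
           (mcmillan_degree W = mcmillan_degree R \<longrightarrow>
             (\<forall>W'. weakly_j_elementary m1 m2 W' \<and> regular_on upper_half_plane W' \<and>
                quotient_rel m1 W' R \<and> mcmillan_degree W' = mcmillan_degree R \<longrightarrow> W' = W))))
   \<and>
     \<comment> \<open>(ii)\<close>
     (\<forall>R \<in> carrier_mat m2 m1. contractive_on \<real> R \<and> tends_at_infinity R (0\<^sub>m m2 m1) \<longrightarrow>
        (\<exists>!W. weakly_j_elementary m1 m2 W \<and> regular_on upper_half_plane W \<and>
              mcmillan_degree W = mcmillan_degree R \<and> quotient_rel m1 W R) \<and>
        (\<forall>n A B C. is_minimal_realization R n A B C (0\<^sub>m m2 m1) \<longrightarrow>
           (\<exists>!X. riccati_choice n A B C X) \<and>
           (\<forall>X. riccati_choice n A B C X \<longrightarrow>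
              invertible_mat X \<and>
              (let W = recovered_W m1 m2 A B C X in
                 weakly_j_elementary m1 m2 W \<and> regular_on upper_half_plane W \<and>
                 mcmillan_degree W = mcmillan_degree R \<and> quotient_rel m1 W R))))
   \<and>
     \<comment> \<open>(iii)\<close>
     (\<forall>W R. j_elementary_factor m1 m2 W \<and> regular_on upper_half_plane W \<and>
        quotient_rel m1 W R \<longrightarrow> contractive_on upper_half_plane R) \<and>
     (\<forall>R \<in> carrier_mat m2 m1. contractive_on \<real> R \<and> tends_at_infinity R (0\<^sub>m m2 m1) \<and>
        contractive_on upper_half_plane R \<longrightarrow>
        (\<forall>n A B C X. is_minimal_realization R n A B C (0\<^sub>m m2 m1) \<and> riccati_choice n A B C X \<longrightarrow>
           pos_def_mat X \<and>
           (let W = recovered_W m1 m2 A B C X in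
              j_elementary_factor m1 m2 W \<and> regular_on upper_half_plane W)))"
proof (intro conjI allI impI ballI; (elim conjE)?)
  fix W assume "weakly_j_elementary m1 m2 W"
  then show "\<exists>R \<in> carrier_mat m2 m1. quotient_rel m1 W R" by (rule quotient_of_weakly_j_elementary(1))
next
  fix W R assume W: "weakly_j_elementary m1 m2 W" and q: "quotient_rel m1 W R"
  note R = quotient_of_weakly_j_elementary(2)[OF W q]
  show "contractive_on \<real> R" "tends_at_infinity R (0\<^sub>m m2 m1)" using R by blast+
  fix W'
  assume "regular_on upper_half_plane W" "mcmillan_degree W = mcmillan_degree R"
    "weakly_j_elementary m1 m2 W'" "regular_on upper_half_plane W'" "quotient_rel m1 W' R"
    "mcmillan_degree W' = mcmillan_degree R"
  with R W q show "W' = W" by (intro recovered_W_unique[of R m2 m1 W' W]) blast+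
next
  fix R :: ratmat
  assume R: "R \<in> carrier_mat m2 m1" "contractive_on \<real> R" "tends_at_infinity R (0\<^sub>m m2 m1)"
  obtain n A B C where min: "is_minimal_realization R n A B C (0\<^sub>m m2 m1)"
    using minimal_realization_exists[OF R(1,3)] by blast
  obtain X where X: "riccati_choice n A B C X"
    using riccati_choice_exists[OF R(1,2) min] by blast
  show "\<exists>!W. weakly_j_elementary m1 m2 W \<and> regular_on upper_half_plane W \<and>
      mcmillan_degree W = mcmillan_degree R \<and> quotient_rel m1 W R"
  proof (rule ex1I)
    show "weakly_j_elementary m1 m2 (recovered_W m1 m2 A B C X) \<and>
        regular_on upper_half_plane (recovered_W m1 m2 A B C X) \<and>
        mcmillan_degree (recovered_W m1 m2 A B C X) = mcmillan_degree R \<and>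
        quotient_rel m1 (recovered_W m1 m2 A B C X) R"
      by (intro conjI recovered_W_correct(2-5)[OF R(1) min X])
    fix V assume "weakly_j_elementary m1 m2 V \<and> regular_on upper_half_plane V \<and>
        mcmillan_degree V = mcmillan_degree R \<and> quotient_rel m1 V R"
    then show "V = recovered_W m1 m2 A B C X"
      by (intro recovered_W_unique[OF R] recovered_W_correct(2-5)[OF R(1) min X]) blast+
  qed
next
  fix R :: ratmat and n A B C
  assume "R \<in> carrier_mat m2 m1" "contractive_on \<real> R" "is_minimal_realization R n A B C (0\<^sub>m m2 m1)"
  then show "\<exists>!X. riccati_choice n A B C X" by (rule riccati_choice_exists)
next
  fix R :: ratmat and n A B C X
  assume R: "R \<in> carrier_mat m2 m1" and min: "is_minimal_realization R n A B C (0\<^sub>m m2 m1)"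
    and X: "riccati_choice n A B C X"
  show "invertible_mat X" by (rule recovered_W_correct(1)[OF R min X])
  show "let W = recovered_W m1 m2 A B C X in
      weakly_j_elementary m1 m2 W \<and> regular_on upper_half_plane W \<and>
      mcmillan_degree W = mcmillan_degree R \<and> quotient_rel m1 W R"
    unfolding Let_def by (intro conjI recovered_W_correct(2-5)[OF R min X])
next
  fix W R assume "j_elementary_factor m1 m2 W" "quotient_rel m1 W R"
  then show "contractive_on upper_half_plane R" by (rule j_elementary_factor_quotient)
next
  fix R :: ratmat and n A B C X
  assume R: "R \<in> carrier_mat m2 m1" "contractive_on \<real> R" "contractive_on upper_half_plane R"
    and min: "is_minimal_realization R n A B C (0\<^sub>m m2 m1)" and X: "riccati_choice n A B C X"
  show "pos_def_mat X" by (rule riccati_choice_pos_def(1)[OF R min X])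
  show "let W = recovered_W m1 m2 A B C X in j_elementary_factor m1 m2 W \<and> regular_on upper_half_plane W"
    unfolding Let_def by (intro conjI riccati_choice_pos_def(2)[OF R min X] recovered_W_correct(3)[OF R(1) min X])
qed

end
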